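(* Let $I=\langle f_1,\dots,f_n\rangle\subset S$, where $n=\dim X$ and $f_i\in S_{\alpha_i}$ with $\alpha_i\in\mathrm{Pic}^\circ(X)$ for $i=1,\dots,n$, and suppose that $V_X(I)$ is zero-dimensional. If $\alpha_0\in\mathrm{Pic}^\circ(X)$, then $\left(\sum_{i=1}^n\alpha_i,\alpha_0\right)$ is a regularity pair for $I$.
   Context: $X=X_\Sigma$ is the normal toric variety over $\mathbb{C}$ of a complete rational polyhedral fan $\Sigma$ in $\mathbb{R}^n$, with rays $\rho_1,\dots,\rho_k$ and corresponding torus-invariant prime divisors $D_1,\dots,D_k$. The Cox ring is $S=\mathbb{C}[x_1,\dots,x_k]$, graded by the class group $\mathrm{Cl}(X)$ via $\deg x_i=[D_i]$, with graded pieces $S_\alpha$; $x^{\hat\sigma}=\prod_{\rho_i\notin\sigma}x_i$ and $B=\langle x^{\hat\sigma}\mid\sigma\in\Sigma\rangle$ is the irrelevant ideal. $\pi:\mathbb{C}^k\setminus\mathrm{Var}_{\mathbb{C}^k}(B)\to X$ is the Cox quotient map; for homogeneous $f$, $\mathrm{Var}_X(f)=\{\zeta\in X\mid f(x)=0\text{ for some }x\in\pi^{-1}(\zeta)\}$. A homogeneous ideal $I\subset S$ defines a closed subscheme $V_X(I)\subset X$, given on the chart $U_\sigma$ by $(I_{x^{\hat\sigma}})_0\subset(S_{x^{\hat\sigma}})_0\simeq\mathbb{C}[U_\sigma]$; $\mathrm{Var}_X(I)$ is its reduced variety. A point $\zeta\in X$ is a basepoint of $\alpha\in\mathrm{Cl}(X)$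 if $\zeta\in\mathrm{Var}_X(f)$ for all $f\in S_\alpha$; $\alpha$ is basepoint free if it has no basepoints, and $V_X(I)$-basepoint free if no point of $\mathrm{Var}_X(I)$ is a basepoint of $\alpha$. $\mathrm{Pic}^\circ(X)=\{\alpha\in\mathrm{Pic}(X)\mid\alpha\text{ basepoint free}\}$ (classes of nef Cartier divisors). For $V_X(I)$ zero-dimensional of degree $\delta^+$ (number of points counted with multiplicity), $\mathrm{Reg}(I)=\{\alpha\in\mathrm{Cl}(X)\mid\dim_{\mathbb C}(S/I)_\alpha=\delta^+,\ I_\alpha=(I:B^\infty)_\alpha,\ \alpha\text{ is }V_X(I)\text{-basepoint free}\}$. A pair $(\alpha,\alpha_0)\in\mathrm{Cl}(X)^2$ is a regularity pair if $\alpha,\alpha+\alpha_0\in\mathrm{Reg}(I)$ and $\alpha_0$ is $V_X(I)$-basepoint free. *)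

theory Defs
  imports
    "HOL-Analysis.Analysis"
    "HOL-Algebra.Algebra"
    "HOL-Algebra.Algebraic_Closure_Type"
    "HOL-Library.Poly_Mapping"
begin

section \<open>Fans\<close>

text \<open>The lattices \<open>N = M = \<int>\<^sup>n\<close> are the type \<^typ>\<open>int ^ 'n\<close>, embedded in \<open>\<real>\<^sup>n\<close> by \<open>rvec\<close>.\<close>

definition rvec :: "int ^ 'n \<Rightarrow> real ^ 'n" where
  "rvec v = (\<chi> j. real_of_int (v $ j))"

definition pairing :: "int ^ 'n \<Rightarrow> int ^ 'n \<Rightarrow> int" where
  "pairing m v = (\<Sum>j\<in>UNIV. m $ j * v $ j)"

definition rational_polyhedral_cone :: "(real ^ 'n) set \<Rightarrow> bool" where
  "rational_polyhedral_cone \<sigma> \<longleftrightarrow> (\<exists>A. finite A \<and> \<sigma> = convex_cone hull (rvec ` A))"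

definition strongly_convex :: "(real ^ 'n) set \<Rightarrow> bool" where
  "strongly_convex \<sigma> \<longleftrightarrow> \<sigma> \<inter> uminus ` \<sigma> = {0}"

text \<open>In the library the empty set is a face of every convex set; it is not a face of a cone
  in the sense of toric geometry.\<close>

definition fan :: "(real ^ 'n) set set \<Rightarrow> bool" where
  "fan \<Sigma> \<longleftrightarrow>
     finite \<Sigma> \<and>
     (\<forall>\<sigma>\<in>\<Sigma>. rational_polyhedral_cone \<sigma> \<and> strongly_convex \<sigma>) \<and>
     (\<forall>\<sigma>\<in>\<Sigma>. \<forall>\<tau>. \<tau> face_of \<sigma> \<and> \<tau> \<noteq> {} \<longrightarrow> \<tau> \<in> \<Sigma>) \<and>
     (\<forall>\<sigma>\<in>\<Sigma>. \<forall>\<tau>\<in>\<Sigma>. (\<sigma> \<inter> \<tau>) face_of \<sigma> \<and> (\<sigma> \<inter> \<tau>) face_of \<tau>)"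

definition complete_fan :: "(real ^ 'n) set set \<Rightarrow> bool" where
  "complete_fan \<Sigma> \<longleftrightarrow> fan \<Sigma> \<and> \<Union>\<Sigma> = UNIV"

text \<open>The finite type \<open>'k\<close> indexes the rays; \<open>u i\<close> is the primitive generator of \<open>\<rho>\<^sub>i\<close>.\<close>

definition ray_generators :: "(real ^ 'n) set set \<Rightarrow> ('k \<Rightarrow> int ^ 'n) \<Rightarrow> bool" where
  "ray_generators \<Sigma> u \<longleftrightarrow>
     bij_betw (\<lambda>i. convex_cone hull {rvec (u i)}) UNIV {\<rho> \<in> \<Sigma>. aff_dim \<rho> = 1} \<and>
     (\<forall>i. Gcd (range (\<lambda>j. u i $ j)) = 1)"


section \<open>The class group\<close>

text \<open>\<open>Cl(X)\<close> is the group of torus-invariant divisors \<open>\<Sum>\<^sub>i a\<^sub>i D\<^sub>i\<close> modulo the divisors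
  \<open>div \<chi>\<^sup>m = \<Sum>\<^sub>i \<langle>m, u\<^sub>i\<rangle> D\<^sub>i\<close> of characters.\<close>

definition torus_divisors :: "(int ^ 'k) monoid" where
  "torus_divisors = \<lparr>carrier = UNIV, monoid.mult = (+), one = 0\<rparr>"

definition char_div :: "('k \<Rightarrow> int ^ 'n) \<Rightarrow> int ^ 'n \<Rightarrow> int ^ 'k" where
  "char_div u m = (\<chi> i. pairing m (u i))"

definition class_group :: "('k \<Rightarrow> int ^ 'n) \<Rightarrow> (int ^ 'k) set monoid" where
  "class_group u = torus_divisors Mod range (char_div u)"

definition divisor_class :: "('k \<Rightarrow> int ^ 'n) \<Rightarrow> int ^ 'k \<Rightarrow> (int ^ 'k) set" where
  "divisor_class u a = range (char_div u) #>\<^bsub>torus_divisors\<^esub> a"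

text \<open>A divisor is Cartier if on each chart \<open>U\<^sub>\<sigma>\<close>, which meets exactly the \<open>D\<^sub>i\<close> with
  \<open>\<rho>\<^sub>i \<subseteq> \<sigma>\<close>, it is the divisor of a character.\<close>

definition cartier :: "(real ^ 'n) set set \<Rightarrow> ('k \<Rightarrow> int ^ 'n) \<Rightarrow> int ^ 'k \<Rightarrow> bool" where
  "cartier \<Sigma> u a \<longleftrightarrow>
     (\<forall>\<sigma>\<in>\<Sigma>. \<exists>m. \<forall>i. rvec (u i) \<in> \<sigma> \<longrightarrow> a $ i = char_div u m $ i)"

definition Pic :: "(real ^ 'n) set set \<Rightarrow> ('k \<Rightarrow> int ^ 'n) \<Rightarrow> (int ^ 'k) set set" where
  "Pic \<Sigma> u = divisor_class u ` {a. cartier \<Sigma> u a}"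


section \<open>The Cox ring\<close>

type_synonym 'k cox = "('k \<Rightarrow>\<^sub>0 nat) \<Rightarrow>\<^sub>0 complex"

abbreviation cox_ring :: "'k cox ring" where
  "cox_ring \<equiv> ring_of_type_algebra"

definition cox_var :: "'k \<Rightarrow> 'k cox" where
  "cox_var i = Poly_Mapping.single (Poly_Mapping.single i 1) 1"

definition eval_cox :: "complex ^ 'k \<Rightarrow> ('k::finite) cox \<Rightarrow> complex" where
  "eval_cox x f =
     (\<Sum>e\<in>Poly_Mapping.keys f. Poly_Mapping.lookup f e * (\<Prod>i\<in>UNIV. x $ i ^ Poly_Mapping.lookup e i))"

text \<open>The zero polynomial lies in every graded piece.\<close>

definition graded_piece ::
  "('k::finite \<Rightarrow> int ^ 'n) \<Rightarrow> (int ^ 'k) set \<Rightarrow> 'k cox set" where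
  "graded_piece u \<alpha> =
     {f. \<forall>e\<in>Poly_Mapping.keys f. divisor_class u (\<chi> i. int (Poly_Mapping.lookup e i)) = \<alpha>}"

text \<open>\<open>x_hat u \<sigma>\<close> is the monomial \<open>x\<^sup>\<sigma>\<close> (with a hat on \<open>\<sigma>\<close>); \<open>\<rho>\<^sub>i \<notin> \<sigma>\<close> means that \<open>\<rho>\<^sub>i\<close>
  is not a ray of \<open>\<sigma>\<close>.\<close>

definition x_hat :: "('k::finite \<Rightarrow> int ^ 'n) \<Rightarrow> (real ^ 'n) set \<Rightarrow> 'k cox" where
  "x_hat u \<sigma> = (\<Prod>i\<in>{i. rvec (u i) \<notin> \<sigma>}. cox_var i)"

definition irrelevant_ideal ::
  "(real ^ 'n) set set \<Rightarrow> ('k::finite \<Rightarrow> int ^ 'n) \<Rightarrow> 'k cox set" where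
  "irrelevant_ideal \<Sigma> u = Idl\<^bsub>cox_ring\<^esub> (x_hat u ` \<Sigma>)"

text \<open>\<open>(I : B\<^sup>\<infinity>)\<close>; the power is taken in the semiring of ideals.\<close>

definition saturation :: "'k cox set \<Rightarrow> 'k cox set \<Rightarrow> 'k cox set" where
  "saturation I B = {f. \<exists>N::nat. \<forall>b \<in> B [^]\<^bsub>ideals_set cox_ring\<^esub> N. f * b \<in> I}"

definition affine_variety :: "('k::finite) cox set \<Rightarrow> (complex ^ 'k) set" where
  "affine_variety J = {x. \<forall>f\<in>J. eval_cox x f = 0}"


section \<open>The toric variety and the Cox quotient map\<close>

definition dual_monoid :: "(real ^ 'n) set \<Rightarrow> (int ^ 'n) set" where
  "dual_monoid \<sigma> = {m. \<forall>v\<in>\<sigma>. rvec m \<bullet> v \<ge> 0}"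

text \<open>The closed points of \<open>U\<^sub>\<sigma> = Spec \<complex>[\<sigma>\<^sup>\<or> \<inter> M]\<close> are the monoid homomorphisms
  \<open>\<sigma>\<^sup>\<or> \<inter> M \<rightarrow> (\<complex>, \<cdot>)\<close>.\<close>

definition chart_points :: "(real ^ 'n) set \<Rightarrow> (int ^ 'n \<Rightarrow> complex) set" where
  "chart_points \<sigma> =
     {\<gamma> \<in> extensional (dual_monoid \<sigma>).
        \<gamma> 0 = 1 \<and> (\<forall>m\<in>dual_monoid \<sigma>. \<forall>m'\<in>dual_monoid \<sigma>. \<gamma> (m + m') = \<gamma> m * \<gamma> m')}"

text \<open>\<open>U\<^sub>\<sigma>\<close> and \<open>U\<^sub>\<tau>\<close> are glued along their common open subset \<open>U\<^bsub>\<sigma> \<inter> \<tau>\<^esub>\<close>.\<close>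

definition glue ::
  "(real ^ 'n) set set \<Rightarrow>
     (((real ^ 'n) set \<times> (int ^ 'n \<Rightarrow> complex)) \<times> ((real ^ 'n) set \<times> (int ^ 'n \<Rightarrow> complex))) set"
  where
  "glue \<Sigma> =
     {((\<sigma>, \<gamma>), (\<tau>, \<gamma>')). \<sigma> \<in> \<Sigma> \<and> \<tau> \<in> \<Sigma> \<and>
        (\<exists>\<delta> \<in> chart_points (\<sigma> \<inter> \<tau>).
           \<gamma> = restrict \<delta> (dual_monoid \<sigma>) \<and> \<gamma>' = restrict \<delta> (dual_monoid \<tau>))}"

type_synonym 'n toric_point = "((real ^ 'n) set \<times> (int ^ 'n \<Rightarrow> complex)) set"

definition toric_variety :: "(real ^ 'n) set set \<Rightarrow> 'n toric_point set" where
  "toric_variety \<Sigma> = (SIGMA \<sigma>:\<Sigma>. chart_points \<sigma>) // glue \<Sigma>"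

text \<open>If \<open>x\<close> is not a zero of the monomial \<open>x_hat u \<sigma>\<close>, then \<open>\<pi>(x) \<in> U\<^sub>\<sigma>\<close> is the point
  \<open>m \<mapsto> \<Prod>\<^sub>i x\<^sub>i\<^bsup>\<langle>m, u\<^sub>i\<rangle>\<^esup>\<close>; all such \<open>\<sigma>\<close> give the same point of \<open>X\<close>, so that the union below is
  a single class.\<close>

definition cox_quotient ::
  "(real ^ 'n) set set \<Rightarrow> ('k::finite \<Rightarrow> int ^ 'n) \<Rightarrow> complex ^ 'k \<Rightarrow> 'n toric_point" where
  "cox_quotient \<Sigma> u x =
     (\<Union>\<sigma>\<in>{\<sigma> \<in> \<Sigma>. eval_cox x (x_hat u \<sigma>) \<noteq> 0}.
        glue \<Sigma> `` {(\<sigma>, \<lambda>m\<in>dual_monoid \<sigma>. \<Prod>i\<in>UNIV. x $ i powi pairing m (u i))})"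

definition Var_poly ::
  "(real ^ 'n) set set \<Rightarrow> ('k::finite \<Rightarrow> int ^ 'n) \<Rightarrow> 'k cox \<Rightarrow> 'n toric_point set" where
  "Var_poly \<Sigma> u f =
     {\<zeta> \<in> toric_variety \<Sigma>.
        \<exists>x. x \<notin> affine_variety (irrelevant_ideal \<Sigma> u) \<and> cox_quotient \<Sigma> u x = \<zeta> \<and> eval_cox x f = 0}"

definition basepoint ::
  "(real ^ 'n) set set \<Rightarrow> ('k::finite \<Rightarrow> int ^ 'n) \<Rightarrow> (int ^ 'k) set \<Rightarrow> 'n toric_point \<Rightarrow> bool"
  where
  "basepoint \<Sigma> u \<alpha> \<zeta> \<longleftrightarrow>
     \<zeta> \<in> toric_variety \<Sigma> \<and> (\<forall>f \<in> graded_piece u \<alpha>. \<zeta> \<in> Var_poly \<Sigma> u f)"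

definition basepoint_free ::
  "(real ^ 'n) set set \<Rightarrow> ('k::finite \<Rightarrow> int ^ 'n) \<Rightarrow> (int ^ 'k) set \<Rightarrow> bool" where
  "basepoint_free \<Sigma> u \<alpha> \<longleftrightarrow> (\<nexists>\<zeta>. basepoint \<Sigma> u \<alpha> \<zeta>)"

definition Pic0 ::
  "(real ^ 'n) set set \<Rightarrow> ('k::finite \<Rightarrow> int ^ 'n) \<Rightarrow> (int ^ 'k) set set" where
  "Pic0 \<Sigma> u = {\<alpha> \<in> Pic \<Sigma> u. basepoint_free \<Sigma> u \<alpha>}"


section \<open>Krull dimension and localization\<close>

text \<open>The dimension of the zero ring is \<open>-\<infinity>\<close>.\<close>

definition krull_dim :: "('a, 'b) ring_scheme \<Rightarrow> ereal" where
  "krull_dim R =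
     Sup {ereal (real d) |d. \<exists>P. (\<forall>i\<le>d. primeideal (P i) R) \<and> (\<forall>i<d. P i \<subset> P (Suc i))}"

definition local_frac_rel ::
  "('a, 'b) ring_scheme \<Rightarrow> 'a set \<Rightarrow> (('a \<times> 'a) \<times> ('a \<times> 'a)) set" where
  "local_frac_rel R P =
     {((a, s), (b, t)). a \<in> carrier R \<and> b \<in> carrier R \<and>
        s \<in> carrier R - P \<and> t \<in> carrier R - P \<and>
        (\<exists>r \<in> carrier R - P. r \<otimes>\<^bsub>R\<^esub> (a \<otimes>\<^bsub>R\<^esub> t \<ominus>\<^bsub>R\<^esub> b \<otimes>\<^bsub>R\<^esub> s) = \<zero>\<^bsub>R\<^esub>)}"

definition local_frac :: "('a, 'b) ring_scheme \<Rightarrow> 'a set \<Rightarrow> 'a \<Rightarrow> 'a \<Rightarrow> ('a \<times> 'a) set" where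
  "local_frac R P a s = local_frac_rel R P `` {(a, s)}"

text \<open>The local ring \<open>R\<^sub>P\<close> at a prime ideal \<open>P\<close> of a commutative ring \<open>R\<close>.\<close>

definition localization :: "('a, 'b) ring_scheme \<Rightarrow> 'a set \<Rightarrow> ('a \<times> 'a) set ring" where
  "localization R P =
     \<lparr>carrier = (carrier R \<times> (carrier R - P)) // local_frac_rel R P,
      monoid.mult = (\<lambda>p q. \<Union>(a, s)\<in>p. \<Union>(b, t)\<in>q. local_frac R P (a \<otimes>\<^bsub>R\<^esub> b) (s \<otimes>\<^bsub>R\<^esub> t)),
      one = local_frac R P \<one>\<^bsub>R\<^esub> \<one>\<^bsub>R\<^esub>,
      ring.zero = local_frac R P \<zero>\<^bsub>R\<^esub> \<one>\<^bsub>R\<^esub>,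
      add = (\<lambda>p q. \<Union>(a, s)\<in>p. \<Union>(b, t)\<in>q.
               local_frac R P (a \<otimes>\<^bsub>R\<^esub> t \<oplus>\<^bsub>R\<^esub> b \<otimes>\<^bsub>R\<^esub> s) (s \<otimes>\<^bsub>R\<^esub> t))\<rparr>"


section \<open>The subscheme defined by a homogeneous ideal\<close>

text \<open>\<open>chart_ring \<sigma>\<close> is \<open>\<complex>[U\<^sub>\<sigma>] = \<complex>[\<sigma>\<^sup>\<or> \<inter> M]\<close>, with \<open>\<chi>\<^sup>m\<close> represented by \<open>single m 1\<close>.\<close>

definition chart_ring :: "(real ^ 'n) set \<Rightarrow> ((int ^ 'n) \<Rightarrow>\<^sub>0 complex) ring" where
  "chart_ring \<sigma> = ring_of_type_algebra \<lparr>carrier := {g. Poly_Mapping.keys g \<subseteq> dual_monoid \<sigma>}\<rparr>"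

definition eval_chart :: "(int ^ 'n \<Rightarrow> complex) \<Rightarrow> ((int ^ 'n) \<Rightarrow>\<^sub>0 complex) \<Rightarrow> complex" where
  "eval_chart \<gamma> g = (\<Sum>m\<in>Poly_Mapping.keys g. Poly_Mapping.lookup g m * \<gamma> m)"

text \<open>Both \<open>S\<close> and the degree-0 part of its localization at \<open>x_hat u \<sigma>\<close> are viewed inside the ring
  of Laurent polynomials \<open>\<complex>[x\<^sub>i, x\<^sub>i\<^sup>-\<^sup>1]\<close>: \<open>homogenize\<close> is the isomorphism from
  \<open>\<complex>[U\<^sub>\<sigma>]\<close> to the latter, \<open>\<chi>\<^sup>m \<mapsto> \<Prod>\<^sub>i x\<^sub>i\<^bsup>\<langle>m, u\<^sub>i\<rangle>\<^esup>\<close>.\<close>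

definition to_laurent :: "('k::finite) cox \<Rightarrow> (int ^ 'k) \<Rightarrow>\<^sub>0 complex" where
  "to_laurent f =
     (\<Sum>e\<in>Poly_Mapping.keys f.
        Poly_Mapping.single (\<chi> i. int (Poly_Mapping.lookup e i)) (Poly_Mapping.lookup f e))"

definition homogenize ::
  "('k::finite \<Rightarrow> int ^ 'n) \<Rightarrow> ((int ^ 'n) \<Rightarrow>\<^sub>0 complex) \<Rightarrow> (int ^ 'k) \<Rightarrow>\<^sub>0 complex" where
  "homogenize u g =
     (\<Sum>m\<in>Poly_Mapping.keys g. Poly_Mapping.single (char_div u m) (Poly_Mapping.lookup g m))"

text \<open>The ideal of \<open>\<complex>[U\<^sub>\<sigma>]\<close> corresponding to the degree-0 part of the localized ideal: those \<open>g\<close>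
  whose image has the form \<open>f / (x_hat u \<sigma>)\<^sup>N\<close> with \<open>f \<in> I\<close>.\<close>

definition chart_ideal ::
  "('k::finite \<Rightarrow> int ^ 'n) \<Rightarrow> 'k cox set \<Rightarrow> (real ^ 'n) set \<Rightarrow> ((int ^ 'n) \<Rightarrow>\<^sub>0 complex) set"
  where
  "chart_ideal u I \<sigma> =
     {g \<in> carrier (chart_ring \<sigma>).
        \<exists>(N::nat). \<exists>f\<in>I. to_laurent (x_hat u \<sigma>) ^ N * homogenize u g = to_laurent f}"

text \<open>\<open>V\<^sub>X(I) \<inter> U\<^sub>\<sigma>\<close> is the spectrum of the following ring.\<close>

definition scheme_chart ::
  "('k::finite \<Rightarrow> int ^ 'n) \<Rightarrow> 'k cox set \<Rightarrow> (real ^ 'n) set \<Rightarrow> ((int ^ 'n) \<Rightarrow>\<^sub>0 complex) set ring"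
  where
  "scheme_chart u I \<sigma> = chart_ring \<sigma> Quot chart_ideal u I \<sigma>"

text \<open>The empty scheme has dimension \<open>-\<infinity>\<close>, so zero-dimensional schemes are nonempty.\<close>

definition scheme_dim ::
  "(real ^ 'n) set set \<Rightarrow> ('k::finite \<Rightarrow> int ^ 'n) \<Rightarrow> 'k cox set \<Rightarrow> ereal" where
  "scheme_dim \<Sigma> u I = (SUP \<sigma>\<in>\<Sigma>. krull_dim (scheme_chart u I \<sigma>))"

definition Var_ideal ::
  "(real ^ 'n) set set \<Rightarrow> ('k::finite \<Rightarrow> int ^ 'n) \<Rightarrow> 'k cox set \<Rightarrow> 'n toric_point set" where
  "Var_ideal \<Sigma> u I =
     {\<zeta> \<in> toric_variety \<Sigma>. \<exists>(\<sigma>, \<gamma>)\<in>\<zeta>. \<forall>g \<in> chart_ideal u I \<sigma>. eval_chart \<gamma> g = 0}"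

text \<open>The local ring of \<open>V\<^sub>X(I)\<close> at the point \<open>\<gamma>\<close> of \<open>U\<^sub>\<sigma>\<close>, and the image of \<open>\<complex>\<close> in it.\<close>

definition point_ideal ::
  "('k::finite \<Rightarrow> int ^ 'n) \<Rightarrow> 'k cox set \<Rightarrow> (real ^ 'n) set \<Rightarrow> (int ^ 'n \<Rightarrow> complex) \<Rightarrow>
     ((int ^ 'n) \<Rightarrow>\<^sub>0 complex) set set" where
  "point_ideal u I \<sigma> \<gamma> =
     (\<lambda>g. chart_ideal u I \<sigma> +>\<^bsub>chart_ring \<sigma>\<^esub> g) ` {g \<in> carrier (chart_ring \<sigma>). eval_chart \<gamma> g = 0}"

definition local_ring ::
  "('k::finite \<Rightarrow> int ^ 'n) \<Rightarrow> 'k cox set \<Rightarrow> (real ^ 'n) set \<Rightarrow> (int ^ 'n \<Rightarrow> complex) \<Rightarrow>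
     (((int ^ 'n) \<Rightarrow>\<^sub>0 complex) set \<times> ((int ^ 'n) \<Rightarrow>\<^sub>0 complex) set) set ring" where
  "local_ring u I \<sigma> \<gamma> = localization (scheme_chart u I \<sigma>) (point_ideal u I \<sigma> \<gamma>)"

definition local_scalars ::
  "('k::finite \<Rightarrow> int ^ 'n) \<Rightarrow> 'k cox set \<Rightarrow> (real ^ 'n) set \<Rightarrow> (int ^ 'n \<Rightarrow> complex) \<Rightarrow>
     (((int ^ 'n) \<Rightarrow>\<^sub>0 complex) set \<times> ((int ^ 'n) \<Rightarrow>\<^sub>0 complex) set) set set" where
  "local_scalars u I \<sigma> \<gamma> =
     range (\<lambda>c. local_frac (scheme_chart u I \<sigma>) (point_ideal u I \<sigma> \<gamma>)
                  (chart_ideal u I \<sigma> +>\<^bsub>chart_ring \<sigma>\<^esub> Poly_Mapping.single 0 c)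
                  \<one>\<^bsub>scheme_chart u I \<sigma>\<^esub>)"

text \<open>The multiplicity of a point is the complex dimension of its local ring, which does not depend
  on the chart in which it is computed.\<close>

definition multiplicity ::
  "('k::finite \<Rightarrow> int ^ 'n) \<Rightarrow> 'k cox set \<Rightarrow> 'n toric_point \<Rightarrow> nat" where
  "multiplicity u I \<zeta> =
     (case (SOME p. p \<in> \<zeta>) of (\<sigma>, \<gamma>) \<Rightarrow>
        ring.dim (local_ring u I \<sigma> \<gamma>)
          (local_scalars u I \<sigma> \<gamma>) (carrier (local_ring u I \<sigma> \<gamma>)))"

definition scheme_degree ::
  "(real ^ 'n) set set \<Rightarrow> ('k::finite \<Rightarrow> int ^ 'n) \<Rightarrow> 'k cox set \<Rightarrow> nat" where
  "scheme_degree \<Sigma> u I = (\<Sum>\<zeta>\<in>Var_ideal \<Sigma> u I. multiplicity u I \<zeta>)"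


section \<open>Regularity\<close>

definition V_basepoint_free ::
  "(real ^ 'n) set set \<Rightarrow> ('k::finite \<Rightarrow> int ^ 'n) \<Rightarrow> 'k cox set \<Rightarrow> (int ^ 'k) set \<Rightarrow> bool" where
  "V_basepoint_free \<Sigma> u I \<alpha> \<longleftrightarrow> (\<forall>\<zeta> \<in> Var_ideal \<Sigma> u I. \<not> basepoint \<Sigma> u \<alpha> \<zeta>)"

definition quotient_scalars :: "'k cox set \<Rightarrow> 'k cox set set" where
  "quotient_scalars I = range (\<lambda>c. I +>\<^bsub>cox_ring\<^esub> Poly_Mapping.single 0 c)"

definition quotient_piece ::
  "('k::finite \<Rightarrow> int ^ 'n) \<Rightarrow> 'k cox set \<Rightarrow> (int ^ 'k) set \<Rightarrow> 'k cox set set" where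
  "quotient_piece u I \<alpha> = (\<lambda>f. I +>\<^bsub>cox_ring\<^esub> f) ` graded_piece u \<alpha>"

definition Reg ::
  "(real ^ 'n) set set \<Rightarrow> ('k::finite \<Rightarrow> int ^ 'n) \<Rightarrow> 'k cox set \<Rightarrow> (int ^ 'k) set set" where
  "Reg \<Sigma> u I =
     {\<alpha> \<in> carrier (class_group u).
        ring.dimension (cox_ring Quot I) (scheme_degree \<Sigma> u I)
          (quotient_scalars I) (quotient_piece u I \<alpha>) \<and>
        I \<inter> graded_piece u \<alpha> = saturation I (irrelevant_ideal \<Sigma> u) \<inter> graded_piece u \<alpha> \<and>
        V_basepoint_free \<Sigma> u I \<alpha>}"

definition regularity_pair ::
  "(real ^ 'n) set set \<Rightarrow> ('k::finite \<Rightarrow> int ^ 'n) \<Rightarrow> 'k cox set \<Rightarrow>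
     (int ^ 'k) set \<times> (int ^ 'k) set \<Rightarrow> bool" where
  "regularity_pair \<Sigma> u I = (\<lambda>(\<alpha>, \<alpha>\<^sub>0).
     \<alpha> \<in> carrier (class_group u) \<and> \<alpha>\<^sub>0 \<in> carrier (class_group u) \<and>
     \<alpha> \<in> Reg \<Sigma> u I \<and> \<alpha> \<otimes>\<^bsub>class_group u\<^esub> \<alpha>\<^sub>0 \<in> Reg \<Sigma> u I \<and>
     V_basepoint_free \<Sigma> u I \<alpha>\<^sub>0)"

end

(* On the chart of a cone sg the ideal I is generated by n sections F_j, and the semigroup ring of
   its dual cone is Cohen-Macaulay (Hochster), so the Koszul complex of the F_j is exact below
   level n. By nefness the Cech complex of the line bundle of alpha_0 + alpha_J is exact for every
   set J of indices: in each degree m it computes the cohomology of a simplicial complex which is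
   the nerve of a cover of a convex set. A chase through the Koszul-Cech double complex then
   identifies (S / I) in degree alpha_0 + alpha_1 + ... + alpha_n with the sections over the finite
   scheme V(I), that is, with the product of its local rings. Injectivity gives equality with the
   saturation, and counting dimensions gives the degree. *)
theory Submission
 imports Defs
begin

text \<open>Hochster's theorem is proved in Koszul form: at a point of the chart, exactness up to a
  denominator holds for all quotients of monomial spans whose exponents fill a translated face of
  the dual cone. The semigroup ring alone is not stable under the induction: dividing by a monomial
  that vanishes at the point leaves a slab, and a generic translation is what makes the slices of
  the slab lattice points of translated facets. If no character of the face vanishes at the point,
  characters minus their values form a regular sequence instead. Krull dimension zero enters through
  one consequence: every function on a chart of V(I) satisfies a split polynomial equation. This
  rests on the uncountability of the complex numbers and yields points, nilpotency and separating
  functions. Line bundles and their restrictions all live in one Laurent polynomial ring, as spans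
  of sets of exponents. The divisor \<open>b\<close> stays arbitrary, so that both memberships in
  \<open>Reg\<close> are instances of one statement. Local rings are handled through the kernels
  \<open>germ\<close>; their finite dimension comes from the surjectivity of the finite-dimensional
  space of global sections.\<close>

section \<open>Koszul cochains\<close>

text \<open>A cochain assigns a ring element to every finite set of naturals; the sets \<open>J\<close> with
 \<open>card J = k\<close> form the level \<open>k\<close>. With \<open>F = (\<lambda>_. 1)\<close> the same differential is that of the
 Cech complex.\<close>

definition ksgn :: "nat => nat set => 'r::comm_ring_1" where
 "ksgn j J = (-1) ^ card {k \<in> J. k < j}"

definition kd :: "(nat => 'r::comm_ring_1) => (nat set => 'r) => nat set => 'r" where
 "kd F z J = (\<Sum>j\<in>J. ksgn j J * F j * z (J - {j}))"

text \<open>Contraction with the \<open>j\<close>-th basis vector of the exterior algebra in which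
  \<open>kd F\<close> multiplies by the combination of the basis vectors with coefficients
  \<open>F j\<close>.\<close>

definition kh :: "nat => (nat set => 'r::comm_ring_1) => nat set => 'r" where
 "kh j z J = (if j \<in> J then 0 else ksgn j J * z (insert j J))"

lemma ksgn_square [simp]: "ksgn j J * ksgn j J = 1" by (simp add: ksgn_def flip: power_add mult_2)

lemma ksgn_square' [simp]: "ksgn j J * (ksgn j J * x) = x" by (simp flip: mult.assoc)

lemma ksgn_remove_self [simp]: "ksgn j (J - {j}) = ksgn j J"
 unfolding ksgn_def by (rule arg_cong[where f = "%A. (-1) ^ card A"]) auto

lemma ksgn_insert:
 assumes "finite J" "j \<notin> J"
 shows "ksgn i (insert j J) = (if j < i then - ksgn i J else ksgn i J)"
proof (cases "j < i")
 case True
 hence "{k \<in> insert j J. k < i} = insert j {k \<in> J. k < i}" by auto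
 with assms True show ?thesis by (simp add: ksgn_def)
next
 case False
 hence "{k \<in> insert j J. k < i} = {k \<in> J. k < i}" by auto
 with False show ?thesis by (simp add: ksgn_def)
qed

lemma ksgn_remove:
 assumes "finite J" "j \<in> J"
 shows "ksgn i (J - {j}) = (if j < i then - ksgn i J else ksgn i J :: 'r::comm_ring_1)"
 using ksgn_insert[of "J - {j}" j i, where 'a='r] assms by (simp add: insert_absorb)

lemma kd_kd:
 assumes fin: "finite J"
 shows "kd F (kd F z) J = 0"
proof -
 \<comment> \<open>The double sum runs over ordered pairs of removed indices; exchanging the two
   reverses the sign.\<close>
 define t where "t j i = ksgn j J * F j * (ksgn i (J - {j}) * F i * z (J - {j} - {i}))" for j i
 have anti: "t i j = - t j i" if "i \<in> J" "j \<in> J" "i < j" for i j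
 proof -
  have "J - {i} - {j} = J - {j} - {i}" by auto
  with that fin show ?thesis by (simp add: t_def ksgn_remove algebra_simps)
 qed
 have "kd F (kd F z) J = (\<Sum>j\<in>J. \<Sum>i\<in>J - {j}. t j i)"
  by (simp add: kd_def t_def sum_distrib_left)
 also have "... = (\<Sum>j\<in>J. (\<Sum>i\<in>{i \<in> J. i < j}. t j i) + (\<Sum>i\<in>{i \<in> J. j < i}. t j i))"
 proof (intro sum.cong refl)
  fix j assume "j \<in> J"
  have eq: "J - {j} = {i \<in> J. i < j} \<union> {i \<in> J. j < i}"
  proof (rule Set.set_eqI)
   show "i \<in> J - {j} \<longleftrightarrow> i \<in> {i \<in> J. i < j} \<union> {i \<in> J. j < i}" for i
    by (cases i j rule: linorder_cases) auto
  qed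
  have "(\<Sum>i\<in>{i \<in> J. i < j} \<union> {i \<in> J. j < i}. t j i)
    = (\<Sum>i\<in>{i \<in> J. i < j}. t j i) + (\<Sum>i\<in>{i \<in> J. j < i}. t j i)"
   by (rule sum.union_disjoint) (simp add: fin, simp add: fin, force)
  thus "(\<Sum>i\<in>J - {j}. t j i) = (\<Sum>i\<in>{i \<in> J. i < j}. t j i) + (\<Sum>i\<in>{i \<in> J. j < i}. t j i)"
   by (simp only: eq)
 qed
 also have "... = (\<Sum>j\<in>J. \<Sum>i\<in>{i \<in> J. i < j}. t j i) + (\<Sum>j\<in>J. \<Sum>i\<in>{i \<in> J. j < i}. t j i)"
  by (rule sum.distrib)
 also have "(\<Sum>j\<in>J. \<Sum>i\<in>{i \<in> J. j < i}. t j i) = (\<Sum>i\<in>J. \<Sum>j\<in>{j \<in> J. j < i}. t j i)"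
  using fin fin by (rule sum.swap_restrict)
 also have "... = (\<Sum>j\<in>J. \<Sum>i\<in>{i \<in> J. i < j}. - t j i)"
 proof (intro sum.cong refl)
  show "t i j = - t j i" if "j \<in> J" "i \<in> {i \<in> J. i < j}" for i j
   using anti[of i j] that by simp
 qed
 finally show ?thesis by (simp add: sum_negf)
qed

text \<open>If \<open>j\<close> is in \<open>J\<close>, only the term that removes \<open>j\<close>
  survives, because \<open>kh j z\<close> vanishes on sets containing \<open>j\<close>. Otherwise
  the two sums cancel except for the term of \<open>j\<close> in the second one. So multiplication
  by \<open>F j\<close> is null-homotopic.\<close>

lemma kh_homotopy:
 assumes fin: "finite J"
 shows "kd F (kh j z) J + kh j (kd F z) J = F j * z J"
proof (cases "j \<in> J")
 case True
 have "kd F (kh j z) J = (\<Sum>i\<in>{j}. ksgn i J * F i * kh j z (J - {i}))"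
  unfolding kd_def using fin True by (intro sum.mono_neutral_right) (auto simp: kh_def)
 with True show ?thesis by (simp add: kh_def insert_absorb algebra_simps)
next
 case False
 have "kd F (kh j z) J = (\<Sum>i\<in>J. ksgn i J * F i * (ksgn j (J - {i}) * z (insert j (J - {i}))))"
  unfolding kd_def using False by (intro sum.cong refl) (auto simp: kh_def)
 also have "... = - (\<Sum>i\<in>J. ksgn j J * (ksgn i (insert j J) * F i * z (insert j J - {i})))"
  unfolding sum_negf[symmetric]
 proof (intro sum.cong refl)
  fix i assume i: "i \<in> J"
  with False have "insert j (J - {i}) = insert j J - {i}" "i ~= j" by auto
  with i False fin show "ksgn i J * F i * (ksgn j (J - {i}) * z (insert j (J - {i})))
    = - (ksgn j J * (ksgn i (insert j J) * F i * z (insert j J - {i})))"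
   by (auto simp: ksgn_remove ksgn_insert algebra_simps)
 qed
 moreover have "kh j (kd F z) J = F j * z J
   + (\<Sum>i\<in>J. ksgn j J * (ksgn i (insert j J) * F i * z (insert j J - {i})))"
  using False fin by (simp add: kh_def kd_def ksgn_insert algebra_simps sum_distrib_left)
 ultimately show ?thesis by simp
qed

lemma kd_add: "kd F (%J. y J + z J) J = kd F y J + kd F z J"
 by (simp add: kd_def algebra_simps sum.distrib)

lemma kd_diff: "kd F (%J. y J - z J) J = kd F y J - kd F z J"
 by (simp add: kd_def algebra_simps sum_subtractf)

lemma kd_scale: "kd F (%J. c * z J) J = c * kd F z J" by (simp add: kd_def sum_distrib_left mult_ac)

lemma kd_sum: "kd F (%J. \<Sum>i\<in>M. z i J) J = (\<Sum>i\<in>M. kd F (z i) J)"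
 by (simp add: kd_def sum_distrib_left) (rule sum.swap)

lemma kd_cong: "(!!j. j \<in> J ==> y (J - {j}) = z (J - {j})) ==> kd F y J = kd F z J"
 by (simp add: kd_def)

text \<open>The signs of the two differentials refer to different index sets, so they commute
  without a sign; this is what makes the Koszul and Cech directions a double complex.\<close>

lemma kd_uncurry_commute:
 "kd F (%J. kd G (c J) T) J = kd G (%T. kd F (%J. c J T) J) T"
 by (simp add: kd_def sum_distrib_left) (subst sum.swap, simp add: mult_ac)

section \<open>Localized Koszul exactness\<close>

text \<open>\<open>A\<close> is a subring of the ambient ring and \<open>S\<close> a multiplicative
  set in it. Modules are sets of ambient elements, and localization is expressed by allowing a
  factor from \<open>S\<close>. Later \<open>S\<close> consists of the functions nonzero at a point,
  of products of linear factors, or of \<open>1\<close> alone.\<close>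

locale denominators =
 fixes A S :: "'r::comm_ring_1 set"
 assumes A_one: "1 \<in> A" and A_uminus: "a \<in> A ==> - a \<in> A"
  and A_add: "a \<in> A ==> b \<in> A ==> a + b \<in> A"
  and A_mult: "a \<in> A ==> b \<in> A ==> a * b \<in> A"
  and S_one: "1 \<in> S" and S_mult: "s \<in> S ==> t \<in> S ==> s * t \<in> S" and S_sub: "S \<subseteq> A"
begin

definition smod :: "'r set => bool" where
 "smod N \<longleftrightarrow> 0 \<in> N \<and> (\<forall>x\<in>N. \<forall>y\<in>N. x + y \<in> N) \<and> (\<forall>a\<in>A. \<forall>x\<in>N. a * x \<in> N)"

lemma smod_zero: "smod N ==> 0 \<in> N"
 and smod_add: "smod N ==> x \<in> N ==> y \<in> N ==> x + y \<in> N"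
 and smod_scale: "smod N ==> a \<in> A ==> x \<in> N ==> a * x \<in> N" by (auto simp: smod_def)

lemma smod_uminus: "smod N ==> x \<in> N ==> - x \<in> N"
 using smod_scale[of N "-1" x] A_one A_uminus by simp

lemma smod_diff: "smod N ==> x \<in> N ==> y \<in> N ==> x - y \<in> N"
 using smod_add[of N x "- y"] smod_uminus by simp

lemma smod_sum: "smod N ==> (!!i. i \<in> M ==> x i \<in> N) ==> sum x M \<in> N"
 by (induction M rule: infinite_finite_induct) (auto intro: smod_zero smod_add)

lemma A_zero: "0 \<in> A" using A_add[of 1 "- 1"] A_one A_uminus by simp

lemma smod_A: "smod A" by (simp add: smod_def A_zero A_add A_mult)

lemma A_power: "a \<in> A ==> a ^ n \<in> A" by (induction n) (auto intro: A_one A_mult)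

lemma A_ksgn: "ksgn j J \<in> A" by (simp add: ksgn_def A_power A_one A_uminus)

lemma smod_kd:
 assumes "smod N" "!!j. j \<in> J ==> F j \<in> A" "!!j. j \<in> J ==> z (J - {j}) \<in> N"
 shows "kd F z J \<in> N" unfolding kd_def
proof (rule smod_sum[OF assms(1)])
 fix j assume "j \<in> J"
 thus "ksgn j J * F j * z (J - {j}) \<in> N"
  by (intro smod_scale[OF assms(1)] A_mult[OF A_ksgn] assms(2,3))
qed

text \<open>Exactness at level \<open>k\<close> of the Koszul complex of \<open>N / Y\<close> after inverting \<open>S\<close>.\<close>

definition kexact :: "(nat => 'r) => nat set => 'r set => 'r set => nat => bool" where
 "kexact F I N Y k \<longleftrightarrow>
   (\<forall>z. (\<forall>J\<subseteq>I. card J = k --> z J \<in> N) --> (\<forall>J\<subseteq>I. card J = Suc k --> kd F z J \<in> Y) -->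
    (\<exists>s\<in>S. \<exists>y. (\<forall>J\<subseteq>I. Suc (card J) = k --> y J \<in> N) \<and>
         (\<forall>J\<subseteq>I. card J = k --> s * z J - kd F y J \<in> Y)))"

lemma kexactD:
 assumes "kexact F I N Y k"
  and "!!J. J \<subseteq> I ==> card J = k ==> z J \<in> N"
  and "!!J. J \<subseteq> I ==> card J = Suc k ==> kd F z J \<in> Y"
 obtains s y where "s \<in> S" "!!J. J \<subseteq> I ==> Suc (card J) = k ==> y J \<in> N"
  "!!J. J \<subseteq> I ==> card J = k ==> s * z J - kd F y J \<in> Y"
proof -
 have "\<exists>s\<in>S. \<exists>y. (\<forall>J\<subseteq>I. Suc (card J) = k --> y J \<in> N) \<and>
         (\<forall>J\<subseteq>I. card J = k --> s * z J - kd F y J \<in> Y)"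
  using assms by (simp add: kexact_def)
 thus ?thesis using that by metis
qed

lemma card_remove:
 assumes "finite I" "J \<subseteq> I" "j \<in> J" shows "Suc (card (J - {j})) = card J"
 using assms by (meson card_Suc_Diff1 finite_subset)

lemma kexact_refl: "smod N ==> kexact F I N N k" unfolding kexact_def
proof (intro allI impI bexI exI conjI)
 fix z J assume "smod N" "\<forall>J\<subseteq>I. card J = k --> z J \<in> N" "J \<subseteq> I" "card J = k"
 thus "1 * z J - kd F (%_. 0) J \<in> N" by (simp add: kd_def)
qed (auto intro: smod_zero S_one)

text \<open>The middle of the long exact sequence of \<open>Y / Z\<close>, \<open>N / Z\<close> and
  \<open>N / Y\<close>: a cocycle is first moved into \<open>Y\<close> by a coboundary, and the
  result is then bounded inside \<open>Y / Z\<close>. The two denominators multiply.\<close>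

lemma kexact_trans:
 assumes fin: "finite I" and F: "!!j. j \<in> I ==> F j \<in> A"
  and N: "smod N" and Y: "smod Y" and Z: "smod Z" and sub: "Y \<subseteq> N" "Z \<subseteq> Y"
  and XY: "kexact F I N Y k" and YZ: "kexact F I Y Z k"
 shows "kexact F I N Z k" unfolding kexact_def
proof (intro allI impI)
 fix z assume zX: "\<forall>J\<subseteq>I. card J = k --> z J \<in> N"
  and dz: "\<forall>J\<subseteq>I. card J = Suc k --> kd F z J \<in> Z"
 obtain s y where sy: "s \<in> S" "!!J. J \<subseteq> I ==> Suc (card J) = k ==> y J \<in> N"
  "!!J. J \<subseteq> I ==> card J = k ==> s * z J - kd F y J \<in> Y"
 proof (rule kexactD[OF XY, of z])
  show "kd F z J \<in> Y" if "J \<subseteq> I" "card J = Suc k" for J using dz sub that by blast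
 qed (use zX in auto)
 define z' where "z' J = s * z J - kd F y J" for J
 have "kd F z' J = s * kd F z J" if "J \<subseteq> I" for J
  using kd_kd[of J F y] finite_subset[OF that fin] by (simp add: z'_def[abs_def] kd_diff kd_scale)
 hence dz': "kd F z' J \<in> Z" if "J \<subseteq> I" "card J = Suc k" for J
  using that dz sy(1) S_sub smod_scale[OF Z] by auto
 obtain s' y' where sy': "s' \<in> S" "!!J. J \<subseteq> I ==> Suc (card J) = k ==> y' J \<in> Y"
  "!!J. J \<subseteq> I ==> card J = k ==> s' * z' J - kd F y' J \<in> Z"
  by (rule kexactD[OF YZ, of z']) (use sy(3) dz' in \<open>auto simp: z'_def\<close>)
 show "\<exists>s\<in>S. \<exists>y. (\<forall>J\<subseteq>I. Suc (card J) = k --> y J \<in> N) \<and>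
      (\<forall>J\<subseteq>I. card J = k --> s * z J - kd F y J \<in> Z)"
 proof (intro bexI[of _ "s' * s"] exI[of _ "%J. s' * y J + y' J"] conjI allI impI)
  show "s' * s \<in> S" using sy(1) sy'(1) S_mult by blast
  fix J assume J: "J \<subseteq> I"
  show "s' * y J + y' J \<in> N" if "Suc (card J) = k"
   using sy(2)[OF J that] sy'(1,2) J that sub S_sub by (intro smod_add[OF N] smod_scale[OF N]) auto
  show "s' * s * z J - kd F (%J. s' * y J + y' J) J \<in> Z" if "card J = k"
   using sy'(3)[OF J that] by (simp add: z'_def kd_add kd_scale algebra_simps)
 qed
qed

text \<open>The elements of the ideal generated by \<open>F\<close> act on the Koszul complex by null-homotopic maps.\<close>

lemma kexact_ideal_action:
 assumes fin: "finite I" and N: "smod N" and Y: "smod Y"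
  and c: "!!j. j \<in> I ==> c j \<in> A" and g: "g = (\<Sum>j\<in>I. c j * F j)"
  and zX: "!!J. J \<subseteq> I ==> card J = k ==> z J \<in> N"
  and dz: "!!J. J \<subseteq> I ==> card J = Suc k ==> kd F z J \<in> Y"
 obtains y where "!!J. J \<subseteq> I ==> Suc (card J) = k ==> y J \<in> N"
  "!!J. J \<subseteq> I ==> card J = k ==> g * z J - kd F y J \<in> Y"
proof
 define y where "y J = (\<Sum>j\<in>I. c j * kh j z J)" for J
 have kh: "kh j w J \<in> M" if M: "smod M" and j: "j \<in> I" "J \<subseteq> I"
  and w: "!!J'. J' \<subseteq> I ==> card J' = Suc (card J) ==> w J' \<in> M" for j w M J
  using j w[of "insert j J"] finite_subset[OF j(2) fin] smod_zero[OF M]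
  by (auto simp: kh_def intro!: smod_scale[OF M A_ksgn])
 show "y J \<in> N" if "J \<subseteq> I" "Suc (card J) = k" for J
  unfolding y_def using c kh[OF N _ \<open>J \<subseteq> I\<close>] zX that
  by (intro smod_sum[OF N] smod_scale[OF N]) auto
 show "g * z J - kd F y J \<in> Y" if J: "J \<subseteq> I" "card J = k" for J
 proof -
  have "g * z J = (\<Sum>j\<in>I. c j * (kd F (kh j z) J + kh j (kd F z) J))"
   by (simp add: g kh_homotopy finite_subset[OF J(1) fin] sum_distrib_right mult.assoc)
  hence "g * z J - kd F y J = (\<Sum>j\<in>I. c j * kh j (kd F z) J)"
   by (simp add: y_def[abs_def] kd_sum kd_scale algebra_simps sum.distrib)
  also have "... \<in> Y" using c kh[OF Y _ J(1), of _ "kd F z"] dz J(2)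
   by (intro smod_sum[OF Y] smod_scale[OF Y]) auto
  finally show ?thesis .
 qed
qed

text \<open>Multiplication by \<open>g\<close> is injective on \<open>N / Y\<close>, so its kernel
  on the cohomology at level \<open>k\<close> comes from the cohomology of
  \<open>N / (g N + Y)\<close> one level lower, which vanishes by \<open>ex\<close>. By
  \<open>gK\<close> a power of \<open>g\<close> lies in the localized ideal of \<open>F\<close> and
  acts as zero. An endomorphism that is both injective and nilpotent leaves no cohomology.\<close>

lemma kexact_step:
 assumes fin: "finite I" and F: "!!j. j \<in> I ==> F j \<in> A"
  and N: "smod N" and Y: "smod Y" and YX: "Y \<subseteq> N"
  and g: "g \<in> A" and nzd: "!!x. x \<in> N ==> g * x \<in> Y ==> x \<in> Y"
  and s0: "s0 \<in> S" and c: "!!j. j \<in> I ==> c j \<in> A" and gK: "s0 * g ^ K = (\<Sum>j\<in>I. c j * F j)"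
  and ex: "!!k'. k = Suc k' ==> kexact F I N {g * x + y |x y. x \<in> N \<and> y \<in> Y} k'"
 shows "kexact F I N Y k"
proof -
 \<comment> \<open>Injectivity of \<open>g\<close> on cohomology: if \<open>g * z\<close> is a
   coboundary, then so is a multiple of \<open>z\<close> by a denominator.\<close>
 have one: "\<exists>s\<in>S. \<exists>y. (\<forall>J\<subseteq>I. Suc (card J) = k --> y J \<in> N) \<and>
         (\<forall>J\<subseteq>I. card J = k --> s * z J - kd F y J \<in> Y)"
  if zX: "!!J. J \<subseteq> I ==> card J = k ==> z J \<in> N"
   and y: "!!J. J \<subseteq> I ==> Suc (card J) = k ==> y J \<in> N"
   and gz: "!!J. J \<subseteq> I ==> card J = k ==> g * z J - kd F y J \<in> Y" for z y
 proof (cases k)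
  case 0
  have "z J \<in> Y" if "J \<subseteq> I" "card J = k" for J
  proof -
   have "J = {}" using that 0 finite_subset[OF _ fin] by auto
   with gz[OF that] zX[OF that] show ?thesis by (auto simp: kd_def intro: nzd)
  qed
  moreover have "J = {}" if "J \<subseteq> I" "card J = k" for J
   using that 0 finite_subset[OF _ fin] by auto
  ultimately show ?thesis
   using 0 S_one by (intro bexI[of _ 1] exI[of _ "%_. 0"]) (auto simp: kd_def)
 next
  case (Suc k')
  let ?W = "{g * x + y |x y. x \<in> N \<and> y \<in> Y}"
  \<comment> \<open>The primitive \<open>y\<close> of \<open>g * z\<close> is a cocycle modulo
    \<open>g N + Y\<close>. Exactness one level lower writes \<open>s * y\<close> as
    \<open>kd F y' + g * x + w\<close>, and \<open>x\<close> turns out to be the primitive of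
    \<open>s * z\<close>.\<close>
  have "kd F y J \<in> ?W" if J: "J \<subseteq> I" "card J = Suc k'" for J
  proof -
   have "kd F y J = g * z J + - (g * z J - kd F y J)" by simp
   with zX gz[OF J(1)] J Suc smod_uminus[OF Y] show ?thesis by blast
  qed
  with kexactD[OF ex[OF Suc], of y] y Suc obtain s y' where sy': "s \<in> S"
   "!!J. J \<subseteq> I ==> Suc (card J) = k' ==> y' J \<in> N"
   "!!J. J \<subseteq> I ==> card J = k' ==> s * y J - kd F y' J \<in> ?W" by auto
  have "\<exists>x w. x \<in> N \<and> w \<in> Y \<and> s * y J - kd F y' J = g * x + w"
   if "J \<subseteq> I" "card J = k'" for J using sy'(3)[OF that] by blast
  then obtain x w where xw: "!!J. J \<subseteq> I ==> card J = k' ==>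
   x J \<in> N \<and> w J \<in> Y \<and> s * y J - kd F y' J = g * x J + w J" by metis
  have "s * z J - kd F x J \<in> Y" if J: "J \<subseteq> I" "card J = k" for J
  proof (rule nzd)
   have fJ: "finite J" using J fin finite_subset by blast
   have Jj: "J - {j} \<subseteq> I" "card (J - {j}) = k'" if "j \<in> J" for j
    using J card_remove[OF fin J(1) that] Suc by auto
   have "s * kd F y J = kd F (%J. s * y J) J" by (simp add: kd_scale)
   also have "... = kd F (%J. g * x J + w J + kd F y' J) J"
    using xw[OF Jj] by (intro kd_cong) (auto simp: algebra_simps)
   also have "... = g * kd F x J + kd F w J"
    using kd_kd[OF fJ, of F y'] by (simp add: kd_add kd_scale)
   finally have eq: "g * (s * z J - kd F x J) = s * (g * z J - kd F y J) + kd F w J"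
    by (simp add: algebra_simps)
   have wY: "kd F w J \<in> Y" using xw[OF Jj] J(1) F by (intro smod_kd[OF Y]) auto
   show "g * (s * z J - kd F x J) \<in> Y" unfolding eq using gz[OF J] sy'(1) S_sub wY
    by (intro smod_add[OF Y] smod_scale[OF Y]) auto
   have xX: "kd F x J \<in> N" using xw[OF Jj] J(1) F by (intro smod_kd[OF N]) auto
   show "s * z J - kd F x J \<in> N" using zX[OF J] sy'(1) S_sub xX
    by (intro smod_diff[OF N] smod_scale[OF N]) auto
  qed
  with sy'(1) xw Suc show ?thesis by (intro bexI[of _ s] exI[of _ x]) auto
 qed
 show ?thesis unfolding kexact_def
 proof (intro allI impI)
  fix z assume zX: "\<forall>J\<subseteq>I. card J = k --> z J \<in> N"
   and dz: "\<forall>J\<subseteq>I. card J = Suc k --> kd F z J \<in> Y"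
  \<comment> \<open>Peels off one factor \<open>g\<close> at a time, collecting a denominator at
    each turn.\<close>
  have iter: "\<exists>s\<in>S. \<exists>y. (\<forall>J\<subseteq>I. Suc (card J) = k --> y J \<in> N) \<and>
         (\<forall>J\<subseteq>I. card J = k --> s * z J - kd F y J \<in> Y)"
   if "s \<in> S" "!!J. J \<subseteq> I ==> Suc (card J) = k ==> y J \<in> N"
    "!!J. J \<subseteq> I ==> card J = k ==> s * g ^ m * z J - kd F y J \<in> Y" for m s y
   using that
  proof (induction m arbitrary: s y)
   case 0
   thus ?case by auto
  next
   case (Suc m)
   have "s * g ^ m * z J \<in> N" if "J \<subseteq> I" "card J = k" for J
    using that zX Suc.prems(1) S_sub g by (intro smod_scale[OF N] A_mult A_power) auto
   moreover have "g * (s * g ^ m * z J) - kd F y J \<in> Y" if "J \<subseteq> I" "card J = k" for J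
    using Suc.prems(3)[OF that] by (simp add: mult_ac)
   ultimately obtain s' y' where "s' \<in> S" "\<forall>J\<subseteq>I. Suc (card J) = k --> y' J \<in> N"
    "\<forall>J\<subseteq>I. card J = k --> s' * (s * g ^ m * z J) - kd F y' J \<in> Y"
    using one[of "%J. s * g ^ m * z J" y] Suc.prems(2) by blast
   thus ?case using Suc.prems(1) by (intro Suc.IH[of "s' * s" y']) (auto simp: S_mult mult.assoc)
  qed
  \<comment> \<open>The start of the iteration: \<open>s0 * g ^ K\<close> is in the ideal of
    \<open>F\<close> and therefore acts by a null-homotopic map.\<close>
  obtain y where y: "!!J. J \<subseteq> I ==> Suc (card J) = k ==> y J \<in> N"
   "!!J. J \<subseteq> I ==> card J = k ==> s0 * g ^ K * z J - kd F y J \<in> Y"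
   by (rule kexact_ideal_action[OF fin N Y c gK, of k z]) (use zX dz in auto)
  show "\<exists>s\<in>S. \<exists>y. (\<forall>J\<subseteq>I. Suc (card J) = k --> y J \<in> N) \<and>
         (\<forall>J\<subseteq>I. card J = k --> s * z J - kd F y J \<in> Y)"
   by (rule iter[OF s0 y])
 qed
qed

end

section \<open>Laurent polynomials with prescribed exponents\<close>

abbreviation mon :: "'m => complex => 'm \<Rightarrow>\<^sub>0 complex" where "mon \<equiv> Poly_Mapping.single"
abbreviation coef :: "('m \<Rightarrow>\<^sub>0 complex) => 'm => complex" where "coef \<equiv> Poly_Mapping.lookup"
abbreviation supp :: "('m \<Rightarrow>\<^sub>0 complex) => 'm set" where "supp \<equiv> Poly_Mapping.keys"
abbreviation "ev \<equiv> eval_chart"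

definition lspan :: "'m set => ('m \<Rightarrow>\<^sub>0 complex) set" where
 "lspan Q = {f. supp f \<subseteq> Q}"

lemma lspan_iff: "f \<in> lspan Q \<longleftrightarrow> (\<forall>m. coef f m ~= 0 --> m \<in> Q)"
 by (auto simp: lspan_def in_keys_iff)

lemma lspanD: "f \<in> lspan Q ==> m \<notin> Q ==> coef f m = 0" by (auto simp: lspan_iff)

lemma lspan_mono: "f \<in> lspan P ==> P \<subseteq> Q ==> f \<in> lspan Q"
 by (auto simp: lspan_def)

lemma lspan_zero [simp]: "0 \<in> lspan Q" by (simp add: lspan_def)

lemma lspan_add: "f \<in> lspan Q ==> g \<in> lspan Q ==> f + g \<in> lspan Q"
 by (auto simp: lspan_iff lookup_add) (metis add.right_neutral)

lemma lspan_uminus: "f \<in> lspan Q ==> - f \<in> lspan Q" by (auto simp: lspan_iff)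

lemma lspan_diff: "f \<in> lspan Q ==> g \<in> lspan Q ==> f - g \<in> lspan Q"
 using lspan_add[of f Q "- g"] lspan_uminus[of g Q] by simp

lemma lspan_sum: "(!!i. i \<in> M ==> f i \<in> lspan Q) ==> sum f M \<in> lspan Q"
 by (induction M rule: infinite_finite_induct) (simp_all add: lspan_add)

lemma lspan_mon [simp]: "mon m c \<in> lspan Q \<longleftrightarrow> m \<in> Q \<or> c = 0"
 by (auto simp: lspan_iff lookup_single when_def)

lemma lspan_mult:
 fixes f g :: "'m::comm_monoid_add \<Rightarrow>\<^sub>0 complex"
 assumes "f \<in> lspan P" "g \<in> lspan Q" "!!a b. a \<in> P ==> b \<in> Q ==> a + b \<in> R"
 shows "f * g \<in> lspan R" using keys_mult[of f g] assms unfolding lspan_def by blast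

lemma coef_mon_mult:
 fixes f :: "'m::ab_group_add \<Rightarrow>\<^sub>0 complex"
 shows "coef (mon a c * f) m = c * coef f (m - a)"
proof -
 have "coef (mon a c * f) m = (\<Sum>l. (c when a = l) * (\<Sum>q. coef f q when m = l + q))"
  by (simp add: lookup_mult lookup_single)
 also have "... = (\<Sum>l. c * (\<Sum>q. coef f q when q = m - l) when l = a)"
  by (rule Sum_any.cong) (auto simp: when_def algebra_simps intro!: arg_cong2[where f = "(*)"] Sum_any.cong)
 finally show ?thesis by simp
qed

lemma monomial_expansion: "f = (\<Sum>m\<in>supp f. mon m (coef f m))"
 by (rule poly_mapping_eqI) (simp add: lookup_sum lookup_single when_def in_keys_iff)

lemma monomial_expansion_on:
 assumes "finite K" "supp f \<subseteq> K"
 shows "f = (\<Sum>m\<in>K. mon m (coef f m))"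
 using assms by (intro poly_mapping_eqI) (auto simp: lookup_sum lookup_single when_def in_keys_iff)

definition restr :: "'m set => ('m \<Rightarrow>\<^sub>0 complex) => 'm \<Rightarrow>\<^sub>0 complex" where
 "restr D f = Abs_poly_mapping (%m. if m \<in> D then coef f m else 0)"

lemma coef_restr: "coef (restr D f) m = (if m \<in> D then coef f m else 0)"
proof -
 have "finite {m. (if m \<in> D then coef f m else 0) ~= 0}"
  by (rule finite_subset[OF _ finite_keys[of f]]) (auto simp: in_keys_iff)
 thus ?thesis unfolding restr_def by (subst lookup_Abs_poly_mapping) auto
qed

section \<open>Affine semigroup rings of rational cones\<close>

text \<open>The dual monoid of a cone given by integral generators; \<open>lspan (dual U)\<close> is
  the coordinate ring of the affine toric variety. It is matched with \<open>dual_monoid\<close> in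
  \<open>dual_monoid_eq\<close>.\<close>

definition dual :: "(int ^ 'n) set => (int ^ 'n) set" where
 "dual U = {m. \<forall>u\<in>U. pairing m u \<ge> 0}"

lemma pairing_add: "pairing (m + m') u = pairing m u + pairing m' u"
 by (simp add: pairing_def algebra_simps sum.distrib)

lemma pairing_diff: "pairing (m - m') u = pairing m u - pairing m' u"
 by (simp add: pairing_def algebra_simps sum_subtractf)

lemma pairing_uminus: "pairing (- m) u = - pairing m u" by (simp add: pairing_def sum_negf)

lemma pairing_zero [simp]: "pairing 0 u = 0" by (simp add: pairing_def)

lemma rvec_inner: "rvec m \<bullet> rvec u = of_int (pairing m u)"
 by (simp add: rvec_def pairing_def inner_vec_def)

lemma rvec_add: "rvec (m + m') = rvec m + rvec m'" by (simp add: rvec_def vec_eq_iff)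

lemma rvec_diff: "rvec (m - m') = rvec m - rvec m'" by (simp add: rvec_def vec_eq_iff)

lemma rvec_zero [simp]: "rvec 0 = 0" by (simp add: rvec_def vec_eq_iff)

lemma rvec_eq_iff [simp]: "rvec m = rvec m' \<longleftrightarrow> m = m'"
 by (simp add: rvec_def vec_eq_iff)

lemma dual_zero [simp]: "0 \<in> dual U" by (simp add: dual_def)

lemma dual_add: "a \<in> dual U ==> b \<in> dual U ==> a + b \<in> dual U"
 by (simp add: dual_def pairing_add)

lemma eval_chart_superset:
 assumes "finite K" "supp f \<subseteq> K"
 shows "ev pt f = (\<Sum>m\<in>K. coef f m * pt m)"
 unfolding eval_chart_def by (rule sum.mono_neutral_left) (use assms in \<open>auto simp: in_keys_iff\<close>)

lemma eval_chart_add: "ev pt (f + g) = ev pt f + ev pt g"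
proof -
 have "supp f \<subseteq> supp f \<union> supp g" "supp g \<subseteq> supp f \<union> supp g" "supp (f + g) \<subseteq> supp f \<union> supp g"
  using keys_add[of f g] by auto
 thus ?thesis
  by (simp add: eval_chart_superset[of "supp f \<union> supp g"] lookup_add algebra_simps sum.distrib)
qed

lemma eval_chart_zero [simp]: "ev pt 0 = 0" by (simp add: eval_chart_def)

lemma eval_chart_mon [simp]: "ev pt (mon m c) = c * pt m"
 by (cases "c = 0") (simp_all add: eval_chart_def)

lemma eval_chart_sum: "ev pt (sum f M) = (\<Sum>i\<in>M. ev pt (f i))"
 by (induction M rule: infinite_finite_induct) (simp_all add: eval_chart_add)

lemma eval_chart_uminus: "ev pt (- f) = - ev pt f"
 using eval_chart_add[of pt f "- f"] by (simp add: add_eq_0_iff)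

lemma eval_chart_diff: "ev pt (f - g) = ev pt f - ev pt g"
 using eval_chart_add[of pt f "- g"] by (simp add: eval_chart_uminus)

lemma eval_chart_mult:
 assumes f: "f \<in> lspan Q" and g: "g \<in> lspan Q"
  and mult: "!!a b. a \<in> Q ==> b \<in> Q ==> pt (a + b) = pt a * pt b"
 shows "ev pt (f * g) = ev pt f * ev pt g"
proof -
 have "f * g = (\<Sum>a\<in>supp f. mon a (coef f a)) * (\<Sum>b\<in>supp g. mon b (coef g b))"
  using monomial_expansion[of f] monomial_expansion[of g] by simp
 also have "... = (\<Sum>a\<in>supp f. \<Sum>b\<in>supp g. mon (a + b) (coef f a * coef g b))"
  by (simp add: sum_product mult_single)
 finally have "ev pt (f * g) = (\<Sum>a\<in>supp f. \<Sum>b\<in>supp g. coef f a * coef g b * pt (a + b))"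
  by (simp add: eval_chart_sum)
 also have "... = (\<Sum>a\<in>supp f. \<Sum>b\<in>supp g. (coef f a * pt a) * (coef g b * pt b))"
 proof (intro sum.cong refl)
  fix a b assume "a \<in> supp f" "b \<in> supp g"
  with f g have "a \<in> Q" "b \<in> Q" by (auto simp: lspan_def)
  thus "coef f a * coef g b * pt (a + b) = (coef f a * pt a) * (coef g b * pt b)"
   by (simp add: mult)
 qed
 also have "... = ev pt f * ev pt g" by (simp add: eval_chart_def sum_product)
 finally show ?thesis .
qed

text \<open>The condition on exponents under which \<open>lspan Q\<close> is a module over
  \<open>lspan C\<close>.\<close>

definition up :: "'m::plus set => 'm set => bool" where
 "up C Q \<longleftrightarrow> (\<forall>m\<in>Q. \<forall>a\<in>C. m + a \<in> Q)"

text \<open>The denominators are the functions that are nonzero at \<open>pt\<close>, so that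
  \<open>kexact\<close> speaks of stalks at this point.\<close>

locale chart_point =
 fixes U :: "(int ^ 'n) set" and pt :: "int ^ 'n => complex"
 assumes finU: "finite U" and pt_zero: "pt 0 = 1"
  and pt_add: "!!a b. a \<in> dual U ==> b \<in> dual U ==> pt (a + b) = pt a * pt b"
begin

sublocale denominators "lspan (dual U)" "{s \<in> lspan (dual U). ev pt s ~= 0}"
proof
 show "1 \<in> lspan (dual U)" by (subst single_one[symmetric]) (simp del: single_one)
 have one: "ev pt 1 = 1" by (subst single_one[symmetric]) (simp del: single_one add: pt_zero)
 thus "1 \<in> {s \<in> lspan (dual U). ev pt s ~= 0}"
  using \<open>1 \<in> lspan (dual U)\<close> by simp
 show "a * b \<in> lspan (dual U)" if "a \<in> lspan (dual U)" "b \<in> lspan (dual U)" for a b :: "(int ^ 'n) \<Rightarrow>\<^sub>0 complex"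
  using that by (rule lspan_mult) (rule dual_add)
 thus "s * t \<in> {s \<in> lspan (dual U). ev pt s ~= 0}"
  if "s \<in> {s \<in> lspan (dual U). ev pt s ~= 0}" "t \<in> {s \<in> lspan (dual U). ev pt s ~= 0}" for s t
  using that by (simp add: eval_chart_mult[where Q = "dual U"] pt_add)
qed (auto intro: lspan_add lspan_uminus)

lemma smod_lspan: "up (dual U) Q ==> smod (lspan Q)" unfolding smod_def
proof (intro conjI ballI)
 fix a x assume "up (dual U) Q" "a \<in> lspan (dual U)" "x \<in> lspan Q"
 thus "a * x \<in> lspan Q"
  by (intro lspan_mult[of a "dual U" x Q]) (simp_all add: up_def, metis add.commute)
qed (auto intro: lspan_add)

text \<open>A filtration by the values of \<open>key\<close>. Monotonicity makes the exponents above
  a given value a module modulo \<open>Q1\<close>; the layer of the least value is split off as a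
  quotient, the rest is treated by induction on the number of values, and
  \<open>kexact_trans\<close> joins the two.\<close>

lemma kexact_by_key:
 fixes key :: "int ^ 'n => real"
 assumes fin: "finite I" and F: "!!j. j \<in> I ==> F j \<in> lspan (dual U)"
  and up: "up (dual U) Q" "up (dual U) Q1" and sub: "Q1 \<subseteq> Q"
  and mono: "!!m a. m \<in> Q - Q1 ==> a \<in> dual U ==> m + a \<in> Q - Q1 ==> key m \<le> key (m + a)"
  and fink: "finite (key ` (Q - Q1))"
  and cell: "!!t P P'. t \<in> key ` (Q - Q1) ==> up (dual U) P ==> up (dual U) P' ==> P' \<subseteq> P ==>
   P - P' = {m \<in> Q - Q1. key m = t} ==> kexact F I (lspan P) (lspan P') k"
 shows "kexact F I (lspan Q) (lspan Q1) k" using fink up(1) sub mono cell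
proof (induction "card (key ` (Q - Q1))" arbitrary: Q rule: less_induct)
 case (less Q)
 show ?case
 proof (cases "Q - Q1 = {}")
  case True
  with less.prems have "Q = Q1" by auto
  with kexact_refl smod_lspan less.prems show ?thesis by blast
 next
  case False
  define t where "t = Min (key ` (Q - Q1))"
  have tin: "t \<in> key ` (Q - Q1)" unfolding t_def using False less.prems(1) by (intro Min_in) auto
  have tle: "t \<le> key m" if "m \<in> Q - Q1" for m
   unfolding t_def using that less.prems(1) by (intro Min_le) auto
  define P where "P = Q1 \<union> {m \<in> Q - Q1. t < key m}"
  have upP: "up (dual U) P" unfolding up_def
  proof (intro ballI)
   fix m a assume m: "m \<in> P" and a: "a \<in> dual U"
   show "m + a \<in> P"
   proof (cases "m + a \<in> Q1")
    case False
    with up(2) m a have "m \<in> Q - Q1" "t < key m" by (auto simp: P_def up_def)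
    moreover from this a less.prems(2) False have "m + a \<in> Q - Q1" by (auto simp: up_def)
    ultimately have "t < key (m + a)" using less.prems(4)[of m a] a by linarith
    with \<open>m + a \<in> Q - Q1\<close> show ?thesis by (simp add: P_def)
   qed (simp add: P_def)
  qed
  have PQ: "P \<subseteq> Q" "Q1 \<subseteq> P" using less.prems(3) by (auto simp: P_def)
  have diff: "Q - P = {m \<in> Q - Q1. key m = t}" "P - Q1 = {m \<in> Q - Q1. t < key m}"
   using tle by (auto simp: P_def) (metis DiffI order_le_less)
  have "kexact F I (lspan Q) (lspan P) k"
   by (rule less.prems(5)[OF tin less.prems(2) upP PQ(1) diff(1)])
  moreover have "kexact F I (lspan P) (lspan Q1) k"
  proof (rule less.hyps)
   have sub: "key ` (P - Q1) \<subseteq> key ` (Q - Q1)" using PQ by auto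
   moreover have "t \<notin> key ` (P - Q1)" by (auto simp: diff)
   ultimately have "key ` (P - Q1) \<subset> key ` (Q - Q1)" using tin by blast
   thus "card (key ` (P - Q1)) < card (key ` (Q - Q1))"
    using less.prems(1) by (rule psubset_card_mono[rotated])
   show "finite (key ` (P - Q1))" using sub less.prems(1) by (rule finite_subset)
   show "up (dual U) P" "Q1 \<subseteq> P" by fact+
   show "key m \<le> key (m + a)" if "m \<in> P - Q1" "a \<in> dual U" "m + a \<in> P - Q1" for m a
    by (rule less.prems(4)) (use that PQ in auto)
   show "kexact F I (lspan R) (lspan R') k" if t': "t' \<in> key ` (P - Q1)" and R: "up (dual U) R" "up (dual U) R'"
    "R' \<subseteq> R" and RR: "R - R' = {m \<in> P - Q1. key m = t'}" for t' R R'
   proof (rule less.prems(5)[OF _ R])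
    show "t' \<in> key ` (Q - Q1)" using t' sub by blast
    have "t < t'" using t' diff(2) by auto
    thus "R - R' = {m \<in> Q - Q1. key m = t'}" unfolding RR diff(2) by auto
   qed
  qed
  ultimately show ?thesis using fin F smod_lspan less.prems(2) upP up(2) PQ lspan_mono
   by (intro kexact_trans[of I F "lspan Q" "lspan P" "lspan Q1"]) (auto simp: lspan_def)
 qed
qed

end

section \<open>Conic modules are Cohen--Macaulay\<close>

text \<open>The integers are discrete, so \<open>c + \<epsilon> * d\<close> leaves them for all
  small positive \<open>\<epsilon>\<close>, even if \<open>c\<close> is an integer itself.\<close>

lemma eventually_not_int:
 fixes c d :: real
 assumes "d ~= 0"
 shows "\<forall>\<^sub>F \<epsilon> in at_right 0. c + \<epsilon> * d \<notin> \<int>"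
proof -
 obtain e where e: "e > 0" "!!k::int. \<bar>c - of_int k\<bar> < e ==> c = of_int k"
 proof (cases "c \<in> \<int>")
  case True
  then obtain l where l: "c = of_int l" by (auto elim: Ints_cases)
  have "c = of_int k" if "\<bar>c - of_int k\<bar> < 1" for k :: int
  proof -
   have "real_of_int \<bar>l - k\<bar> < real_of_int 1" using that l by simp
   hence "\<bar>l - k\<bar> < 1" by (simp only: of_int_less_iff)
   thus ?thesis using l by simp
  qed
  with that[of 1] show ?thesis by simp
 next
  case False
  have fr: "0 < frac c" "frac c < 1" using False by (simp_all add: frac_gt_0_iff frac_lt_1)
  have "c = of_int k" if "\<bar>c - of_int k\<bar> < min (frac c) (1 - frac c)" for k :: int
  proof -
   have lt: "\<bar>c - of_int k\<bar> < c - of_int \<lfloor>c\<rfloor>" "\<bar>c - of_int k\<bar> < 1 - (c - of_int \<lfloor>c\<rfloor>)"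
    using that by (simp_all add: frac_def)
   have "real_of_int k \<le> of_int \<lfloor>c\<rfloor> \<or> real_of_int k \<ge> of_int (\<lfloor>c\<rfloor> + 1)"
    by (simp only: of_int_le_iff) linarith
   hence False
   proof
    assume "real_of_int k \<le> of_int \<lfloor>c\<rfloor>"
    with lt(1) show False by linarith
   next
    assume "real_of_int k \<ge> of_int (\<lfloor>c\<rfloor> + 1)"
    with lt(2) show False by linarith
   qed
   thus ?thesis ..
  qed
  with that[of "min (frac c) (1 - frac c)"] fr show ?thesis by simp
 qed
 have "eventually (%\<epsilon>. \<epsilon> \<in> {0<..<e / \<bar>d\<bar>}) (at_right 0)"
  using e(1) assms by (intro eventually_at_right_real) simp
 thus ?thesis
 proof eventually_elim
  case (elim \<epsilon>)
  show ?case
  proof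
   assume "c + \<epsilon> * d \<in> \<int>"
   then obtain k where k: "c + \<epsilon> * d = of_int k" by (auto elim: Ints_cases)
   have "\<bar>c - of_int k\<bar> = \<epsilon> * \<bar>d\<bar>"
    using k elim by (simp add: abs_mult flip: k)
   also have "... < e" using elim assms by (simp add: field_simps)
   finally have "c = of_int k" by (rule e(2))
   with k elim assms show False by simp
  qed
 qed
qed

text \<open>All integers below \<open>c\<close> keep the distance \<open>g\<close> from it, so one
  bound on \<open>\<epsilon>\<close> serves them all.\<close>

lemma eventually_int_less:
 fixes c d :: real
 shows "\<forall>\<^sub>F \<epsilon> in at_right 0. \<forall>a::int. of_int a < c --> of_int a + \<epsilon> * d < c"
proof -
 define g where "g = c - of_int (\<lceil>c\<rceil> - 1)"
 have "g > 0" unfolding g_def by linarith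
 have "((%\<epsilon>. \<epsilon> * d) \<longlongrightarrow> 0 * d) (at_right 0)"
  by (intro tendsto_intros)
 hence "\<forall>\<^sub>F \<epsilon> in at_right 0. \<epsilon> * d < g"
  using \<open>g > 0\<close> by (intro order_tendstoD(2)) auto
 thus ?thesis
 proof eventually_elim
  case (elim \<epsilon>)
  show ?case
  proof (intro allI impI)
   fix a :: int assume "of_int a < c"
   hence "a \<le> \<lceil>c\<rceil> - 1" by linarith
   hence "real_of_int a \<le> of_int (\<lceil>c\<rceil> - 1)" by (simp only: of_int_le_iff)
   with elim show "of_int a + \<epsilon> * d < c" by (simp add: g_def)
  qed
 qed
qed

text \<open>Finitely many hyperplanes, none containing the cone, do not cover it. From
  \<open>w\<close> one moves along \<open>y\<close> beyond all of the finitely many parameters in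
  \<open>B\<close> at which a hyperplane is met.\<close>

lemma ex_generic_in_cone:
 fixes K :: "'a::real_inner set"
 assumes "finite \<Delta>" and add: "!!x y. x \<in> K ==> y \<in> K ==> x + y \<in> K"
  and scale: "!!c x. c \<ge> 0 ==> x \<in> K ==> c *\<^sub>R x \<in> K" and "0 \<in> K"
  and "!!qt. qt \<in> \<Delta> ==> \<exists>y\<in>K. y \<bullet> qt ~= 0"
 shows "\<exists>w\<in>K. \<forall>qt\<in>\<Delta>. w \<bullet> qt ~= 0" using assms(1,5)
proof (induction \<Delta> rule: finite_induct)
 case empty
 with assms(4) show ?case by auto
next
 case (insert qt \<Delta>)
 then obtain w where w: "w \<in> K" "!!qt'. qt' \<in> \<Delta> ==> w \<bullet> qt' ~= 0" by auto
 obtain y where y: "y \<in> K" "y \<bullet> qt ~= 0" using insert.prems by blast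
 define B where "B = insert 0 ((%qt'. - (w \<bullet> qt') / (y \<bullet> qt')) ` insert qt \<Delta>)"
 define \<epsilon> where "\<epsilon> = Max B + 1"
 have "finite B" using insert.hyps by (simp add: B_def)
 hence Bless: "b < \<epsilon>" if "b \<in> B" for b
  using Max_ge[OF \<open>finite B\<close> that] by (simp add: \<epsilon>_def del: Max_ge)
 hence "\<epsilon> > 0" by (simp add: B_def)
 have "w + \<epsilon> *\<^sub>R y \<in> K" using w y \<open>\<epsilon> > 0\<close> by (intro add scale) auto
 moreover have "(w + \<epsilon> *\<^sub>R y) \<bullet> qt' ~= 0" if "qt' \<in> insert qt \<Delta>" for qt'
 proof
  assume eq: "(w + \<epsilon> *\<^sub>R y) \<bullet> qt' = 0"
  show False
  proof (cases "y \<bullet> qt' = 0")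
   case True
   with eq have "w \<bullet> qt' = 0" by (simp add: inner_simps)
   moreover have "qt' ~= qt" using True y by auto
   ultimately show False using that w(2) by auto
  next
   case False
   with eq have "\<epsilon> = - (w \<bullet> qt') / (y \<bullet> qt')" by (simp add: inner_simps field_simps)
   moreover have "- (w \<bullet> qt') / (y \<bullet> qt') \<in> B" using that by (auto simp: B_def)
   ultimately show False using Bless[of \<epsilon>] by auto
  qed
 qed
 ultimately show ?case by blast
qed

text \<open>The face of the real dual cone of \<open>U\<close> on which \<open>S\<close> vanishes;
  \<open>S = {}\<close> gives the whole cone.\<close>

definition rface :: "(int ^ 'n) set => (int ^ 'n) set => (real ^ 'n) set" where
 "rface U S = {y. (\<forall>u\<in>U. y \<bullet> rvec u \<ge> 0) \<and> (\<forall>u\<in>S. y \<bullet> rvec u = 0)}"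

text \<open>Exponents of a conic module. The apex \<open>x\<close> is real and in general not a
  lattice point; \<open>x = 0\<close> with \<open>S = {}\<close> gives the semigroup itself.\<close>

definition cpts :: "(int ^ 'n) set => real ^ 'n => (int ^ 'n) set => (int ^ 'n) set" where
 "cpts U x S = {m. rvec m - x \<in> rface U S}"

lemma rface_add: "x \<in> rface U S ==> y \<in> rface U S ==> x + y \<in> rface U S"
 and rface_scale: "c \<ge> 0 ==> x \<in> rface U S ==> c *\<^sub>R x \<in> rface U S"
 and rface_zero: "0 \<in> rface U S" by (auto simp: rface_def inner_simps)

lemma in_span_vanishes:
 assumes "y \<in> span K" "!!x. x \<in> K ==> x \<bullet> qt = (0::real)"
 shows "y \<bullet> qt = 0"
 using assms(1) by (induction rule: span_induct_alt) (auto simp: inner_simps assms(2))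

text \<open>By \<open>pos\<close>, \<open>p\<close> is a relative interior point of the smaller
  face: it is positive on every functional that is not a multiple of \<open>u\<close> on the larger
  face. Hence \<open>p\<close> plus a small multiple of any \<open>y\<close> in the span with
  \<open>y \<bullet> rvec u = 0\<close> stays in the smaller face, and such \<open>y\<close> form a
  subspace of codimension one in the span.\<close>

lemma dim_rface_insert:
 fixes U S :: "(int ^ 'n) set"
 assumes finU: "finite U" and u: "u \<in> U" and v: "v \<in> rface U S" "v \<bullet> rvec u > 0"
  and p: "p \<in> rface U (insert u S)"
  and pos: "!!u'. u' \<in> U ==> p \<bullet> rvec u' > 0 \<or> (\<exists>c. \<forall>y\<in>rface U S. y \<bullet> rvec u' = c * (y \<bullet> rvec u))"
 shows "dim (rface U S) \<le> Suc (dim (rface U (insert u S)))"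
proof -
 define H where "H = {y \<in> span (rface U S). y \<bullet> rvec u = 0}"
 have "span (rface U S) \<subseteq> span (insert v H)"
 proof
  fix y assume y: "y \<in> span (rface U S)"
  define c where "c = (y \<bullet> rvec u) / (v \<bullet> rvec u)"
  have "y - c *\<^sub>R v \<in> H"
   using y v by (simp add: H_def c_def inner_simps span_base span_diff span_scale)
  hence "(y - c *\<^sub>R v) + c *\<^sub>R v \<in> span (insert v H)"
   by (intro span_add span_scale span_base) auto
  thus "y \<in> span (insert v H)" by simp
 qed
 hence "dim (rface U S) \<le> dim (insert v H)" by (metis dim_span dim_subset span_span)
 also have "... \<le> Suc (dim H)" by (simp add: dim_insert)
 also have "dim H \<le> dim (rface U (insert u S))"
 proof -
  have "H \<subseteq> span (rface U (insert u S))"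
  proof
   fix y assume "y \<in> H"
   hence y: "y \<in> span (rface U S)" "y \<bullet> rvec u = 0" by (auto simp: H_def)
   have "\<forall>u'\<in>U. \<forall>\<^sub>F \<epsilon> in at_right 0. (p + \<epsilon> *\<^sub>R y) \<bullet> rvec u' \<ge> 0"
   proof
    fix u' assume u': "u' \<in> U"
    from pos[OF u'] show "\<forall>\<^sub>F \<epsilon> in at_right 0. (p + \<epsilon> *\<^sub>R y) \<bullet> rvec u' \<ge> 0"
    proof
     assume "p \<bullet> rvec u' > 0"
     moreover have "((%\<epsilon>. (p + \<epsilon> *\<^sub>R y) \<bullet> rvec u') \<longlongrightarrow> (p + 0 *\<^sub>R y) \<bullet> rvec u') (at_right 0)"
      by (intro tendsto_intros)
     ultimately have "\<forall>\<^sub>F \<epsilon> in at_right 0. (p + \<epsilon> *\<^sub>R y) \<bullet> rvec u' > 0"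
      by (intro order_tendstoD(1)) auto
     thus ?thesis by eventually_elim simp
    next
     assume "\<exists>c. \<forall>y\<in>rface U S. y \<bullet> rvec u' = c * (y \<bullet> rvec u)"
     then obtain c where c: "!!y. y \<in> rface U S ==> y \<bullet> rvec u' = c * (y \<bullet> rvec u)" by blast
     have "y \<bullet> (rvec u' - c *\<^sub>R rvec u) = 0"
      by (rule in_span_vanishes[OF y(1)]) (simp add: inner_diff_right c)
     hence "y \<bullet> rvec u' = 0" using y(2) by (simp add: inner_diff_right)
     thus ?thesis using p u' by (intro always_eventually) (auto simp: inner_simps rface_def)
    qed
   qed
   hence "\<forall>\<^sub>F \<epsilon> in at_right 0. \<forall>u'\<in>U. (p + \<epsilon> *\<^sub>R y) \<bullet> rvec u' \<ge> 0"
    using finU by (simp add: eventually_ball_finite_distrib)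
   moreover have "\<forall>\<^sub>F \<epsilon>::real in at_right 0. \<epsilon> > 0" by (rule eventually_at_right_less)
   ultimately have "\<forall>\<^sub>F \<epsilon> in at_right 0. \<epsilon> > 0 \<and> (\<forall>u'\<in>U. (p + \<epsilon> *\<^sub>R y) \<bullet> rvec u' \<ge> 0)"
    by (rule eventually_conj[rotated])
   then obtain \<epsilon> where \<epsilon>: "\<epsilon> > 0" "\<forall>u'\<in>U. (p + \<epsilon> *\<^sub>R y) \<bullet> rvec u' \<ge> 0"
    using eventually_happens'[OF trivial_limit_at_right_real] by blast
   have "(p + \<epsilon> *\<^sub>R y) \<bullet> rvec u' = 0" if "u' \<in> insert u S" for u'
   proof -
    have "p \<bullet> rvec u' = 0" using p that by (auto simp: rface_def)
    moreover have "y \<bullet> rvec u' = 0"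
    proof (cases "u' = u")
     case False
     with that show ?thesis by (intro in_span_vanishes[OF y(1)]) (auto simp: rface_def)
    qed (use y in simp)
    ultimately show ?thesis by (simp add: inner_simps)
   qed
   with \<epsilon> have mem: "p + \<epsilon> *\<^sub>R y \<in> rface U (insert u S)" by (auto simp: rface_def)
   have "(1 / \<epsilon>) *\<^sub>R ((p + \<epsilon> *\<^sub>R y) - p) \<in> span (rface U (insert u S))"
    using mem p by (intro span_scale span_diff span_base)
   thus "y \<in> span (rface U (insert u S))" using \<epsilon>(1) by simp
  qed
  thus ?thesis by (metis dim_span dim_subset)
 qed
 finally show ?thesis by simp
qed

text \<open>The apex moves by a small step against a generic direction \<open>w\<close> of the face.
  This enlarges the region, but no integral value below a bound can cross it, so the lattice points
  stay the same. Afterwards integral bounds and coincidences of the ratios occur only where an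
  identity of functionals on the face forces them.\<close>

lemma ex_generic_translation:
 fixes U S V :: "(int ^ 'n) set" and d :: "int ^ 'n => int"
 assumes finU: "finite U" and V: "V \<subseteq> U" and d: "!!u. u \<in> V ==> d u > 0"
 obtains x' where "cpts U x' S = cpts U x S"
  "!!u. u \<in> U ==> (\<forall>y\<in>rface U S. y \<bullet> rvec u = 0) \<or> x' \<bullet> rvec u \<notin> \<int>"
  "!!u u' a b. u \<in> V ==> u' \<in> V ==>
    (of_int a - x' \<bullet> rvec u) / of_int (d u) = (of_int b - x' \<bullet> rvec u') / of_int (d u') ==>
    \<forall>y\<in>rface U S. y \<bullet> rvec u / of_int (d u) = y \<bullet> rvec u' / of_int (d u')"
proof -
 \<comment> \<open>The cross-multiplied difference of two ratios: if the ratios agree for integers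
   \<open>a\<close> and \<open>b\<close>, then \<open>x'\<close> has an integral inner product with
   it.\<close>
 let ?e = "%u u'. of_int (d u') *\<^sub>R rvec u - of_int (d u) *\<^sub>R rvec u'"
 define \<Delta> where "\<Delta> = {qt \<in> rvec ` U \<union> (%(u, u'). ?e u u') ` (V \<times> V). \<exists>y\<in>rface U S. y \<bullet> qt ~= 0}"
 have finV: "finite V" using finU V by (rule finite_subset[rotated])
 have "finite \<Delta>" unfolding \<Delta>_def using finU finV by simp
 hence "\<exists>w\<in>rface U S. \<forall>qt\<in>\<Delta>. w \<bullet> qt ~= 0"
  by (rule ex_generic_in_cone) (simp_all add: rface_add rface_scale rface_zero \<Delta>_def)
 then obtain w where w: "w \<in> rface U S" "!!qt. qt \<in> \<Delta> ==> w \<bullet> qt ~= 0" by blast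
 have "\<forall>qt\<in>\<Delta>. \<forall>\<^sub>F \<epsilon> in at_right 0. x \<bullet> qt + \<epsilon> * (- (w \<bullet> qt)) \<notin> \<int>"
  using w(2) by (intro ballI eventually_not_int) auto
 hence 1: "\<forall>\<^sub>F \<epsilon> in at_right 0. \<forall>qt\<in>\<Delta>. x \<bullet> qt + \<epsilon> * (- (w \<bullet> qt)) \<notin> \<int>"
  using \<open>finite \<Delta>\<close> by (simp add: eventually_ball_finite_distrib)
 have "\<forall>u\<in>U. \<forall>\<^sub>F \<epsilon> in at_right 0. \<forall>a::int. of_int a < x \<bullet> rvec u -->
   of_int a + \<epsilon> * (w \<bullet> rvec u) < x \<bullet> rvec u"
  by (intro ballI eventually_int_less)
 hence 2: "\<forall>\<^sub>F \<epsilon> in at_right 0. \<forall>u\<in>U. \<forall>a::int. of_int a < x \<bullet> rvec u -->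
   of_int a + \<epsilon> * (w \<bullet> rvec u) < x \<bullet> rvec u"
  using finU by (simp add: eventually_ball_finite_distrib)
 have 3: "\<forall>\<^sub>F \<epsilon>::real in at_right 0. \<epsilon> > 0" by (rule eventually_at_right_less)
 obtain \<epsilon> where \<epsilon>: "\<epsilon> > 0" "!!qt. qt \<in> \<Delta> ==> x \<bullet> qt + \<epsilon> * (- (w \<bullet> qt)) \<notin> \<int>"
  "!!u a. u \<in> U ==> of_int a < x \<bullet> rvec u ==> of_int a + \<epsilon> * (w \<bullet> rvec u) < x \<bullet> rvec u"
  using eventually_happens'[OF trivial_limit_at_right_real eventually_conj[OF 1 eventually_conj[OF 2 3]]]
  by blast
 define x' where "x' = x - \<epsilon> *\<^sub>R w"
 have x'qt: "x' \<bullet> qt \<notin> \<int>" if "qt \<in> \<Delta>" for qt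
  using \<epsilon>(2)[OF that] by (simp add: x'_def inner_simps)
 show thesis
 proof (rule that)
  have "rvec m - x' \<in> rface U S \<longleftrightarrow> rvec m - x \<in> rface U S" for m
  proof
   assume "rvec m - x \<in> rface U S"
   hence "(rvec m - x) + \<epsilon> *\<^sub>R w \<in> rface U S"
    using w(1) \<epsilon>(1) by (intro rface_add rface_scale) auto
   thus "rvec m - x' \<in> rface U S" by (simp add: x'_def algebra_simps)
  next
   assume m: "rvec m - x' \<in> rface U S"
   have "(rvec m - x) \<bullet> rvec u \<ge> 0" if "u \<in> U" for u
   proof (rule ccontr)
    assume "\<not> (rvec m - x) \<bullet> rvec u \<ge> 0"
    hence "of_int (pairing m u) < x \<bullet> rvec u" by (simp add: inner_simps rvec_inner)
    from \<epsilon>(3)[OF that this] have "(rvec m - x') \<bullet> rvec u < 0"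
     by (simp add: x'_def inner_simps rvec_inner)
    with m that show False by (auto simp: rface_def)
   qed
   moreover have "(rvec m - x) \<bullet> rvec u = 0" if "u \<in> S" for u
    using m w(1) that by (auto simp: rface_def x'_def inner_simps)
   ultimately show "rvec m - x \<in> rface U S" by (simp add: rface_def)
  qed
  thus "cpts U x' S = cpts U x S" by (simp add: cpts_def)
  show "(\<forall>y\<in>rface U S. y \<bullet> rvec u = 0) \<or> x' \<bullet> rvec u \<notin> \<int>" if "u \<in> U" for u
   using x'qt[of "rvec u"] that by (auto simp: \<Delta>_def)
  show "\<forall>y\<in>rface U S. y \<bullet> rvec u / of_int (d u) = y \<bullet> rvec u' / of_int (d u')"
   if u: "u \<in> V" "u' \<in> V" and eq: "(of_int a - x' \<bullet> rvec u) / of_int (d u) =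
    (of_int b - x' \<bullet> rvec u') / of_int (d u')" for u u' a b
  proof -
   have dpos: "real_of_int (d u) > 0" "real_of_int (d u') > 0" using d u by auto
   have "x' \<bullet> ?e u u' = of_int (a * d u' - b * d u)"
    using eq dpos by (simp add: inner_simps field_simps)
   hence "x' \<bullet> ?e u u' \<in> \<int>" by simp
   hence "?e u u' \<notin> \<Delta>" using x'qt by blast
   hence "\<forall>y\<in>rface U S. y \<bullet> ?e u u' = 0" using u by (auto simp: \<Delta>_def)
   with dpos show ?thesis by (simp add: inner_simps field_simps)
  qed
 qed
qed

text \<open>Keeps the quotient that occurs in \<open>kexact_step\<close> within the monomial
  spans.\<close>

lemma lspan_shift_union:
 fixes v :: "'m::ab_group_add"
 shows "{mon v 1 * x + y |x y. x \<in> lspan Q \<and> y \<in> lspan Q'} = lspan ((+) v ` Q \<union> Q')"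
proof (intro equalityI subsetI)
 fix f assume "f \<in> {mon v 1 * x + y |x y. x \<in> lspan Q \<and> y \<in> lspan Q'}"
 then obtain x y where f: "f = mon v 1 * x + y" and xy: "x \<in> lspan Q" "y \<in> lspan Q'" by blast
 have "mon v 1 * x \<in> lspan ((+) v ` Q \<union> Q')"
  by (rule lspan_mult[of _ "{v}" _ Q]) (use xy in auto)
 moreover have "y \<in> lspan ((+) v ` Q \<union> Q')" by (rule lspan_mono[OF xy(2)]) simp
 ultimately show "f \<in> lspan ((+) v ` Q \<union> Q')" unfolding f by (rule lspan_add)
next
 fix f assume f: "f \<in> lspan ((+) v ` Q \<union> Q')"
 define x where "x = mon (- v) 1 * restr ((+) v ` Q) f"
 define y where "y = restr (- ((+) v ` Q)) f"
 have "mon v 1 * x = restr ((+) v ` Q) f" by (simp add: x_def mult_single flip: mult.assoc)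
 hence "f = mon v 1 * x + y" by (intro poly_mapping_eqI) (simp add: y_def lookup_add coef_restr)
 moreover have "x \<in> lspan Q" unfolding x_def
 proof (rule lspan_mult[of _ "{- v}" _ "(+) v ` Q"])
  show "restr ((+) v ` Q) f \<in> lspan ((+) v ` Q)"
   by (auto simp: lspan_iff coef_restr split: if_splits)
 qed auto
 moreover have "y \<in> lspan Q'"
  using f by (auto simp: y_def lspan_iff coef_restr split: if_splits)
 ultimately show "f \<in> {mon v 1 * x + y |x y. x \<in> lspan Q \<and> y \<in> lspan Q'}" by blast
qed

lemma rface_insert_subset: "rface U (insert u S) \<subseteq> rface U S" by (auto simp: rface_def)

lemma rvec_in_rface: "v \<in> dual U ==> (!!u. u \<in> S ==> pairing v u = 0) ==> rvec v \<in> rface U S"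
 by (auto simp: rface_def rvec_inner dual_def)

context chart_point
begin

lemma up_shift: "up (dual U) Q ==> up (dual U) ((+) v ` Q)"
 by (auto simp: up_def image_iff add.assoc)

lemma up_Un: "up (dual U) Q ==> up (dual U) Q' ==> up (dual U) (Q \<union> Q')"
 by (auto simp: up_def)

text \<open>The monomial of \<open>v\<close> vanishes at the point and is divided out. What remains
  are the points of the translated face that leave it when \<open>v\<close> is subtracted, a slab of
  thickness one along \<open>v\<close>. Sliced by \<open>key\<close> it has finitely many layers,
  each filling a translated facet, and \<open>IH\<close> applies to them one level lower.\<close>

lemma kexact_facets:
 assumes fin: "finite I" and F: "!!j. j \<in> I ==> F j \<in> lspan (dual U)"
  and S: "S \<subseteq> U" and v: "rvec v \<in> rface U S" "pt v = 0"
  and s0: "s0 \<in> {s \<in> lspan (dual U). ev pt s ~= 0}"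
  and c: "!!j. j \<in> I ==> c j \<in> lspan (dual U)"
  and gK: "s0 * mon v 1 ^ K = (\<Sum>j\<in>I. c j * F j)"
  and Q: "up (dual U) Q" and Q': "up (dual U) Q'" and sub: "Q' \<subseteq> Q" and D: "Q - Q' = cpts U x S"
  and IH: "!!S' x' P P' k'. S' \<subseteq> U ==> dim (rface U S) \<le> Suc (dim (rface U S')) ==>
   up (dual U) P ==> up (dual U) P' ==> P' \<subseteq> P ==> P - P' = cpts U x' S' ==> k = Suc k' ==>
   kexact F I (lspan P) (lspan P') k'"
 shows "kexact F I (lspan Q) (lspan Q') k"
proof -
 have vd: "v \<in> dual U" using v(1) by (auto simp: dual_def rface_def rvec_inner)
 define V where "V = {u \<in> U. pairing v u > 0}"
 have VU: "V \<subseteq> U" "finite V" using finU by (auto simp: V_def)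
 have notV: "pairing v u = 0" if "u \<in> U - V" for u using that vd by (force simp: V_def dual_def)
 \<comment> \<open>Otherwise \<open>v\<close> would be invertible in the monoid, and
   \<open>pt v\<close> a unit.\<close>
 have Vne: "V ~= {}"
 proof
  assume "V = {}"
  hence "- v \<in> dual U" using notV by (auto simp: dual_def pairing_uminus)
  with pt_add[OF vd] have "pt (v + - v) = pt v * pt (- v)" by blast
  with v(2) pt_zero show False by simp
 qed
 have vS: "pairing v u = 0" if "u \<in> S" for u
  using v(1) that by (auto simp: rface_def rvec_inner)
 have SV: "S \<inter> V = {}" using vS by (force simp: V_def)
 obtain x' where x': "cpts U x' S = cpts U x S"
  "!!u. u \<in> U ==> (\<forall>y\<in>rface U S. y \<bullet> rvec u = 0) \<or> x' \<bullet> rvec u \<notin> \<int>"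
  "!!u u' a b. u \<in> V ==> u' \<in> V ==>
    (of_int a - x' \<bullet> rvec u) / of_int (pairing v u) = (of_int b - x' \<bullet> rvec u') / of_int (pairing v u') ==>
    \<forall>y\<in>rface U S. y \<bullet> rvec u / of_int (pairing v u) = y \<bullet> rvec u' / of_int (pairing v u')"
 proof (rule ex_generic_translation[OF finU VU(1)])
  show "pairing v u > 0" if "u \<in> V" for u using that by (simp add: V_def)
 qed (rule that)
 define Q1 where "Q1 = (+) v ` Q \<union> Q'"
 \<comment> \<open>\<open>tc u m\<close> is the time at which the path from \<open>m\<close> in
   direction \<open>- v\<close> leaves the half-space of \<open>u\<close>. The minimum
   \<open>key m\<close> is the time at which it leaves the translated face; the functionals outside
   \<open>V\<close> are constant along the path.\<close>
 define tc where "tc u m = (rvec m - x') \<bullet> rvec u / of_int (pairing v u)" for u m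
 define key where "key m = Min ((%u. tc u m) ` V)" for m
 have tc_alt: "tc u m = (of_int (pairing m u) - x' \<bullet> rvec u) / of_int (pairing v u)" for u m
  by (simp add: tc_def inner_simps rvec_inner)
 have dpos: "real_of_int (pairing v u) > 0" if "u \<in> V" for u using that by (simp add: V_def)
 have inner_tc: "(rvec m - x') \<bullet> rvec u = tc u m * of_int (pairing v u)" if "u \<in> V" for u m
  using dpos[OF that] by (simp add: tc_def)
 have key_le: "key m \<le> tc u m" if "u \<in> V" for u m
  unfolding key_def using that VU(2) by (intro Min_le) auto
 have key_ge: "t \<le> key m" if "!!u. u \<in> V ==> t \<le> tc u m" for t m
  unfolding key_def using that VU(2) Vne by (subst Min_ge_iff) auto
 have key_attained: "\<exists>u\<in>V. key m = tc u m" for m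
 proof -
  have "key m \<in> (%u. tc u m) ` V" unfolding key_def using VU(2) Vne by (intro Min_in) auto
  thus ?thesis by blast
 qed
 have QQ1: "m \<in> Q - Q1 \<longleftrightarrow> m \<in> cpts U x' S \<and> m - v \<notin> cpts U x' S" for m
 proof -
  have "m \<in> (+) v ` Q \<longleftrightarrow> m - v \<in> Q" by (auto simp: image_iff intro!: bexI[of _ "m - v"])
  moreover have "m - v \<notin> Q'" if "m \<notin> Q'"
  proof
   assume "m - v \<in> Q'"
   with Q' vd have "m - v + v \<in> Q'" unfolding up_def by blast
   with that show False by simp
  qed
  ultimately show ?thesis unfolding x'(1) D[symmetric] by (auto simp: Q1_def)
 qed
 have key_nonneg: "0 \<le> key m" if "m \<in> Q - Q1" for m
 proof (rule key_ge)
  fix u assume u: "u \<in> V"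
  have "(rvec m - x') \<bullet> rvec u \<ge> 0"
   using that u VU(1) unfolding QQ1 by (auto simp: cpts_def rface_def)
  thus "0 \<le> tc u m" using dpos[OF u] by (simp add: tc_def)
 qed
 have key_less: "key m < 1 \<longleftrightarrow> m - v \<notin> cpts U x' S" if m: "m \<in> cpts U x' S" for m
 proof -
  have eq: "(rvec (m - v) - x') \<bullet> rvec u = (rvec m - x') \<bullet> rvec u - of_int (pairing v u)" for u
   by (simp add: rvec_diff inner_simps rvec_inner)
  have eqV: "(rvec (m - v) - x') \<bullet> rvec u = (tc u m - 1) * of_int (pairing v u)" if "u \<in> V" for u
   by (simp only: eq[of u] inner_tc[OF that, of m] left_diff_distrib mult_1)
  have "m - v \<in> cpts U x' S \<longleftrightarrow> (\<forall>u\<in>V. (rvec (m - v) - x') \<bullet> rvec u \<ge> 0)"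
  proof
   assume "m - v \<in> cpts U x' S"
   with VU(1) show "\<forall>u\<in>V. (rvec (m - v) - x') \<bullet> rvec u \<ge> 0" by (auto simp: cpts_def rface_def)
  next
   assume V: "\<forall>u\<in>V. (rvec (m - v) - x') \<bullet> rvec u \<ge> 0"
   have "(rvec (m - v) - x') \<bullet> rvec u \<ge> 0" if "u \<in> U" for u
   proof (cases "u \<in> V")
    case False
    with that m notV show ?thesis unfolding eq by (auto simp: cpts_def rface_def)
   qed (use V in blast)
   moreover have "(rvec (m - v) - x') \<bullet> rvec u = 0" if "u \<in> S" for u
    using that m vS unfolding eq by (auto simp: cpts_def rface_def)
   ultimately show "m - v \<in> cpts U x' S" by (simp add: cpts_def rface_def)
  qed
  also have "... \<longleftrightarrow> (\<forall>u\<in>V. 1 \<le> tc u m)"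
  proof (intro ball_cong refl)
   fix u assume u: "u \<in> V"
   show "(rvec (m - v) - x') \<bullet> rvec u \<ge> 0 \<longleftrightarrow> 1 \<le> tc u m"
    unfolding eqV[OF u] using mult_le_cancel_right_pos[OF dpos[OF u], of 0 "tc u m - 1"] by simp
  qed
  also have "... \<longleftrightarrow> 1 \<le> key m" using key_le key_ge by (meson order_trans)
  finally show ?thesis by auto
 qed
 have key_less1: "key m < 1" if "m \<in> Q - Q1" for m
  using that key_less[of m] unfolding QQ1 by blast
 have upQ1: "up (dual U) Q1" unfolding Q1_def by (intro up_Un up_shift Q Q')
 have Q1Q: "Q1 \<subseteq> Q" using sub Q vd by (auto simp: Q1_def up_def) (metis add.commute)
 have "kexact F I (lspan Q) (lspan Q1) k'" if k': "k = Suc k'" for k'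
 proof (rule kexact_by_key[OF fin F Q upQ1 Q1Q])
  show "key m \<le> key (m + a)" if "a \<in> dual U" for m a
  proof (rule key_ge)
   fix u assume u: "u \<in> V"
   with that VU(1) have "pairing a u \<ge> 0" by (auto simp: dual_def)
   hence "tc u m \<le> tc u (m + a)"
    using dpos[OF u] by (simp add: tc_alt pairing_add divide_right_mono)
   with key_le[OF u, of m] show "key m \<le> tc u (m + a)" by simp
  qed
  \<comment> \<open>A time in \<open>[0, 1)\<close> confines the integer \<open>pairing m u\<close>
    to a bounded range, so only finitely many times occur.\<close>
  define T where "T = (\<Union>u\<in>V. (%a. (of_int a - x' \<bullet> rvec u) / of_int (pairing v u)) `
   {\<lfloor>x' \<bullet> rvec u\<rfloor> .. \<lceil>x' \<bullet> rvec u + of_int (pairing v u)\<rceil>})"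
  have "finite T" unfolding T_def using VU(2) by blast
  moreover have "key ` (Q - Q1) \<subseteq> T"
  proof (rule image_subsetI)
   fix m assume m: "m \<in> Q - Q1"
   obtain u where u: "u \<in> V" "key m = tc u m" using key_attained by blast
   have "0 \<le> tc u m" "tc u m < 1" using key_nonneg[OF m] key_less1[OF m] u(2) by auto
   hence "x' \<bullet> rvec u \<le> of_int (pairing m u)"
    "of_int (pairing m u) < x' \<bullet> rvec u + of_int (pairing v u)"
    using dpos[OF u(1)] by (simp_all add: tc_alt field_simps zero_le_divide_iff)
   hence "pairing m u \<in> {\<lfloor>x' \<bullet> rvec u\<rfloor> .. \<lceil>x' \<bullet> rvec u + of_int (pairing v u)\<rceil>}"
    by simp linarith
   thus "key m \<in> T" unfolding u(2) tc_alt T_def using u(1) by blast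
  qed
  ultimately show "finite (key ` (Q - Q1))" by (rule finite_subset[rotated])
  fix t P P' assume t: "t \<in> key ` (Q - Q1)" and P: "up (dual U) P" "up (dual U) P'" "P' \<subseteq> P"
   "P - P' = {m \<in> Q - Q1. key m = t}"
  obtain m0 where m0: "m0 \<in> Q - Q1" "key m0 = t" using t by auto
  obtain u where u: "u \<in> V" "t = tc u m0" using key_attained m0(2) by metis
  have t01: "0 \<le> t" "t < 1" using key_nonneg key_less1 m0 by auto
  \<comment> \<open>The apex of the layer with exit time \<open>t\<close>.\<close>
  define x'' where "x'' = x' + t *\<^sub>R rvec v"
  have eq: "(rvec m - x'') \<bullet> rvec u' = (rvec m - x') \<bullet> rvec u' - t * of_int (pairing v u')" for m u'
   by (simp add: x''_def inner_simps rvec_inner)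
  have eqV: "(rvec m - x'') \<bullet> rvec u' = (tc u' m - t) * of_int (pairing v u')" if "u' \<in> V" for m u'
   unfolding eq inner_tc[OF that] by (simp add: algebra_simps)
  \<comment> \<open>By genericity, functionals with the same exit time are proportional on the face,
    so one layer does not spread over several facets.\<close>
  have same: "\<forall>y\<in>rface U S. y \<bullet> rvec u / of_int (pairing v u) = y \<bullet> rvec u' / of_int (pairing v u')"
   if "u' \<in> V" "tc u' m = t" for u' m
   by (rule x'(3)[OF u(1) that(1), of "pairing m0 u" "pairing m u'"])
    (use u(2) that(2) in \<open>simp add: tc_alt\<close>)
  have cell: "cpts U x'' (insert u S) = {m \<in> Q - Q1. key m = t}"
  proof (intro equalityI subsetI)
   fix m assume m: "m \<in> {m \<in> Q - Q1. key m = t}"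
   hence mD: "rvec m - x' \<in> rface U S" unfolding QQ1 mem_Collect_eq by (simp add: cpts_def)
   have km: "key m = t" using m by simp
   obtain u' where u': "u' \<in> V" "key m = tc u' m" using key_attained[of m] by blast
   have "tc u m = tc u' m"
    using bspec[OF same[OF u'(1) trans[OF sym[OF u'(2)] km]] mD] by (simp only: tc_def)
   hence tcu: "tc u m = t" using u'(2) km by simp
   have "(rvec m - x'') \<bullet> rvec u'' \<ge> 0" if "u'' \<in> U" for u''
   proof (cases "u'' \<in> V")
    case True
    hence "t \<le> tc u'' m" using key_le[OF True, of m] km by simp
    thus ?thesis unfolding eqV[OF True] using dpos[OF True] by simp
   next
    case False
    with that notV mD show ?thesis unfolding eq by (auto simp: rface_def)
   qed
   moreover have "(rvec m - x'') \<bullet> rvec u'' = 0" if "u'' \<in> S" for u''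
    using that vS mD unfolding eq by (auto simp: rface_def)
   moreover have "(rvec m - x'') \<bullet> rvec u = 0" unfolding eqV[OF u(1)] tcu by simp
   ultimately show "m \<in> cpts U x'' (insert u S)" by (auto simp: cpts_def rface_def)
  next
   fix m assume "m \<in> cpts U x'' (insert u S)"
   hence mD: "rvec m - x'' \<in> rface U (insert u S)" by (simp add: cpts_def)
   have "(rvec m - x'') + t *\<^sub>R rvec v \<in> rface U S"
    using mD rface_insert_subset v(1) t01 by (intro rface_add rface_scale) auto
   hence m: "m \<in> cpts U x' S" by (simp add: cpts_def x''_def)
   have "tc u m = t" using mD eqV[OF u(1), of m] dpos[OF u(1)] by (simp add: rface_def)
   moreover have "t \<le> tc u' m" if "u' \<in> V" for u'
   proof -
    have "(rvec m - x'') \<bullet> rvec u' \<ge> 0" using mD that VU(1) by (auto simp: rface_def)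
    thus ?thesis unfolding eqV[OF that] using dpos[OF that] by (simp add: zero_le_mult_iff)
   qed
   ultimately have "key m = t" using key_le[OF u(1), of m] key_ge[of t m] by (intro antisym) auto
   with m t01 show "m \<in> {m \<in> Q - Q1. key m = t}"
    using key_less[OF m] unfolding mem_Collect_eq QQ1 by simp
  qed
  show "kexact F I (lspan P) (lspan P') k'"
  proof (rule IH[OF _ _ P(1-3) _ k'])
   show "insert u S \<subseteq> U" using u(1) VU(1) S by auto
   show "P - P' = cpts U x'' (insert u S)" using P(4) cell by simp
   \<comment> \<open>This vector is relatively interior to the facet: a functional of
     \<open>V\<close> not proportional to \<open>u\<close> has a later exit time, and one outside
     \<open>V\<close> is positive by non-integrality unless it vanishes on the face.\<close>
   have p: "rvec m0 - x'' \<in> rface U (insert u S)" using cell m0 by (auto simp: cpts_def)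
   show "dim (rface U S) \<le> Suc (dim (rface U (insert u S)))"
   proof (rule dim_rface_insert[OF finU _ v(1) _ p])
    show "u \<in> U" using u(1) VU(1) by blast
    show "0 < rvec v \<bullet> rvec u" using dpos[OF u(1)] by (simp add: rvec_inner)
    fix u' assume u': "u' \<in> U"
    show "0 < (rvec m0 - x'') \<bullet> rvec u' \<or>
     (\<exists>c. \<forall>y\<in>rface U S. y \<bullet> rvec u' = c * (y \<bullet> rvec u))"
    proof (cases "u' \<in> V")
     case True
     show ?thesis
     proof (cases "tc u' m0 = t")
      case eqt: True
      have "\<forall>y\<in>rface U S. y \<bullet> rvec u' = of_int (pairing v u') / of_int (pairing v u) * (y \<bullet> rvec u)"
      proof
       fix y assume "y \<in> rface U S"
       from bspec[OF same[OF True eqt] this]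
       show "y \<bullet> rvec u' = of_int (pairing v u') / of_int (pairing v u) * (y \<bullet> rvec u)"
        using dpos[OF True] dpos[OF u(1)] by (simp add: field_simps)
      qed
      thus ?thesis by blast
     next
      case False
      with key_le[OF True, of m0] m0(2) have "t < tc u' m0" by auto
      thus ?thesis unfolding eqV[OF True] using dpos[OF True] by simp
     qed
    next
     case False
     have mD: "rvec m0 - x' \<in> rface U S" using m0(1) unfolding QQ1 by (simp add: cpts_def)
     show ?thesis
     proof (cases "x' \<bullet> rvec u' \<in> \<int>")
      case True
      with x'(2)[OF u'] have "\<forall>y\<in>rface U S. y \<bullet> rvec u' = 0 * (y \<bullet> rvec u)" by auto
      thus ?thesis by blast
     next
      case nonint: False
      have "(rvec m0 - x') \<bullet> rvec u' ~= 0"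
       using nonint by (metis Ints_of_int eq_iff_diff_eq_0 inner_diff_left rvec_inner)
      moreover have "(rvec m0 - x') \<bullet> rvec u' \<ge> 0" using mD u' by (auto simp: rface_def)
      ultimately show ?thesis using notV[of u'] False u' by (auto simp: eq)
     qed
    qed
   qed
  qed
 qed
 note ex = this
 \<comment> \<open>Adding \<open>v\<close> maps \<open>cpts U x S\<close> into itself, so no term of
   \<open>f\<close> outside \<open>Q'\<close> can be moved into \<open>Q'\<close>.\<close>
 have nzd: "f \<in> lspan Q'" if f: "f \<in> lspan Q" and gf: "mon v 1 * f \<in> lspan Q'" for f
  unfolding lspan_iff
 proof (intro allI impI)
  fix m assume m: "coef f m ~= 0"
  hence "m \<in> Q" using f by (auto simp: lspan_iff)
  have "coef (mon v 1 * f) (m + v) ~= 0" using m by (simp add: coef_mon_mult)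
  hence "m + v \<in> Q'" using gf by (auto simp: lspan_iff)
  show "m \<in> Q'"
  proof (rule ccontr)
   assume "m \<notin> Q'"
   with \<open>m \<in> Q\<close> D have "rvec m - x \<in> rface U S" by (auto simp: cpts_def)
   hence "(rvec m - x) + rvec v \<in> rface U S" using v(1) by (rule rface_add)
   hence "m + v \<in> cpts U x S" by (simp add: cpts_def rvec_add algebra_simps)
   with D \<open>m + v \<in> Q'\<close> show False by blast
  qed
 qed
 show ?thesis
 proof (rule kexact_step[OF fin F smod_lspan[OF Q] smod_lspan[OF Q'] _ _ nzd s0 c gK])
  show "lspan Q' \<subseteq> lspan Q" using sub by (auto simp: lspan_def)
  show "mon v 1 \<in> lspan (dual U)" using vd by simp
  show "kexact F I (lspan Q) {mon v 1 * x + y |x y. x \<in> lspan Q \<and> y \<in> lspan Q'} k'" if "k = Suc k'" for k'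
   using ex[OF that] by (simp only: lspan_shift_union Q1_def)
 qed
qed

end

section \<open>Lattice points in rational cones\<close>

lemma ex_int_approx:
 fixes y :: "real ^ 'n"
 assumes "\<epsilon> > 0"
 shows "\<exists>q m. (q::int) > 0 \<and> norm (of_int q *\<^sub>R y - rvec m) < \<epsilon>"
proof -
 let ?n = "CARD('n)"
 obtain h :: "nat => 'n" where h: "bij_betw h {..<?n} UNIV"
  using ex_bij_betw_nat_finite[of "UNIV :: 'n set"] by (auto simp: atLeast0LessThan)
 \<comment> \<open>The coordinate errors below \<open>1 / N\<close> add up to less than
   \<open>\<epsilon>\<close>.\<close>
 obtain N :: nat where N: "real ?n / \<epsilon> < real N" using reals_Archimedean2 by blast
 hence "N > 0" using assms by (cases N) (auto simp: divide_less_0_iff)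
 obtain q p where q: "0 < q" and p: "!!i. i < ?n ==> \<bar>of_int q * (y $ h i) - of_int (p i)\<bar> < 1 / N"
  using Dirichlet_approx_simult[OF \<open>N > 0\<close>, of ?n "%i. y $ h i"] by metis
 define m :: "int ^ 'n" where "m = (\<chi> j. p (inv_into {..<?n} h j))"
 have comp: "\<bar>(of_int q *\<^sub>R y - rvec m) $ j\<bar> \<le> 1 / N" for j
 proof -
  define i where "i = inv_into {..<?n} h j"
  have "i < ?n" "h i = j" using h inv_into_into[of j h "{..<?n}"] f_inv_into_f[of j h "{..<?n}"]
   by (auto simp: i_def bij_betw_def)
  with p[of i] show ?thesis by (simp add: m_def rvec_def i_def)
 qed
 have "norm (of_int q *\<^sub>R y - rvec m) \<le> (\<Sum>j\<in>UNIV. \<bar>(of_int q *\<^sub>R y - rvec m) $ j\<bar>)"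
  by (rule norm_le_l1_cart)
 also have "... \<le> (\<Sum>j\<in>(UNIV::'n set). 1 / N)" by (rule sum_mono) (rule comp)
 also have "... < \<epsilon>" using N assms \<open>N > 0\<close> by (simp add: field_simps)
 finally show ?thesis using q by blast
qed

text \<open>By Dirichlet's theorem on simultaneous approximation.\<close>

lemma ex_int_same_signs:
 fixes y :: "real ^ 'n"
 assumes "finite W" "\<epsilon> > 0"
 shows "\<exists>q m. (q::int) > 0 \<and> norm (of_int q *\<^sub>R y - rvec m) < \<epsilon> \<and>
  (\<forall>u\<in>W. sgn (real_of_int (pairing m u)) = sgn (y \<bullet> rvec u))"
proof -
 \<comment> \<open>Within this bound the integer \<open>pairing m u\<close> differs from
   \<open>q\<close> times \<open>y \<bullet> rvec u\<close> by less than \<open>1\<close> if that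
   product is zero, which forces it to be zero, and otherwise by less than its absolute value, which
   keeps the sign.\<close>
 define b where "b u = (if y \<bullet> rvec u = 0 then 1 else min 1 \<bar>y \<bullet> rvec u\<bar>) / (norm (rvec u) + 1)" for u
 define e where "e = Min (insert \<epsilon> (b ` W))"
 have "e > 0" unfolding e_def using assms
  by (subst Min_gr_iff) (auto simp: b_def intro!: divide_pos_pos add_nonneg_pos)
 have e_le: "e \<le> \<epsilon>" "!!u. u \<in> W ==> e \<le> b u"
  unfolding e_def using assms by (auto intro!: Min_le)
 obtain q m where q: "q > 0" and m: "norm (of_int q *\<^sub>R y - rvec m) < e"
  using ex_int_approx[OF \<open>e > 0\<close>, of y] by blast
 have "sgn (real_of_int (pairing m u)) = sgn (y \<bullet> rvec u)" if u: "u \<in> W" for u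
 proof -
  define s where "s = y \<bullet> rvec u"
  define c where "c = (if s = 0 then 1 else min 1 \<bar>s\<bar>)"
  have "c > 0" by (simp add: c_def)
  have "\<bar>of_int q * s - of_int (pairing m u)\<bar> = \<bar>(of_int q *\<^sub>R y - rvec m) \<bullet> rvec u\<bar>"
   by (simp add: s_def inner_simps rvec_inner)
  also have "... \<le> norm (of_int q *\<^sub>R y - rvec m) * norm (rvec u)"
   by (rule Cauchy_Schwarz_ineq2)
  also have "... \<le> b u * norm (rvec u)" using m e_le(2)[OF u] by (intro mult_right_mono) auto
  also have "... = c * (norm (rvec u) / (norm (rvec u) + 1))" by (simp add: b_def c_def s_def)
  also have "... < c * 1"
   using \<open>c > 0\<close> by (intro mult_strict_left_mono) (auto simp: divide_less_eq add_nonneg_pos)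
  finally have err: "\<bar>of_int q * s - of_int (pairing m u)\<bar> < c" by simp
  have q1: "real_of_int q \<ge> 1" using q by simp
  show ?thesis
  proof (cases s "0::real" rule: linorder_cases)
   case equal
   with err have "\<bar>real_of_int (pairing m u)\<bar> < 1" by (simp add: c_def)
   hence "pairing m u = 0" by linarith
   with equal show ?thesis by (simp add: s_def)
  next
   case greater
   hence "of_int q * s \<ge> 1 * s" using q1 by (intro mult_right_mono) auto
   moreover have "c \<le> s" using greater by (auto simp: c_def)
   ultimately have "real_of_int (pairing m u) > 0" using err by linarith
   with greater show ?thesis unfolding s_def by (simp only: sgn_1_pos sgn_pos)
  next
   case less
   hence "of_int q * s \<le> 1 * s" using q1 by (intro mult_right_mono_neg) auto
   moreover have "c \<le> - s" using less by (auto simp: c_def)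
   ultimately have "real_of_int (pairing m u) < 0" using err by linarith
   with less show ?thesis unfolding s_def by (simp only: sgn_neg)
  qed
 qed
 with q m e_le(1) show ?thesis by (intro exI[of _ q] exI[of _ m]) auto
qed

lemma rface_same_signs:
 assumes "y \<in> rface U S" "S \<subseteq> U" "!!u. u \<in> U ==> sgn (real_of_int (pairing m u)) = sgn (y \<bullet> rvec u)"
 shows "rvec m \<in> rface U S"
proof -
 have "real_of_int (pairing m u) \<ge> 0" if "u \<in> U" for u
 proof -
  have "sgn (y \<bullet> rvec u) \<ge> 0" using assms(1) that by (auto simp: rface_def)
  hence "sgn (real_of_int (pairing m u)) \<ge> 0" using assms(3)[OF that] by (simp only:)
  thus ?thesis by (simp add: sgn_if split: if_splits)
 qed
 moreover have "real_of_int (pairing m u) = 0" if "u \<in> S" for u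
  using assms(1,2) assms(3)[of u] that by (auto simp: rface_def sgn_zero_iff)
 ultimately show ?thesis by (simp add: rface_def rvec_inner)
qed

text \<open>Scaled lattice points of the face come arbitrarily close to each of its points, and a
  linear subspace is closed.\<close>

lemma rface_span_lattice:
 assumes "finite U" "S \<subseteq> U"
 shows "rface U S \<subseteq> span (rvec ` {m. rvec m \<in> rface U S})"
proof
 fix y assume y: "y \<in> rface U S"
 let ?L = "span (rvec ` {m. rvec m \<in> rface U S})"
 have "\<exists>z\<in>?L. dist z y < \<epsilon>" if "\<epsilon> > 0" for \<epsilon>
 proof -
  obtain q m where q: "q > 0" and m: "norm (of_int q *\<^sub>R y - rvec m) < \<epsilon>"
   "\<forall>u\<in>U. sgn (real_of_int (pairing m u)) = sgn (y \<bullet> rvec u)"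
   using ex_int_same_signs[OF assms(1) \<open>\<epsilon> > 0\<close>, of y] by blast
  have "rvec m \<in> rface U S" using rface_same_signs[OF y assms(2)] m(2) by blast
  hence "(1 / of_int q) *\<^sub>R rvec m \<in> ?L" by (intro span_scale span_base) auto
  moreover have "dist ((1 / of_int q) *\<^sub>R rvec m) y < \<epsilon>"
  proof -
   have q1: "real_of_int q \<ge> 1" using q by simp
   have "(1 / of_int q) *\<^sub>R rvec m - y = (1 / of_int q) *\<^sub>R (rvec m - of_int q *\<^sub>R y)"
    using q by (simp add: scaleR_diff_right)
   hence "dist ((1 / of_int q) *\<^sub>R rvec m) y = norm (of_int q *\<^sub>R y - rvec m) / of_int q"
    using q by (simp add: dist_norm norm_minus_commute)
   also have "... \<le> norm (of_int q *\<^sub>R y - rvec m)"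
    using divide_left_mono[OF q1, of "norm (of_int q *\<^sub>R y - rvec m)"] q by simp
   finally show ?thesis using m(1) by simp
  qed
  ultimately show ?thesis by blast
 qed
 hence "y \<in> closure ?L" unfolding closure_approachable by blast
 thus "y \<in> ?L" by (metis closed_span closure_closed)
qed

lemma ex_lattice_basis_of_face:
 assumes "finite U" "S \<subseteq> U"
 obtains v :: "nat => int ^ 'n" where "!!i. i < dim (rface U S) ==> rvec (v i) \<in> rface U S"
  "!!i. i < dim (rface U S) ==> rvec (v i) \<notin> span (rvec ` v ` {..<i})"
proof -
 let ?L = "rvec ` {m. rvec m \<in> rface U S}"
 obtain B where B: "B \<subseteq> ?L" "independent B" "?L \<subseteq> span B" "card B = dim ?L"
  using basis_exists[of ?L] by blast
 have "dim ?L = dim (rface U S)"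
 proof (rule antisym)
  show "dim ?L \<le> dim (rface U S)" by (rule dim_subset) auto
  show "dim (rface U S) \<le> dim ?L"
   using rface_span_lattice[OF assms] by (metis dim_span dim_subset)
 qed
 with B(4) have card: "card B = dim (rface U S)" by simp
 have "finite B" using B(2) by (rule independent_imp_finite)
 then obtain h where h: "bij_betw h {..<card B} B"
  using ex_bij_betw_nat_finite[of B] by (auto simp: atLeast0LessThan)
 define v where "v i = (SOME m. rvec m = h i)" for i
 have hB: "h i \<in> B" if "i < card B" for i using h that by (auto simp: bij_betw_def)
 have rv: "rvec (v i) = h i" if "i < card B" for i
  unfolding v_def by (rule someI_ex) (use hB[OF that] B(1) in auto)
 show thesis
 proof (rule that)
  fix i assume i: "i < dim (rface U S)"
  hence i': "i < card B" using card by simp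
  show "rvec (v i) \<in> rface U S" using rv[OF i'] hB[OF i'] B(1) by auto
  have eq: "rvec ` v ` {..<i} = h ` {..<i}"
   using i' rv by (auto simp: image_image intro!: image_cong)
  have "h ` {..<i} \<subseteq> B - {h i}" using h i' by (auto simp: bij_betw_def inj_on_def)
  moreover have "h i \<notin> span (B - {h i})"
   using B(2) hB[OF i'] unfolding dependent_def by blast
  ultimately show "rvec (v i) \<notin> span (rvec ` v ` {..<i})"
   unfolding eq rv[OF i'] using span_mono by blast
 qed
qed

text \<open>A generic point of the face is rounded to a lattice point without changing the sign of
  any functional in \<open>U\<close>.\<close>

lemma ex_lattice_relative_interior:
 fixes U S :: "(int ^ 'n) set"
 assumes "finite U" "S \<subseteq> U"
 obtains w where "rvec w \<in> rface U S"
  "!!u. u \<in> U ==> pairing w u > 0 \<or> (\<forall>y\<in>rface U S. y \<bullet> rvec u = 0)"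
proof -
 define \<Delta> where "\<Delta> = {qt \<in> rvec ` U. \<exists>y\<in>rface U S. y \<bullet> qt ~= 0}"
 have "finite \<Delta>" using assms by (simp add: \<Delta>_def)
 hence "\<exists>w\<in>rface U S. \<forall>qt\<in>\<Delta>. w \<bullet> qt ~= 0"
  by (rule ex_generic_in_cone) (simp_all add: rface_add rface_scale rface_zero \<Delta>_def)
 then obtain y where y: "y \<in> rface U S" "!!qt. qt \<in> \<Delta> ==> y \<bullet> qt ~= 0" by blast
 obtain q w where w: "\<forall>u\<in>U. sgn (real_of_int (pairing w u)) = sgn (y \<bullet> rvec u)"
  using ex_int_same_signs[OF assms(1) zero_less_one, of y] by blast
 show thesis
 proof (rule that)
  show "rvec w \<in> rface U S" using rface_same_signs[OF y(1) assms(2)] w by blast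
  fix u assume u: "u \<in> U"
  show "pairing w u > 0 \<or> (\<forall>y\<in>rface U S. y \<bullet> rvec u = 0)"
  proof (cases "rvec u \<in> \<Delta>")
   case True
   have "y \<bullet> rvec u > 0" using y(2)[OF True] y(1) u by (force simp: rface_def)
   hence "sgn (real_of_int (pairing w u)) > 0" using w u by simp
   thus ?thesis by simp
  next
   case False
   with u show ?thesis by (auto simp: \<Delta>_def)
  qed
 qed
qed


section \<open>Points of the open orbit\<close>

text \<open>The subgroup generated by the first \<open>k\<close> vectors, built up one generator at
  a time to match the induction on the regular sequence.\<close>

primrec zcomb :: "(nat => int ^ 'n) => nat => (int ^ 'n) set" where
 "zcomb v 0 = {0}"
| "zcomb v (Suc k) = {l + j *s v k |l j. l \<in> zcomb v k}"

lemma rvec_scale: "rvec (j *s m) = of_int j *\<^sub>R rvec m" by (simp add: rvec_def vec_eq_iff)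

lemma pairing_scale: "pairing (j *s m) u = j * pairing m u"
 by (simp add: pairing_def sum_distrib_left mult.assoc)

lemma zcomb_zero: "0 \<in> zcomb v k" by (induction k) (auto intro: exI[of _ 0])

lemma zcomb_add: "a \<in> zcomb v k ==> b \<in> zcomb v k ==> a + b \<in> zcomb v k"
proof (induction k arbitrary: a b)
 case (Suc k)
 then obtain l j l' j' where "a = l + j *s v k" "b = l' + j' *s v k" "l \<in> zcomb v k" "l' \<in> zcomb v k"
  by auto
 moreover from this have "a + b = (l + l') + (j + j') *s v k"
  by (simp add: vec_eq_iff algebra_simps)
 ultimately show ?case using Suc.IH by (auto intro!: exI[of _ "l + l'"] exI[of _ "j + j'"])
qed simp

lemma zcomb_uminus: "a \<in> zcomb v k ==> - a \<in> zcomb v k"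
proof (induction k arbitrary: a)
 case (Suc k)
 then obtain l j where "a = l + j *s v k" "l \<in> zcomb v k" by auto
 moreover from this have "- a = - l + (- j) *s v k" by (simp add: vec_eq_iff)
 ultimately show ?case using Suc.IH by (auto intro!: exI[of _ "- l"] exI[of _ "- j"])
qed simp

lemma zcomb_diff: "a \<in> zcomb v k ==> b \<in> zcomb v k ==> a - b \<in> zcomb v k"
 using zcomb_add[of a v k "- b"] zcomb_uminus[of b v k] by simp

lemma zcomb_span: "a \<in> zcomb v k ==> rvec a \<in> span (rvec ` v ` {..<k})"
proof (induction k arbitrary: a)
 case (Suc k)
 then obtain l j where a: "a = l + j *s v k" "l \<in> zcomb v k" by auto
 have "span (rvec ` v ` {..<k}) \<subseteq> span (rvec ` v ` {..<Suc k})" by (intro span_mono) auto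
 with Suc.IH[OF a(2)] have "rvec l \<in> span (rvec ` v ` {..<Suc k})" by blast
 moreover have "rvec (v k) \<in> span (rvec ` v ` {..<Suc k})" by (intro span_base) auto
 ultimately show ?case unfolding a(1) rvec_add rvec_scale by (intro span_add span_scale)
qed simp

lemma zcomb_multiple:
 assumes "j *s v k \<in> zcomb v k" "rvec (v k) \<notin> span (rvec ` v ` {..<k})"
 shows "j = 0"
proof (rule ccontr)
 assume "j ~= 0"
 have "of_int j *\<^sub>R rvec (v k) \<in> span (rvec ` v ` {..<k})"
  using zcomb_span[OF assms(1)] by (simp add: rvec_scale)
 hence "(1 / of_int j) *\<^sub>R of_int j *\<^sub>R rvec (v k) \<in> span (rvec ` v ` {..<k})"
  by (rule span_scale)
 with \<open>j ~= 0\<close> assms(2) show False by simp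
qed

context chart_point
begin

lemma pt_scale: "v \<in> dual U ==> pt (int k *s v) = pt v ^ k \<and> int k *s v \<in> dual U"
proof (induction k)
 case 0
 have "int 0 *s v = 0" by (simp add: vec_eq_iff)
 thus ?case using pt_zero by simp
next
 case (Suc k)
 have eq: "int (Suc k) *s v = v + int k *s v" by (simp add: vec_eq_iff algebra_simps)
 show ?case unfolding eq using Suc pt_add[of v "int k *s v"] dual_add[of v U "int k *s v"] by simp
qed

text \<open>Differences of points of \<open>cpts U x S\<close> lie in the group generated by the
  lattice points of the face, to which the nonvanishing \<open>pt\<close> extends as a character.
  \<open>\<beta> m\<close> is its value at \<open>m - m0\<close>, computed after shifting into the
  face by a multiple of the interior point \<open>w\<close>.\<close>

lemma ex_character_on_cpts:
 assumes S: "S \<subseteq> U" and nz: "!!v. rvec v \<in> rface U S ==> pt v ~= 0"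
 obtains \<beta> where "!!m. m \<in> cpts U x S ==> \<beta> m ~= 0"
  "!!m a. m \<in> cpts U x S ==> rvec a \<in> rface U S ==> \<beta> (m + a) = pt a * \<beta> m"
proof (cases "cpts U x S = {}")
 case True
 with that[of "%_. 0"] show ?thesis by auto
next
 case False
 then obtain m0 where m0: "m0 \<in> cpts U x S" by blast
 obtain w where w: "rvec w \<in> rface U S"
  "!!u. u \<in> U ==> pairing w u > 0 \<or> (\<forall>y\<in>rface U S. y \<bullet> rvec u = 0)"
  using ex_lattice_relative_interior[OF finU S] by blast
 have rf_dual: "a \<in> dual U" if "rvec a \<in> rface U S" for a
  using that by (auto simp: rface_def dual_def rvec_inner)
 \<comment> \<open>So many copies of \<open>w\<close> suffice, because \<open>pairing w u\<close> is
   at least \<open>1\<close> for every \<open>u\<close> that does not vanish on the face.\<close>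
 define N where "N m = nat (\<Sum>u\<in>U. \<bar>pairing (m - m0) u\<bar>)" for m
 define tr where "tr m k = m - m0 + int k *s w" for m k
 have tr: "rvec (tr m k) \<in> rface U S" if m: "m \<in> cpts U x S" and k: "k \<ge> N m" for m k
 proof -
  have eq: "rvec (tr m k) \<bullet> rvec u = of_int (pairing (m - m0) u + int k * pairing w u)" for u
   unfolding rvec_inner tr_def by (simp add: pairing_add pairing_scale)
  have van: "pairing (m - m0) u = 0" if "\<forall>y\<in>rface U S. y \<bullet> rvec u = 0" for u
  proof -
   have "rvec m - x \<in> rface U S" "rvec m0 - x \<in> rface U S" using m m0 by (auto simp: cpts_def)
   with that have "(rvec m - x) \<bullet> rvec u = 0" "(rvec m0 - x) \<bullet> rvec u = 0" by blast+
   hence "(rvec m - rvec m0) \<bullet> rvec u = 0" by (simp add: inner_simps)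
   hence "real_of_int (pairing (m - m0) u) = 0" by (simp add: inner_simps rvec_inner pairing_diff)
   thus ?thesis by simp
  qed
  have wS: "pairing w u = 0" if "\<forall>y\<in>rface U S. y \<bullet> rvec u = 0" for u
   using that w(1) by (auto simp: rvec_inner)
  have "pairing (m - m0) u + int k * pairing w u \<ge> 0" if u: "u \<in> U" for u using w(2)[OF u]
  proof
   assume "pairing w u > 0"
   hence "int k * pairing w u \<ge> int k * 1" by (intro mult_left_mono) auto
   moreover have "\<bar>pairing (m - m0) u\<bar> \<le> (\<Sum>u\<in>U. \<bar>pairing (m - m0) u\<bar>)"
    using finU u by (intro member_le_sum) auto
   hence "\<bar>pairing (m - m0) u\<bar> \<le> int k" using k by (simp add: N_def)
   ultimately show ?thesis by linarith
  qed (use van wS in simp)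
  moreover have "pairing (m - m0) u + int k * pairing w u = 0" if u: "u \<in> S" for u
  proof -
   have "\<forall>y\<in>rface U S. y \<bullet> rvec u = 0" using u by (auto simp: rface_def)
   with van wS show ?thesis by simp
  qed
  ultimately show ?thesis
   unfolding rface_def mem_Collect_eq eq by (simp del: of_int_add of_int_mult)
 qed
 define \<beta> where "\<beta> m = pt (tr m (N m)) / pt w ^ N m" for m
 have w0: "pt w ~= 0" using nz[OF w(1)] .
 have \<beta>_eq: "\<beta> m = pt (tr m k) / pt w ^ k" if m: "m \<in> cpts U x S" and k: "k \<ge> N m" for m k
 proof -
  define j where "j = k - N m"
  have "tr m k = tr m (N m) + int j *s w"
   using k by (simp add: tr_def j_def vec_eq_iff algebra_simps of_nat_diff)
  hence "pt (tr m k) = pt (tr m (N m)) * pt w ^ j"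
   using pt_add[OF rf_dual[OF tr[OF m order_refl]]] pt_scale[OF rf_dual[OF w(1)], of j] by simp
  moreover have "pt w ^ k = pt w ^ N m * pt w ^ j" using k by (simp add: j_def flip: power_add)
  ultimately show ?thesis using w0 by (simp add: \<beta>_def)
 qed
 show ?thesis
 proof (rule that)
  fix m assume m: "m \<in> cpts U x S"
  show "\<beta> m ~= 0" using nz[OF tr[OF m order_refl]] w0 by (simp add: \<beta>_def)
  fix a assume a: "rvec a \<in> rface U S"
  have ma: "m + a \<in> cpts U x S"
   using m rface_add[OF _ a, of "rvec m - x"] by (simp add: cpts_def rvec_add algebra_simps)
  define k where "k = max (N m) (N (m + a))"
  have "tr (m + a) k = a + tr m k" by (simp add: tr_def)
  hence "pt (tr (m + a) k) = pt a * pt (tr m k)"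
   using pt_add[OF rf_dual[OF a] rf_dual[OF tr[OF m, of k]]] by (simp add: k_def)
  thus "\<beta> (m + a) = pt a * \<beta> m"
   using \<beta>_eq[OF m, of k] \<beta>_eq[OF ma, of k] by (simp add: k_def)
 qed
qed

end

text \<open>For a group \<open>\<Lambda>\<close>, the coefficient at the class of \<open>m\<close>
  when the characters in \<open>\<Lambda>\<close> are set equal to their values;
  \<open>\<beta>\<close> provides the values on the translated face.\<close>

definition csum :: "'m set => ('m => complex) => 'm set => ('m::ab_group_add \<Rightarrow>\<^sub>0 complex) => 'm => complex" where
 "csum D \<beta> \<Lambda> f m = (\<Sum>m'\<in>{m' \<in> supp f. m' \<in> D \<and> m' - m \<in> \<Lambda>}. \<beta> m' * coef f m')"

lemma csum_superset:
 assumes "finite K" "supp f \<subseteq> K"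
 shows "csum D \<beta> \<Lambda> f m = (\<Sum>m'\<in>{m' \<in> K. m' \<in> D \<and> m' - m \<in> \<Lambda>}. \<beta> m' * coef f m')"
 unfolding csum_def by (rule sum.mono_neutral_left) (use assms in \<open>auto simp: in_keys_iff\<close>)

lemma csum_add: "csum D \<beta> \<Lambda> (f + g) m = csum D \<beta> \<Lambda> f m + csum D \<beta> \<Lambda> g m"
proof -
 have "supp f \<subseteq> supp f \<union> supp g" "supp g \<subseteq> supp f \<union> supp g" "supp (f + g) \<subseteq> supp f \<union> supp g"
  using keys_add[of f g] by auto
 thus ?thesis
  by (simp add: csum_superset[of "supp f \<union> supp g"] lookup_add algebra_simps sum.distrib)
qed

lemma csum_uminus: "csum D \<beta> \<Lambda> (- f) m = - csum D \<beta> \<Lambda> f m"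
 by (simp add: csum_def sum_negf)

lemma csum_diff: "csum D \<beta> \<Lambda> (f - g) m = csum D \<beta> \<Lambda> f m - csum D \<beta> \<Lambda> g m"
 using csum_add[of D \<beta> \<Lambda> f "- g" m] by (simp add: csum_uminus)

lemma zcomb_base: "i < e ==> v i \<in> zcomb v e"
proof (induction e)
 case (Suc e)
 show ?case
 proof (cases "i = e")
  case True
  have "v e = 0 + 1 *s v e" by (simp add: vec_eq_iff)
  thus ?thesis unfolding zcomb.simps True using zcomb_zero[of v e] by blast
 next
  case False
  hence "v i \<in> zcomb v e" using Suc by simp
  moreover have "v i = v i + 0 *s v e" by (simp add: vec_eq_iff)
  ultimately show ?thesis unfolding zcomb.simps by blast
 qed
qed simp

context denominators
begin

lemma smod_extend:
 assumes "smod N" "smod Y" "g \<in> A"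
 shows "smod {g * x + y |x y. x \<in> N \<and> y \<in> Y}" unfolding smod_def
proof (intro conjI ballI)
 show "0 \<in> {g * x + y |x y. x \<in> N \<and> y \<in> Y}"
  using smod_zero[OF assms(1)] smod_zero[OF assms(2)] by (auto intro!: exI[of _ 0])
 fix f assume "f \<in> {g * x + y |x y. x \<in> N \<and> y \<in> Y}"
 then obtain x y where f: "f = g * x + y" "x \<in> N" "y \<in> Y" by blast
 show "f + f' \<in> {g * x + y |x y. x \<in> N \<and> y \<in> Y}"
  if f'in: "f' \<in> {g * x + y |x y. x \<in> N \<and> y \<in> Y}" for f'
 proof -
  obtain x' y' where f': "f' = g * x' + y'" "x' \<in> N" "y' \<in> Y" using f'in by blast
  have "f + f' = g * (x + x') + (y + y')" by (simp add: f f' algebra_simps)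
  with smod_add[OF assms(1) f(2) f'(2)] smod_add[OF assms(2) f(3) f'(3)] show ?thesis by blast
 qed
 show "a * f \<in> {g * x + y |x y. x \<in> N \<and> y \<in> Y}" if "a \<in> A" for a
 proof -
  have "a * f = g * (a * x) + a * y" by (simp add: f algebra_simps)
  with smod_scale[OF assms(1) that f(2)] smod_scale[OF assms(2) that f(3)] show ?thesis by blast
 qed
qed

end

context chart_point
begin

text \<open>The characters of independent lattice points of the face, minus their values, form a
  regular sequence on \<open>lspan Q / lspan Q'\<close>, and by \<open>alg\<close> each acts
  nilpotently on the localized cohomology. Every use of \<open>kexact_step\<close> trades one level
  of \<open>k\<close> for one more element of the sequence, so \<open>k\<close> may be anything
  below its length.\<close>

lemma kexact_open_orbit:
 assumes fin: "finite I" and F: "!!j. j \<in> I ==> F j \<in> lspan (dual U)"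
  and S: "S \<subseteq> U" and nz: "!!v. rvec v \<in> rface U S ==> pt v ~= 0"
  and alg: "!!v. v \<in> dual U ==> \<exists>s\<in>{s \<in> lspan (dual U). ev pt s ~= 0}. \<exists>c K.
   (\<forall>j\<in>I. c j \<in> lspan (dual U)) \<and> s * (mon v 1 - mon 0 (pt v)) ^ K = (\<Sum>j\<in>I. c j * F j)"
  and Q: "up (dual U) Q" and Q': "up (dual U) Q'" and sub: "Q' \<subseteq> Q" and D: "Q - Q' = cpts U x S"
  and k: "k < dim (rface U S)"
 shows "kexact F I (lspan Q) (lspan Q') k"
proof -
 let ?D = "cpts U x S"
 define d where "d = dim (rface U S)"
 obtain v where v: "!!i. i < d ==> rvec (v i) \<in> rface U S"
  "!!i. i < d ==> rvec (v i) \<notin> span (rvec ` v ` {..<i})"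
  using ex_lattice_basis_of_face[OF finU S] unfolding d_def by blast
 obtain \<beta> where \<beta>0: "!!m. m \<in> ?D ==> \<beta> m ~= 0"
  and \<beta>: "!!m a. m \<in> ?D ==> rvec a \<in> rface U S ==> \<beta> (m + a) = pt a * \<beta> m"
  using ex_character_on_cpts[OF S nz] by blast
 have rf_dual: "a \<in> dual U" if "rvec a \<in> rface U S" for a
  using that by (auto simp: rface_def dual_def rvec_inner)
 have D_add: "m + a \<in> ?D" if "m \<in> ?D" "rvec a \<in> rface U S" for m a
  using that rface_add[of "rvec m - x" U S "rvec a"] by (simp add: cpts_def rvec_add algebra_simps)
 have D_iff: "a + m \<in> ?D \<longleftrightarrow> m \<in> ?D \<and> rvec a \<in> rface U S" if a: "a \<in> dual U" and m: "m \<in> Q" for a m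
 proof
  assume am: "a + m \<in> ?D"
  have "m \<notin> Q'"
  proof
   assume "m \<in> Q'"
   with Q' a have "m + a \<in> Q'" by (auto simp: up_def)
   with am D show False by (auto simp: add.commute)
  qed
  with m D have mD: "m \<in> ?D" by blast
  have "pairing a u = 0" if "u \<in> S" for u
  proof -
   have "(rvec (a + m) - x) \<bullet> rvec u = 0" "(rvec m - x) \<bullet> rvec u = 0"
    using am mD that by (auto simp: cpts_def rface_def)
   hence "real_of_int (pairing a u) = 0" by (simp add: rvec_add inner_simps rvec_inner)
   thus ?thesis by simp
  qed
  with a mD show "m \<in> ?D \<and> rvec a \<in> rface U S" by (simp add: rvec_in_rface)
 next
  show "m \<in> ?D \<and> rvec a \<in> rface U S ==> a + m \<in> ?D" using D_add by (metis add.commute)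
 qed
 have csum_shift: "csum ?D \<beta> \<Lambda> (mon a c * f) m = c * pt a * csum ?D \<beta> \<Lambda> f (m - a)"
  if a: "rvec a \<in> rface U S" and f: "f \<in> lspan Q" for a c f m \<Lambda>
 proof -
  have "supp (mon a c * f) \<subseteq> (+) a ` supp f"
  proof
   fix m' assume "m' \<in> supp (mon a c * f)"
   hence "m' - a \<in> supp f" by (simp add: in_keys_iff coef_mon_mult)
   thus "m' \<in> (+) a ` supp f" by (auto intro!: image_eqI[of _ _ "m' - a"])
  qed
  hence "csum ?D \<beta> \<Lambda> (mon a c * f) m =
    (\<Sum>m'\<in>{m' \<in> (+) a ` supp f. m' \<in> ?D \<and> m' - m \<in> \<Lambda>}. \<beta> m' * coef (mon a c * f) m')"
   by (intro csum_superset) auto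
  also have "{m' \<in> (+) a ` supp f. m' \<in> ?D \<and> m' - m \<in> \<Lambda>}
    = (+) a ` {m' \<in> supp f. m' \<in> ?D \<and> m' - (m - a) \<in> \<Lambda>}"
   using D_iff[OF rf_dual[OF a]] f a by (auto simp: lspan_def algebra_simps)
  also have "(\<Sum>m'\<in>.... \<beta> m' * coef (mon a c * f) m') =
    (\<Sum>m'\<in>{m' \<in> supp f. m' \<in> ?D \<and> m' - (m - a) \<in> \<Lambda>}. \<beta> (a + m') * coef (mon a c * f) (a + m'))"
   by (subst sum.reindex) (auto simp: inj_on_def)
  also have "... = (\<Sum>m'\<in>{m' \<in> supp f. m' \<in> ?D \<and> m' - (m - a) \<in> \<Lambda>}. c * pt a * (\<beta> m' * coef f m'))"
  proof (intro sum.cong refl)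
   fix m' assume "m' \<in> {m' \<in> supp f. m' \<in> ?D \<and> m' - (m - a) \<in> \<Lambda>}"
   hence "\<beta> (a + m') = pt a * \<beta> m'" using \<beta>[OF _ a, of m'] by (simp add: add.commute)
   thus "\<beta> (a + m') * coef (mon a c * f) (a + m') = c * pt a * (\<beta> m' * coef f m')"
    by (simp add: coef_mon_mult)
  qed
  also have "... = c * pt a * csum ?D \<beta> \<Lambda> f (m - a)" by (simp add: csum_def sum_distrib_left)
  finally show ?thesis .
 qed
 define g where "g e = mon (v e) 1 - mon 0 (pt (v e))" for e
 \<comment> \<open>\<open>Y e\<close> is \<open>lspan Q'\<close> together with the multiples of the
   first \<open>e\<close> elements of the sequence.\<close>
 define Y where "Y = rec_nat (lspan Q') (%e W. {g e * x + y |x y. x \<in> lspan Q \<and> y \<in> W})"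
 have Y0: "Y 0 = lspan Q'" and YS: "Y (Suc e) = {g e * x + y |x y. x \<in> lspan Q \<and> y \<in> Y e}" for e
  by (simp_all add: Y_def)
 have gA: "g e \<in> lspan (dual U)" if "e < d" for e
  unfolding g_def using rf_dual[OF v(1)[OF that]] by (intro lspan_diff) auto
 have smY: "smod (Y e)" if "e \<le> d" for e using that
 proof (induction e)
  case (Suc e)
  thus ?case unfolding YS using gA smod_lspan[OF Q] by (intro smod_extend) auto
 qed (simp add: Y0 smod_lspan[OF Q'])
 have YQ: "Y e \<subseteq> lspan Q" if "e \<le> d" for e using that
 proof (induction e)
  case 0
  thus ?case using sub by (auto simp: Y0 lspan_def)
 next
  case (Suc e)
  show ?case
  proof
   fix f assume "f \<in> Y (Suc e)"
   then obtain x y where "f = g e * x + y" "x \<in> lspan Q" "y \<in> Y e" unfolding YS by blast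
   with Suc gA[of e] show "f \<in> lspan Q"
    using smod_scale[OF smod_lspan[OF Q] gA[of e], of x] by (auto intro!: lspan_add)
  qed
 qed
 have YY: "Y e \<subseteq> Y (Suc e)" for e
 proof
  fix y assume "y \<in> Y e"
  hence "g e * 0 + y \<in> Y (Suc e)" unfolding YS using lspan_zero by blast
  thus "y \<in> Y (Suc e)" by simp
 qed
 have Y0Y: "Y 0 \<subseteq> Y e" for e by (induction e) (use YY in blast)+
 \<comment> \<open>The sums over classes are invariants of the quotient by \<open>Y e\<close>;
   \<open>in_Y\<close> below shows that they are complete.\<close>
 have csum_Y: "csum ?D \<beta> \<Lambda> f m = 0" if "f \<in> Y e" "e \<le> d" "!!i. i < e ==> v i \<in> \<Lambda>"
  and grp: "!!a b. a \<in> \<Lambda> ==> b \<in> \<Lambda> ==> a + b \<in> \<Lambda>" "!!a. a \<in> \<Lambda> ==> - a \<in> \<Lambda>" for e f m \<Lambda>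
  using that(1,2,3)
 proof (induction e arbitrary: f)
  case 0
  hence "{m' \<in> supp f. m' \<in> ?D \<and> m' - m \<in> \<Lambda>} = {}"
   unfolding Y0 using D by (auto simp: lspan_def)
  thus ?case unfolding csum_def by (simp only: sum.empty)
 next
  case (Suc e)
  then obtain x y where f: "f = g e * x + y" "x \<in> lspan Q" "y \<in> Y e" unfolding YS by blast
  have e: "e < d" using Suc.prems by simp
  have ve: "v e \<in> \<Lambda>" using Suc.prems by simp
  have same: "m' - (m - v e) \<in> \<Lambda> \<longleftrightarrow> m' - m \<in> \<Lambda>" for m'
  proof
   assume "m' - (m - v e) \<in> \<Lambda>"
   from grp(1)[OF this grp(2)[OF ve]] show "m' - m \<in> \<Lambda>" by simp
  next
   assume "m' - m \<in> \<Lambda>"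
   from grp(1)[OF this ve] show "m' - (m - v e) \<in> \<Lambda>" by (simp add: algebra_simps)
  qed
  have z: "rvec (0 :: int ^ 'n) \<in> rface U S" by (simp add: rface_zero)
  have "csum ?D \<beta> \<Lambda> (g e * x) m = pt (v e) * csum ?D \<beta> \<Lambda> x (m - v e) - pt (v e) * csum ?D \<beta> \<Lambda> x m"
   unfolding g_def left_diff_distrib csum_diff csum_shift[OF v(1)[OF e] f(2)] csum_shift[OF z f(2)]
   by (simp add: pt_zero)
  also have "csum ?D \<beta> \<Lambda> x (m - v e) = csum ?D \<beta> \<Lambda> x m" by (simp add: csum_def same)
  finally show ?case using Suc f by (simp add: csum_add)
 qed
 have mon_step: "mon (m + int j *s v e) 1 - mon m (pt (v e) ^ j) \<in> Y (Suc e)"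
  if e: "e < d" and m: "m \<in> ?D" for m j e
 proof (induction j)
  case 0
  have "m + int 0 *s v e = m" by (simp add: vec_eq_iff)
  thus ?case using smod_zero[OF smY[of "Suc e"]] e by simp
 next
  case (Suc j)
  let ?n = "m + int j *s v e"
  have "?n \<in> ?D" using m v(1)[OF e] by (intro D_add) (simp_all add: rvec_scale rface_scale)
  hence "mon ?n 1 \<in> lspan Q" using D by auto
  hence "g e * mon ?n 1 + 0 \<in> Y (Suc e)"
   unfolding YS using smod_zero[OF smY[of e]] e by (intro CollectI exI conjI) (rule refl, auto)
  hence 1: "g e * mon ?n 1 \<in> Y (Suc e)" by simp
  have "mon 0 (pt (v e)) * (mon ?n 1 - mon m (pt (v e) ^ j)) \<in> Y (Suc e)"
   using e by (intro smod_scale[OF smY] Suc) auto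
  from smod_add[OF smY 1 this] have "g e * mon ?n 1 +
   mon 0 (pt (v e)) * (mon ?n 1 - mon m (pt (v e) ^ j)) \<in> Y (Suc e)" using e by simp
  also have "g e * mon ?n 1 + mon 0 (pt (v e)) * (mon ?n 1 - mon m (pt (v e) ^ j))
    = mon (v e + ?n) 1 - mon m (pt (v e) ^ Suc j)"
   by (simp add: g_def left_diff_distrib right_diff_distrib mult_single)
  also have "v e + ?n = m + int (Suc j) *s v e" by (simp add: vec_eq_iff algebra_simps)
  finally show ?case .
 qed
 \<comment> \<open>Modulo \<open>Y e\<close>, monomials in one class of \<open>zcomb v e\<close> are
   proportional, with the ratio given by \<open>\<beta>\<close>.\<close>
 have binom: "mon m1 1 - mon m2 (\<beta> m1 / \<beta> m2) \<in> Y e"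
  if "e \<le> d" "m1 \<in> ?D" "m2 \<in> ?D" "m1 - m2 \<in> zcomb v e" for e m1 m2 using that
 proof (induction e arbitrary: m1 m2)
  case 0
  thus ?case using \<beta>0[of m1] smod_zero[OF smY[of 0]] by simp
 next
  case (Suc e)
  have e: "e < d" using Suc.prems by simp
  have pos: "mon m1 1 - mon m2 (\<beta> m1 / \<beta> m2) \<in> Y (Suc e)"
   if m: "m1 \<in> ?D" "m2 \<in> ?D" "m1 - m2 = l + int j *s v e" "l \<in> zcomb v e" for m1 m2 l j
  proof -
   define m3 where "m3 = m2 + int j *s v e"
   have rj: "rvec (int j *s v e) \<in> rface U S" using v(1)[OF e] by (simp add: rvec_scale rface_scale)
   have m3: "m3 \<in> ?D" unfolding m3_def using m(2) rj by (rule D_add)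
   have b3: "\<beta> m3 = pt (v e) ^ j * \<beta> m2"
    unfolding m3_def \<beta>[OF m(2) rj] using pt_scale[OF rf_dual[OF v(1)[OF e]], of j] by simp
   have "m1 - m3 = l" using m(3) by (simp add: m3_def algebra_simps)
   hence "mon m1 1 - mon m3 (\<beta> m1 / \<beta> m3) \<in> Y (Suc e)"
    using Suc.IH[OF _ m(1) m3] e m(4) YY by auto
   moreover have "mon 0 (\<beta> m1 / \<beta> m3) * (mon m3 1 - mon m2 (pt (v e) ^ j)) \<in> Y (Suc e)"
    using mon_step[OF e m(2), of j] e by (intro smod_scale[OF smY]) (auto simp: m3_def)
   ultimately have "mon m1 1 - mon m3 (\<beta> m1 / \<beta> m3) +
    mon 0 (\<beta> m1 / \<beta> m3) * (mon m3 1 - mon m2 (pt (v e) ^ j)) \<in> Y (Suc e)"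
    using smY[of "Suc e"] e by (intro smod_add) auto
   also have "mon m1 1 - mon m3 (\<beta> m1 / \<beta> m3) +
    mon 0 (\<beta> m1 / \<beta> m3) * (mon m3 1 - mon m2 (pt (v e) ^ j)) = mon m1 1 - mon m2 (\<beta> m1 / \<beta> m2)"
    using \<beta>0[OF m(2)] \<beta>0[OF m3] b3 by (simp add: right_diff_distrib mult_single)
   finally show ?thesis .
  qed
  from Suc.prems(4) obtain l j where lj: "m1 - m2 = l + j *s v e" "l \<in> zcomb v e" by auto
  show ?case
  proof (cases "j \<ge> 0")
   case True
   thus ?thesis using pos[OF Suc.prems(2,3), of l "nat j"] lj by simp
  next
   case False
   have "m2 - m1 = - (m1 - m2)" by simp
   also have "... = - l + int (nat (- j)) *s v e"
    unfolding lj(1) using False by (simp add: vec_eq_iff)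
   finally have "mon m2 1 - mon m1 (\<beta> m2 / \<beta> m1) \<in> Y (Suc e)"
    by (rule pos[OF Suc.prems(3,2)]) (rule zcomb_uminus[OF lj(2)])
   hence "mon 0 (- (\<beta> m1 / \<beta> m2)) * (mon m2 1 - mon m1 (\<beta> m2 / \<beta> m1)) \<in> Y (Suc e)"
    using e by (intro smod_scale[OF smY]) auto
   thus ?thesis using \<beta>0[OF Suc.prems(2)] \<beta>0[OF Suc.prems(3)]
    by (simp add: right_diff_distrib mult_single single_uminus)
  qed
 qed
 \<comment> \<open>If all class sums vanish, a support point in \<open>cpts U x S\<close> has a
   partner in its class, and subtracting a binomial removes it without adding a new support
   point.\<close>
 have in_Y: "f \<in> Y e" if "e \<le> d" "f \<in> lspan Q" "!!m. csum ?D \<beta> (zcomb v e) f m = 0" for e f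
  using that(2,3)
 proof (induction "card (supp f \<inter> ?D)" arbitrary: f rule: less_induct)
  case (less f)
  show ?case
  proof (cases "supp f \<inter> ?D = {}")
   case True
   hence "f \<in> lspan Q'" using less.prems(1) D by (auto simp: lspan_def)
   thus ?thesis using Y0Y Y0 by blast
  next
   case False
   then obtain m1 where m1: "m1 \<in> supp f" "m1 \<in> ?D" by blast
   let ?A = "{m' \<in> supp f. m' \<in> ?D \<and> m' - m1 \<in> zcomb v e}"
   have "\<exists>m2\<in>?A. m2 ~= m1"
   proof (rule ccontr)
    assume "\<not> (\<exists>m2\<in>?A. m2 ~= m1)"
    hence "?A = {m1}" using m1 zcomb_zero[of v e] by auto
    hence "csum ?D \<beta> (zcomb v e) f m1 = (\<Sum>m'\<in>{m1}. \<beta> m' * coef f m')"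
     unfolding csum_def by (simp only:)
    with less.prems(2)[of m1] \<beta>0[OF m1(2)] m1(1) show False by (simp add: in_keys_iff)
   qed
   then obtain m2 where m2: "m2 \<in> supp f" "m2 \<in> ?D" "m2 - m1 \<in> zcomb v e" "m2 ~= m1" by blast
   have "m1 - m2 \<in> zcomb v e" using zcomb_uminus[OF m2(3)] by simp
   hence "mon 0 (coef f m1) * (mon m1 1 - mon m2 (\<beta> m1 / \<beta> m2)) \<in> Y e" (is "?h \<in> _")
    using that(1) m1(2) m2(2) by (intro smod_scale[OF smY] binom) auto
   have h: "?h = mon m1 (coef f m1) - mon m2 (coef f m1 * (\<beta> m1 / \<beta> m2))"
    by (simp add: right_diff_distrib mult_single)
   have "f - ?h \<in> Y e"
   proof (rule less.hyps)
    show "f - ?h \<in> lspan Q"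
     using less.prems(1) \<open>?h \<in> Y e\<close> YQ[OF that(1)] by (intro lspan_diff) auto
    show "csum ?D \<beta> (zcomb v e) (f - ?h) m = 0" for m
    proof -
     have "csum ?D \<beta> (zcomb v e) ?h m = 0"
      using \<open>?h \<in> Y e\<close> that(1) zcomb_add zcomb_uminus zcomb_base by (intro csum_Y) auto
     thus ?thesis using less.prems(2) by (simp only: csum_diff diff_0_right)
    qed
    have "supp (f - ?h) \<inter> ?D \<subseteq> (supp f \<inter> ?D) - {m1}" using m1 m2 unfolding h
     by (auto simp: in_keys_iff lookup_minus lookup_single when_def split: if_splits)
    moreover have "m1 \<in> supp f \<inter> ?D" using m1 by simp
    ultimately have "supp (f - ?h) \<inter> ?D \<subset> supp f \<inter> ?D" by blast
    thus "card (supp (f - ?h) \<inter> ?D) < card (supp f \<inter> ?D)"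
     by (intro psubset_card_mono) auto
   qed
   from smod_add[OF smY[OF that(1)] this \<open>?h \<in> Y e\<close>] show ?thesis by simp
  qed
 qed
 have nzd: "f \<in> Y e" if e: "e < d" and f: "f \<in> lspan Q" and gf: "g e * f \<in> Y e" for e f
 proof (rule in_Y)
  fix m
  let ?s = "csum ?D \<beta> (zcomb v e) f"
  have z: "rvec (0 :: int ^ 'n) \<in> rface U S" by (simp add: rface_zero)
  have shift: "?s (m - v e) = ?s m" for m
  proof -
   have "csum ?D \<beta> (zcomb v e) (g e * f) m = 0"
    using gf e zcomb_base zcomb_add zcomb_uminus by (intro csum_Y) auto
   moreover have "csum ?D \<beta> (zcomb v e) (g e * f) m = pt (v e) * ?s (m - v e) - pt (v e) * ?s m"
    unfolding g_def left_diff_distrib csum_diff csum_shift[OF v(1)[OF e] f] csum_shift[OF z f]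
    by (simp add: pt_zero)
   ultimately show ?thesis using nz[OF v(1)[OF e]] by simp
  qed
  \<comment> \<open>The class sums of \<open>f\<close> are periodic along \<open>v e\<close>. A
    nonzero sum would give infinitely many nonzero ones, at classes that are distinct by
    independence, while the support of \<open>f\<close> is finite.\<close>
  have shifts: "?s (m - int j *s v e) = ?s m" for j
  proof (induction j)
   case 0
   have "m - int 0 *s v e = m" by (simp add: vec_eq_iff)
   thus ?case by simp
  next
   case (Suc j)
   have eq: "m - int (Suc j) *s v e = (m - int j *s v e) - v e" by (simp add: vec_eq_iff algebra_simps)
   show ?case unfolding eq shift by (rule Suc)
  qed
  show "?s m = 0"
  proof (rule ccontr)
   assume "?s m ~= 0"
   have "\<exists>m'\<in>supp f. m' - (m - int j *s v e) \<in> zcomb v e" for j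
   proof (rule ccontr)
    assume "\<not> ?thesis"
    hence "{m' \<in> supp f. m' \<in> ?D \<and> m' - (m - int j *s v e) \<in> zcomb v e} = {}" by blast
    hence "?s (m - int j *s v e) = 0" unfolding csum_def by (simp only: sum.empty)
    with shifts \<open>?s m ~= 0\<close> show False by simp
   qed
   then obtain \<phi> where \<phi>: "!!j. \<phi> j \<in> supp f" "!!j. \<phi> j - (m - int j *s v e) \<in> zcomb v e"
    by metis
   have "\<not> inj \<phi>"
    using \<phi>(1) finite_keys[of f] by (meson finite_subset image_subsetI infinite_UNIV_nat finite_imageD)
   then obtain i j where ij: "i ~= j" "\<phi> i = \<phi> j" by (auto simp: inj_def)
   have "\<phi> i - (m - int i *s v e) - (\<phi> j - (m - int j *s v e)) \<in> zcomb v e"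
    by (intro zcomb_diff \<phi>(2))
   also have "\<phi> i - (m - int i *s v e) - (\<phi> j - (m - int j *s v e)) = (int i - int j) *s v e"
    using ij(2) by (simp add: vec_eq_iff algebra_simps)
   finally have "int i - int j = 0" using v(2)[OF e] by (rule zcomb_multiple)
   with ij(1) show False by simp
  qed
 qed (use e f in auto)
 \<comment> \<open>As \<open>k\<close> drops by one, \<open>e\<close> rises by one, so
   \<open>k + e < d\<close> is preserved.\<close>
 have "kexact F I (lspan Q) (Y e) k" if "k + e < d" for k e using that
 proof (induction k arbitrary: e rule: less_induct)
  case (less k e)
  have e: "e < d" using less.prems by simp
  obtain s c K where sc: "s \<in> {s \<in> lspan (dual U). ev pt s ~= 0}"
   "!!j. j \<in> I ==> c j \<in> lspan (dual U)" "s * g e ^ K = (\<Sum>j\<in>I. c j * F j)"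
   unfolding g_def using alg[OF rf_dual[OF v(1)[OF e]]] by blast
  show ?case
  proof (rule kexact_step[OF fin F smod_lspan[OF Q] smY YQ gA[OF e] nzd[OF e] sc])
   show "kexact F I (lspan Q) {g e * x + y |x y. x \<in> lspan Q \<and> y \<in> Y e} k'" if "k = Suc k'" for k'
    using less.IH[of k' "Suc e"] less.prems that by (simp add: YS)
  qed (use e in auto)
 qed
 from this[of k 0] k show ?thesis by (simp add: Y0 d_def)
qed

text \<open>Passing to a facet lowers the level \<open>k\<close> by one. If the point kills the character of some lattice point \<open>v\<close>
 of the face, divide by that character and filter the quotient by conic modules of facets. Otherwise the
 characters of independent lattice points of the face, minus their values, form a regular sequence.\<close>

theorem kexact_conic:
 assumes fin: "finite I" and F: "!!j. j \<in> I ==> F j \<in> lspan (dual U)"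
  and alg: "!!v. v \<in> dual U ==> \<exists>s\<in>{s \<in> lspan (dual U). ev pt s ~= 0}. \<exists>c K.
   (\<forall>j\<in>I. c j \<in> lspan (dual U)) \<and> s * (mon v 1 - mon 0 (pt v)) ^ K = (\<Sum>j\<in>I. c j * F j)"
  and "S \<subseteq> U" "up (dual U) Q" "up (dual U) Q'" "Q' \<subseteq> Q" "Q - Q' = cpts U x S"
  and "k < dim (rface U S)"
 shows "kexact F I (lspan Q) (lspan Q') k" using assms(4-)
proof (induction k arbitrary: S x Q Q' rule: less_induct)
 case (less k S x Q Q')
 show ?case
 proof (cases "\<exists>v. rvec v \<in> rface U S \<and> pt v = 0")
  case True
  then obtain v where v: "rvec v \<in> rface U S" "pt v = 0" by blast
  hence "v \<in> dual U" by (auto simp: rface_def dual_def rvec_inner)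
  then obtain s c K where sc: "s \<in> {s \<in> lspan (dual U). ev pt s ~= 0}"
   "!!j. j \<in> I ==> c j \<in> lspan (dual U)" "s * mon v 1 ^ K = (\<Sum>j\<in>I. c j * F j)"
   using alg[of v] v(2) by auto
  show ?thesis
  proof (rule kexact_facets[OF fin F less.prems(1) v sc less.prems(2-5)])
   fix S' x' P P' k'
   assume "S' \<subseteq> U" "dim (rface U S) \<le> Suc (dim (rface U S'))" "up (dual U) P" "up (dual U) P'"
    "P' \<subseteq> P" "P - P' = cpts U x' S'" "k = Suc k'"
   with less.prems(6) less.IH[of k' S' P P' x'] show "kexact F I (lspan P) (lspan P') k'" by simp
  qed
 next
  case False
  thus ?thesis by (intro kexact_open_orbit[OF fin F less.prems(1) _ alg less.prems(2-6)]) auto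
 qed
qed

end

section \<open>Ideals, primes and the weak Nullstellensatz\<close>

context denominators
begin

definition aideal :: "'r set => bool" where
 "aideal J \<longleftrightarrow> smod J \<and> J \<subseteq> A"

definition aprime :: "'r set => bool" where
 "aprime P \<longleftrightarrow> aideal P \<and> 1 \<notin> P \<and> (\<forall>a\<in>A. \<forall>b\<in>A. a * b \<in> P --> a \<in> P \<or> b \<in> P)"

lemma aideal_principal_sum:
 assumes "aideal P" "a \<in> A"
 shows "aideal {p + a * x |p x. p \<in> P \<and> x \<in> A}"
proof -
 have "{p + a * x |p x. p \<in> P \<and> x \<in> A} = {a * x + p |x p. x \<in> A \<and> p \<in> P}"
  by (auto simp: add.commute)
 moreover have "smod {a * x + p |x p. x \<in> A \<and> p \<in> P}"
  using assms by (intro smod_extend smod_A) (auto simp: aideal_def)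
 moreover have "{p + a * x |p x. p \<in> P \<and> x \<in> A} \<subseteq> A"
  using assms A_add A_mult by (auto simp: aideal_def)
 ultimately show ?thesis by (simp add: aideal_def)
qed

text \<open>An ideal that is maximal among those disjoint from a multiplicative set is prime: two
  elements outside it would give two elements of \<open>S\<close> whose product lies in the ideal if
  the product of the two does. Maximality stays in the conclusion for the sake of
  \<open>ex_maximal\<close>.\<close>

lemma ex_prime_disjoint:
 assumes J: "aideal J" and disj: "J \<inter> S = {}"
 shows "\<exists>P. aprime P \<and> J \<subseteq> P \<and> P \<inter> S = {} \<and>
  (\<forall>P'. aideal P' --> P \<subseteq> P' --> P' \<inter> S = {} --> P' = P)"
proof -
 define \<A> where "\<A> = {P. aideal P \<and> J \<subseteq> P \<and> P \<inter> S = {}}"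
 have "\<exists>M\<in>\<A>. \<forall>N\<in>\<A>. M \<subseteq> N --> N = M"
 proof (rule subset_Zorn_nonempty)
  show "\<A> ~= {}" using assms by (auto simp: \<A>_def)
  fix \<C> assume ne: "\<C> ~= {}" and ch: "subset.chain \<A> \<C>"
  have sub: "P \<in> \<A>" if "P \<in> \<C>" for P using ch that by (auto simp: subset.chain_def)
  have "smod (\<Union>\<C>)" unfolding smod_def
  proof (intro conjI ballI)
   show "0 \<in> \<Union>\<C>" using ne sub by (auto simp: \<A>_def aideal_def smod_def)
   show "x + y \<in> \<Union>\<C>" if xy: "x \<in> \<Union>\<C>" "y \<in> \<Union>\<C>" for x y
   proof -
    obtain P P' where P: "P \<in> \<C>" "x \<in> P" "P' \<in> \<C>" "y \<in> P'" using xy by blast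
    have "P \<subseteq> P' \<or> P' \<subseteq> P" using ch P by (auto simp: subset_chain_def)
    then obtain R where "R \<in> \<C>" "x \<in> R" "y \<in> R" using P by blast
    moreover from this sub have "x + y \<in> R" by (auto simp: \<A>_def aideal_def smod_def)
    ultimately show ?thesis by blast
   qed
   show "a * x \<in> \<Union>\<C>" if ax: "a \<in> A" "x \<in> \<Union>\<C>" for a x
   proof -
    obtain P where P: "P \<in> \<C>" "x \<in> P" using ax by blast
    hence "smod P" using sub by (auto simp: \<A>_def aideal_def)
    hence "a * x \<in> P" using ax(1) P(2) by (rule smod_scale)
    with P(1) show ?thesis by blast
   qed
  qed
  thus "\<Union>\<C> \<in> \<A>" using sub ne by (auto simp: \<A>_def aideal_def)
 qed
 then obtain P where P: "P \<in> \<A>" "!!N. N \<in> \<A> ==> P \<subseteq> N ==> N = P" by blast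
 have PI: "aideal P" "J \<subseteq> P" "P \<inter> S = {}" using P(1) by (auto simp: \<A>_def)
 have meets: "\<exists>p\<in>P. \<exists>x\<in>A. p + a * x \<in> S" if a: "a \<in> A" "a \<notin> P" for a
 proof (rule ccontr)
  assume neg: "\<not> ?thesis"
  let ?P = "{p + a * x |p x. p \<in> P \<and> x \<in> A}"
  have "P \<subseteq> ?P"
  proof
   fix p assume "p \<in> P"
   thus "p \<in> ?P" using A_zero by (intro CollectI exI[of _ p] exI[of _ 0]) simp
  qed
  moreover have "?P \<inter> S = {}" using neg by blast
  ultimately have "?P = P"
   using PI aideal_principal_sum[OF PI(1) a(1)] by (intro P(2)) (auto simp: \<A>_def)
  moreover have "a \<in> ?P"
   using PI(1) A_one by (intro CollectI exI[of _ 0] exI[of _ 1]) (auto simp: aideal_def smod_def)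
  ultimately show False using a(2) by blast
 qed
 have "1 \<notin> P" using PI(3) S_one by blast
 have "aprime P" unfolding aprime_def
 proof (intro conjI ballI impI PI(1) \<open>1 \<notin> P\<close>)
  fix a b assume ab: "a \<in> A" "b \<in> A" "a * b \<in> P"
  show "a \<in> P \<or> b \<in> P"
  proof (rule ccontr)
   assume "\<not> (a \<in> P \<or> b \<in> P)"
   then obtain p x q y where pq: "p \<in> P" "x \<in> A" "p + a * x \<in> S" "q \<in> P" "y \<in> A" "q + b * y \<in> S"
    using meets[OF ab(1)] meets[OF ab(2)] by blast
   have sP: "smod P" and PA: "P \<subseteq> A" using PI(1) by (auto simp: aideal_def)
   have "(p + a * x) * (q + b * y) = (q + b * y) * p + ((a * x) * q + (x * y) * (a * b))"
    by (simp add: algebra_simps)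
   also have "... \<in> P"
   proof (intro smod_add[OF sP])
    show "(q + b * y) * p \<in> P" by (rule smod_scale[OF sP _ pq(1)]) (use pq(6) S_sub in blast)
    show "(a * x) * q \<in> P" by (rule smod_scale[OF sP A_mult[OF ab(1) pq(2)] pq(4)])
    show "(x * y) * (a * b) \<in> P" by (rule smod_scale[OF sP A_mult[OF pq(2,5)] ab(3)])
   qed
   finally show False using S_mult[OF pq(3,6)] PI(3) by blast
  qed
 qed
 moreover have "P' = P" if "aideal P'" "P \<subseteq> P'" "P' \<inter> S = {}" for P'
  by (rule P(2)) (use that PI in \<open>auto simp: \<A>_def\<close>)
 ultimately show ?thesis using PI by (intro exI[of _ P]) simp
qed

lemma A_prod_mset: "(!!x. x \<in># R ==> f x \<in> A) ==> (\<Prod>x\<in>#R. f x) \<in> A"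
proof (induction R)
 case (add x R)
 have "f x \<in> A" "(\<Prod>x\<in>#R. f x) \<in> A" using add.prems by (auto intro!: add.IH)
 thus ?case by (simp add: A_mult)
qed (simp add: A_one)

lemma aprime_prod_mset:
 assumes "aprime P" "!!x. x \<in># R ==> f x \<in> A" "(\<Prod>x\<in>#R. f x) \<in> P"
 shows "\<exists>x\<in>#R. f x \<in> P" using assms(2,3)
proof (induction R)
 case empty
 with assms(1) show ?case by (simp add: aprime_def)
next
 case (add x R)
 have "(\<Prod>x\<in>#R. f x) \<in> A" using add.prems(1) by (intro A_prod_mset) auto
 hence "f x \<in> P \<or> (\<Prod>x\<in>#R. f x) \<in> P"
  using add.prems assms(1) unfolding aprime_def by auto
 thus ?case using add.IH add.prems(1) by auto
qed

lemma trivial_denominators: "denominators A {1}"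
 using A_one A_uminus A_add A_mult by unfold_locales auto

text \<open>The case of the multiplicative set \<open>{1}\<close>; maximality is turned into the
  existence of inverses modulo \<open>P\<close>.\<close>

lemma ex_maximal:
 assumes "aideal J" "1 \<notin> J"
 shows "\<exists>P. aprime P \<and> J \<subseteq> P \<and> (\<forall>a\<in>A. a \<notin> P --> (\<exists>b\<in>A. a * b - 1 \<in> P))"
proof -
 interpret M: denominators A "{1}" by (rule trivial_denominators)
 have disj: "J \<inter> {1} = {}" using assms(2) by simp
 obtain P where P: "aprime P" "J \<subseteq> P"
  "\<forall>P'. aideal P' --> P \<subseteq> P' --> P' \<inter> {1} = {} --> P' = P"
  using M.ex_prime_disjoint[OF assms(1) disj] by blast
 show ?thesis
 proof (intro exI[of _ P] conjI ballI impI P(1,2))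
  fix a assume a: "a \<in> A" "a \<notin> P"
  have PI: "aideal P" and sP: "smod P" using P(1) by (auto simp: aprime_def aideal_def)
  define P' where "P' = {p + a * x |p x. p \<in> P \<and> x \<in> A}"
  have PI': "aideal P'" unfolding P'_def by (rule aideal_principal_sum[OF PI a(1)])
  have sub: "P \<subseteq> P'"
  proof
   fix p assume "p \<in> P"
   thus "p \<in> P'" unfolding P'_def using A_zero by (intro CollectI exI[of _ p] exI[of _ 0]) simp
  qed
  have aP: "a \<in> P'"
   unfolding P'_def using smod_zero[OF sP] A_one by (intro CollectI exI[of _ 0] exI[of _ 1]) auto
  have "1 \<in> P'"
  proof (rule ccontr)
   assume "1 \<notin> P'"
   hence "P' \<inter> {1} = {}" by simp
   from P(3)[rule_format, OF PI' sub this] aP a(2) show False by simp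
  qed
  then obtain p x where px: "1 = p + a * x" "p \<in> P" "x \<in> A" unfolding P'_def by blast
  have "a * x - 1 = - p" using px(1) by (simp add: algebra_simps)
  hence "a * x - 1 \<in> P" using smod_uminus[OF sP px(2)] by (simp only:)
  thus "\<exists>b\<in>A. a * b - 1 \<in> P" using px(3) by (rule bexI)
 qed
qed

end

text \<open>Algebraic over the complex numbers modulo \<open>J\<close>, with the polynomial already
  split, so that a prime ideal or a point can select a linear factor. The empty multiset means that
  \<open>1\<close> is in \<open>J\<close>.\<close>

definition algebraic_mod :: "('m::comm_monoid_add \<Rightarrow>\<^sub>0 complex) set => ('m \<Rightarrow>\<^sub>0 complex) => bool" where
 "algebraic_mod J a \<longleftrightarrow> (\<exists>R. (\<Prod>c\<in>#R. a - mon 0 c) \<in> J)"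

lemma one_eq_mon: "1 = mon 0 (1::complex)" by simp

lemma mon_const_mult [simp]: "mon (0::'m::comm_monoid_add) a * mon 0 b = mon 0 (a * b)"
 by (simp add: mult_single)

locale affine_monoid =
 fixes C :: "(int ^ 'n) set"
 assumes C_zero: "0 \<in> C" and C_add: "!!a b. a \<in> C ==> b \<in> C ==> a + b \<in> C"
begin

sublocale denominators "lspan C" "{1}"
proof
 show "1 \<in> lspan C" unfolding one_eq_mon lspan_mon using C_zero by simp
 show "a * b \<in> lspan C" if "a \<in> lspan C" "b \<in> lspan C" for a b :: "(int ^ 'n) \<Rightarrow>\<^sub>0 complex"
  using that by (rule lspan_mult) (rule C_add)
qed (auto intro: lspan_add lspan_uminus, auto simp: lspan_def C_zero)

lemma const_in: "mon 0 c \<in> lspan C" using C_zero by simp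

text \<open>A prime ideal over \<open>J\<close> contains, for every monomial, one of the linear
  factors supplied by \<open>alg\<close>; so each monomial is congruent to a number, and these
  numbers are the values of the point.\<close>

lemma weak_nullstellensatz:
 assumes J: "aideal J" "1 \<notin> J" and alg: "!!m. m \<in> C ==> algebraic_mod J (mon m 1)"
 shows "\<exists>pt\<in>extensional C. pt 0 = 1 \<and> (\<forall>a\<in>C. \<forall>b\<in>C. pt (a + b) = pt a * pt b) \<and>
  (\<forall>f\<in>J. ev pt f = 0)"
proof -
 obtain P where P: "aprime P" "J \<subseteq> P" using ex_maximal[OF J] by blast
 have sP: "smod P" and PA: "P \<subseteq> lspan C" and P1: "1 \<notin> P"
  using P(1) by (auto simp: aprime_def aideal_def)
 have "\<exists>c. mon m 1 - mon 0 c \<in> P" if m: "m \<in> C" for m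
 proof -
  obtain R where "(\<Prod>c\<in>#R. mon m 1 - mon 0 c) \<in> P"
   using alg[OF m] P(2) by (auto simp: algebraic_mod_def)
  hence "\<exists>c\<in>#R. mon m 1 - mon 0 c \<in> P"
   using m const_in by (intro aprime_prod_mset[OF P(1)]) (auto intro!: lspan_diff)
  thus ?thesis by blast
 qed
 then obtain g where g: "!!m. m \<in> C ==> mon m 1 - mon 0 (g m) \<in> P" by metis
 have const: "c = 0" if c: "mon 0 c \<in> P" for c
 proof (rule ccontr)
  assume "c ~= 0"
  hence "mon 0 (1 / c) * mon 0 c = (1 :: (int ^ 'n) \<Rightarrow>\<^sub>0 complex)" by simp
  with smod_scale[OF sP const_in c] P1 show False by metis
 qed
 have uniq: "c = g m" if m: "m \<in> C" and c: "mon m 1 - mon 0 c \<in> P" for m c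
 proof -
  have "mon 0 (c - g m) = (mon m 1 - mon 0 (g m)) - (mon m 1 - mon 0 c)" by (simp add: single_diff)
  also have "... \<in> P" using g[OF m] c by (rule smod_diff[OF sP])
  finally show ?thesis using const[of "c - g m"] by simp
 qed
 define pt where "pt = restrict g C"
 have pt: "pt m = g m" if "m \<in> C" for m using that by (simp add: pt_def)
 show ?thesis
 proof (intro bexI[of _ pt] conjI ballI)
  show "pt \<in> extensional C" by (simp add: pt_def)
  have "mon 0 1 - mon 0 1 \<in> P" using smod_zero[OF sP] by simp
  thus "pt 0 = 1" using uniq[OF C_zero, of 1] C_zero by (simp add: pt)
  fix a b assume ab: "a \<in> C" "b \<in> C"
  have "mon (a + b) 1 - mon 0 (g a * g b) =
   mon a 1 * (mon b 1 - mon 0 (g b)) + mon 0 (g b) * (mon a 1 - mon 0 (g a))"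
   by (simp add: algebra_simps mult_single)
  also have "... \<in> P" using g ab const_in by (intro smod_add[OF sP] smod_scale[OF sP]) auto
  finally show "pt (a + b) = pt a * pt b"
   using uniq[OF C_add[OF ab]] ab C_add[OF ab] by (simp add: pt)
 next
  fix f assume f: "f \<in> J"
  hence fC: "supp f \<subseteq> C" using P(2) PA by (auto simp: lspan_def)
  have "f - mon 0 (ev pt f) = (\<Sum>m\<in>supp f. mon 0 (coef f m) * (mon m 1 - mon 0 (pt m)))"
  proof -
   have "(\<Sum>m\<in>supp f. mon 0 (coef f m) * (mon m 1 - mon 0 (pt m)))
     = (\<Sum>m\<in>supp f. mon m (coef f m)) - (\<Sum>m\<in>supp f. mon 0 (coef f m * pt m))"
    by (simp add: right_diff_distrib mult_single sum_subtractf)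
   also have "(\<Sum>m\<in>supp f. mon 0 (coef f m * pt m)) = mon 0 (ev pt f)"
    unfolding eval_chart_def by (induction "supp f" rule: infinite_finite_induct)
     (auto simp: single_add intro!: poly_mapping_eqI simp: lookup_sum lookup_single when_def)
   finally show ?thesis using monomial_expansion[of f] by simp
  qed
  also have "... \<in> P"
   using fC g const_in by (intro smod_sum[OF sP] smod_scale[OF sP]) (auto simp: pt)
  finally have "f - mon 0 (ev pt f) \<in> P" .
  from smod_diff[OF sP _ this, of f] f P(2) have "mon 0 (ev pt f) \<in> P" by auto
  thus "ev pt f = 0" by (rule const)
 qed
qed

definition gen_ideal :: "'i set => ('i => (int ^ 'n) \<Rightarrow>\<^sub>0 complex) => ((int ^ 'n) \<Rightarrow>\<^sub>0 complex) set" where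
 "gen_ideal I F = {\<Sum>j\<in>I. c j * F j |c. \<forall>j\<in>I. c j \<in> lspan C}"

lemma aideal_gen_ideal:
 assumes "!!j. j \<in> I ==> F j \<in> lspan C"
 shows "aideal (gen_ideal I F)" unfolding aideal_def smod_def
proof (intro conjI ballI subsetI)
 show "0 \<in> gen_ideal I F" unfolding gen_ideal_def by (intro CollectI exI[of _ "%_. 0"]) simp
 fix x assume "x \<in> gen_ideal I F"
 then obtain c where c: "x = (\<Sum>j\<in>I. c j * F j)" "\<forall>j\<in>I. c j \<in> lspan C" by (auto simp: gen_ideal_def)
 show "x + y \<in> gen_ideal I F" if y: "y \<in> gen_ideal I F" for y
 proof -
  obtain c' where c': "y = (\<Sum>j\<in>I. c' j * F j)" "\<forall>j\<in>I. c' j \<in> lspan C"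
   using y by (auto simp: gen_ideal_def)
  hence "x + y = (\<Sum>j\<in>I. (c j + c' j) * F j)"
   using c by (simp add: algebra_simps sum.distrib)
  with c c' show ?thesis unfolding gen_ideal_def
   by (intro CollectI exI[of _ "%j. c j + c' j"]) (auto intro: lspan_add)
 qed
 show "a * x \<in> gen_ideal I F" if "a \<in> lspan C" for a unfolding gen_ideal_def
  by (intro CollectI exI[of _ "%j. a * c j"]) (use c that A_mult in \<open>auto simp: sum_distrib_left mult.assoc\<close>)
 show "x \<in> lspan C" unfolding c(1) using c(2) assms by (intro lspan_sum) (auto intro: A_mult)
qed

end

lemma affine_monoid_dual: "affine_monoid (dual U)" by unfold_locales (auto intro: dual_add)

text \<open>A system of parameters on a normal affine toric variety is a regular sequence.\<close>

theorem koszul_exact_on_chart: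
 fixes U :: "(int ^ 'n) set"
 assumes finU: "finite U" and fin: "finite I" and F: "!!j. j \<in> I ==> F j \<in> lspan (dual U)"
  and alg: "!!m. m \<in> dual U ==> algebraic_mod (affine_monoid.gen_ideal (dual U) I F) (mon m 1)"
  and k: "k < dim (rface U {})"
  and z: "!!J. J \<subseteq> I ==> card J = k ==> z J \<in> lspan (dual U)"
  and dz: "!!J. J \<subseteq> I ==> card J = Suc k ==> kd F z J = 0"
 obtains y where "!!J. J \<subseteq> I ==> Suc (card J) = k ==> y J \<in> lspan (dual U)"
  "!!J. J \<subseteq> I ==> card J = k ==> z J = kd F y J"
proof -
 interpret affine_monoid "dual U" by (rule affine_monoid_dual)
 define G where "G = gen_ideal I F"
 \<comment> \<open>The functions that turn \<open>z\<close> into a coboundary. They form an ideal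
   that contains the ideal of \<open>F\<close> by null-homotopy; if it were proper, all of it would
   vanish at some point, against the exactness of the stalk there.\<close>
 define B where "B = {s \<in> lspan (dual U). \<exists>y. (\<forall>J\<subseteq>I. Suc (card J) = k --> y J \<in> lspan (dual U)) \<and>
  (\<forall>J\<subseteq>I. card J = k --> s * z J = kd F y J)}"
 have B: "aideal B" unfolding aideal_def smod_def
 proof (intro conjI ballI)
  show "0 \<in> B" unfolding B_def by (auto simp: kd_def intro!: exI[of _ "%_. 0"])
  show "B \<subseteq> lspan (dual U)" by (auto simp: B_def)
  fix s assume "s \<in> B"
  then obtain y where s: "s \<in> lspan (dual U)" and y: "\<forall>J\<subseteq>I. Suc (card J) = k --> y J \<in> lspan (dual U)"
   "\<forall>J\<subseteq>I. card J = k --> s * z J = kd F y J" by (auto simp: B_def)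
  show "s + t \<in> B" if t: "t \<in> B" for t
  proof -
   obtain y' where t: "t \<in> lspan (dual U)" and y': "\<forall>J\<subseteq>I. Suc (card J) = k --> y' J \<in> lspan (dual U)"
    "\<forall>J\<subseteq>I. card J = k --> t * z J = kd F y' J" using t by (auto simp: B_def)
   show ?thesis unfolding B_def using s t y y'
    by (intro CollectI conjI exI[of _ "%J. y J + y' J"]) (auto simp: kd_add algebra_simps intro: lspan_add)
  qed
  show "a * s \<in> B" if a: "a \<in> lspan (dual U)" for a unfolding B_def using s y a
   by (intro CollectI conjI exI[of _ "%J. a * y J"]) (auto simp: kd_scale mult.assoc intro: A_mult)
 qed
 have GB: "G \<subseteq> B"
 proof
  fix g assume g: "g \<in> G"
  then obtain c where c: "g = (\<Sum>j\<in>I. c j * F j)" "!!j. j \<in> I ==> c j \<in> lspan (dual U)"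
   by (auto simp: G_def gen_ideal_def)
  have s0: "smod {0}" by (simp add: smod_def)
  obtain y where "!!J. J \<subseteq> I ==> Suc (card J) = k ==> y J \<in> lspan (dual U)"
   "!!J. J \<subseteq> I ==> card J = k ==> g * z J - kd F y J \<in> {0}"
   by (rule kexact_ideal_action[OF fin smod_A s0 c(2,1), of k z]) (use z dz in auto)
  moreover have "g \<in> lspan (dual U)"
   using g aideal_gen_ideal[of I F] F by (auto simp: G_def aideal_def)
  ultimately show "g \<in> B" unfolding B_def by (auto intro!: exI[of _ y])
 qed
 have "1 \<in> B"
 proof (rule ccontr)
  assume "1 \<notin> B"
  have algB: "algebraic_mod B (mon m 1)" if "m \<in> dual U" for m
   using alg[OF that] GB by (auto simp: algebraic_mod_def G_def)
  obtain pt where pt: "pt 0 = 1" "!!a b. a \<in> dual U ==> b \<in> dual U ==> pt (a + b) = pt a * pt b"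
   "!!f. f \<in> B ==> ev pt f = 0"
   using weak_nullstellensatz[OF B \<open>1 \<notin> B\<close> algB] by blast
  interpret P: chart_point U pt using finU pt by unfold_locales
  have ex: "P.kexact F I (lspan (dual U)) (lspan {}) k"
  \<comment> \<open>The conic module is the coordinate ring itself, and \<open>lspan {}\<close> is
    zero.\<close>
  proof (rule P.kexact_conic[OF fin F, where S = "{}" and x = 0])
   fix v assume v: "v \<in> dual U"
   obtain R where R: "(\<Prod>c\<in>#R. mon v 1 - mon 0 c) \<in> G"
    using alg[OF v] by (auto simp: algebraic_mod_def G_def)
   \<comment> \<open>The factors with a root other than \<open>pt v\<close> are nonzero at the point
     and form the denominator; the rest is a power of the monomial minus its value.\<close>
   define s where "s = (\<Prod>c\<in>#filter_mset (%c. c ~= pt v) R. mon v 1 - mon 0 c)"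
   have fac: "mon v 1 - mon 0 c \<in> lspan (dual U)" for c
    using v const_in by (intro lspan_diff) auto
   have sA: "s \<in> lspan (dual U)" and se: "ev pt s ~= 0" unfolding s_def
   proof (induction R)
    case empty
    case 1 show ?case using A_one by simp
    case 2 show ?case using pt(1) eval_chart_mon[of pt 0 1] by (simp del: eval_chart_mon)
   next
    case (add c R)
    case 1 show ?case using add fac A_mult by simp
    case 2
    have "ev pt ((mon v 1 - mon 0 c) * x) = (pt v - c) * ev pt x"
     if "x \<in> lspan (dual U)" for x
     using that fac by (subst eval_chart_mult[where Q = "dual U"]) (auto simp: pt eval_chart_diff)
    with add show ?case by auto
   qed
   have "(\<Prod>c\<in>#R. mon v 1 - mon 0 c) = s * (mon v 1 - mon 0 (pt v)) ^ count R (pt v)"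
    unfolding s_def by (induction R) (auto simp: algebra_simps)
   with R have "s * (mon v 1 - mon 0 (pt v)) ^ count R (pt v) \<in> G" by simp
   then obtain c where "\<forall>j\<in>I. c j \<in> lspan (dual U)"
    "s * (mon v 1 - mon 0 (pt v)) ^ count R (pt v) = (\<Sum>j\<in>I. c j * F j)"
    unfolding G_def gen_ideal_def by blast
   with sA se show "\<exists>s\<in>{s \<in> lspan (dual U). ev pt s ~= 0}. \<exists>c K.
    (\<forall>j\<in>I. c j \<in> lspan (dual U)) \<and> s * (mon v 1 - mon 0 (pt v)) ^ K = (\<Sum>j\<in>I. c j * F j)"
    by blast
  qed (use k in \<open>auto simp: up_def pairing_add cpts_def rface_def dual_def rvec_inner\<close>)
  obtain s y where s: "s \<in> {s \<in> lspan (dual U). ev pt s ~= 0}"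
   and y: "!!J. J \<subseteq> I ==> Suc (card J) = k ==> y J \<in> lspan (dual U)"
    "!!J. J \<subseteq> I ==> card J = k ==> s * z J - kd F y J \<in> lspan {}"
   by (rule P.kexactD[OF ex, of z]) (use z dz in auto)
  have "s * z J = kd F y J" if "J \<subseteq> I" "card J = k" for J
   using y(2)[OF that] by (simp add: lspan_def)
  with s y(1) have "s \<in> B" unfolding B_def by blast
  with pt(3) s show False by simp
 qed
 thus thesis using that unfolding B_def by auto
qed

section \<open>Finite quotients from Krull dimension zero\<close>

text \<open>Elimination: a pivot \<open>j\<close> for the equation \<open>k\<close> is set aside,
  and its unknown is solved for afterwards.\<close>

lemma underdetermined_system:
 fixes f :: "'b => 'm => complex"
 assumes "finite K" "finite B" "card K < card B"
 shows "\<exists>l. (\<exists>i\<in>B. l i ~= 0) \<and> (\<forall>k\<in>K. (\<Sum>i\<in>B. l i * f i k) = 0)"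
 using assms
proof (induction K arbitrary: B f rule: finite_induct)
 case empty
 then obtain i where "i \<in> B" by fastforce
 thus ?case by (intro exI[of _ "%_. 1"]) auto
next
 case (insert k K)
 show ?case
 proof (cases "\<forall>i\<in>B. f i k = 0")
  case True
  have "card K < card B" using insert by simp
  then obtain l where "\<exists>i\<in>B. l i ~= 0" "\<forall>k\<in>K. (\<Sum>i\<in>B. l i * f i k) = 0"
   using insert.IH[of B f] insert.prems(1) by blast
  with True show ?thesis by (intro exI[of _ l]) auto
 next
  case False
  then obtain j where j: "j \<in> B" "f j k ~= 0" by blast
  define g where "g i m = f i m - f i k / f j k * f j m" for i m
  have "card K < card (B - {j})" using insert j by (simp add: card_Diff_singleton)
  then obtain l where l: "\<exists>i\<in>B - {j}. l i ~= 0" "\<forall>m\<in>K. (\<Sum>i\<in>B - {j}. l i * g i m) = 0"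
   using insert.IH[of "B - {j}" g] insert.prems(1) by blast
  define l' where "l' i = (if i = j then - (\<Sum>i\<in>B - {j}. l i * (f i k / f j k)) else l i)" for i
  have "(\<Sum>i\<in>B. l' i * f i m) = (\<Sum>i\<in>B - {j}. l i * g i m)" for m
  proof -
   have "(\<Sum>i\<in>B. l' i * f i m) = l' j * f j m + (\<Sum>i\<in>B - {j}. l' i * f i m)"
    using insert.prems(1) j(1) by (rule sum.remove)
   also have "(\<Sum>i\<in>B - {j}. l' i * f i m) = (\<Sum>i\<in>B - {j}. l i * f i m)"
    by (intro sum.cong) (auto simp: l'_def)
   also have "l' j * f j m = - (\<Sum>i\<in>B - {j}. l i * (f i k / f j k * f j m))"
    by (simp add: l'_def sum_distrib_right mult.assoc)
   finally show ?thesis by (simp add: g_def right_diff_distrib sum_subtractf)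
  qed
  moreover have "g i k = 0" for i using j(2) by (simp add: g_def)
  ultimately have "\<forall>m\<in>insert k K. (\<Sum>i\<in>B. l' i * f i m) = 0" using l(2) by simp
  moreover have "\<exists>i\<in>B. l' i ~= 0" using l(1) by (auto simp: l'_def)
  ultimately show ?thesis by blast
 qed
qed

section \<open>Univariate polynomials evaluated in a semigroup ring\<close>

definition peval :: "('m::comm_monoid_add \<Rightarrow>\<^sub>0 complex) => complex poly => 'm \<Rightarrow>\<^sub>0 complex" where
 "peval a q = fold_coeffs (%c r. mon 0 c + a * r) q 0"

lemma peval_0 [simp]: "peval a 0 = 0" by (simp add: peval_def)

lemma peval_pCons [simp]: "peval a (pCons c q) = mon 0 c + a * peval a q"
 by (cases "c = 0 \<and> q = 0") (auto simp: peval_def fold_coeffs_def cCons_def)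

lemma peval_add: "peval a (p + q) = peval a p + peval a q"
 by (induction p q rule: poly_induct2) (simp_all add: single_add algebra_simps)

lemma peval_smult: "peval a (Polynomial.smult c q) = mon 0 c * peval a q"
 by (induction q) (simp_all add: algebra_simps)

lemma peval_mult: "peval a (p * q) = peval a p * peval a q"
 by (induction p) (simp_all add: peval_add peval_smult algebra_simps)

lemma peval_sum: "peval a (sum f B) = (\<Sum>i\<in>B. peval a (f i))"
 by (induction B rule: infinite_finite_induct) (simp_all add: peval_add)

lemma peval_linear [simp]: "peval a [:- c, 1:] = a - mon 0 c" by (simp add: single_uminus)

lemma peval_1 [simp]: "peval a 1 = 1" by (simp add: one_pCons)

lemma peval_prod: "peval a (\<Prod>i\<in>B. f i) = (\<Prod>i\<in>B. peval a (f i))"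
 by (induction B rule: infinite_finite_induct) (simp_all add: peval_mult)

lemma peval_prod_mset: "peval a (\<Prod>i\<in>#B. f i) = (\<Prod>i\<in>#B. peval a (f i))"
 by (induction B) (simp_all add: peval_mult)

section \<open>Subrings and their quotients as rings with a carrier\<close>

lemma type_algebra_simps:
 "carrier ring_of_type_algebra = UNIV" "x \<otimes>\<^bsub>ring_of_type_algebra\<^esub> y = x * y"
 "x \<oplus>\<^bsub>ring_of_type_algebra\<^esub> y = x + y" "\<one>\<^bsub>ring_of_type_algebra\<^esub> = 1" "\<zero>\<^bsub>ring_of_type_algebra\<^esub> = 0"
 by (simp_all add: ring_of_type_algebra_def)

context denominators
begin

lemma A_prod: "(!!i. i \<in> B ==> f i \<in> A) ==> (\<Prod>i\<in>B. f i) \<in> A"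
 by (induction B rule: infinite_finite_induct) (simp_all add: A_one A_mult)

text \<open>The bridge from sets of ambient elements to the record-based rings in terms of which
  Krull dimension and local rings are defined.\<close>

abbreviation (input) aring :: "'r ring" where
 "aring \<equiv> ring_of_type_algebra\<lparr>carrier := A\<rparr>"

abbreviation (input) coset (infixl "+>>" 60) where "J +>> g \<equiv> J +>\<^bsub>aring\<^esub> g"

lemma carrier_aring: "carrier aring = A" by simp

lemmas aring_simps = carrier_aring type_algebra_simps

lemma cring_aring: "cring aring"
proof (rule cringI)
 show "abelian_group aring"
 proof (rule abelian_groupI)
  show "\<exists>y\<in>carrier aring. y \<oplus>\<^bsub>aring\<^esub> x = \<zero>\<^bsub>aring\<^esub>" if "x \<in> carrier aring" for x
   using that A_uminus by (auto simp: aring_simps intro!: bexI[of _ "- x"])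
 qed (auto simp: aring_simps A_zero A_add add_ac)
 show "Group.comm_monoid aring" by (rule comm_monoidI) (auto simp: aring_simps A_one A_mult mult_ac)
qed (auto simp: aring_simps algebra_simps)

lemma ring_aring: "ring aring" using cring_aring by (rule cring.axioms(1))

lemma ideal_aring:
 assumes "aideal J"
 shows "ideal J aring"
proof (rule idealI[OF ring_aring])
 have sJ: "smod J" "J \<subseteq> A" using assms by (auto simp: aideal_def)
 interpret R: ring aring by (rule ring_aring)
 show "subgroup J (add_monoid aring)"
 proof (rule R.add.subgroupI)
  show "J \<subseteq> carrier aring" using sJ(2) by (simp add: aring_simps)
  show "J ~= {}" using smod_zero[OF sJ(1)] by blast
  show "\<ominus>\<^bsub>aring\<^esub> a \<in> J" if a: "a \<in> J" for a
  proof -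
   have "\<ominus>\<^bsub>aring\<^esub> a = - a"
   proof (rule R.minus_equality)
    show "- a \<oplus>\<^bsub>aring\<^esub> a = \<zero>\<^bsub>aring\<^esub>" by (simp add: aring_simps)
   qed (use a sJ A_uminus in \<open>auto simp: aring_simps\<close>)
   thus ?thesis using smod_uminus[OF sJ(1) a] by simp
  qed
  show "a \<oplus>\<^bsub>aring\<^esub> b \<in> J" if "a \<in> J" "b \<in> J" for a b
   using smod_add[OF sJ(1) that] by (simp add: aring_simps)
 qed
 show "x \<otimes>\<^bsub>aring\<^esub> a \<in> J" "a \<otimes>\<^bsub>aring\<^esub> x \<in> J" if "a \<in> J" "x \<in> carrier aring" for a x
  using smod_scale[OF sJ(1) _ that(1), of x] that(2) by (simp_all add: aring_simps mult.commute)
qed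

lemma coset_aring: "J +>> a = {j + a |j. j \<in> J}" by (auto simp: a_r_coset_def' aring_simps)

lemma coset_aring_eq_iff:
 assumes "smod J"
 shows "J +>> a = J +>> b \<longleftrightarrow> a - b \<in> J"
proof
 assume eq: "J +>> a = J +>> b"
 have "a = 0 + a" by simp
 hence "a \<in> J +>> a" unfolding coset_aring using smod_zero[OF assms] by blast
 hence "a \<in> J +>> b" by (simp only: eq)
 then obtain j where "a = j + b" "j \<in> J" unfolding coset_aring by blast
 thus "a - b \<in> J" by simp
next
 assume ab: "a - b \<in> J"
 show "J +>> a = J +>> b" unfolding coset_aring
 proof (intro equalityI subsetI)
  fix x assume "x \<in> {j + a |j. j \<in> J}"
  then obtain j where j: "x = j + a" "j \<in> J" by blast
  hence "x = (j + (a - b)) + b" by simp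
  thus "x \<in> {j + b |j. j \<in> J}" using smod_add[OF assms j(2) ab] by blast
 next
  fix x assume "x \<in> {j + b |j. j \<in> J}"
  then obtain j where j: "x = j + b" "j \<in> J" by blast
  hence "x = (j - (a - b)) + a" by simp
  thus "x \<in> {j + a |j. j \<in> J}" using smod_diff[OF assms j(2) ab] by blast
 qed
qed

lemma quot_mult:
 assumes "aideal J" "a \<in> A" "b \<in> A"
 shows "(J +>> a) \<otimes>\<^bsub>aring Quot J\<^esub> (J +>> b) = J +>> (a * b)"
 using ideal.rcoset_mult_add[OF ideal_aring[OF assms(1)], of a b] assms(2,3)
 by (simp add: FactRing_def aring_simps)

lemma quot_add:
 assumes "aideal J" "a \<in> A" "b \<in> A"
 shows "(J +>> a) \<oplus>\<^bsub>aring Quot J\<^esub> (J +>> b) = J +>> (a + b)"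
 using abelian_subgroup.a_rcos_sum[OF abelian_subgroupI3, of J aring a b] ideal_aring[OF assms(1)]
  assms(2,3) ring_aring
 by (simp add: FactRing_def aring_simps ideal.axioms(1) ring.is_abelian_group)

lemma carrier_quot: "carrier (aring Quot J) = {J +>> a |a. a \<in> A}"
 by (auto simp: FactRing_def A_RCOSETS_def' aring_simps)

lemma primeideal_quot:
 assumes J: "aideal J" and P: "aprime P" "J \<subseteq> P"
 shows "primeideal ((+>>) J ` P) (aring Quot J)"
proof (rule primeidealI)
 have PI: "aideal P" and sP: "smod P" "P \<subseteq> A" using P(1) by (auto simp: aprime_def aideal_def)
 have sJ: "smod J" using J by (simp add: aideal_def)
 interpret R: ring aring by (rule ring_aring)
 show "ideal ((+>>) J ` P) (aring Quot J)"
  by (rule R.ring_ideal_imp_quot_ideal[OF ideal_aring[OF J] ideal_aring[OF PI]])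
 show "cring (aring Quot J)" by (rule ideal.quotient_is_cring[OF ideal_aring[OF J] cring_aring])
 have mem: "a \<in> P" if a: "J +>> a \<in> (+>>) J ` P" for a
 proof -
  obtain p where p: "p \<in> P" "J +>> a = J +>> p" using a by blast
  hence "a - p \<in> P" using coset_aring_eq_iff[OF sJ] P(2) by blast
  from smod_add[OF sP(1) this p(1)] show ?thesis by simp
 qed
 show "carrier (aring Quot J) ~= (+>>) J ` P"
 proof
  assume eq: "carrier (aring Quot J) = (+>>) J ` P"
  have "J +>> 1 \<in> carrier (aring Quot J)" unfolding carrier_quot using A_one by blast
  with mem[of 1] P(1) show False by (simp add: eq aprime_def)
 qed
 fix x y assume x: "x \<in> carrier (aring Quot J)" and y: "y \<in> carrier (aring Quot J)"
  and xy: "x \<otimes>\<^bsub>aring Quot J\<^esub> y \<in> (+>>) J ` P"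
 obtain a b where ab: "x = J +>> a" "y = J +>> b" "a \<in> A" "b \<in> A"
  using x y unfolding carrier_quot by blast
 have "a * b \<in> P" using xy unfolding ab(1,2) quot_mult[OF J ab(3,4)] by (rule mem)
 hence "a \<in> P \<or> b \<in> P" using P(1) ab by (auto simp: aprime_def)
 thus "x \<in> (+>>) J ` P \<or> y \<in> (+>>) J ` P" unfolding ab by blast
qed

text \<open>A strict inclusion of primes over \<open>J\<close> stays strict in the quotient and
  would be a chain of length one.\<close>

lemma krull_dim_le_0_primes:
 assumes J: "aideal J" and dim: "krull_dim (aring Quot J) \<le> 0"
  and P: "aprime P" "J \<subseteq> P" and Q: "aprime Q" and PQ: "P \<subseteq> Q"
 shows "P = Q"
proof (rule ccontr)
 assume "P ~= Q"
 then obtain q where q: "q \<in> Q" "q \<notin> P" using PQ by blast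
 have sJ: "smod J" and sP: "smod P" using J P(1) by (auto simp: aprime_def aideal_def)
 define R where "R i = (+>>) J ` (if i = (0::nat) then P else Q)" for i
 have "primeideal (R i) (aring Quot J)" for i
  unfolding R_def using primeideal_quot[OF J] P Q PQ by auto
 moreover have "R 0 \<subset> R 1"
 proof
  show "R 0 \<subseteq> R 1" using PQ by (auto simp: R_def)
  have "J +>> q \<notin> R 0"
  proof
   assume "J +>> q \<in> R 0"
   then obtain p where p: "p \<in> P" "J +>> q = J +>> p" by (auto simp: R_def)
   hence "q - p \<in> P" using coset_aring_eq_iff[OF sJ] P(2) by blast
   from smod_add[OF sP this p(1)] q(2) show False by simp
  qed
  moreover have "J +>> q \<in> R 1" using q(1) by (simp add: R_def)
  ultimately show "R 0 ~= R 1" by blast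
 qed
 ultimately have "ereal (real 1) \<le> krull_dim (aring Quot J)"
  unfolding krull_dim_def by (intro Sup_upper CollectI exI[of _ 1] exI[of _ R] conjI refl) auto
 also note dim
 finally show False by simp
qed

end

context affine_monoid
begin

text \<open>Otherwise some quotient of \<open>\<complex>[C]\<close> would be a field of countable dimension containing an
 element transcendental over \<open>\<complex>\<close>, and the inverses of its translates are uncountably many
 linearly independent elements.\<close>

theorem algebraic_mod_if_krull_dim_0:
 assumes J: "aideal J" and dim: "krull_dim (aring Quot J) \<le> 0" and a: "a \<in> lspan C"
 shows "algebraic_mod J a"
proof (rule ccontr)
 assume "\<not> algebraic_mod J a"
 \<comment> \<open>Up to scalars, the values at \<open>a\<close> of the nonzero polynomials. If
   \<open>J\<close> misses this set, so does some prime \<open>P\<close> over \<open>J\<close>;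
   dimension zero makes \<open>P\<close> maximal, and all \<open>a - mon 0 c\<close> become
   invertible modulo \<open>P\<close>.\<close>
 define T where "T = {\<Prod>c\<in>#R. a - mon 0 c |R. True}"
 have fac: "a - mon 0 c \<in> lspan C" for c using a const_in by (rule lspan_diff)
 interpret T: denominators "lspan C" T
 proof (unfold_locales)
  show "1 \<in> T" unfolding T_def by (intro CollectI exI[of _ "{#}"]) simp
  show "T \<subseteq> lspan C" unfolding T_def using fac by (auto intro!: A_prod_mset)
  show "s * t \<in> T" if st: "s \<in> T" "t \<in> T" for s t
  proof -
   obtain R R' where "s = (\<Prod>c\<in>#R. a - mon 0 c)" "t = (\<Prod>c\<in>#R'. a - mon 0 c)"
    using st by (auto simp: T_def)
   thus ?thesis unfolding T_def by (intro CollectI exI[of _ "R + R'"]) simp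
  qed
 qed (auto intro: A_one A_uminus A_add A_mult)
 have "J \<inter> T = {}" using \<open>\<not> algebraic_mod J a\<close> by (auto simp: T_def algebraic_mod_def)
 then obtain P where P: "aprime P" "J \<subseteq> P" "P \<inter> T = {}"
  using T.ex_prime_disjoint[OF J] by blast
 hence PI: "aideal P" "1 \<notin> P" and sP: "smod P" by (auto simp: aprime_def aideal_def)
 obtain Q where Q: "aprime Q" "P \<subseteq> Q" "\<forall>a\<in>lspan C. a \<notin> Q --> (\<exists>b\<in>lspan C. a * b - 1 \<in> Q)"
  using ex_maximal[OF PI] by blast
 have "P = Q" by (rule krull_dim_le_0_primes[OF J dim P(1,2) Q(1,2)])
 have "a - mon 0 c \<notin> P" for c
 proof -
  have "a - mon 0 c \<in> T" unfolding T_def by (intro CollectI exI[of _ "{#c#}"]) simp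
  with P(3) show ?thesis by blast
 qed
 hence "\<exists>b. b \<in> lspan C \<and> (a - mon 0 c) * b - 1 \<in> P" for c
  using Q(3) fac \<open>P = Q\<close> by blast
 then obtain b where b: "!!c. b c \<in> lspan C" "!!c. (a - mon 0 c) * b c - 1 \<in> P" by metis
 \<comment> \<open>There are uncountably many \<open>c\<close> but only countably many finite
   supports.\<close>
 have "\<exists>K. finite K \<and> infinite {c. supp (b c) = K}"
 proof (rule ccontr)
  assume "\<nexists>K. finite K \<and> infinite {c. supp (b c) = K}"
  hence "countable {c. supp (b c) = K}" if "finite K" for K using that by (auto intro: countable_finite)
  moreover have "countable {K :: (int ^ 'n) set. finite K}" by (rule countable_Collect_finite)
  ultimately have "countable (\<Union>K\<in>{K. finite K}. {c. supp (b c) = K})" by (intro countable_UN) auto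
  also have "(\<Union>K\<in>{K. finite K}. {c. supp (b c) = K}) = UNIV" by auto
  finally have "countable (range complex_of_real)" by (rule countable_subset[rotated]) simp
  hence "countable (UNIV :: real set)" by (rule countable_image_inj_on) (simp add: inj_on_def)
  with uncountable_UNIV_real show False by blast
 qed
 then obtain K where K: "finite K" "infinite {c. supp (b c) = K}" by blast
 \<comment> \<open>One more element than there are exponents in the common support \<open>K\<close>
   forces a linear relation among the inverses.\<close>
 obtain B where B: "finite B" "card B = Suc (card K)" "B \<subseteq> {c. supp (b c) = K}"
  using infinite_arbitrarily_large[OF K(2)] by blast
 obtain l where l: "\<exists>c\<in>B. l c ~= 0" "\<forall>m\<in>K. (\<Sum>c\<in>B. l c * coef (b c) m) = 0"
  using underdetermined_system[OF K(1) B(1), of "%c. coef (b c)"] B(2) by auto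
 then obtain c0 where c0: "c0 \<in> B" "l c0 ~= 0" by blast
 have zero: "(\<Sum>c\<in>B. mon 0 (l c) * b c) = 0"
 proof (rule poly_mapping_eqI)
  fix m
  have "coef (\<Sum>c\<in>B. mon 0 (l c) * b c) m = (\<Sum>c\<in>B. l c * coef (b c) m)"
   by (simp add: lookup_sum coef_mon_mult)
  also have "... = 0"
  proof (cases "m \<in> K")
   case False
   hence "coef (b c) m = 0" if "c \<in> B" for c using B(3) that by (auto simp: in_keys_iff)
   thus ?thesis by simp
  qed (use l in simp)
  finally show "coef (\<Sum>c\<in>B. mon 0 (l c) * b c) m = coef 0 m" by simp
 qed
 \<comment> \<open>The relation with denominators cleared, so that \<open>peval a q\<close> is in
   \<open>P\<close>. At \<open>c0\<close> only the summand of \<open>c0\<close> survives, hence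
   \<open>q\<close> is nonzero; its linear factors then put an element of \<open>T\<close> into
   \<open>P\<close>.\<close>
 define q where "q = (\<Sum>c\<in>B. Polynomial.smult (l c) (\<Prod>d\<in>B - {c}. [:- d, 1:]))"
 define \<pi> where "\<pi> c = (\<Prod>d\<in>B - {c}. a - mon 0 d)" for c
 have \<pi>: "(a - mon 0 c) * \<pi> c = (\<Prod>d\<in>B. a - mon 0 d)" if "c \<in> B" for c
  using prod.remove[OF B(1) that, of "%d. a - mon 0 d"] by (simp add: \<pi>_def)
 have "peval a q = (\<Sum>c\<in>B. mon 0 (l c) * \<pi> c)"
  by (simp add: q_def peval_sum peval_smult peval_prod \<pi>_def del: peval_pCons)
 also have "... = (\<Prod>d\<in>B. a - mon 0 d) * (\<Sum>c\<in>B. mon 0 (l c) * b c) -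
   (\<Sum>c\<in>B. (mon 0 (l c) * \<pi> c) * ((a - mon 0 c) * b c - 1))"
 proof -
  have "(mon 0 (l c) * \<pi> c) * ((a - mon 0 c) * b c - 1) =
    (\<Prod>d\<in>B. a - mon 0 d) * (mon 0 (l c) * b c) - mon 0 (l c) * \<pi> c" if "c \<in> B" for c
   unfolding \<pi>[OF that, symmetric] by (simp add: algebra_simps)
  hence "(\<Sum>c\<in>B. (mon 0 (l c) * \<pi> c) * ((a - mon 0 c) * b c - 1)) =
   (\<Sum>c\<in>B. (\<Prod>d\<in>B. a - mon 0 d) * (mon 0 (l c) * b c) - mon 0 (l c) * \<pi> c)"
   by (intro sum.cong refl)
  thus ?thesis by (simp add: sum_subtractf sum_distrib_left)
 qed
 also have "... \<in> P" unfolding zero mult_zero_right diff_0 using b(2) fac const_in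
  by (intro smod_uminus[OF sP] smod_sum[OF sP] smod_scale[OF sP]) (auto simp: \<pi>_def intro!: A_mult A_prod)
 finally have qP: "peval a q \<in> P" .
 have "poly q c0 = l c0 * (\<Prod>d\<in>B - {c0}. c0 - d)"
 proof -
  have "poly q c0 = (\<Sum>c\<in>B. l c * (\<Prod>d\<in>B - {c}. c0 - d))"
   by (simp add: q_def poly_sum poly_prod)
  also have "... = (\<Sum>c\<in>{c0}. l c * (\<Prod>d\<in>B - {c}. c0 - d))"
   using B(1) c0(1) by (intro sum.mono_neutral_right) auto
  finally show ?thesis by simp
 qed
 hence "q ~= 0" using c0(2) B(1) by (auto simp: prod_zero_iff)
 define l0 where "l0 = Polynomial.coeff q (Polynomial.degree q)"
 obtain R where R: "q = Polynomial.smult l0 (\<Prod>x\<in>#R. [:- x, 1:])"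
  using alg_closed_imp_factorization[OF \<open>q ~= 0\<close>] unfolding l0_def by blast
 have "l0 ~= 0" using \<open>q ~= 0\<close> by (simp add: l0_def)
 have "peval a q = mon 0 l0 * (\<Prod>x\<in>#R. a - mon 0 x)"
  by (subst R) (simp add: peval_smult peval_prod_mset del: peval_pCons)
 with qP have "mon 0 (1 / l0) * (mon 0 l0 * (\<Prod>x\<in>#R. a - mon 0 x)) \<in> P"
  using smod_scale[OF sP const_in] by simp
 hence "(\<Prod>x\<in>#R. a - mon 0 x) \<in> P"
  using \<open>l0 ~= 0\<close> by (simp flip: mult.assoc)
 thus False using P(3) by (auto simp: T_def)
qed

end

section \<open>The nerve of a polyhedral cover\<close>

text \<open>Cochains supported on \<open>G\<close>. For upward closed \<open>G\<close> this is the
  augmented cochain complex of the full simplex on \<open>N\<close> relative to the simplicial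
  complex of the sets outside \<open>G\<close>. The levels are taken together and are separated
  again in \<open>cech_exact\<close>.\<close>

definition cexact :: "nat set => nat set set => bool" where
 "cexact N G \<longleftrightarrow>
   (\<forall>c :: nat set => complex. (\<forall>T\<subseteq>N. T \<notin> G --> c T = 0) --> (\<forall>T\<subseteq>N. kd (%_. 1) c T = 0) -->
    (\<exists>b. (\<forall>T\<subseteq>N. T \<notin> G --> b T = 0) \<and> (\<forall>T\<subseteq>N. c T = kd (%_. 1) b T)))"

lemma cexactD:
 fixes c :: "nat set => complex"
 assumes "cexact N G" "!!T. T \<subseteq> N ==> T \<notin> G ==> c T = 0" "!!T. T \<subseteq> N ==> kd (%_. 1) c T = 0"
 shows "\<exists>b. (\<forall>T\<subseteq>N. T \<notin> G --> b T = 0) \<and> (\<forall>T\<subseteq>N. c T = kd (%_. 1) b T)"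
 using assms(1)[unfolded cexact_def, THEN spec, of c] assms(2,3) by simp

text \<open>Inserting \<open>j\<close> does not leave the support, so the homotopy
  \<open>kh j\<close> is available.\<close>

lemma cexact_cone:
 assumes fin: "finite N" and j: "j \<in> N" and G: "!!T. T \<subseteq> N ==> insert j T \<in> G \<longleftrightarrow> T \<in> G"
 shows "cexact N G" unfolding cexact_def
proof (intro allI impI)
 fix c :: "nat set => complex"
 assume c: "\<forall>T\<subseteq>N. T \<notin> G --> c T = 0" and dc: "\<forall>T\<subseteq>N. kd (%_. 1) c T = 0"
 show "\<exists>b. (\<forall>T\<subseteq>N. T \<notin> G --> b T = 0) \<and> (\<forall>T\<subseteq>N. c T = kd (%_. 1) b T)"
 proof (intro exI[of _ "kh j c"] conjI allI impI)
  show "kh j c T = 0" if "T \<subseteq> N" "T \<notin> G" for T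
   using that c j G[OF that(1)] by (simp add: kh_def)
  show "c T = kd (%_. 1) (kh j c) T" if "T \<subseteq> N" for T
  proof -
   have "kh j (kd (%_. 1) c) T = 0" using dc that j by (simp add: kh_def)
   with kh_homotopy[OF finite_subset[OF that fin], of "%_. 1" j c] show ?thesis by simp
  qed
 qed
qed

text \<open>Mayer-Vietoris. The primitives with support in \<open>G\<close> and in \<open>H\<close>
  differ by the coboundary of some \<open>e\<close> supported on the union; subtracting the
  coboundary of the part of \<open>e\<close> inside \<open>G\<close> moves the first primitive into
  the intersection.\<close>

lemma cexact_Int:
 assumes fin: "finite N"
  and up: "!!T T'. T \<in> G ==> T \<subseteq> T' ==> T' \<in> G" "!!T T'. T \<in> H ==> T \<subseteq> T' ==> T' \<in> H"
  and ex: "cexact N G" "cexact N H" "cexact N (G \<union> H)"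
 shows "cexact N (G \<inter> H)" unfolding cexact_def
proof (intro allI impI)
 let ?d = "kd (%_. 1 :: complex)"
 fix c :: "nat set => complex"
 assume c: "\<forall>T\<subseteq>N. T \<notin> G \<inter> H --> c T = 0" and dc: "\<forall>T\<subseteq>N. ?d c T = 0"
 obtain b1 where b1: "\<forall>T\<subseteq>N. T \<notin> G --> b1 T = 0" "\<forall>T\<subseteq>N. c T = ?d b1 T"
  using cexactD[OF ex(1), of c] c dc by blast
 obtain b2 where b2: "\<forall>T\<subseteq>N. T \<notin> H --> b2 T = 0" "\<forall>T\<subseteq>N. c T = ?d b2 T"
  using cexactD[OF ex(2), of c] c dc by blast
 have "\<exists>e. (\<forall>T\<subseteq>N. T \<notin> G \<union> H --> e T = 0) \<and> (\<forall>T\<subseteq>N. b1 T - b2 T = ?d e T)"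
 proof (rule cexactD[OF ex(3)])
  show "b1 T - b2 T = 0" if "T \<subseteq> N" "T \<notin> G \<union> H" for T using that b1(1) b2(1) by simp
  show "?d (%T. b1 T - b2 T) T = 0" if "T \<subseteq> N" for T
   using that b1(2) b2(2) by (simp add: kd_diff)
 qed
 then obtain e where e: "\<forall>T\<subseteq>N. T \<notin> G \<union> H --> e T = 0" "\<forall>T\<subseteq>N. b1 T - b2 T = ?d e T" by blast
 define e1 where "e1 T = (if T \<in> G then e T else 0)" for T
 define e2 where "e2 T = (if T \<in> G then 0 else e T)" for T
 have split: "?d e T = ?d e1 T + ?d e2 T" for T
  by (subst kd_add[symmetric]) (intro kd_cong, simp add: e1_def e2_def)
 have van: "?d e1 T = 0" if "T \<notin> G" for T unfolding kd_def
 proof (intro sum.neutral ballI)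
  fix i assume "i \<in> T"
  have "T - {i} \<notin> G" using up(1)[of "T - {i}" T] that by blast
  thus "ksgn i T * 1 * e1 (T - {i}) = 0" by (simp add: e1_def)
 qed
 have van2: "?d e2 T = 0" if "T \<subseteq> N" "T \<notin> H" for T unfolding kd_def
 proof (intro sum.neutral ballI)
  fix i assume "i \<in> T"
  have "T - {i} \<notin> H" using up(2)[of "T - {i}" T] that by blast
  moreover have "T - {i} \<subseteq> N" using that(1) by blast
  ultimately show "ksgn i T * 1 * e2 (T - {i}) = 0" using e(1) by (simp add: e2_def)
 qed
 show "\<exists>b. (\<forall>T\<subseteq>N. T \<notin> G \<inter> H --> b T = 0) \<and> (\<forall>T\<subseteq>N. c T = ?d b T)"
 proof (intro exI[of _ "%T. b1 T - ?d e1 T"] conjI allI impI)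
  fix T assume T: "T \<subseteq> N"
  show "b1 T - ?d e1 T = 0" if "T \<notin> G \<inter> H"
  proof (cases "T \<in> G")
   case False
   thus ?thesis using b1(1) T van by simp
  next
   case True
   hence "T \<notin> H" using that by simp
   have "b1 T - b2 T = ?d e1 T + ?d e2 T" using e(2) T split by simp
   with van2[OF T \<open>T \<notin> H\<close>] b2(1) T \<open>T \<notin> H\<close> show ?thesis by simp
  qed
  show "c T = ?d (%T. b1 T - ?d e1 T) T"
   using b1(2) T kd_kd[OF finite_subset[OF T fin], of "%_. 1" e1] by (simp add: kd_diff)
 qed
qed

text \<open>\<open>Z\<close> lies on one side of each hyperplane, so a midpoint is on a hyperplane
  only if both endpoints are. Averaging with \<open>y\<close> therefore leaves one more hyperplane
  and returns to none.\<close>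

lemma ex_point_off_hyperplanes:
 fixes Z :: "'a::euclidean_space set"
 assumes "finite H" "convex Z" "Z ~= {}"
  and side: "!!a b. (a, b) \<in> H ==> Z \<subseteq> {x. a \<bullet> x \<le> b} \<or> Z \<subseteq> {x. a \<bullet> x \<ge> b}"
 shows "\<exists>z\<in>Z. \<forall>(a, b)\<in>H. a \<bullet> z = b --> Z \<subseteq> {x. a \<bullet> x = b}"
 using assms(1,4)
proof (induction H rule: finite_induct)
 case empty
 with assms(3) show ?case by auto
next
 case (insert h H)
 obtain a b where h: "h = (a, b)" by (cases h)
 obtain z where z: "z \<in> Z" "\<forall>(a, b)\<in>H. a \<bullet> z = b --> Z \<subseteq> {x. a \<bullet> x = b}"
  using insert.IH insert.prems by blast
 show ?case
 proof (cases "a \<bullet> z = b --> Z \<subseteq> {x. a \<bullet> x = b}")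
  case True
  with z h show ?thesis by (intro bexI[of _ z]) auto
 next
  case False
  then obtain y where y: "y \<in> Z" "a \<bullet> y ~= b" "a \<bullet> z = b" by blast
  define z' where "z' = (1/2) *\<^sub>R z + (1/2) *\<^sub>R y"
  have "z' \<in> Z" unfolding z'_def using z(1) y(1) assms(2) by (intro convexD) auto
  have val: "a' \<bullet> z' = (a' \<bullet> z + a' \<bullet> y) / 2" for a' by (simp add: z'_def inner_simps)
  have "Z \<subseteq> {x. a' \<bullet> x = b'}" if h': "(a', b') \<in> insert h H" "a' \<bullet> z' = b'" for a' b'
  proof (cases "(a', b') = h")
   case True
   with h y h'(2) val[of a] show ?thesis by simp
  next
   case False
   with h' have "(a', b') \<in> H" by blast
   moreover have "a' \<bullet> z = b'"
   proof -
    have sum: "a' \<bullet> z + a' \<bullet> y = 2 * b'" using val[of a'] h'(2) by simp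
    from insert.prems[OF h'(1)] have "a' \<bullet> z \<le> b' \<and> a' \<bullet> y \<le> b' \<or> a' \<bullet> z \<ge> b' \<and> a' \<bullet> y \<ge> b'"
     using z(1) y(1) by blast
    with sum show ?thesis by linarith
   qed
   ultimately show ?thesis using z(2) by blast
  qed
  with \<open>z' \<in> Z\<close> show ?thesis by (intro bexI[of _ z']) auto
 qed
qed

text \<open>Induction on the number of facet hyperplanes that cut \<open>Z\<close> properly. A cut
  produces two convex halves and their common wall, which \<open>cexact_Int\<close> puts together.
  If nothing cuts \<open>Z\<close>, a point of \<open>Z\<close> in general position shows that one
  \<open>K j\<close> contains all of \<open>Z\<close>, and adding \<open>j\<close> changes no
  intersection.\<close>

theorem nerve_exact:
 fixes K :: "nat => 'a::euclidean_space set" and Hs :: "nat => ('a \<times> real) set"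
 assumes fin: "finite N" "N ~= {}" and finH: "!!j. j \<in> N ==> finite (Hs j)"
  and K: "!!j. j \<in> N ==> K j = {x. \<forall>(a, b)\<in>Hs j. a \<bullet> x \<le> b}"
  and "convex Z" "Z \<subseteq> (\<Union>j\<in>N. K j)"
 shows "cexact N {T. (\<Inter>j\<in>T \<inter> N. K j) \<inter> Z = {}}" using assms(5,6)
proof (induction "card {(a, b) \<in> (\<Union>j\<in>N. Hs j). \<not> Z \<subseteq> {x. a \<bullet> x \<le> b} \<and> \<not> Z \<subseteq> {x. a \<bullet> x \<ge> b}}"
  arbitrary: Z rule: less_induct)
 case (less Z)
 define H where "H = (\<Union>j\<in>N. Hs j)"
 have finH': "finite H" using fin(1) finH by (simp add: H_def)
 define und where "und Z = {(a, b) \<in> H. \<not> Z \<subseteq> {x. a \<bullet> x \<le> b} \<and> \<not> Z \<subseteq> {x. a \<bullet> x \<ge> b}}" for Z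
 have finu: "finite (und Z)" for Z unfolding und_def using finH' by (rule finite_subset[rotated]) auto
 have IH: "cexact N {T. (\<Inter>j\<in>T \<inter> N. K j) \<inter> Z' = {}}"
  if "card (und Z') < card (und Z)" "convex Z'" "Z' \<subseteq> (\<Union>j\<in>N. K j)" for Z'
  using less.hyps[of Z'] that unfolding und_def H_def by blast
 have convK: "convex (\<Inter>j\<in>T \<inter> N. K j)" for T
 proof (intro convex_INT)
  fix j assume "j \<in> T \<inter> N"
  hence "K j = (\<Inter>(a, b)\<in>Hs j. {x. a \<bullet> x \<le> b})" using K by auto
  thus "convex (K j)" by (auto intro!: convex_INT convex_halfspace_le)
 qed
 show ?case
 proof (cases "und Z = {}")
  case True
  have "\<exists>j\<in>N. Z \<subseteq> K j"
  proof (cases "Z = {}")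
   case False
   have "\<exists>z\<in>Z. \<forall>(a, b)\<in>H. a \<bullet> z = b --> Z \<subseteq> {x. a \<bullet> x = b}"
    using True by (intro ex_point_off_hyperplanes finH' less.prems(1) False) (auto simp: und_def)
   then obtain z where z: "z \<in> Z" "\<forall>(a, b)\<in>H. a \<bullet> z = b --> Z \<subseteq> {x. a \<bullet> x = b}" by blast
   obtain j where j: "j \<in> N" "z \<in> K j" using z(1) less.prems(2) by blast
   have "Z \<subseteq> {x. a \<bullet> x \<le> b}" if ab: "(a, b) \<in> Hs j" for a b
   proof (rule ccontr)
    assume neg: "\<not> Z \<subseteq> {x. a \<bullet> x \<le> b}"
    have abH: "(a, b) \<in> H" using ab j(1) by (auto simp: H_def)
    hence "Z \<subseteq> {x. a \<bullet> x \<ge> b}" using True neg unfolding und_def by blast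
    hence "a \<bullet> z \<ge> b" using z(1) by blast
    moreover have "a \<bullet> z \<le> b" using j ab K by auto
    ultimately have "a \<bullet> z = b" by simp
    with z(2) abH have "Z \<subseteq> {x. a \<bullet> x = b}" by blast
    with neg show False by auto
   qed
   hence "Z \<subseteq> K j" unfolding K[OF j(1)] by blast
   with j(1) show ?thesis by blast
  qed (use fin in auto)
  then obtain j where j: "j \<in> N" "Z \<subseteq> K j" by blast
  show ?thesis by (rule cexact_cone[OF fin(1) j(1)]) (use j in auto)
 next
  case False
  then obtain a b where ab: "(a, b) \<in> H" "\<not> Z \<subseteq> {x. a \<bullet> x \<le> b}" "\<not> Z \<subseteq> {x. a \<bullet> x \<ge> b}"
   unfolding und_def by blast
  have small: "card (und Z') < card (und Z)"
   if "Z' \<subseteq> Z" "Z' \<subseteq> {x. a \<bullet> x \<le> b} \<or> Z' \<subseteq> {x. a \<bullet> x \<ge> b}" for Z'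
  proof (rule psubset_card_mono[OF finu])
   have "und Z' \<subseteq> und Z" using that(1) unfolding und_def by blast
   moreover have "(a, b) \<in> und Z" "(a, b) \<notin> und Z'" using ab that(2) unfolding und_def by blast+
   ultimately show "und Z' \<subset> und Z" by blast
  qed
  let ?P = "Z \<inter> {x. a \<bullet> x \<ge> b}" and ?M = "Z \<inter> {x. a \<bullet> x \<le> b}" and ?O = "Z \<inter> {x. a \<bullet> x = b}"
  let ?G = "%Z. {T. (\<Inter>j\<in>T \<inter> N. K j) \<inter> Z = {}}"
  have P: "cexact N (?G ?P)"
   using less.prems by (intro IH small convex_Int convex_halfspace_ge) auto
  have M: "cexact N (?G ?M)"
   using less.prems by (intro IH small convex_Int convex_halfspace_le) auto
  have O: "cexact N (?G ?O)" using less.prems by (intro IH small convex_Int convex_hyperplane) auto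
  have "Z = ?P \<union> ?M" by auto
  hence GZ: "?G Z = ?G ?P \<inter> ?G ?M" by blast
  \<comment> \<open>A convex set that meets both closed halves meets the wall, so missing the wall
    means missing one of the halves.\<close>
  have GO: "?G ?O = ?G ?P \<union> ?G ?M"
  proof (intro equalityI subsetI)
   fix T assume T: "T \<in> ?G ?O"
   show "T \<in> ?G ?P \<union> ?G ?M"
   proof (rule ccontr)
    assume "T \<notin> ?G ?P \<union> ?G ?M"
    then obtain x y where x: "x \<in> (\<Inter>j\<in>T \<inter> N. K j) \<inter> Z" "a \<bullet> x \<ge> b"
     and y: "y \<in> (\<Inter>j\<in>T \<inter> N. K j) \<inter> Z" "a \<bullet> y \<le> b" by blast
    have conv: "convex ((\<Inter>j\<in>T \<inter> N. K j) \<inter> Z)" using convK less.prems(1) by (rule convex_Int)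
    have "\<exists>w\<in>(\<Inter>j\<in>T \<inter> N. K j) \<inter> Z. a \<bullet> w = b"
    proof (cases "a \<bullet> x = a \<bullet> y")
     case True
     with x y show ?thesis by (intro bexI[of _ x]) auto
    next
     case False
     define t where "t = (b - a \<bullet> y) / (a \<bullet> x - a \<bullet> y)"
     have pos: "a \<bullet> x - a \<bullet> y > 0" using x(2) y(2) False by linarith
     have t: "0 \<le> t" "t \<le> 1" using x(2) y(2) pos by (simp_all add: t_def)
     have "t *\<^sub>R x + (1 - t) *\<^sub>R y \<in> (\<Inter>j\<in>T \<inter> N. K j) \<inter> Z"
      using t by (intro convexD[OF conv x(1) y(1)]) auto
     moreover have "a \<bullet> (t *\<^sub>R x + (1 - t) *\<^sub>R y) = t * (a \<bullet> x - a \<bullet> y) + a \<bullet> y"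
      by (simp add: inner_simps algebra_simps)
     hence "a \<bullet> (t *\<^sub>R x + (1 - t) *\<^sub>R y) = b" using pos by (simp add: t_def)
     ultimately show ?thesis by blast
    qed
    with T show False by blast
   qed
  qed blast
  show ?thesis unfolding GZ
  proof (rule cexact_Int[OF fin(1) _ _ P M])
   show "cexact N (?G ?P \<union> ?G ?M)" using O unfolding GO .
  qed blast+
 qed
qed

lemma polyhedron_halfspaces:
 fixes K :: "'a::euclidean_space set"
 assumes "polyhedron K"
 obtains H where "finite H" "K = {x. \<forall>(a, b)\<in>H. a \<bullet> x \<le> b}"
proof -
 obtain F where F: "finite F" "K = \<Inter>F" "\<forall>h\<in>F. \<exists>a b. a ~= 0 \<and> h = {x. a \<bullet> x \<le> b}"
  using assms by (auto simp: polyhedron_def)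
 have "\<exists>p. h = {x. fst p \<bullet> x \<le> snd p}" if h: "h \<in> F" for h
 proof -
  obtain a b where "h = {x. a \<bullet> x \<le> b}" using F(3) h by blast
  thus ?thesis by (intro exI[of _ "(a, b)"]) simp
 qed
 then obtain f where f: "!!h. h \<in> F ==> h = {x. fst (f h) \<bullet> x \<le> snd (f h)}" by metis
 show thesis
 proof (rule that)
  show "finite (f ` F)" using F(1) by simp
  show "K = {x. \<forall>(a, b)\<in>f ` F. a \<bullet> x \<le> b}"
  proof (intro equalityI subsetI)
   fix x assume x: "x \<in> K"
   have "fst (f h) \<bullet> x \<le> snd (f h)" if "h \<in> F" for h
   proof -
    have "x \<in> h" using x that F(2) by blast
    thus ?thesis by (subst (asm) f[OF that]) simp
   qed
   thus "x \<in> {x. \<forall>(a, b)\<in>f ` F. a \<bullet> x \<le> b}" by (simp add: split_beta)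
  next
   fix x assume x: "x \<in> {x. \<forall>(a, b)\<in>f ` F. a \<bullet> x \<le> b}"
   have "x \<in> h" if "h \<in> F" for h
    by (subst f[OF that]) (use x that in \<open>simp add: split_beta\<close>)
   thus "x \<in> K" using F(2) by blast
  qed
 qed
qed

section \<open>The Koszul--Cech double complex\<close>

lemma kd_zero_fun [simp]: "kd F (%_. 0) J = 0" by (simp add: kd_def)

lemma coef_kd_one: "coef (kd (%_. 1) c T) m = kd (%_. 1) (%T. coef (c T) m) T"
proof -
 have "coef (ksgn j T * f) m = ksgn j T * coef f m" for j f
  by (simp add: ksgn_def uminus_add_conv_diff minus_one_power_iff)
 thus ?thesis by (simp add: kd_def lookup_sum)
qed

text \<open>Used for sets that lack exactly one index, that is, at the Koszul level just below the
  top.\<close>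

definition missing :: "nat set => nat set => nat" where
 "missing I J = (THE i. i \<in> I - J)"

lemma missing_remove [simp]: "j \<in> I ==> missing I (I - {j}) = j"
 unfolding missing_def by (intro the_equality) auto

lemma ksgn_singleton [simp]: "ksgn t {t} = 1"
proof -
 have "{k \<in> {t}. k < t} = {}" by auto
 thus ?thesis by (simp only: ksgn_def card.empty power_0)
qed

text \<open>\<open>G J T\<close> holds the exponents of the sections, over the overlap of the charts
  in \<open>T\<close>, of the line bundle at Koszul position \<open>J\<close>; \<open>T = {}\<close>
  is the global position. The Cech direction is exact with the global position included, the Koszul
  direction over nonempty \<open>T\<close> and below the top level.\<close>

locale koszul_cech =
 fixes I N :: "nat set" and F :: "nat => ('m::ab_group_add) \<Rightarrow>\<^sub>0 complex" and G :: "nat set => nat set => 'm set"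
 assumes finI: "finite I" and finN: "finite N"
  and mono: "!!J T T'. J \<subseteq> I ==> T \<subseteq> T' ==> T' \<subseteq> N ==> G J T \<subseteq> G J T'"
  and Fmult: "!!J T j m m'. J \<subseteq> I ==> T \<subseteq> N ==> j \<in> J ==> m \<in> supp (F j) ==> m' \<in> G (J - {j}) T ==> m + m' \<in> G J T"
  and cech: "!!J m. J \<subseteq> I ==> cexact N {T. m \<in> G J T}"
  and koszul: "!!T k z. T \<subseteq> N ==> T ~= {} ==> k < card I ==>
   (!!J. J \<subseteq> I ==> card J = k ==> z J \<in> lspan (G J T)) ==>
   (!!J. J \<subseteq> I ==> card J = Suc k ==> kd F z J = 0) ==>
   \<exists>y. (\<forall>J\<subseteq>I. Suc (card J) = k --> y J \<in> lspan (G J T)) \<and> (\<forall>J\<subseteq>I. card J = k --> z J = kd F y J)"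
begin

abbreviation "qt \<equiv> kd (%_. 1 :: 'm \<Rightarrow>\<^sub>0 complex)"

text \<open>The Cech differential preserves exponents, so there is one complex of scalars per
  exponent. Extending \<open>c\<close> by zero to the other levels makes it a cocycle of the complex
  without levels; the primitives are collected over the finite set \<open>W\<close> of occurring
  exponents.\<close>

lemma cech_exact:
 assumes J: "J \<subseteq> I"
  and c: "!!T. T \<subseteq> N ==> card T = t ==> c T \<in> lspan (G J T)"
  and dc: "!!T. T \<subseteq> N ==> card T = Suc t ==> qt c T = 0"
 shows "\<exists>b. (\<forall>T\<subseteq>N. Suc (card T) = t --> b T \<in> lspan (G J T)) \<and> (\<forall>T\<subseteq>N. card T = t --> c T = qt b T)"
proof -
 define W where "W = (\<Union>T\<in>Pow N. supp (c T))"
 have finW: "finite W" unfolding W_def using finN by auto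
 have card_rm: "Suc (card (T - {i})) = card T" if "T \<subseteq> N" "i \<in> T" for T i
  using that finite_subset[OF that(1) finN] by (meson card_Suc_Diff1)
 have "\<exists>b. (\<forall>T\<subseteq>N. T \<notin> {T. m \<in> G J T} --> b T = 0) \<and>
   (\<forall>T\<subseteq>N. (if card T = t then coef (c T) m else 0) = kd (%_. 1) b T)" for m
 proof (rule cexactD[OF cech[OF J]])
  show "(if card T = t then coef (c T) m else 0) = 0" if "T \<subseteq> N" "T \<notin> {T. m \<in> G J T}" for T
   using that c[OF that(1)] by (auto simp: lspan_iff)
  show "kd (%_. 1) (%T. if card T = t then coef (c T) m else 0) T = 0" if T: "T \<subseteq> N" for T
  proof (cases "card T = Suc t")
   case True
   have "kd (%_. 1) (%T. if card T = t then coef (c T) m else 0) T = kd (%_. 1) (%T. coef (c T) m) T"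
    using card_rm[OF T] True by (intro kd_cong) auto
   also have "... = coef (qt c T) m" by (simp add: coef_kd_one)
   finally show ?thesis using dc[OF T True] by simp
  next
   case False
   thus ?thesis unfolding kd_def using card_rm[OF T] by (intro sum.neutral ballI) auto
  qed
 qed
 then obtain b where b: "!!m T. T \<subseteq> N ==> m \<notin> G J T ==> b m T = 0"
  "!!m T. T \<subseteq> N ==> (if card T = t then coef (c T) m else 0) = kd (%_. 1) (b m) T"
  by (simp only: mem_Collect_eq) metis
 define B where "B T = (\<Sum>m\<in>W. mon m (b m T))" for T
 have coefB: "coef (B T) m = (if m \<in> W then b m T else 0)" for T m
  unfolding B_def using finW by (simp add: lookup_sum lookup_single when_def)
 show ?thesis
 proof (intro exI[of _ B] conjI allI impI)
  show "B T \<in> lspan (G J T)" if "T \<subseteq> N" for T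
   unfolding lspan_iff coefB using b(1)[OF that] by auto
  show "c T = qt B T" if T: "T \<subseteq> N" "card T = t" for T
  proof (rule poly_mapping_eqI)
   fix m
   have "coef (qt B T) m = kd (%_. 1) (%T. if m \<in> W then b m T else 0) T"
    by (simp add: coef_kd_one coefB)
   also have "... = coef (c T) m"
   proof (cases "m \<in> W")
    case True
    thus ?thesis using b(2)[OF T(1), of m] T(2) by simp
   next
    case False
    hence "coef (c T) m = 0" using T(1) by (auto simp: W_def in_keys_iff)
    with False show ?thesis by simp
   qed
   finally show "coef (c T) m = coef (qt B T) m" by simp
  qed
 qed
qed

lemma kd_in_lspan:
 assumes "J \<subseteq> I" "T \<subseteq> N" "!!j. j \<in> J ==> y (J - {j}) \<in> lspan (G (J - {j}) T)"
 shows "kd F y J \<in> lspan (G J T)" unfolding kd_def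
proof (rule lspan_sum)
 fix j assume j: "j \<in> J"
 have "F j * y (J - {j}) \<in> lspan (G J T)"
  by (rule lspan_mult[of _ "supp (F j)" _ "G (J - {j}) T"])
   (use assms(3)[OF j] Fmult[OF assms(1,2) j] in \<open>auto simp: lspan_def\<close>)
 thus "ksgn j J * F j * y (J - {j}) \<in> lspan (G J T)"
  by (auto simp: ksgn_def minus_one_power_iff lspan_uminus)
qed

lemma cech_in_lspan:
 assumes "J \<subseteq> I" "T \<subseteq> N" "!!i. i \<in> T ==> b (T - {i}) \<in> lspan (G J (T - {i}))"
 shows "qt b T \<in> lspan (G J T)" unfolding kd_def
proof (rule lspan_sum)
 fix i assume i: "i \<in> T"
 have "b (T - {i}) \<in> lspan (G J T)"
  by (rule lspan_mono[OF assms(3)[OF i]]) (use mono[OF assms(1) _ assms(2)] in blast)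
 thus "ksgn i T * 1 * b (T - {i}) \<in> lspan (G J T)"
  by (auto simp: ksgn_def minus_one_power_iff lspan_uminus)
qed

text \<open>The Cech image of \<open>y\<close> is a Koszul cocycle, hence the Koszul image of some
  \<open>y'\<close> one level lower, and the induction hypothesis decomposes \<open>y\<close>.
  Subtracting from \<open>a\<close> the Koszul image of the resulting \<open>f\<close> leaves a Cech
  cocycle. At Koszul level zero \<open>a\<close> is a Cech cocycle already.\<close>

lemma zigzag:
 assumes "j \<le> card I"
  and "!!J T. J \<subseteq> I ==> T \<subseteq> N ==> card J = j ==> card T = t ==> a J T \<in> lspan (G J T)"
  and "!!J T. J \<subseteq> I ==> T \<subseteq> N ==> Suc (card J) = j ==> card T = Suc t ==> y J T \<in> lspan (G J T)"
  and "!!J T. J \<subseteq> I ==> T \<subseteq> N ==> card J = j ==> card T = Suc t ==> qt (a J) T = kd F (%J. y J T) J"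
 shows "\<exists>e f. (\<forall>J\<subseteq>I. \<forall>T\<subseteq>N. Suc (card J) = j --> card T = t --> e J T \<in> lspan (G J T)) \<and>
  (\<forall>J\<subseteq>I. \<forall>T\<subseteq>N. card J = j --> Suc (card T) = t --> f J T \<in> lspan (G J T)) \<and>
  (\<forall>J\<subseteq>I. \<forall>T\<subseteq>N. card J = j --> card T = t --> a J T = kd F (%J. e J T) J + qt (f J) T)"
 using assms
proof (induction j arbitrary: t a y)
 case (0 t a y)
 have "\<exists>b. (\<forall>T\<subseteq>N. Suc (card T) = t --> b T \<in> lspan (G {} T)) \<and> (\<forall>T\<subseteq>N. card T = t --> a {} T = qt b T)"
 proof (rule cech_exact)
  show "a {} T \<in> lspan (G {} T)" if "T \<subseteq> N" "card T = t" for T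
   using 0(2)[of "{}" T] that by simp
  show "qt (a {}) T = 0" if "T \<subseteq> N" "card T = Suc t" for T
   using 0(4)[of "{}" T] that by (simp add: kd_def[of F])
 qed simp
 then obtain b where b: "\<forall>T\<subseteq>N. Suc (card T) = t --> b T \<in> lspan (G {} T)"
  "\<forall>T\<subseteq>N. card T = t --> a {} T = qt b T" by blast
 have J0: "J = {}" if "J \<subseteq> I" "card J = 0" for J
  using that finite_subset[OF _ finI] by auto
 show ?case
 proof (rule exI[of _ "%_ _. 0"], rule exI[of _ "%_. b"], intro conjI allI impI)
  show "b T \<in> lspan (G J T)" if "J \<subseteq> I" "T \<subseteq> N" "card J = 0" "Suc (card T) = t" for J T
   using b(1) that J0[OF that(1,3)] by simp
  show "a J T = kd F (%J. 0) J + qt b T" if "J \<subseteq> I" "T \<subseteq> N" "card J = 0" "card T = t" for J T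
   using b(2) that J0[OF that(1,3)] by simp
 qed simp
next
 case (Suc j t a y)
 have fT: "finite T" if "T \<subseteq> N" for T using that finN by (rule finite_subset)
 have fJ: "finite J" if "J \<subseteq> I" for J using that finI by (rule finite_subset)
 have crT: "card (T - {i}) = k" if "T \<subseteq> N" "card T = Suc k" "i \<in> T" for T k i
  using that fT by simp
 have crJ: "card (J - {i}) = k" if "J \<subseteq> I" "card J = Suc k" "i \<in> J" for J k i
  using that fJ by simp
 have "\<exists>y'. (\<forall>J\<subseteq>I. Suc (card J) = j --> y' J \<in> lspan (G J T)) \<and>
  (\<forall>J\<subseteq>I. card J = j --> qt (y J) T = kd F y' J)" if T: "T \<subseteq> N" "card T = Suc (Suc t)" for T
 proof (rule koszul[OF T(1)])
  show "T ~= {}" using T by auto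
  show "j < card I" using Suc.prems(1) by simp
  show "qt (y J) T \<in> lspan (G J T)" if "J \<subseteq> I" "card J = j" for J
  proof (rule cech_in_lspan[OF that(1) T(1)])
   fix i assume i: "i \<in> T"
   have "T - {i} \<subseteq> N" using T(1) by blast
   from Suc.prems(3)[OF that(1) this _ crT[OF T i]] that(2)
   show "y J (T - {i}) \<in> lspan (G J (T - {i}))" by simp
  qed
  show "kd F (%J. qt (y J) T) J = 0" if J: "J \<subseteq> I" "card J = Suc j" for J
  proof -
   have "kd F (%J. qt (y J) T) J = qt (%T. kd F (%J. y J T) J) T" by (rule kd_uncurry_commute)
   also have "... = qt (%T. qt (a J) T) T"
   proof (rule kd_cong)
    fix i assume i: "i \<in> T"
    have "T - {i} \<subseteq> N" using T(1) by blast
    from Suc.prems(4)[OF J(1) this J(2) crT[OF T i]]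
    show "kd F (%J. y J (T - {i})) J = qt (a J) (T - {i})" by simp
   qed
   also have "... = 0" by (rule kd_kd[OF fT[OF T(1)]])
   finally show ?thesis .
  qed
 qed
 hence "\<forall>T. \<exists>y'. T \<subseteq> N --> card T = Suc (Suc t) --> (\<forall>J\<subseteq>I. Suc (card J) = j --> y' J \<in> lspan (G J T)) \<and>
  (\<forall>J\<subseteq>I. card J = j --> qt (y J) T = kd F y' J)" by blast
 from choice[OF this] obtain y' where y0: "\<forall>T. T \<subseteq> N --> card T = Suc (Suc t) -->
  (\<forall>J\<subseteq>I. Suc (card J) = j --> y' T J \<in> lspan (G J T)) \<and>
  (\<forall>J\<subseteq>I. card J = j --> qt (y J) T = kd F (y' T) J)" by (elim exE)
 have y': "y' T J \<in> lspan (G J T)" if "T \<subseteq> N" "card T = Suc (Suc t)" "J \<subseteq> I" "Suc (card J) = j" for J T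
  using y0[rule_format, OF that(1,2)] that(3,4) by simp
 have y'': "qt (y J) T = kd F (y' T) J" if "T \<subseteq> N" "card T = Suc (Suc t)" "J \<subseteq> I" "card J = j" for J T
  using y0[rule_format, OF that(1,2)] that(3,4) by simp
 have "\<exists>e f. (\<forall>J\<subseteq>I. \<forall>T\<subseteq>N. Suc (card J) = j --> card T = Suc t --> e J T \<in> lspan (G J T)) \<and>
  (\<forall>J\<subseteq>I. \<forall>T\<subseteq>N. card J = j --> Suc (card T) = Suc t --> f J T \<in> lspan (G J T)) \<and>
  (\<forall>J\<subseteq>I. \<forall>T\<subseteq>N. card J = j --> card T = Suc t --> y J T = kd F (%J. e J T) J + qt (f J) T)"
 proof (rule Suc.IH[where y = "%J T. y' T J"])
  show "j \<le> card I" using Suc.prems(1) by simp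
  show "y J T \<in> lspan (G J T)" if "J \<subseteq> I" "T \<subseteq> N" "card J = j" "card T = Suc t" for J T
   using Suc.prems(3)[OF that(1,2)] that by simp
  show "y' T J \<in> lspan (G J T)"
   if "J \<subseteq> I" "T \<subseteq> N" "Suc (card J) = j" "card T = Suc (Suc t)" for J T
   using y' that by simp
  show "qt (y J) T = kd F (%J. y' T J) J"
   if "J \<subseteq> I" "T \<subseteq> N" "card J = j" "card T = Suc (Suc t)" for J T
   using y''[OF that(2,4,1,3)] .
 qed
 then obtain e f where ef: "\<forall>J\<subseteq>I. \<forall>T\<subseteq>N. card J = j --> Suc (card T) = Suc t --> f J T \<in> lspan (G J T)"
  "\<forall>J\<subseteq>I. \<forall>T\<subseteq>N. card J = j --> card T = Suc t --> y J T = kd F (%J. e J T) J + qt (f J) T"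
  by (elim exE conjE) (rule that)
 have "\<exists>b. (\<forall>T\<subseteq>N. Suc (card T) = t --> b T \<in> lspan (G J T)) \<and>
  (\<forall>T\<subseteq>N. card T = t --> a J T - kd F (%J. f J T) J = qt b T)" if J: "J \<subseteq> I" "card J = Suc j" for J
 proof (rule cech_exact[OF J(1)])
  show "a J T - kd F (%J. f J T) J \<in> lspan (G J T)" if T: "T \<subseteq> N" "card T = t" for T
  proof (rule lspan_diff[OF Suc.prems(2)[OF J(1) T(1) J(2) T(2)] kd_in_lspan[OF J(1) T(1)]])
   fix i assume i: "i \<in> J"
   have "J - {i} \<subseteq> I" using J(1) by blast
   with ef(1) T crJ[OF J i] show "f (J - {i}) T \<in> lspan (G (J - {i}) T)" by simp
  qed
  show "qt (%T. a J T - kd F (%J. f J T) J) T = 0" if T: "T \<subseteq> N" "card T = Suc t" for T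
  proof -
   have "qt (%T. kd F (%J. f J T) J) T = kd F (%J. qt (f J) T) J"
    by (rule kd_uncurry_commute[symmetric])
   also have "... = kd F (%J. y J T - kd F (%J. e J T) J) J"
   proof (rule kd_cong)
    fix i assume i: "i \<in> J"
    have "J - {i} \<subseteq> I" using J(1) by blast
    with ef(2) T crJ[OF J i] show "qt (f (J - {i})) T = y (J - {i}) T - kd F (%J. e J T) (J - {i})" by simp
   qed
   also have "... = kd F (%J. y J T) J"
    using kd_kd[OF fJ[OF J(1)], of F "%J. e J T"] by (simp add: kd_diff)
   also have "... = qt (a J) T" using Suc.prems(4)[OF J(1) T(1) J(2) T(2)] by simp
   finally show ?thesis by (simp add: kd_diff)
  qed
 qed
 hence "\<forall>J. \<exists>b. J \<subseteq> I --> card J = Suc j --> (\<forall>T\<subseteq>N. Suc (card T) = t --> b T \<in> lspan (G J T)) \<and>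
  (\<forall>T\<subseteq>N. card T = t --> a J T - kd F (%J. f J T) J = qt b T)" by blast
 from choice[OF this] obtain g where g0: "\<forall>J. J \<subseteq> I --> card J = Suc j -->
  (\<forall>T\<subseteq>N. Suc (card T) = t --> g J T \<in> lspan (G J T)) \<and>
  (\<forall>T\<subseteq>N. card T = t --> a J T - kd F (%J. f J T) J = qt (g J) T)" by (elim exE)
 show ?case
 proof (rule exI[of _ f], rule exI[of _ g], intro conjI allI impI)
  show "f J T \<in> lspan (G J T)" if "J \<subseteq> I" "T \<subseteq> N" "Suc (card J) = Suc j" "card T = t" for J T
   using ef(1) that by simp
  show "g J T \<in> lspan (G J T)" if "J \<subseteq> I" "T \<subseteq> N" "card J = Suc j" "Suc (card T) = t" for J T
   using g0[rule_format, OF that(1,3)] that by simp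
  show "a J T = kd F (%J. f J T) J + qt (g J) T" if "J \<subseteq> I" "T \<subseteq> N" "card J = Suc j" "card T = t" for J T
   using g0[rule_format, OF that(1,3)] that(2,4) by (simp add: algebra_simps)
 qed
qed

lemma kd_top: "kd F (%J. ksgn (missing I J) I * y (missing I J)) I = (\<Sum>j\<in>I. F j * y j)"
 unfolding kd_def by (intro sum.cong refl) (simp add: mult.left_commute mult.assoc)

lemma eq_top_level: "J \<subseteq> I ==> card J = card I ==> J = I" using finI by (metis card_subset_eq)

lemma card_remove_index: "j \<in> I ==> Suc (card (I - {j})) = card I" using finI by (meson card_Suc_Diff1)

lemma ex_removed_index:
 assumes "J \<subseteq> I" "Suc (card J) = card I"
 shows "\<exists>j\<in>I. J = I - {j}"
proof -
 have "card (I - J) = 1" using assms card_Diff_subset[of J I] finite_subset[OF assms(1) finI] by simp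
 then obtain j where "I - J = {j}" by (auto simp: card_1_singleton_iff)
 with assms(1) have "j \<in> I" "J = I - {j}" by auto
 thus ?thesis by blast
qed

lemma ex_vertex: "T \<subseteq> N ==> card T = Suc 0 ==> \<exists>t\<in>N. T = {t}" by (auto simp: card_1_singleton_iff)

text \<open>The zigzag at the top Koszul level and Cech level zero: its Cech part is an empty sum,
  so the Koszul part alone expresses \<open>z\<close> globally.\<close>

theorem global_injective:
 assumes z: "z \<in> lspan (G I {})"
  and y: "!!t j. t \<in> N ==> j \<in> I ==> y t j \<in> lspan (G (I - {j}) {t})"
  and zy: "!!t. t \<in> N ==> z = (\<Sum>j\<in>I. F j * y t j)"
 shows "\<exists>e. (\<forall>j\<in>I. e j \<in> lspan (G (I - {j}) {})) \<and> z = (\<Sum>j\<in>I. F j * e j)"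
proof -
 define w where "w J T = ksgn (missing I J) I * y (THE t. t \<in> T) (missing I J)" for J T
 have "\<exists>e f. (\<forall>J\<subseteq>I. \<forall>T\<subseteq>N. Suc (card J) = card I --> card T = 0 --> e J T \<in> lspan (G J T)) \<and>
  (\<forall>J\<subseteq>I. \<forall>T\<subseteq>N. card J = card I --> Suc (card T) = 0 --> f J T \<in> lspan (G J T)) \<and>
  (\<forall>J\<subseteq>I. \<forall>T\<subseteq>N. card J = card I --> card T = 0 --> z = kd F (%J. e J T) J + qt (f J) T)"
 proof (rule zigzag[where a = "%_ _. z" and y = w])
  show "z \<in> lspan (G J T)" if JT: "J \<subseteq> I" "T \<subseteq> N" "card J = card I" "card T = 0" for J T
  proof -
   have "T = {}" using JT finite_subset[OF JT(2) finN] by auto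
   thus ?thesis using z eq_top_level[OF JT(1,3)] by (simp only:)
  qed
  show "w J T \<in> lspan (G J T)" if JT: "J \<subseteq> I" "T \<subseteq> N" "Suc (card J) = card I" "card T = Suc 0" for J T
  proof -
   obtain j t where "j \<in> I" "J = I - {j}" "t \<in> N" "T = {t}" using ex_removed_index[OF JT(1,3)] ex_vertex[OF JT(2,4)] by blast
   with y show ?thesis by (auto simp: w_def ksgn_def minus_one_power_iff lspan_uminus)
  qed
  show "qt (%_. z) T = kd F (%J. w J T) J" if JT: "J \<subseteq> I" "T \<subseteq> N" "card J = card I" "card T = Suc 0" for J T
  proof -
   obtain t where t: "t \<in> N" "T = {t}" using ex_vertex[OF JT(2,4)] by blast
   have "kd F (%J. w J T) J = (\<Sum>j\<in>I. F j * y t j)"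
    unfolding eq_top_level[OF JT(1,3)] w_def t(2) using kd_top[of "y t"] by simp
   moreover have "qt (%_. z) T = z" by (simp add: t(2) kd_def)
   ultimately show ?thesis using zy[OF t(1)] by simp
  qed
 qed simp
 then obtain e f where
  ef: "\<forall>J\<subseteq>I. \<forall>T\<subseteq>N. Suc (card J) = card I --> card T = 0 --> e J T \<in> lspan (G J T)"
  "\<forall>J\<subseteq>I. \<forall>T\<subseteq>N. card J = card I --> card T = 0 --> z = kd F (%J. e J T) J + qt (f J) T"
  by (elim exE conjE) (rule that)
 have e: "e J {} \<in> lspan (G J {})" if "J \<subseteq> I" "Suc (card J) = card I" for J
  using ef(1)[rule_format, OF that(1) empty_subsetI that(2)] by simp
 have zef: "z = kd F (%J. e J {}) I + qt (f I) {}"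
  using ef(2)[rule_format, OF order_refl empty_subsetI refl] by simp
 show ?thesis
 proof (intro exI[of _ "%j. ksgn j I * e (I - {j}) {}"] conjI ballI)
  show "ksgn j I * e (I - {j}) {} \<in> lspan (G (I - {j}) {})" if "j \<in> I" for j
   using e[of "I - {j}"] card_remove_index[OF that] by (auto simp: ksgn_def minus_one_power_iff lspan_uminus)
  show "z = (\<Sum>j\<in>I. F j * (ksgn j I * e (I - {j}) {}))"
   using zef by (simp add: kd_def mult_ac)
 qed
qed

text \<open>The zigzag at the top Koszul level and Cech level one: the entry of its Cech part at the
  empty set is the global section, and the Koszul part holds the local corrections.\<close>

theorem global_surjective:
 assumes s: "!!t. t \<in> N ==> s t \<in> lspan (G I {t})"
  and y: "!!t t' j. t \<in> N ==> t' \<in> N ==> j \<in> I ==> y t t' j \<in> lspan (G (I - {j}) {t, t'})"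
  and sy: "!!t t'. t \<in> N ==> t' \<in> N ==> s t - s t' = (\<Sum>j\<in>I. F j * y t t' j)"
 shows "\<exists>z e. z \<in> lspan (G I {}) \<and> (\<forall>t\<in>N. \<forall>j\<in>I. e t j \<in> lspan (G (I - {j}) {t})) \<and>
  (\<forall>t\<in>N. s t - z = (\<Sum>j\<in>I. F j * e t j))"
proof -
 \<comment> \<open>\<open>Max T\<close> and \<open>Min T\<close> orient a two-element set in
   accordance with the Cech sign; on a singleton, \<open>Max T\<close> is its element.\<close>
 define w where "w J T = ksgn (missing I J) I * y (Max T) (Min T) (missing I J)" for J T
 have two: "\<exists>t\<in>N. \<exists>t'\<in>N. T = {t, t'} \<and> t < t'" if "T \<subseteq> N" "card T = Suc (Suc 0)" for T
 proof -
  obtain t t' where tt: "T = {t, t'}" "t ~= t'" using \<open>card T = Suc (Suc 0)\<close> by (auto simp: card_Suc_eq)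
  then consider "t < t'" | "t' < t" by linarith
  thus ?thesis using tt \<open>T \<subseteq> N\<close> by cases (auto simp: insert_commute)
 qed
 have "\<exists>e f. (\<forall>J\<subseteq>I. \<forall>T\<subseteq>N. Suc (card J) = card I --> card T = Suc 0 --> e J T \<in> lspan (G J T)) \<and>
  (\<forall>J\<subseteq>I. \<forall>T\<subseteq>N. card J = card I --> Suc (card T) = Suc 0 --> f J T \<in> lspan (G J T)) \<and>
  (\<forall>J\<subseteq>I. \<forall>T\<subseteq>N. card J = card I --> card T = Suc 0 --> s (Max T) = kd F (%J. e J T) J + qt (f J) T)"
 proof (rule zigzag[where a = "%_ T. s (Max T)" and y = w])
  show "s (Max T) \<in> lspan (G J T)" if JT: "J \<subseteq> I" "T \<subseteq> N" "card J = card I" "card T = Suc 0" for J T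
  proof -
   obtain t where "t \<in> N" "T = {t}" using ex_vertex[OF JT(2,4)] by blast
   thus ?thesis unfolding eq_top_level[OF JT(1,3)] using s by simp
  qed
  show "w J T \<in> lspan (G J T)" if JT: "J \<subseteq> I" "T \<subseteq> N" "Suc (card J) = card I" "card T = Suc (Suc 0)" for J T
  proof -
   obtain j t t' where *: "j \<in> I" "J = I - {j}" "t \<in> N" "t' \<in> N" "T = {t, t'}" "t < t'"
    using ex_removed_index[OF JT(1,3)] two[OF JT(2,4)] by blast
   have "y t' t j \<in> lspan (G (I - {j}) {t, t'})" using y[OF *(4,3,1)] by (simp add: insert_commute)
   with * show ?thesis by (auto simp: w_def ksgn_def minus_one_power_iff lspan_uminus)
  qed
  show "qt (%T. s (Max T)) T = kd F (%J. w J T) J"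
   if JT: "J \<subseteq> I" "T \<subseteq> N" "card J = card I" "card T = Suc (Suc 0)" for J T
  proof -
   obtain t t' where t: "t \<in> N" "t' \<in> N" "T = {t, t'}" "t < t'" using two[OF JT(2,4)] by blast
   have "kd F (%J. w J T) J = (\<Sum>j\<in>I. F j * y (Max T) (Min T) j)"
    unfolding eq_top_level[OF JT(1,3)] w_def using kd_top[of "y (Max T) (Min T)"] by simp
   also have "... = s t' - s t" using sy[OF t(2,1)] t(3,4) by simp
   finally have 1: "kd F (%J. w J T) J = s t' - s t" .
   have sets: "{k \<in> {t, t'}. k < t} = {}" "{k \<in> {t, t'}. k < t'} = {t}"
    "{t, t'} - {t} = {t'}" "{t, t'} - {t'} = {t}" using t(4) by auto
   have sg: "ksgn t {t, t'} = (1 :: 'm \<Rightarrow>\<^sub>0 complex)" "ksgn t' {t, t'} = (- 1 :: 'm \<Rightarrow>\<^sub>0 complex)"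
    by (simp_all only: ksgn_def sets card.empty power_0 card_1_singleton_iff) simp
   have "qt (%T. s (Max T)) T = s t' - s t"
    using t(3,4) by (simp add: kd_def sets sg del: insert_Diff_single)
   with 1 show ?thesis by simp
  qed
 qed simp
 then obtain e f where
  ef: "\<forall>J\<subseteq>I. \<forall>T\<subseteq>N. Suc (card J) = card I --> card T = Suc 0 --> e J T \<in> lspan (G J T)"
  "\<forall>J\<subseteq>I. \<forall>T\<subseteq>N. card J = card I --> Suc (card T) = Suc 0 --> f J T \<in> lspan (G J T)"
  "\<forall>J\<subseteq>I. \<forall>T\<subseteq>N. card J = card I --> card T = Suc 0 --> s (Max T) = kd F (%J. e J T) J + qt (f J) T"
  by (elim exE conjE) (rule that)
 have e: "e J T \<in> lspan (G J T)" if "J \<subseteq> I" "T \<subseteq> N" "Suc (card J) = card I" "card T = Suc 0" for J T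
  using ef(1)[rule_format, OF that] .
 have f: "f I {} \<in> lspan (G I {})"
  using ef(2)[rule_format, OF order_refl empty_subsetI refl] by simp
 have sef: "s (Max T) = kd F (%J. e J T) I + qt (f I) T" if "T \<subseteq> N" "card T = Suc 0" for T
  using ef(3)[rule_format, OF order_refl that(1) refl that(2)] .
 show ?thesis
 proof (intro exI[of _ "f I {}"] exI[of _ "%t j. ksgn j I * e (I - {j}) {t}"] conjI ballI f)
  fix t assume t: "t \<in> N"
  show "ksgn j I * e (I - {j}) {t} \<in> lspan (G (I - {j}) {t})" if "j \<in> I" for j
   using e[of "I - {j}" "{t}"] card_remove_index[OF that] t by (auto simp: ksgn_def minus_one_power_iff lspan_uminus)
  have "qt (f I) {t} = f I {}" by (simp add: kd_def)
  thus "s t - f I {} = (\<Sum>j\<in>I. F j * (ksgn j I * e (I - {j}) {t}))"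
   using sef[of "{t}"] t by (simp add: kd_def mult_ac)
 qed
qed

end

section \<open>Cones of a complete fan\<close>

lemma convex_cone_hull_finite_explicit:
 fixes A :: "'a::real_vector set"
 assumes "finite A"
 shows "convex_cone hull A = {\<Sum>a\<in>A. c a *\<^sub>R a |c. \<forall>a\<in>A. (0::real) \<le> c a}" (is "_ = ?R")
proof (rule equalityI)
 have sc: "(\<Sum>a\<in>A. c a *\<^sub>R a) \<in> ?R" if "\<forall>a\<in>A. 0 \<le> c a" for c using that by blast
 have "convex_cone ?R" unfolding convex_cone_iff
 proof (intro conjI ballI allI impI)
  show "0 \<in> ?R" using sc[of "%_. 0"] by simp
  fix x assume "x \<in> ?R"
  then obtain c where c: "x = (\<Sum>a\<in>A. c a *\<^sub>R a)" "\<forall>a\<in>A. 0 \<le> c a" by blast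
  show "t *\<^sub>R x \<in> ?R" if "0 \<le> t" for t
   using sc[of "%a. t * c a"] c that by (simp add: scaleR_sum_right)
  show "x + y \<in> ?R" if y: "y \<in> ?R" for y
  proof -
   obtain d where d: "y = (\<Sum>a\<in>A. d a *\<^sub>R a)" "\<forall>a\<in>A. 0 \<le> d a" using y by blast
   thus ?thesis using sc[of "%a. c a + d a"] c by (simp add: scaleR_add_left sum.distrib)
  qed
 qed
 moreover have "A \<subseteq> ?R"
 proof
  fix a assume a: "a \<in> A"
  have "(\<Sum>x\<in>A. (if x = a then 1 else 0) *\<^sub>R x) = a"
   using assms a by (simp add: if_distrib[of "%c. c *\<^sub>R _"] cong: if_cong)
  thus "a \<in> ?R" using sc[of "%x. if x = a then 1 else 0"] by simp
 qed
 ultimately show "convex_cone hull A \<subseteq> ?R" by (intro hull_minimal)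
 show "?R \<subseteq> convex_cone hull A"
 proof
  fix x assume "x \<in> ?R"
  then obtain c where c: "x = (\<Sum>a\<in>A. c a *\<^sub>R a)" "\<forall>a\<in>A. 0 \<le> c a" by blast
  have "(\<Sum>a\<in>B. c a *\<^sub>R a) \<in> convex_cone hull A" if "B \<subseteq> A" for B
   using finite_subset[OF that assms] that
  proof (induction B rule: finite_induct)
   case (insert b B)
   hence "b \<in> A" "0 \<le> c b" using c(2) by auto
   hence "c b *\<^sub>R b \<in> convex_cone hull A" by (intro convex_cone_hull_mul hull_inc)
   with insert show ?case by (simp add: convex_cone_hull_add)
  qed (simp add: convex_cone_hull_contains_0)
  thus "x \<in> convex_cone hull A" unfolding c(1) by simp
 qed
qed

lemma extreme_ray_face:
 fixes A :: "'a::real_vector set"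
 assumes fin: "finite A" and scv: "convex_cone hull A \<inter> uminus ` (convex_cone hull A) = {0}"
  and nz: "0 \<notin> A" and a: "a \<in> A" and min: "a \<notin> convex_cone hull (A - {a})"
 shows "convex_cone hull {a} face_of convex_cone hull A" unfolding face_of_def
proof (intro conjI ballI impI)
 let ?sg = "convex_cone hull A"
 have ray: "x \<in> convex_cone hull {a} \<longleftrightarrow> (\<exists>c\<ge>0. x = c *\<^sub>R a)" for x
  by (subst convex_cone_hull_finite_explicit) auto
 show "convex_cone hull {a} \<subseteq> ?sg" using a by (intro hull_mono) auto
 show "convex (convex_cone hull {a})" by (rule convex_convex_cone_hull)
 have zero: "w = 0" if "w \<in> ?sg" "- w \<in> ?sg" for w
 proof -
  have "w \<in> uminus ` ?sg" using that(2) by (metis image_eqI minus_minus)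
  with that(1) scv show ?thesis by blast
 qed
 have sum_in: "(\<Sum>b\<in>B. c b *\<^sub>R b) \<in> convex_cone hull B" if "B \<subseteq> A" "!!b. b \<in> B ==> 0 \<le> c b" for B c
  using that finite_subset[OF that(1) fin] by (subst convex_cone_hull_finite_explicit) auto
 have key: "\<exists>c\<ge>0. p = c *\<^sub>R a" if p: "p \<in> ?sg" and q: "q \<in> ?sg" and pq: "p + q = s *\<^sub>R a" for p q s
 proof -
  obtain c where c: "p = (\<Sum>b\<in>A. c b *\<^sub>R b)" "\<forall>b\<in>A. 0 \<le> c b"
   using p convex_cone_hull_finite_explicit[OF fin] by auto
  obtain d where d: "q = (\<Sum>b\<in>A. d b *\<^sub>R b)" "\<forall>b\<in>A. 0 \<le> d b"
   using q convex_cone_hull_finite_explicit[OF fin] by auto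
  \<comment> \<open>The generators other than \<open>a\<close> contribute a multiple of
    \<open>a\<close> to \<open>p + q\<close>. A positive multiple contradicts \<open>min\<close>;
    otherwise both \<open>w\<close> and \<open>- w\<close> are in the cone, and strong convexity
    kills every summand of \<open>w\<close>.\<close>
  define w where "w = (\<Sum>b\<in>A - {a}. (c b + d b) *\<^sub>R b)"
  have pw: "p + q = (c a + d a) *\<^sub>R a + w"
   unfolding c(1) d(1) w_def sum.distrib[symmetric] scaleR_add_left[symmetric]
   by (rule sum.remove[OF fin a])
  have w: "w = (s - (c a + d a)) *\<^sub>R a" using pw pq by (simp add: algebra_simps)
  have wA: "w \<in> convex_cone hull (A - {a})"
   unfolding w_def using c(2) d(2) by (intro sum_in) auto
  have wsg: "w \<in> ?sg" using wA hull_mono[of "A - {a}" A] by blast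
  have "s - (c a + d a) \<le> 0"
  proof (rule ccontr)
   assume "\<not> s - (c a + d a) \<le> 0"
   hence "(1 / (s - (c a + d a))) *\<^sub>R w = a" "0 \<le> 1 / (s - (c a + d a))" by (simp_all add: w)
   with convex_cone_hull_mul[OF wA] min show False by metis
  qed
  hence "- w \<in> ?sg"
   using convex_cone_hull_mul[OF hull_inc[OF a], of "(c a + d a) - s"] by (simp add: w algebra_simps)
  with zero[OF wsg] have w0: "w = 0" by simp
  have "c b = 0" if b: "b \<in> A - {a}" for b
  proof -
   have "w = (c b + d b) *\<^sub>R b + (\<Sum>x\<in>A - {a} - {b}. (c x + d x) *\<^sub>R x)"
    unfolding w_def using fin b by (intro sum.remove) auto
   hence "- ((c b + d b) *\<^sub>R b) = (\<Sum>x\<in>A - {a} - {b}. (c x + d x) *\<^sub>R x)"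
    unfolding w0 by (intro minus_unique) (rule sym)
   also have "... \<in> ?sg"
    using sum_in[of "A - {a} - {b}" "%x. c x + d x"] c(2) d(2) hull_mono[of "A - {a} - {b}" A] by auto
   finally have "- ((c b + d b) *\<^sub>R b) \<in> ?sg" .
   moreover have "(c b + d b) *\<^sub>R b \<in> ?sg"
    using b c(2) d(2) by (intro convex_cone_hull_mul hull_inc) auto
   ultimately have "(c b + d b) *\<^sub>R b = 0" using zero by blast
   moreover have "b ~= 0" using b nz by auto
   ultimately have "c b + d b = 0" by simp
   thus ?thesis using b c(2) d(2) by (metis DiffD1 add_nonneg_eq_0_iff)
  qed
  hence "(\<Sum>b\<in>A. c b *\<^sub>R b) = c a *\<^sub>R a"
   using sum.remove[OF fin a, of "%b. c b *\<^sub>R b"] by simp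
  with c a show ?thesis by auto
 qed
 fix p q x assume pq: "p \<in> ?sg" "q \<in> ?sg" and x: "x \<in> convex_cone hull {a}" "x \<in> open_segment p q"
 obtain t where t: "0 < t" "t < 1" "x = (1 - t) *\<^sub>R p + t *\<^sub>R q" using x(2) by (auto simp: in_segment)
 obtain s where s: "x = s *\<^sub>R a" using x(1) ray by blast
 have p': "(1 - t) *\<^sub>R p \<in> ?sg" and q': "t *\<^sub>R q \<in> ?sg" using pq t by (auto intro: convex_cone_hull_mul)
 obtain c where c: "c \<ge> 0" "(1 - t) *\<^sub>R p = c *\<^sub>R a" using key[OF p' q', of s] t s by auto
 obtain d where d: "d \<ge> 0" "t *\<^sub>R q = d *\<^sub>R a" using key[OF q' p', of s] t s by (auto simp: add.commute)
 have "p = (1 / (1 - t)) *\<^sub>R ((1 - t) *\<^sub>R p)" using t by simp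
 also have "... = (c / (1 - t)) *\<^sub>R a" unfolding c(2) by simp
 finally show "p \<in> convex_cone hull {a}" unfolding ray using c(1) t by (intro exI[of _ "c / (1 - t)"]) simp
 have "q = (1 / t) *\<^sub>R (t *\<^sub>R q)" using t by simp
 also have "... = (d / t) *\<^sub>R a" unfolding d(2) by simp
 finally show "q \<in> convex_cone hull {a}" unfolding ray using d(1) t by (intro exI[of _ "d / t"]) simp
qed

lemma aff_dim_ray:
 fixes a :: "'a::euclidean_space"
 assumes "a ~= 0"
 shows "aff_dim (convex_cone hull {a}) = 1"
proof -
 have ray: "x \<in> convex_cone hull {a} \<longleftrightarrow> (\<exists>c\<ge>0. x = c *\<^sub>R a)" for x
  by (subst convex_cone_hull_finite_explicit) auto
 have "0 \<in> affine hull (convex_cone hull {a})" by (intro hull_inc convex_cone_hull_contains_0)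
 hence "aff_dim (convex_cone hull {a}) = dim (convex_cone hull {a})" by (rule aff_dim_zero)
 also have "dim (convex_cone hull {a}) = dim {a}"
 proof (rule antisym)
  have "convex_cone hull {a} \<subseteq> span {a}"
  proof
   fix x assume "x \<in> convex_cone hull {a}"
   then obtain c where "x = c *\<^sub>R a" unfolding ray by blast
   thus "x \<in> span {a}" by (simp add: span_scale span_base)
  qed
  thus "dim (convex_cone hull {a}) \<le> dim {a}" by (metis dim_span dim_subset)
  show "dim {a} \<le> dim (convex_cone hull {a})" by (rule dim_subset) (auto intro: hull_inc)
 qed
 also have "dim {a} = 1" using assms by (simp add: dim_insert)
 finally show ?thesis by simp
qed

locale toric =
 fixes \<Sigma> :: "(real ^ 'n) set set" and u :: "'k::finite => int ^ 'n"
 assumes complete: "complete_fan \<Sigma>" and ray_gen: "ray_generators \<Sigma> u"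
begin

definition gens :: "(real ^ 'n) set => (int ^ 'n) set" where
 "gens sg = u ` {i. rvec (u i) \<in> sg}"

abbreviation "dc sg \<equiv> dual (gens sg)"

lemma finite_gens [simp]: "finite (gens sg)" by (simp add: gens_def)

lemma fan: "fan \<Sigma>" using complete by (simp add: complete_fan_def)

lemma finite_\<Sigma>: "finite \<Sigma>" using fan by (simp add: fan_def)

lemma covers: "\<exists>sg\<in>\<Sigma>. v \<in> sg" using complete by (auto simp: complete_fan_def)

lemma u_nonzero: "u i ~= 0"
proof
 assume "u i = 0"
 moreover have "Gcd (range (%j. u i $ j)) = 1" using ray_gen by (simp add: ray_generators_def)
 ultimately show False by (simp add: image_constant_conv)
qed

lemma cone_explicit:
 assumes "sg \<in> \<Sigma>"
 obtains A where "finite A" "sg = convex_cone hull (rvec ` A)"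
proof -
 have "rational_polyhedral_cone sg" using fan assms by (simp add: fan_def)
 thus thesis using that by (auto simp: rational_polyhedral_cone_def)
qed

lemma cone_zero: "sg \<in> \<Sigma> ==> 0 \<in> sg"
 by (erule cone_explicit) (simp add: convex_cone_hull_contains_0)

lemma cone_scale: "sg \<in> \<Sigma> ==> x \<in> sg ==> 0 \<le> c ==> c *\<^sub>R x \<in> sg"
 by (erule cone_explicit) (simp add: convex_cone_hull_mul)

lemma cone_polyhedron: "sg \<in> \<Sigma> ==> polyhedron sg"
 by (erule cone_explicit) (simp add: polyhedron_convex_cone_hull)

lemma cone_strongly_convex: "sg \<in> \<Sigma> ==> sg \<inter> uminus ` sg = {0}"
 using fan by (simp add: fan_def strongly_convex_def)

lemma face_in_fan: "sg \<in> \<Sigma> ==> tc face_of sg ==> tc ~= {} ==> tc \<in> \<Sigma>"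
 using fan by (simp add: fan_def)

lemma Int_face: "sg \<in> \<Sigma> ==> tc \<in> \<Sigma> ==> (sg \<inter> tc) face_of sg"
 using fan by (simp add: fan_def)

lemma Int_in_fan: "sg \<in> \<Sigma> ==> tc \<in> \<Sigma> ==> sg \<inter> tc \<in> \<Sigma>"
 using face_in_fan[OF _ Int_face] cone_zero by blast

lemma subset_face: "sg \<in> \<Sigma> ==> tc \<in> \<Sigma> ==> tc \<subseteq> sg ==> tc face_of sg"
 using Int_face[of sg tc] by (simp add: Int_absorb1)

text \<open>In a generating set of least size every element spans an extreme ray, which is a
  one-dimensional cone of the fan and so is spanned by some \<open>u i\<close>.\<close>

lemma cone_generated:
 assumes sg: "sg \<in> \<Sigma>"
 shows "sg = convex_cone hull (rvec ` gens sg)"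
proof -
 obtain A0 where A0: "finite A0" "sg = convex_cone hull (rvec ` A0)" using cone_explicit[OF sg] .
 define \<A> where "\<A> = {A. A \<subseteq> rvec ` A0 - {0} \<and> convex_cone hull A = sg}"
 have "convex_cone hull (rvec ` A0 - {0}) = sg"
 proof
  show "convex_cone hull (rvec ` A0 - {0}) \<subseteq> sg" unfolding A0(2) by (intro hull_mono) auto
  have "rvec ` A0 \<subseteq> convex_cone hull (rvec ` A0 - {0})"
  proof
   fix a assume "a \<in> rvec ` A0"
   thus "a \<in> convex_cone hull (rvec ` A0 - {0})"
    by (cases "a = 0") (auto simp: convex_cone_hull_contains_0 intro: hull_inc)
  qed
  thus "sg \<subseteq> convex_cone hull (rvec ` A0 - {0})"
   unfolding A0(2) by (intro hull_minimal convex_cone_convex_cone_hull)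
 qed
 hence "rvec ` A0 - {0} \<in> \<A>" by (simp add: \<A>_def)
 have fin\<A>: "finite A" if "A \<in> \<A>" for A
  using that A0(1) finite_subset[of A "rvec ` A0 - {0}"] by (simp add: \<A>_def)
 obtain A where A: "A \<in> \<A>" "!!A'. A' \<in> \<A> ==> card A \<le> card A'"
  using ex_has_least_nat[of "%A. A \<in> \<A>" _ card] \<open>rvec ` A0 - {0} \<in> \<A>\<close> by blast
 have finA: "finite A" and hullA: "convex_cone hull A = sg" and zA: "0 \<notin> A"
  using A(1) fin\<A> by (auto simp: \<A>_def)
 have "a \<in> convex_cone hull (rvec ` gens sg)" if a: "a \<in> A" for a
 proof -
  have "a \<notin> convex_cone hull (A - {a})"
  proof
   assume "a \<in> convex_cone hull (A - {a})"
   hence "convex_cone hull (A - {a}) = convex_cone hull A" by (metis hull_redundant insert_Diff a)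
   hence "A - {a} \<in> \<A>" using A(1) by (auto simp: \<A>_def)
   thus False using A(2)[of "A - {a}"] finA a by (metis card_Diff1_less leD)
  qed
  hence "convex_cone hull {a} face_of sg"
   using extreme_ray_face[OF finA _ zA a] cone_strongly_convex[OF sg] hullA by simp
  hence "convex_cone hull {a} \<in> \<Sigma>"
   using face_in_fan[OF sg] convex_cone_hull_nonempty by blast
  moreover have "aff_dim (convex_cone hull {a}) = 1" using aff_dim_ray[of a] a zA by metis
  ultimately have ray: "convex_cone hull {a} \<in> {fc \<in> \<Sigma>. aff_dim fc = 1}" by simp
  have "range (%i. convex_cone hull {rvec (u i)}) = {fc \<in> \<Sigma>. aff_dim fc = 1}"
   using ray_gen by (simp add: ray_generators_def bij_betw_def)
  with ray have "convex_cone hull {a} \<in> range (%i. convex_cone hull {rvec (u i)})" by (simp only:)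
  then obtain i where i: "convex_cone hull {rvec (u i)} = convex_cone hull {a}" by auto
  have "rvec (u i) \<in> sg"
  proof -
   have "rvec (u i) \<in> convex_cone hull {a}" unfolding i[symmetric] by (rule hull_inc) simp
   also have "... \<subseteq> sg" unfolding hullA[symmetric] using a by (intro hull_mono) simp
   finally show ?thesis .
  qed
  have "a \<in> convex_cone hull {rvec (u i)}" unfolding i by (rule hull_inc) simp
  also have "... \<subseteq> convex_cone hull (rvec ` gens sg)"
   using \<open>rvec (u i) \<in> sg\<close> by (intro hull_mono) (auto simp: gens_def)
  finally show ?thesis .
 qed
 hence "sg \<subseteq> convex_cone hull (rvec ` gens sg)"
  unfolding hullA[symmetric] by (intro hull_minimal convex_cone_convex_cone_hull) auto
 moreover have "convex_cone hull (rvec ` gens sg) \<subseteq> sg"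
 proof (rule hull_minimal)
  show "rvec ` gens sg \<subseteq> sg" by (auto simp: gens_def)
  show "convex_cone sg" unfolding hullA[symmetric] by (rule convex_cone_convex_cone_hull)
 qed
 ultimately show ?thesis by blast
qed

lemma cone_combination:
 assumes "sg \<in> \<Sigma>" "v \<in> sg"
 shows "\<exists>c. (\<forall>w\<in>gens sg. 0 \<le> c w) \<and> v = (\<Sum>w\<in>gens sg. c w *\<^sub>R rvec w)"
proof -
 have "v \<in> convex_cone hull (rvec ` gens sg)" using assms cone_generated by blast
 then obtain c where c: "v = (\<Sum>a\<in>rvec ` gens sg. c a *\<^sub>R a)" "\<forall>a\<in>rvec ` gens sg. 0 \<le> c a"
  by (subst (asm) convex_cone_hull_finite_explicit) auto
 have "v = (\<Sum>w\<in>gens sg. c (rvec w) *\<^sub>R rvec w)"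
  unfolding c(1) by (subst sum.reindex) (auto simp: inj_on_def)
 with c(2) show ?thesis by (intro exI[of _ "%w. c (rvec w)"]) auto
qed

lemma inner_cone_nonneg:
 assumes "sg \<in> \<Sigma>" "v \<in> sg" "!!w. w \<in> gens sg ==> 0 \<le> y \<bullet> rvec w"
 shows "0 \<le> y \<bullet> v"
proof -
 obtain c where c: "!!w. w \<in> gens sg ==> 0 \<le> c w" "v = (\<Sum>w\<in>gens sg. c w *\<^sub>R rvec w)"
  using cone_combination[OF assms(1,2)] by blast
 show ?thesis unfolding c(2) inner_sum_right
  using c(1) assms(3) by (intro sum_nonneg) (simp add: inner_simps)
qed

lemma dual_monoid_eq:
 assumes "sg \<in> \<Sigma>"
 shows "dual_monoid sg = dc sg"
proof
 show "dual_monoid sg \<subseteq> dc sg"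
 proof
  fix m assume "m \<in> dual_monoid sg"
  hence "0 \<le> rvec m \<bullet> rvec (u i)" if "rvec (u i) \<in> sg" for i using that by (auto simp: dual_monoid_def)
  thus "m \<in> dc sg" by (auto simp: dual_def gens_def rvec_inner)
 qed
 show "dc sg \<subseteq> dual_monoid sg"
  using inner_cone_nonneg[OF assms] by (auto simp: dual_monoid_def dual_def rvec_inner)
qed

lemma gens_mono: "tc \<subseteq> sg ==> gens tc \<subseteq> gens sg" by (auto simp: gens_def)

lemma dual_anti: "tc \<subseteq> sg ==> dc sg \<subseteq> dc tc"
 using gens_mono[of tc sg] by (auto simp: dual_def)

text \<open>Faces of polyhedra are exposed by a real functional; it is made integral by rounding
  that keeps its signs on the finitely many generators.\<close>

lemma face_functional:
 assumes sg: "sg \<in> \<Sigma>" and tc: "tc face_of sg" "0 \<in> tc"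
 obtains m where "m \<in> dc sg" "!!w. w \<in> gens sg ==> pairing m w = 0 \<longleftrightarrow> rvec w \<in> tc"
proof -
 have "tc exposed_face_of sg" using exposed_face_of_polyhedron[OF cone_polyhedron[OF sg]] tc(1) by blast
 then obtain a b where ab: "sg \<subseteq> {x. a \<bullet> x \<le> b}" "tc = sg \<inter> {x. a \<bullet> x = b}"
  by (auto simp: exposed_face_of_def)
 have "b = 0" using ab(2) tc(2) by auto
 obtain q m where m: "\<forall>w\<in>gens sg. sgn (real_of_int (pairing m w)) = sgn ((- a) \<bullet> rvec w)"
  using ex_int_same_signs[OF finite_gens zero_less_one, of "- a"] by blast
 have gsg: "rvec w \<in> sg" if "w \<in> gens sg" for w using that by (auto simp: gens_def)
 show thesis
 proof (rule that)
  show "m \<in> dc sg" unfolding dual_def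
  proof (intro CollectI ballI)
   fix w assume w: "w \<in> gens sg"
   have "sgn ((- a) \<bullet> rvec w) \<ge> 0" using ab(1) gsg[OF w] \<open>b = 0\<close> by (auto simp: sgn_if)
   hence "sgn (real_of_int (pairing m w)) \<ge> 0" using m w by simp
   thus "0 \<le> pairing m w" by (simp add: sgn_if split: if_splits)
  qed
  show "pairing m w = 0 \<longleftrightarrow> rvec w \<in> tc" if w: "w \<in> gens sg" for w
  proof -
   have "pairing m w = 0 \<longleftrightarrow> sgn (real_of_int (pairing m w)) = 0" by (simp add: sgn_zero_iff)
   also have "... \<longleftrightarrow> sgn ((- a) \<bullet> rvec w) = 0" using m w by simp
   also have "... \<longleftrightarrow> a \<bullet> rvec w = 0" by (simp add: sgn_zero_iff)
   also have "... \<longleftrightarrow> rvec w \<in> tc" using ab(2) gsg[OF w] \<open>b = 0\<close> by auto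
   finally show ?thesis .
  qed
 qed
qed

text \<open>Strong convexity makes the origin a face, so some functional is positive on all
  generators. The functionals with this property form an open set inside the dual cone.\<close>

lemma dim_dual_cone:
 assumes sg: "sg \<in> \<Sigma>"
 shows "dim (rface (gens sg) {}) = CARD('n)"
proof -
 have zero_face: "{0} face_of sg" unfolding face_of_def
 proof (intro conjI ballI impI)
  fix p q x assume pq: "p \<in> sg" "q \<in> sg" and x: "x \<in> {0}" "x \<in> open_segment p q"
  obtain t where t: "0 < t" "t < 1" "(1 - t) *\<^sub>R p + t *\<^sub>R q = 0"
   using x by (auto simp: in_segment)
  have tp: "(1 - t) *\<^sub>R p \<in> sg" "t *\<^sub>R q \<in> sg" using cone_scale[OF sg] pq t by auto
  have "(1 - t) *\<^sub>R p = - (t *\<^sub>R q)" using t(3) by (simp add: eq_neg_iff_add_eq_0)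
  hence "(1 - t) *\<^sub>R p \<in> sg \<inter> uminus ` sg" using tp by auto
  hence p0: "(1 - t) *\<^sub>R p = 0" using cone_strongly_convex[OF sg] by blast
  thus "p \<in> {0}" using t by simp
  show "q \<in> {0}" using t p0 by auto
 qed (use cone_zero[OF sg] in auto)
 obtain m where m: "m \<in> dc sg" "!!w. w \<in> gens sg ==> pairing m w = 0 \<longleftrightarrow> rvec w \<in> {0}"
  using face_functional[OF sg zero_face] by blast
 define W where "W = (\<Inter>w\<in>gens sg. {y. y \<bullet> rvec w > 0})"
 have "open W" unfolding W_def by (intro open_INT finite_gens ballI) (subst inner_commute, rule open_halfspace_gt)
 moreover have "rvec m \<in> W" unfolding W_def
 proof (intro INT_I CollectI)
  fix w assume w: "w \<in> gens sg"
  hence "rvec w ~= 0" using u_nonzero rvec_eq_iff[of _ 0] by (auto simp: gens_def simp del: rvec_eq_iff)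
  hence "pairing m w ~= 0" using m(2)[OF w] by simp
  moreover have "pairing m w \<ge> 0" using m(1) w by (simp add: dual_def)
  ultimately show "rvec m \<bullet> rvec w > 0" by (simp add: rvec_inner)
 qed
 ultimately have "dim W = dim (UNIV :: (real ^ 'n) set)" by (intro dim_openin) auto
 hence W: "dim W = CARD('n)" by simp
 have "W \<subseteq> rface (gens sg) {}" by (auto simp: W_def rface_def intro: less_imp_le)
 hence "dim W \<le> dim (rface (gens sg) {})" by (rule dim_subset)
 moreover have "dim (rface (gens sg) {}) \<le> CARD('n)"
  using dim_subset_UNIV[of "rface (gens sg) {}"] by simp
 ultimately show ?thesis using W by simp
qed

text \<open>By completeness \<open>rvec m\<close> itself lies in a cone, so it is a combination of
  ray generators and is orthogonal to itself.\<close>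

lemma pairing_all_zero: "(!!i. pairing m (u i) = 0) ==> m = 0"
proof -
 assume z: "!!i. pairing m (u i) = 0"
 obtain sg where sg: "sg \<in> \<Sigma>" "rvec m \<in> sg" using covers by blast
 obtain c where c: "rvec m = (\<Sum>w\<in>gens sg. c w *\<^sub>R rvec w)" using cone_combination[OF sg] by blast
 have "rvec m \<bullet> rvec m = (\<Sum>w\<in>gens sg. c w * (rvec m \<bullet> rvec w))"
  by (subst (2) c) (simp add: inner_sum_right)
 also have "... = 0" using z by (intro sum.neutral) (auto simp: gens_def rvec_inner)
 finally have "rvec m = rvec 0" by simp
 thus "m = 0" by (simp only: rvec_eq_iff)
qed

lemma inj_char_div: "inj (char_div u)"
proof (rule injI)
 fix m m' assume "char_div u m = char_div u m'"
 hence "pairing (m - m') (u i) = 0" for i by (simp add: char_div_def vec_eq_iff pairing_diff)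
 hence "m - m' = 0" by (rule pairing_all_zero)
 thus "m = m'" by simp
qed

end

section \<open>Global sections of nef divisors\<close>

lemma mon_inverse [simp]: "mon (- m) 1 * (mon m 1 * f) = f" "mon m 1 * (mon (- m) 1 * f) = f"
 for m :: "'m::ab_group_add" by (simp_all add: mult_single flip: mult.assoc)

lemma lspan_shift: "mon a 1 * f \<in> lspan Q \<longleftrightarrow> f \<in> lspan {m. a + m \<in> Q}" for a :: "'m::ab_group_add"
proof
 assume f: "mon a 1 * f \<in> lspan Q"
 have "mon (- a) 1 * (mon a 1 * f) \<in> lspan {m. a + m \<in> Q}"
  by (rule lspan_mult[OF _ f, of _ "{- a}"]) auto
 thus "f \<in> lspan {m. a + m \<in> Q}" by simp
next
 assume f: "f \<in> lspan {m. a + m \<in> Q}"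
 show "mon a 1 * f \<in> lspan Q" by (rule lspan_mult[OF _ f, of _ "{a}"]) auto
qed

lemma cexact_cong: "(!!T. T \<subseteq> N ==> T \<in> G \<longleftrightarrow> T \<in> H) ==> cexact N G \<longleftrightarrow> cexact N H"
 unfolding cexact_def by (simp cong: imp_cong)

text \<open>Characters that are sections of the divisor \<open>a\<close> over the chart of
  \<open>fc\<close>. The value \<open>UNIV\<close> imposes the conditions of all rays and gives the
  global sections, in accordance with the empty intersection of cones.\<close>

definition poly_pts :: "('k => int ^ 'n) => int ^ 'k => (real ^ 'n) set => (int ^ 'n) set" where
 "poly_pts u a fc = {m. \<forall>i. rvec (u i) \<in> fc --> pairing m (u i) \<ge> - a $ i}"

abbreviation "secs u a fc \<equiv> lspan (poly_pts u a fc)"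

lemma poly_pts_add:
 "m \<in> poly_pts u a fc ==> m' \<in> poly_pts u a' fc ==> m + m' \<in> poly_pts u (a + a') fc"
 unfolding poly_pts_def
proof (intro CollectI allI impI)
 fix i assume "m \<in> {m. \<forall>i. rvec (u i) \<in> fc --> - a $ i \<le> pairing m (u i)}"
  "m' \<in> {m. \<forall>i. rvec (u i) \<in> fc --> - a' $ i \<le> pairing m (u i)}" "rvec (u i) \<in> fc"
 hence "- a $ i \<le> pairing m (u i)" "- a' $ i \<le> pairing m' (u i)" by auto
 thus "- (a + a') $ i \<le> pairing (m + m') (u i)" by (simp add: pairing_add)
qed

lemma poly_pts_anti: "fc' \<subseteq> fc ==> poly_pts u a fc \<subseteq> poly_pts u a fc'"
 by (auto simp: poly_pts_def)

context toric
begin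

text \<open>The character of \<open>m sg\<close> generates the line bundle of the divisor \<open>a\<close> on the chart of \<open>sg\<close>, and is
 a global section.\<close>

definition nef_data :: "int ^ 'k => ((real ^ 'n) set => int ^ 'n) => bool" where
 "nef_data a m \<longleftrightarrow> (\<forall>sg\<in>\<Sigma>. \<forall>i. (rvec (u i) \<in> sg --> pairing (m sg) (u i) = - a $ i) \<and> pairing (m sg) (u i) \<ge> - a $ i)"

lemma nef_data_zero: "nef_data 0 (%_. 0)" by (simp add: nef_data_def)

lemma nef_data_add: "nef_data a m ==> nef_data a' m' ==> nef_data (a + a') (%sg. m sg + m' sg)"
 unfolding nef_data_def
proof (intro ballI allI conjI impI)
 fix sg i
 assume h: "\<forall>sg\<in>\<Sigma>. \<forall>i. (rvec (u i) \<in> sg --> pairing (m sg) (u i) = - a $ i) \<and> pairing (m sg) (u i) \<ge> - a $ i"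
  "\<forall>sg\<in>\<Sigma>. \<forall>i. (rvec (u i) \<in> sg --> pairing (m' sg) (u i) = - a' $ i) \<and> pairing (m' sg) (u i) \<ge> - a' $ i"
  and sg: "sg \<in> \<Sigma>"
 note h1 = h(1)[rule_format, OF sg, of i] and h2 = h(2)[rule_format, OF sg, of i]
 show "- (a + a') $ i \<le> pairing (m sg + m' sg) (u i)" using h1 h2 by (simp add: pairing_add)
 show "pairing (m sg + m' sg) (u i) = - (a + a') $ i" if "rvec (u i) \<in> sg"
  using h1 h2 that by (simp add: pairing_add)
qed

lemma nef_data_sum:
 "(!!j. j \<in> J ==> nef_data (a j) (m j)) ==> nef_data (\<Sum>j\<in>J. a j) (%sg. \<Sum>j\<in>J. m j sg)"
 by (induction J rule: infinite_finite_induct) (simp_all add: nef_data_zero nef_data_add)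

lemma nef_data_poly_pts:
 assumes "nef_data a m" "sg \<in> \<Sigma>"
 shows "x \<in> poly_pts u a sg \<longleftrightarrow> x - m sg \<in> dc sg"
proof -
 have e: "pairing (m sg) (u i) = - a $ i" if "rvec (u i) \<in> sg" for i
  using assms that by (simp add: nef_data_def)
 have "x \<in> poly_pts u a sg \<longleftrightarrow> (\<forall>i. rvec (u i) \<in> sg --> 0 \<le> pairing (x - m sg) (u i))"
  unfolding poly_pts_def mem_Collect_eq
 proof (intro all_cong1 imp_cong refl)
  show "(- a $ i \<le> pairing x (u i)) = (0 \<le> pairing (x - m sg) (u i))" if "rvec (u i) \<in> sg" for i
   using e[OF that] unfolding pairing_diff by linarith
 qed
 thus ?thesis by (auto simp: dual_def gens_def)
qed

lemma section_local:
 assumes "nef_data a m" "sg \<in> \<Sigma>" "f \<in> secs u a UNIV"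
 shows "mon (- m sg) 1 * f \<in> lspan (dc sg)"
proof -
 have "f \<in> secs u a sg" by (rule lspan_mono[OF assms(3) poly_pts_anti]) simp
 thus ?thesis
  unfolding lspan_shift by (rule lspan_mono) (use nef_data_poly_pts[OF assms(1,2)] in auto)
qed

text \<open>Nefness makes the region where the character of \<open>m\<close> fails to be a section convex.\<close>

lemma cech_nef:
 assumes nef: "nef_data a mm" and tc: "bij_betw tc N \<Sigma>" and N: "finite N"
 shows "cexact N {T. m \<in> poly_pts u a (\<Inter>t\<in>T. tc t)}"
proof -
 have tc\<Sigma>: "tc t \<in> \<Sigma>" if "t \<in> N" for t using tc that by (auto simp: bij_betw_def)
 have "\<exists>H. finite H \<and> tc t = {x. \<forall>(a, b)\<in>H. a \<bullet> x \<le> b}" if t: "t \<in> N" for t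
  by (rule polyhedron_halfspaces[OF cone_polyhedron[OF tc\<Sigma>[OF t]]]) (intro exI conjI)
 hence "\<exists>Hs. \<forall>t\<in>N. finite (Hs t) \<and> tc t = {x. \<forall>(a, b)\<in>Hs t. a \<bullet> x \<le> b}" by (intro bchoice ballI)
 then obtain Hs where Hs: "\<forall>t\<in>N. finite (Hs t) \<and> tc t = {x. \<forall>(a, b)\<in>Hs t. a \<bullet> x \<le> b}" by (elim exE)
 \<comment> \<open>By nefness the support function of the divisor is the least of the linear
   functions \<open>mm sg\<close>, so \<open>Z\<close> is the region where \<open>m\<close> is
   strictly below the support function. As an intersection of half-spaces it is convex.\<close>
 define Z where "Z = (\<Inter>sg\<in>\<Sigma>. {v. (rvec m - rvec (mm sg)) \<bullet> v < 0})"
 have cov: "\<exists>t\<in>N. v \<in> tc t" for v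
 proof -
  obtain sg where "sg \<in> \<Sigma>" "v \<in> sg" using covers[of v] by blast
  moreover have "tc ` N = \<Sigma>" using tc by (simp add: bij_betw_def)
  ultimately show ?thesis by blast
 qed
 have "cexact N {T. (\<Inter>j\<in>T \<inter> N. tc j) \<inter> Z = {}}"
 proof (rule nerve_exact[of N Hs tc Z])
  show "finite N" by (rule N)
  show "N ~= {}" using cov[of 0] by blast
  show "finite (Hs j)" if "j \<in> N" for j using Hs that by blast
  show "tc j = {x. \<forall>(a, b)\<in>Hs j. a \<bullet> x \<le> b}" if "j \<in> N" for j using Hs that by blast
  show "convex Z" unfolding Z_def by (intro convex_INT convex_halfspace_lt)
  show "Z \<subseteq> (\<Union>j\<in>N. tc j)" using cov by blast
 qed
 moreover have "(\<Inter>j\<in>T \<inter> N. tc j) \<inter> Z = {} \<longleftrightarrow> m \<in> poly_pts u a (\<Inter>t\<in>T. tc t)" if T: "T \<subseteq> N" for T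
 proof -
  have TN: "T \<inter> N = T" using T by blast
  let ?fc = "\<Inter>t\<in>T. tc t"
  show ?thesis unfolding TN
  proof
   assume e: "?fc \<inter> Z = {}"
   show "m \<in> poly_pts u a ?fc" unfolding poly_pts_def
   proof (intro CollectI allI impI, rule ccontr)
    fix i assume i: "rvec (u i) \<in> ?fc" and neg: "\<not> - a $ i \<le> pairing m (u i)"
    have "rvec (u i) \<in> Z" unfolding Z_def
    proof (intro INT_I CollectI)
     fix sg assume "sg \<in> \<Sigma>"
     hence "- a $ i \<le> pairing (mm sg) (u i)" using nef by (simp add: nef_data_def)
     with neg have "pairing m (u i) < pairing (mm sg) (u i)" by linarith
     thus "(rvec m - rvec (mm sg)) \<bullet> rvec (u i) < 0" by (simp add: inner_simps rvec_inner)
    qed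
    with e i show False by blast
   qed
  next
   assume m: "m \<in> poly_pts u a ?fc"
   show "?fc \<inter> Z = {}"
   proof (rule ccontr)
    assume "?fc \<inter> Z ~= {}"
    then obtain v where v: "v \<in> ?fc" "v \<in> Z" by blast
    \<comment> \<open>For empty \<open>T\<close> the intersection is the whole space, and any cone
      containing \<open>v\<close> serves.\<close>
    obtain sg where sg: "sg \<in> \<Sigma>" "v \<in> sg" "sg \<subseteq> ?fc"
    proof (cases "T = {}")
     case True
     with covers[of v] that show ?thesis by auto
    next
     case False
     have "finite T" using T N by (rule finite_subset)
     hence "?fc \<in> \<Sigma>" using False T
     proof (induction T rule: finite_ne_induct)
      case (insert t T)
      hence "tc t \<inter> (\<Inter>t\<in>T. tc t) \<in> \<Sigma>" using tc\<Sigma> by (intro Int_in_fan) auto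
      thus ?case by simp
     qed (use tc\<Sigma> in auto)
     thus ?thesis using that v(1) by blast
    qed
    have "0 \<le> (rvec m - rvec (mm sg)) \<bullet> v"
    proof (rule inner_cone_nonneg[OF sg(1,2)])
     fix w assume "w \<in> gens sg"
     then obtain i where i: "w = u i" "rvec (u i) \<in> sg" by (auto simp: gens_def)
     have "- a $ i \<le> pairing m (u i)" using m i(2) sg(3) by (auto simp: poly_pts_def)
     moreover have "pairing (mm sg) (u i) = - a $ i" using nef sg(1) i(2) by (simp add: nef_data_def)
     ultimately show "0 \<le> (rvec m - rvec (mm sg)) \<bullet> rvec w" by (simp add: i(1) inner_simps rvec_inner)
    qed
    moreover have "(rvec m - rvec (mm sg)) \<bullet> v < 0" using v(2) sg(1) by (auto simp: Z_def)
    ultimately show False by simp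
   qed
  qed
 qed
 ultimately show ?thesis
  using cexact_cong[of N "{T. (\<Inter>j\<in>T \<inter> N. tc j) \<inter> Z = {}}" "{T. m \<in> poly_pts u a (\<Inter>t\<in>T. tc t)}"]
  by (simp only: mem_Collect_eq)
qed

end

text \<open>\<open>mm j sg\<close> and \<open>mb sg\<close> are exponents of local generators, so
  \<open>mon (- mm j sg) 1 * F j\<close> is the function that represents the section
  \<open>F j\<close> on the chart of \<open>sg\<close>. Zero-dimensionality of the common zero
  scheme is present in the form \<open>alg\<close>.\<close>

locale nef_system = toric \<Sigma> u for \<Sigma> :: "(real ^ 'n) set set" and u :: "'k::finite => int ^ 'n" +
 fixes I :: "nat set" and a :: "nat => int ^ 'k" and b :: "int ^ 'k"
  and mm :: "nat => (real ^ 'n) set => int ^ 'n" and mb :: "(real ^ 'n) set => int ^ 'n"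
  and F :: "nat => (int ^ 'n) \<Rightarrow>\<^sub>0 complex"
 assumes finI: "finite I" and cardI: "card I = CARD('n)"
  and nef_a: "!!j. j \<in> I ==> nef_data (a j) (mm j)" and nef_b: "nef_data b mb"
  and F: "!!j. j \<in> I ==> F j \<in> secs u (a j) UNIV"
  and alg: "!!sg g. sg \<in> \<Sigma> ==> g \<in> lspan (dc sg) ==>
   algebraic_mod (affine_monoid.gen_ideal (dc sg) I (%j. mon (- mm j sg) 1 * F j)) g"
begin

definition div_sum :: "nat set => int ^ 'k" where "div_sum J = b + (\<Sum>j\<in>J. a j)"
definition m_sum :: "nat set => (real ^ 'n) set => int ^ 'n" where "m_sum J sg = mb sg + (\<Sum>j\<in>J. mm j sg)"

lemma nef_sum: "J \<subseteq> I ==> nef_data (div_sum J) (m_sum J)"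
 unfolding div_sum_def m_sum_def[abs_def] by (intro nef_data_add nef_b nef_data_sum nef_a) auto

abbreviation "in_ideal sg f \<equiv> \<exists>y. (\<forall>j\<in>I. y j \<in> secs u (div_sum (I - {j})) sg) \<and> f = (\<Sum>j\<in>I. F j * y j)"

lemma F_local: "j \<in> I ==> sg \<in> \<Sigma> ==> mon (- mm j sg) 1 * F j \<in> lspan (dc sg)"
 by (rule section_local[OF nef_a _ F])

lemma div_sum_remove: "J \<subseteq> I ==> j \<in> J ==> div_sum J = a j + div_sum (J - {j})"
 using finite_subset[OF _ finI, of J] by (simp add: div_sum_def sum.remove[of J j] algebra_simps)

lemma m_sum_remove: "J \<subseteq> I ==> j \<in> J ==> m_sum J sg = mm j sg + m_sum (J - {j}) sg"
 using finite_subset[OF _ finI, of J] by (simp add: m_sum_def sum.remove[of J j] algebra_simps)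

lemma sect_iff:
 assumes "J \<subseteq> I" "sg \<in> \<Sigma>"
 shows "f \<in> secs u (div_sum J) sg \<longleftrightarrow> mon (- m_sum J sg) 1 * f \<in> lspan (dc sg)"
proof -
 have "poly_pts u (div_sum J) sg = {m. - m_sum J sg + m \<in> dc sg}"
  using nef_data_poly_pts[OF nef_sum[OF assms(1)] assms(2)] by auto
 thus ?thesis by (simp only: lspan_shift)
qed

text \<open>Dividing by the local generators turns sections into functions and respects the
  differential, because the generators multiply. By \<open>cardI\<close> the levels below the top
  are the levels below the dimension of the dual cone.\<close>

lemma local_koszul_exact:
 assumes sg: "sg \<in> \<Sigma>" and k: "k < card I"
  and z: "!!J. J \<subseteq> I ==> card J = k ==> z J \<in> secs u (div_sum J) sg"
  and dz: "!!J. J \<subseteq> I ==> card J = Suc k ==> kd F z J = 0"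
 shows "\<exists>y. (\<forall>J\<subseteq>I. Suc (card J) = k --> y J \<in> secs u (div_sum J) sg) \<and>
  (\<forall>J\<subseteq>I. card J = k --> z J = kd F y J)"
proof -
 define F' where "F' j = mon (- mm j sg) 1 * F j" for j
 define z' where "z' J = mon (- m_sum J sg) 1 * z J" for J
 have kd': "kd F' (%J. mon (- m_sum J sg) 1 * w J) J = mon (- m_sum J sg) 1 * kd F w J" if J: "J \<subseteq> I" for w J
  unfolding kd_def sum_distrib_left
 proof (intro sum.cong refl)
  fix j assume j: "j \<in> J"
  have "mon (- mm j sg) 1 * mon (- m_sum (J - {j}) sg) 1 = (mon (- m_sum J sg) 1 :: (int ^ 'n) \<Rightarrow>\<^sub>0 complex)"
   by (simp add: m_sum_remove[OF J j] mult_single)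
  thus "ksgn j J * F' j * (mon (- m_sum (J - {j}) sg) 1 * w (J - {j})) =
    mon (- m_sum J sg) 1 * (ksgn j J * F j * w (J - {j}))" by (simp add: F'_def mult_ac)
 qed
 obtain y where y: "!!J. J \<subseteq> I ==> Suc (card J) = k ==> y J \<in> lspan (dc sg)"
  "!!J. J \<subseteq> I ==> card J = k ==> z' J = kd F' y J"
 proof (rule koszul_exact_on_chart[OF finite_gens finI, of F' sg k z'])
  show "F' j \<in> lspan (dc sg)" if "j \<in> I" for j unfolding F'_def using that sg by (rule F_local)
  show "algebraic_mod (affine_monoid.gen_ideal (dc sg) I F') (mon m 1)" if "m \<in> dc sg" for m
   using alg[OF sg, of "mon m 1"] that by (simp add: F'_def[abs_def])
  show "k < dim (rface (gens sg) {})" using k dim_dual_cone[OF sg] cardI by simp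
  show "z' J \<in> lspan (dc sg)" if "J \<subseteq> I" "card J = k" for J
   using z[OF that] unfolding z'_def sect_iff[OF that(1) sg] .
  show "kd F' z' J = 0" if "J \<subseteq> I" "card J = Suc k" for J
   using dz[OF that] by (simp add: z'_def[abs_def] kd'[OF that(1)])
 qed blast
 show ?thesis
 proof (intro exI[of _ "%J. mon (m_sum J sg) 1 * y J"] conjI allI impI)
  show "mon (m_sum J sg) 1 * y J \<in> secs u (div_sum J) sg" if "J \<subseteq> I" "Suc (card J) = k" for J
   using y(1)[OF that] by (simp add: sect_iff[OF that(1) sg])
  show "z J = kd F (%J. mon (m_sum J sg) 1 * y J) J" if J: "J \<subseteq> I" "card J = k" for J
  proof -
   have "mon (- m_sum J sg) 1 * z J = kd F' y J" using y(2)[OF J] by (simp add: z'_def)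
   also have "... = kd F' (%J. mon (- m_sum J sg) 1 * (mon (m_sum J sg) 1 * y J)) J" by simp
   also have "... = mon (- m_sum J sg) 1 * kd F (%J. mon (m_sum J sg) 1 * y J) J" by (rule kd'[OF J(1)])
   finally have "mon (m_sum J sg) 1 * (mon (- m_sum J sg) 1 * z J) =
    mon (m_sum J sg) 1 * (mon (- m_sum J sg) 1 * kd F (%J. mon (m_sum J sg) 1 * y J) J)" by simp
   thus ?thesis by simp
  qed
 qed
qed

lemma ex_enumeration:
 obtains N :: "nat set" and tc where "finite N" "bij_betw tc N \<Sigma>"
 using ex_bij_betw_nat_finite[OF finite_\<Sigma>] by (metis finite_atLeastLessThan)

lemma Inter_in_fan:
 assumes "finite T" "T ~= {}" "!!t. t \<in> T ==> tc t \<in> \<Sigma>"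
 shows "(\<Inter>t\<in>T. tc t) \<in> \<Sigma>" using assms
proof (induction T rule: finite_ne_induct)
 case (insert t T)
 hence "tc t \<inter> (\<Inter>t\<in>T. tc t) \<in> \<Sigma>" by (intro Int_in_fan) auto
 thus ?case by simp
qed simp

lemma koszul_cech_fan:
 assumes N: "finite N" and tc: "bij_betw tc N \<Sigma>"
 shows "koszul_cech I N F (%J T. poly_pts u (div_sum J) (\<Inter>t\<in>T. tc t))"
proof
 show "finite I" by (rule finI)
 show "finite N" by (rule N)
 show "poly_pts u (div_sum J) (\<Inter>t\<in>T. tc t) \<subseteq> poly_pts u (div_sum J) (\<Inter>t\<in>T'. tc t)" if "T \<subseteq> T'" for J T T'
  using that by (intro poly_pts_anti) auto
 show "m + m' \<in> poly_pts u (div_sum J) (\<Inter>t\<in>T. tc t)"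
  if J: "J \<subseteq> I" "j \<in> J" and m: "m \<in> supp (F j)" "m' \<in> poly_pts u (div_sum (J - {j})) (\<Inter>t\<in>T. tc t)" for J T j m m'
 proof -
  have "m \<in> poly_pts u (a j) UNIV" using F[of j] J m(1) by (auto simp: lspan_def)
  hence "m \<in> poly_pts u (a j) (\<Inter>t\<in>T. tc t)" by (auto simp: poly_pts_def)
  from poly_pts_add[OF this m(2)] show ?thesis by (simp only: div_sum_remove[OF J])
 qed
 show "cexact N {T. m \<in> poly_pts u (div_sum J) (\<Inter>t\<in>T. tc t)}" if "J \<subseteq> I" for J m
  by (rule cech_nef[OF nef_sum[OF that] tc N])
 show "\<exists>y. (\<forall>J\<subseteq>I. Suc (card J) = k --> y J \<in> secs u (div_sum J) (\<Inter>t\<in>T. tc t)) \<and>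
  (\<forall>J\<subseteq>I. card J = k --> z J = kd F y J)"
  if T: "T \<subseteq> N" "T ~= {}" and z: "k < card I"
   "!!J. J \<subseteq> I ==> card J = k ==> z J \<in> secs u (div_sum J) (\<Inter>t\<in>T. tc t)"
   "!!J. J \<subseteq> I ==> card J = Suc k ==> kd F z J = 0" for T k z
 proof (rule local_koszul_exact[OF _ z])
  show "(\<Inter>t\<in>T. tc t) \<in> \<Sigma>"
   using T tc finite_subset[OF T(1) N] by (intro Inter_in_fan) (auto simp: bij_betw_def)
 qed
qed

theorem sections_injective:
 assumes z: "z \<in> secs u (div_sum I) UNIV"
  and loc: "!!sg. sg \<in> \<Sigma> ==> in_ideal sg z"
 shows "in_ideal UNIV z"
proof -
 obtain N :: "nat set" and tc where N: "finite N" "bij_betw tc N \<Sigma>" by (rule ex_enumeration)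
 interpret K: koszul_cech I N F "%J T. poly_pts u (div_sum J) (\<Inter>t\<in>T. tc t)"
  using N by (rule koszul_cech_fan)
 have tc: "tc t \<in> \<Sigma>" if "t \<in> N" for t using N(2) that by (auto simp: bij_betw_def)
 obtain y where y: "!!sg. sg \<in> \<Sigma> ==> (\<forall>j\<in>I. y sg j \<in> secs u (div_sum (I - {j})) sg) \<and> z = (\<Sum>j\<in>I. F j * y sg j)"
  using loc by metis
 show ?thesis using K.global_injective[of z "%t. y (tc t)"] z y[OF tc] by simp
qed

theorem sections_surjective:
 assumes s: "!!sg. sg \<in> \<Sigma> ==> s sg \<in> secs u (div_sum I) sg"
  and glue: "!!sg tc. sg \<in> \<Sigma> ==> tc \<in> \<Sigma> ==>
   in_ideal (sg \<inter> tc) (s sg - s tc)"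
 shows "\<exists>z\<in>secs u (div_sum I) UNIV. \<forall>sg\<in>\<Sigma>.
   in_ideal sg (s sg - z)"
proof -
 obtain N :: "nat set" and tc where N: "finite N" "bij_betw tc N \<Sigma>" by (rule ex_enumeration)
 interpret K: koszul_cech I N F "%J T. poly_pts u (div_sum J) (\<Inter>t\<in>T. tc t)"
  using N by (rule koszul_cech_fan)
 have tc: "tc t \<in> \<Sigma>" if "t \<in> N" for t using N(2) that by (auto simp: bij_betw_def)
 define y where "y sg tc = (SOME y. (\<forall>j\<in>I. y j \<in> secs u (div_sum (I - {j})) (sg \<inter> tc)) \<and>
  s sg - s tc = (\<Sum>j\<in>I. F j * y j))" for sg tc
 have y: "(\<forall>j\<in>I. y sg tc j \<in> secs u (div_sum (I - {j})) (sg \<inter> tc)) \<and> s sg - s tc = (\<Sum>j\<in>I. F j * y sg tc j)"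
  if "sg \<in> \<Sigma>" "tc \<in> \<Sigma>" for sg tc
  unfolding y_def using someI_ex[OF glue[OF that]] .
 have "\<exists>z e. z \<in> secs u (div_sum I) (\<Inter>t\<in>{}. tc t) \<and>
  (\<forall>t\<in>N. \<forall>j\<in>I. e t j \<in> secs u (div_sum (I - {j})) (\<Inter>t\<in>{t}. tc t)) \<and>
  (\<forall>t\<in>N. s (tc t) - z = (\<Sum>j\<in>I. F j * e t j))"
 proof (rule K.global_surjective[where y = "%t t'. y (tc t) (tc t')"])
  show "s (tc t) \<in> secs u (div_sum I) (\<Inter>t\<in>{t}. tc t)" if "t \<in> N" for t
   using s[OF tc[OF that]] by simp
  show "y (tc t) (tc t') j \<in> secs u (div_sum (I - {j})) (\<Inter>t\<in>{t, t'}. tc t)"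
   if "t \<in> N" "t' \<in> N" "j \<in> I" for t t' j
   using bspec[OF conjunct1[OF y[OF tc[OF that(1)] tc[OF that(2)]]] that(3)] by simp
  show "s (tc t) - s (tc t') = (\<Sum>j\<in>I. F j * y (tc t) (tc t') j)" if "t \<in> N" "t' \<in> N" for t t'
   by (rule conjunct2[OF y[OF tc[OF that(1)] tc[OF that(2)]]])
 qed
 moreover have "(\<Inter>t\<in>{}. tc t) = UNIV" "!!t. (\<Inter>t\<in>{t}. tc t) = tc t" by simp_all
 ultimately have "\<exists>z e. z \<in> secs u (div_sum I) UNIV \<and>
  (\<forall>t\<in>N. \<forall>j\<in>I. e t j \<in> secs u (div_sum (I - {j})) (tc t)) \<and>
  (\<forall>t\<in>N. s (tc t) - z = (\<Sum>j\<in>I. F j * e t j))" by (simp only:)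
 then obtain z e where z: "z \<in> secs u (div_sum I) UNIV"
  and e: "\<forall>t\<in>N. \<forall>j\<in>I. e t j \<in> secs u (div_sum (I - {j})) (tc t)"
   "\<forall>t\<in>N. s (tc t) - z = (\<Sum>j\<in>I. F j * e t j)" by (elim exE conjE) (rule that)
 show ?thesis
 proof (intro bexI[OF _ z] ballI)
  fix sg assume "sg \<in> \<Sigma>"
  then obtain t where t: "t \<in> N" "sg = tc t" using N(2) by (auto simp: bij_betw_def)
  show "in_ideal sg (s sg - z)"
   unfolding t(2) using bspec[OF e(1) t(1)] bspec[OF e(2) t(1)] by (intro exI[of _ "e t"] conjI)
 qed
qed

end

section \<open>Points of the toric variety\<close>

lemma int_scale_Suc: "int (Suc k) *s m = m + int k *s (m :: int ^ 'n)"
 by (simp add: vec_eq_iff algebra_simps)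

lemma dual_scale: "m \<in> dual U ==> int k *s m \<in> dual U" by (simp add: dual_def pairing_scale)

context toric
begin

lemma chart_points_iff:
 "sg \<in> \<Sigma> ==> pt \<in> chart_points sg \<longleftrightarrow> pt \<in> extensional (dc sg) \<and> pt 0 = 1 \<and>
  (\<forall>a\<in>dc sg. \<forall>b\<in>dc sg. pt (a + b) = pt a * pt b)"
 by (simp add: chart_points_def dual_monoid_eq)

lemma point_zero: "sg \<in> \<Sigma> ==> pt \<in> chart_points sg ==> pt 0 = 1"
 by (simp add: chart_points_iff)

lemma point_add:
 "sg \<in> \<Sigma> ==> pt \<in> chart_points sg ==> a \<in> dc sg ==> b \<in> dc sg ==> pt (a + b) = pt a * pt b"
 by (simp add: chart_points_iff)

lemma point_scale:
 assumes "sg \<in> \<Sigma>" "pt \<in> chart_points sg" "m \<in> dc sg"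
 shows "pt (int k *s m) = pt m ^ k"
proof (induction k)
 case 0
 have "int 0 *s m = 0" by (simp add: vec_eq_iff)
 thus ?case using point_zero[OF assms(1,2)] by simp
next
 case (Suc k)
 show ?case unfolding int_scale_Suc point_add[OF assms(1,2,3) dual_scale[OF assms(3)]] Suc by simp
qed

lemma point_eqI:
 assumes sg: "sg \<in> \<Sigma>" and pt: "pt \<in> chart_points sg" and pt': "pt' \<in> chart_points sg"
  and eq: "!!m. m \<in> dc sg ==> pt m = pt' m"
 shows "pt = pt'"
proof (rule extensionalityI)
 show "pt \<in> extensional (dc sg)" "pt' \<in> extensional (dc sg)"
  using pt pt' sg by (simp_all add: chart_points_iff)
qed (rule eq)

lemma restrict_point:
 assumes sg: "sg \<in> \<Sigma>" and fc: "fc \<in> \<Sigma>" and sub: "fc \<subseteq> sg" and qt: "qt \<in> chart_points fc"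
 shows "restrict qt (dc sg) \<in> chart_points sg" unfolding chart_points_iff[OF sg]
proof (intro conjI ballI)
 fix a b assume ab: "a \<in> dc sg" "b \<in> dc sg"
 hence "qt (a + b) = qt a * qt b" using point_add[OF fc qt] dual_anti[OF sub] by blast
 thus "restrict qt (dc sg) (a + b) = restrict qt (dc sg) a * restrict qt (dc sg) b"
  using ab by (simp add: dual_add)
qed (simp_all add: point_zero[OF fc qt])

definition cuts :: "(real ^ 'n) set => (real ^ 'n) set => int ^ 'n => bool" where
 "cuts sg fc m \<longleftrightarrow> m \<in> dc sg \<and> (\<forall>w\<in>gens sg. pairing m w = 0 \<longleftrightarrow> rvec w \<in> fc)"

lemma ex_cuts:
 assumes sg: "sg \<in> \<Sigma>" and fc: "fc \<in> \<Sigma>" and sub: "fc \<subseteq> sg"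
 shows "\<exists>m. cuts sg fc m"
 by (rule face_functional[OF sg subset_face[OF sg fc sub] cone_zero[OF fc]])
  (auto simp: cuts_def intro!: exI)

lemma cuts_dual:
 assumes "cuts sg fc m" "fc \<subseteq> sg"
 shows "m \<in> dc fc" "- m \<in> dc fc"
proof -
 have "pairing m w = 0" if "w \<in> gens fc" for w
  using assms(1) that gens_mono[OF assms(2)] unfolding cuts_def by (auto simp: gens_def)
 thus "m \<in> dc fc" "- m \<in> dc fc" by (simp_all add: dual_def pairing_uminus)
qed

text \<open>Each copy of \<open>m\<close> raises the pairing with a generator outside
  \<open>fc\<close> by at least one and leaves those on \<open>fc\<close> unchanged. This is the
  clearing of denominators between charts.\<close>

lemma cuts_shift:
 assumes m: "cuts sg fc m" and x: "x \<in> dc fc"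
 shows "\<exists>k::nat. \<forall>l\<ge>k. x + int l *s m \<in> dc sg"
proof (intro exI allI impI)
 fix l assume l: "nat (\<Sum>w\<in>gens sg. \<bar>pairing x w\<bar>) \<le> l"
 show "x + int l *s m \<in> dc sg" unfolding dual_def
 proof (intro CollectI ballI)
  fix w assume w: "w \<in> gens sg"
  show "0 \<le> pairing (x + int l *s m) w"
  proof (cases "rvec w \<in> fc")
   case True
   hence "w \<in> gens fc" using w by (auto simp: gens_def)
   hence "0 \<le> pairing x w" using x by (simp add: dual_def)
   moreover have "pairing m w = 0" using m w True by (simp add: cuts_def)
   ultimately show ?thesis by (simp add: pairing_add pairing_scale)
  next
   case False
   have "0 \<le> pairing m w" "pairing m w ~= 0" using m w False by (simp_all add: cuts_def dual_def)
   hence "int l * 1 \<le> int l * pairing m w" by (intro mult_left_mono) linarith+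
   moreover have "\<bar>pairing x w\<bar> \<le> (\<Sum>w\<in>gens sg. \<bar>pairing x w\<bar>)"
    using w by (intro member_le_sum) auto
   ultimately show ?thesis using l by (simp add: pairing_add pairing_scale)
  qed
 qed
qed

lemma cuts_nonzero:
 assumes fc: "fc \<in> \<Sigma>" "qt \<in> chart_points fc" and m: "cuts sg fc m" "fc \<subseteq> sg"
 shows "qt m ~= 0" using point_add[OF fc cuts_dual[OF m]] point_zero[OF fc] by auto

text \<open>The chart of a face \<open>fc\<close> of \<open>sg\<close> is the open subset of the chart of \<open>sg\<close> on which the character
 cutting out \<open>fc\<close> does not vanish.\<close>

lemma restrict_point_inj:
 assumes sg: "sg \<in> \<Sigma>" and fc: "fc \<in> \<Sigma>" and sub: "fc \<subseteq> sg"
  and qt: "qt \<in> chart_points fc" and \<epsilon>: "\<epsilon> \<in> chart_points fc"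
  and eq: "!!m. m \<in> dc sg ==> qt m = \<epsilon> m"
 shows "qt = \<epsilon>"
proof (rule point_eqI[OF fc qt \<epsilon>])
 fix x assume x: "x \<in> dc fc"
 obtain m where m: "cuts sg fc m" using ex_cuts[OF sg fc sub] by blast
 obtain k :: nat where k: "x + int k *s m \<in> dc sg" using cuts_shift[OF m x] by blast
 have mfc: "m \<in> dc fc" by (rule cuts_dual(1)[OF m sub])
 have e: "\<phi> (x + int k *s m) = \<phi> x * \<phi> m ^ k" if "\<phi> \<in> chart_points fc" for \<phi>
  using point_add[OF fc that x dual_scale[OF mfc]] point_scale[OF fc that mfc] by simp
 have "m \<in> dc sg" using m by (simp add: cuts_def)
 from eq[OF this] have mm: "qt m = \<epsilon> m" .
 have "qt x * qt m ^ k = \<epsilon> x * \<epsilon> m ^ k" using eq[OF k] e[OF qt] e[OF \<epsilon>] by simp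
 thus "qt x = \<epsilon> x" using cuts_nonzero[OF fc \<epsilon> m sub] mm by simp
qed

text \<open>The value at \<open>x\<close> is forced: add copies of \<open>m\<close> until
  \<open>dc sg\<close> is reached and divide by as many factors \<open>pt m\<close>. The number of
  copies does not matter, by \<open>indep\<close>.\<close>

lemma extend_point:
 assumes sg: "sg \<in> \<Sigma>" and fc: "fc \<in> \<Sigma>" and sub: "fc \<subseteq> sg" and pt: "pt \<in> chart_points sg"
  and m: "cuts sg fc m" and nz: "pt m ~= 0"
 shows "\<exists>qt\<in>chart_points fc. pt = restrict qt (dc sg)"
proof -
 let ?D = "dc sg"
 have msg: "m \<in> ?D" using m by (simp add: cuts_def)
 define k where "k x = (SOME k::nat. x + int k *s m \<in> ?D)" for x
 have k: "x + int (k x) *s m \<in> ?D" if "x \<in> dc fc" for x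
  unfolding k_def by (rule someI_ex) (use cuts_shift[OF m that] in blast)
 have indep: "pt (x + int i *s m) / pt m ^ i = pt (x + int j *s m) / pt m ^ j"
  if i: "x + int i *s m \<in> ?D" and j: "x + int j *s m \<in> ?D" for x i j
 proof -
  have "pt (x + int i *s m) * pt m ^ j = pt ((x + int i *s m) + int j *s m)"
   using point_add[OF sg pt i dual_scale[OF msg]] point_scale[OF sg pt msg] by simp
  also have "(x + int i *s m) + int j *s m = (x + int j *s m) + int i *s m" by (simp add: algebra_simps)
  also have "pt ... = pt (x + int j *s m) * pt m ^ i"
   using point_add[OF sg pt j dual_scale[OF msg]] point_scale[OF sg pt msg] by simp
  finally show ?thesis using nz by (simp add: divide_simps)
 qed
 define qt where "qt = (\<lambda>x\<in>dc fc. pt (x + int (k x) *s m) / pt m ^ k x)"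
 have qt: "qt x = pt (x + int i *s m) / pt m ^ i" if "x \<in> dc fc" "x + int i *s m \<in> ?D" for x i
  using indep[OF k[OF that(1)] that(2)] that(1) by (simp add: qt_def)
 have qtsg: "qt x = pt x" if "x \<in> ?D" for x
 proof -
  have e: "x + int 0 *s m = x" by (simp add: vec_eq_iff)
  have "x \<in> dc fc" using that dual_anti[OF sub] by blast
  from qt[OF this, of 0] show ?thesis unfolding e using that by simp
 qed
 have "qt \<in> chart_points fc" unfolding chart_points_iff[OF fc]
 proof (intro conjI ballI)
  show "qt \<in> extensional (dc fc)" by (simp add: qt_def)
  show "qt 0 = 1" using qtsg[of 0] point_zero[OF sg pt] by simp
  fix a b assume ab: "a \<in> dc fc" "b \<in> dc fc"
  have s: "(a + b) + int (k a + k b) *s m = (a + int (k a) *s m) + (b + int (k b) *s m)"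
   by (simp add: vec_eq_iff algebra_simps)
  have "(a + b) + int (k a + k b) *s m \<in> ?D" unfolding s by (rule dual_add[OF k[OF ab(1)] k[OF ab(2)]])
  from qt[OF dual_add[OF ab] this]
  have "qt (a + b) = pt ((a + int (k a) *s m) + (b + int (k b) *s m)) / pt m ^ (k a + k b)" by (simp only: s)
  also have "... = qt a * qt b" unfolding qt[OF ab(1) k[OF ab(1)]] qt[OF ab(2) k[OF ab(2)]]
   by (simp add: point_add[OF sg pt k[OF ab(1)] k[OF ab(2)]] power_add)
  finally show "qt (a + b) = qt a * qt b" .
 qed
 moreover have "pt = restrict qt ?D"
 proof (rule extensionalityI[of _ ?D])
  show "pt \<in> extensional ?D" using pt by (simp add: chart_points_iff[OF sg])
 qed (simp_all add: qtsg)
 ultimately show ?thesis by blast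
qed

text \<open>Any common face may serve as the overlap in place of the intersection, which makes the
  relation easier to compose.\<close>

lemma glue_iff:
 "((sg, pt), (tc, pt')) \<in> glue \<Sigma> \<longleftrightarrow> sg \<in> \<Sigma> \<and> tc \<in> \<Sigma> \<and> (\<exists>fc\<in>\<Sigma>. fc \<subseteq> sg \<and> fc \<subseteq> tc \<and>
  (\<exists>qt\<in>chart_points fc. pt = restrict qt (dc sg) \<and> pt' = restrict qt (dc tc)))"
proof
 assume "((sg, pt), (tc, pt')) \<in> glue \<Sigma>"
 then obtain qt where "sg \<in> \<Sigma>" "tc \<in> \<Sigma>" "qt \<in> chart_points (sg \<inter> tc)"
  "pt = restrict qt (dc sg)" "pt' = restrict qt (dc tc)" by (auto simp: glue_def dual_monoid_eq)
 thus "sg \<in> \<Sigma> \<and> tc \<in> \<Sigma> \<and> (\<exists>fc\<in>\<Sigma>. fc \<subseteq> sg \<and> fc \<subseteq> tc \<and>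
  (\<exists>qt\<in>chart_points fc. pt = restrict qt (dc sg) \<and> pt' = restrict qt (dc tc)))"
  using Int_in_fan[of sg tc] by (intro conjI bexI[of _ "sg \<inter> tc"] bexI[of _ qt]) simp_all
next
 assume "sg \<in> \<Sigma> \<and> tc \<in> \<Sigma> \<and> (\<exists>fc\<in>\<Sigma>. fc \<subseteq> sg \<and> fc \<subseteq> tc \<and>
  (\<exists>qt\<in>chart_points fc. pt = restrict qt (dc sg) \<and> pt' = restrict qt (dc tc)))"
 then obtain fc qt where sg: "sg \<in> \<Sigma>" and tc: "tc \<in> \<Sigma>" and fc: "fc \<in> \<Sigma>" "fc \<subseteq> sg" "fc \<subseteq> tc"
  and qt: "qt \<in> chart_points fc" "pt = restrict qt (dc sg)" "pt' = restrict qt (dc tc)"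
  by (elim conjE bexE) (rule that)
 let ?D = "dc (sg \<inter> tc)"
 have "fc \<subseteq> sg \<inter> tc" using fc by blast
 from restrict_point[OF Int_in_fan[OF sg tc] fc(1) this qt(1)]
 have p: "restrict qt ?D \<in> chart_points (sg \<inter> tc)" .
 have "dc sg \<subseteq> ?D" "dc tc \<subseteq> ?D" by (simp_all add: dual_anti)
 hence e: "restrict (restrict qt ?D) (dc sg) = pt" "restrict (restrict qt ?D) (dc tc) = pt'"
  unfolding qt(2,3) restrict_restrict by (simp_all add: Int_absorb1)
 have "\<exists>qt\<in>chart_points (sg \<inter> tc). pt = restrict qt (dc sg) \<and> pt' = restrict qt (dc tc)"
  by (intro bexI[OF _ p] conjI) (rule e[symmetric])+
 with sg tc show "((sg, pt), (tc, pt')) \<in> glue \<Sigma>" by (simp add: glue_def dual_monoid_eq)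
qed

lemma glueE:
 assumes "((sg, pt), (tc, pt')) \<in> glue \<Sigma>"
 obtains fc qt where "sg \<in> \<Sigma>" "tc \<in> \<Sigma>" "fc \<in> \<Sigma>" "fc \<subseteq> sg" "fc \<subseteq> tc" "qt \<in> chart_points fc"
  "pt = restrict qt (dc sg)" "pt' = restrict qt (dc tc)"
 using assms unfolding glue_iff by (elim conjE bexE) (rule that)

lemma glueI:
 assumes "sg \<in> \<Sigma>" "tc \<in> \<Sigma>" "fc \<in> \<Sigma>" "fc \<subseteq> sg" "fc \<subseteq> tc" "qt \<in> chart_points fc"
 shows "((sg, restrict qt (dc sg)), (tc, restrict qt (dc tc))) \<in> glue \<Sigma>"
 unfolding glue_iff using assms by (intro conjI bexI[of _ fc] bexI[of _ qt]) simp_all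

lemma restrict_point_self: "sg \<in> \<Sigma> ==> pt \<in> chart_points sg ==> restrict pt (dc sg) = pt"
 by (simp add: chart_points_iff extensional_restrict)

lemma glue_face:
 assumes "sg \<in> \<Sigma>" "fc \<in> \<Sigma>" "fc \<subseteq> sg" "qt \<in> chart_points fc"
 shows "((fc, qt), (sg, restrict qt (dc sg))) \<in> glue \<Sigma>"
 using glueI[OF assms(2,1,2) _ assms(3,4)] restrict_point_self[OF assms(2,4)] by simp

lemma glue_sym: "(p, q) \<in> glue \<Sigma> ==> (q, p) \<in> glue \<Sigma>"
 by (cases p; cases q) (auto simp: glue_iff)

text \<open>In the middle chart the point lies in the charts of both faces \<open>fc1\<close> and
  \<open>fc2\<close>. The character cutting out \<open>fc2\<close> is nonzero there and, within
  \<open>fc1\<close>, cuts out the intersection, so the point extends to the chart of the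
  intersection.\<close>

lemma glue_trans:
 assumes "(p, q) \<in> glue \<Sigma>" "(q, r) \<in> glue \<Sigma>"
 shows "(p, r) \<in> glue \<Sigma>"
proof -
 obtain sg pt tc pt' \<kappa> pt'' where pqr: "p = (sg, pt)" "q = (tc, pt')" "r = (\<kappa>, pt'')"
  by (cases p; cases q; cases r)
 obtain fc1 qt where sg: "sg \<in> \<Sigma>" and tc: "tc \<in> \<Sigma>" and fc1: "fc1 \<in> \<Sigma>" "fc1 \<subseteq> sg" "fc1 \<subseteq> tc"
  and qt: "qt \<in> chart_points fc1" "pt = restrict qt (dc sg)" "pt' = restrict qt (dc tc)"
  using assms(1) unfolding pqr by (rule glueE)
 obtain fc2 \<epsilon> where \<kappa>: "\<kappa> \<in> \<Sigma>" and fc2: "fc2 \<in> \<Sigma>" "fc2 \<subseteq> tc" "fc2 \<subseteq> \<kappa>"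
  and \<epsilon>: "\<epsilon> \<in> chart_points fc2" "pt' = restrict \<epsilon> (dc tc)" "pt'' = restrict \<epsilon> (dc \<kappa>)"
  using assms(2) unfolding pqr by (rule glueE)
 have agree: "qt x = \<epsilon> x" if "x \<in> dc tc" for x
  using fun_cong[OF trans[OF sym[OF qt(3)] \<epsilon>(2)], of x] that by simp
 define fc where "fc = fc1 \<inter> fc2"
 have fc: "fc \<in> \<Sigma>" "fc \<subseteq> fc1" "fc \<subseteq> fc2" unfolding fc_def using Int_in_fan[OF fc1(1) fc2(1)] by auto
 obtain m where m: "cuts tc fc2 m" using ex_cuts[OF tc fc2(1,2)] by blast
 have mtc: "m \<in> dc tc" using m by (simp add: cuts_def)
 have "qt m ~= 0" using agree[OF mtc] cuts_nonzero[OF fc2(1) \<epsilon>(1) m fc2(2)] by simp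
 moreover have "cuts fc1 fc m" unfolding cuts_def
 proof (intro conjI ballI)
  show "m \<in> dual (gens fc1)" using mtc dual_anti[OF fc1(3)] by blast
  fix w assume w: "w \<in> gens fc1"
  hence "w \<in> gens tc" "rvec w \<in> fc1" using gens_mono[OF fc1(3)] by (auto simp: gens_def)
  thus "pairing m w = 0 \<longleftrightarrow> rvec w \<in> fc" using m by (simp add: cuts_def fc_def)
 qed
 ultimately obtain \<eta> where \<eta>: "\<eta> \<in> chart_points fc" "qt = restrict \<eta> (dual (gens fc1))"
  using extend_point[OF fc1(1) fc(1,2) qt(1)] by blast
 have "restrict \<eta> (dual (gens fc2)) = \<epsilon>"
 proof (rule restrict_point_inj[OF tc fc2(1,2) restrict_point[OF fc2(1) fc(1,3) \<eta>(1)] \<epsilon>(1)])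
  fix x assume x: "x \<in> dc tc"
  hence "x \<in> dual (gens fc1)" "x \<in> dual (gens fc2)" using dual_anti[OF fc1(3)] dual_anti[OF fc2(2)] by auto
  thus "restrict \<eta> (dual (gens fc2)) x = \<epsilon> x" using agree[OF x] unfolding \<eta>(2) by simp
 qed
 hence "pt'' = restrict \<eta> (dc \<kappa>)"
  unfolding \<epsilon>(3) using dual_anti[OF fc2(3)] by (auto simp: restrict_restrict Int_absorb1)
 moreover have "pt = restrict \<eta> (dc sg)"
  unfolding qt(2) \<eta>(2) using dual_anti[OF fc1(2)] by (simp add: restrict_restrict Int_absorb1)
 ultimately show ?thesis
  unfolding pqr using glueI[OF sg \<kappa> fc(1) _ _ \<eta>(1)] fc fc1 fc2 by simp
qed

lemma equiv_glue: "equiv (SIGMA sg:\<Sigma>. chart_points sg) (glue \<Sigma>)"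
proof (rule equivI)
 show "glue \<Sigma> \<subseteq> (SIGMA sg:\<Sigma>. chart_points sg) \<times> (SIGMA sg:\<Sigma>. chart_points sg)"
 proof
  fix z assume z: "z \<in> glue \<Sigma>"
  obtain sg pt tc pt' where e: "z = ((sg, pt), (tc, pt'))" by (cases z) auto
  show "z \<in> (SIGMA sg:\<Sigma>. chart_points sg) \<times> (SIGMA sg:\<Sigma>. chart_points sg)"
   using z unfolding e by (rule glueE) (simp add: restrict_point)
 qed
 show "refl_on (SIGMA sg:\<Sigma>. chart_points sg) (glue \<Sigma>)"
 proof (rule refl_onI)
  fix p assume "p \<in> (SIGMA sg:\<Sigma>. chart_points sg)"
  then obtain sg pt where "p = (sg, pt)" "sg \<in> \<Sigma>" "pt \<in> chart_points sg" by auto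
  thus "(p, p) \<in> glue \<Sigma>" using glue_face[of sg sg pt] restrict_point_self by simp
 qed
 show "sym (glue \<Sigma>)" by (rule symI) (rule glue_sym)
 show "trans (glue \<Sigma>)" by (rule transI) (rule glue_trans)
qed

lemma point_rep: "pz \<in> toric_variety \<Sigma> ==> \<exists>sg pt. (sg, pt) \<in> pz"
 using in_quotient_imp_non_empty[OF equiv_glue, of pz] unfolding toric_variety_def by (metis all_not_in_conv surj_pair)

lemma rep_chart:
 assumes "pz \<in> toric_variety \<Sigma>" "(sg, pt) \<in> pz"
 shows "sg \<in> \<Sigma>" "pt \<in> chart_points sg"
 using in_quotient_imp_subset[OF equiv_glue, of pz] assms unfolding toric_variety_def by auto

lemma rep_glue: "pz \<in> toric_variety \<Sigma> ==> p \<in> pz ==> q \<in> pz ==> (p, q) \<in> glue \<Sigma>"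
 unfolding toric_variety_def by (rule in_quotient_imp_in_rel[OF equiv_glue]) auto

lemma rep_closed: "pz \<in> toric_variety \<Sigma> ==> p \<in> pz ==> (p, q) \<in> glue \<Sigma> ==> q \<in> pz"
 unfolding toric_variety_def by (rule in_quotient_imp_closed[OF equiv_glue])

lemma ex_class:
 assumes "sg \<in> \<Sigma>" "pt \<in> chart_points sg"
 shows "\<exists>pz\<in>toric_variety \<Sigma>. (sg, pt) \<in> pz"
proof
 have p: "(sg, pt) \<in> (SIGMA sg:\<Sigma>. chart_points sg)" using assms by simp
 show "glue \<Sigma> `` {(sg, pt)} \<in> toric_variety \<Sigma>" unfolding toric_variety_def using p by (rule quotientI)
 show "(sg, pt) \<in> glue \<Sigma> `` {(sg, pt)}" using equiv_class_self[OF equiv_glue p] .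
qed

lemma rep_disjoint:
 assumes "pz \<in> toric_variety \<Sigma>" "pz' \<in> toric_variety \<Sigma>" "p \<in> pz" "p \<in> pz'"
 shows "pz = pz'" using quotient_disj[OF equiv_glue] assms unfolding toric_variety_def by blast

lemma rep_face:
 assumes "pz \<in> toric_variety \<Sigma>" "(fc, qt) \<in> pz" "sg \<in> \<Sigma>" "fc \<subseteq> sg"
 shows "(sg, restrict qt (dc sg)) \<in> pz"
 using rep_closed[OF assms(1,2) glue_face[OF assms(3) _ assms(4)]] rep_chart[OF assms(1,2)] by blast

lemma rep_common:
 assumes "pz \<in> toric_variety \<Sigma>" "(sg, pt) \<in> pz" "(tc, pt') \<in> pz"
 obtains fc qt where "fc \<in> \<Sigma>" "fc \<subseteq> sg" "fc \<subseteq> tc" "qt \<in> chart_points fc" "(fc, qt) \<in> pz"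
  "pt = restrict qt (dc sg)" "pt' = restrict qt (dc tc)"
proof -
 obtain fc qt where h: "sg \<in> \<Sigma>" "tc \<in> \<Sigma>" "fc \<in> \<Sigma>" "fc \<subseteq> sg" "fc \<subseteq> tc" "qt \<in> chart_points fc"
  "pt = restrict qt (dc sg)" "pt' = restrict qt (dc tc)" using rep_glue[OF assms] by (rule glueE)
 have "((sg, pt), (fc, qt)) \<in> glue \<Sigma>"
  unfolding h(7) by (rule glue_sym) (rule glue_face[OF h(1,3,4,6)])
 with rep_closed[OF assms(1,2)] have "(fc, qt) \<in> pz" by blast
 with h that show thesis by blast
qed

end

section \<open>Gordan's lemma\<close>

text \<open>A monotone subsequence exists; if it decreases, it is constant from the index of its
  minimum on.\<close>

lemma nat_mono_subseq:
 fixes s :: "nat => nat"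
 shows "\<exists>h :: nat => nat. strict_mono h \<and> mono (s \<circ> h)"
proof -
 obtain h :: "nat => nat" where h: "strict_mono h" "monoseq (%n. s (h n))" using seq_monosub[of s] by blast
 show ?thesis
 proof (cases "incseq (%n. s (h n))")
  case True
  hence "mono (s \<circ> h)" by (auto simp: mono_def)
  with h(1) show ?thesis by blast
 next
  case False
  with h(2) have dec: "decseq (%n. s (h n))" unfolding monoseq_iff by blast
  obtain N where N: "!!n. s (h N) \<le> s (h n)"
   using ex_has_least_nat[of "%_. True" 0 "%n. s (h n)"] by blast
  have "s (h (N + n)) = s (h N)" for n using decseqD[OF dec, of N "N + n"] N[of "N + n"] by simp
  moreover have "strict_mono (%n. h (N + n))" using h(1) by (simp add: strict_mono_def)
  ultimately show ?thesis by (intro exI[of _ "%n. h (N + n)"] conjI) (simp_all add: mono_def)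
 qed
qed

lemma dickson:
 fixes f :: "nat => 'a => nat"
 assumes "finite U"
 shows "\<exists>g :: nat => nat. strict_mono g \<and> (\<forall>w\<in>U. mono (%i. f (g i) w))"
 using assms
proof induction
 case empty
 show ?case by (intro exI[of _ id]) (simp add: strict_mono_def)
next
 case (insert w U)
 then obtain g :: "nat => nat" where g: "strict_mono g" "\<forall>w\<in>U. mono (%i. f (g i) w)" by blast
 obtain h :: "nat => nat" where h: "strict_mono h" "mono (%i. f (g (h i)) w)"
  using nat_mono_subseq[of "%i. f (g i) w"] by (auto simp: o_def)
 show ?case
 proof (intro exI[of _ "%i. g (h i)"] conjI ballI)
  show "strict_mono (%i. g (h i))" using g(1) h(1) by (simp add: strict_mono_def)
  fix v assume "v \<in> insert w U"
  then consider "v = w" | "v \<in> U" by blast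
  thus "mono (%i. f (g (h i)) v)"
  proof cases
   case 2
   have "mono h" using h(1) by (rule strict_mono_mono)
   with 2 g(2) show ?thesis by (auto simp: mono_def)
  qed (use h(2) in simp)
 qed
qed

text \<open>Finite generation in the form of an induction principle. The generators are the minimal
  nonzero elements; infinitely many of them would contain a comparable pair by Dickson's lemma.
  Pointedness makes \<open>\<mu>\<close> positive off zero, which drives the induction.\<close>

lemma gordan_pointed:
 assumes fin: "finite U" and pt: "!!m. (!!w. w \<in> U ==> pairing m w = 0) ==> m = 0"
 shows "\<exists>G\<subseteq>dual U. finite G \<and> (\<forall>P. P 0 --> (\<forall>g\<in>G. \<forall>m\<in>dual U. P m --> P (g + m)) --> (\<forall>m\<in>dual U. P m))"
proof -
 define G where "G = {g \<in> dual U. g ~= 0 \<and> (\<forall>h\<in>dual U. h ~= 0 --> g - h \<in> dual U --> h = g)}"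
 define \<mu> where "\<mu> m = (\<Sum>w\<in>U. nat (pairing m w))" for m
 have \<mu>_pos: "0 < \<mu> m" if "m \<in> dual U" "m ~= 0" for m
 proof -
  obtain w where w: "w \<in> U" "pairing m w ~= 0" using pt[of m] \<open>m ~= 0\<close> by blast
  hence "0 < nat (pairing m w)" using that(1) by (auto simp: dual_def)
  also have "... \<le> \<mu> m" unfolding \<mu>_def using w(1) fin by (intro member_le_sum) auto
  finally show ?thesis .
 qed
 have \<mu>_diff: "\<mu> m = \<mu> h + \<mu> (m - h)" if "h \<in> dual U" "m - h \<in> dual U" for m h
  unfolding \<mu>_def sum.distrib[symmetric]
 proof (rule sum.cong[OF refl])
  fix w assume "w \<in> U"
  thus "nat (pairing m w) = nat (pairing h w) + nat (pairing (m - h) w)"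
   using that by (simp add: dual_def pairing_diff nat_add_distrib[symmetric])
 qed
 have "finite G"
 proof (rule ccontr)
  assume "infinite G"
  then obtain f :: "nat => int ^ 'a" where f: "inj f" "range f \<subseteq> G" using infinite_countable_subset by blast
  obtain g :: "nat => nat" where g: "strict_mono g" "\<forall>w\<in>U. mono (%i. nat (pairing (f (g i)) w))"
   using dickson[OF fin, of "%i w. nat (pairing (f i) w)"] by blast
  have fG: "f i \<in> dual U" "f i ~= 0" for i using f(2) by (auto simp: G_def)
  have "f (g 1) - f (g 0) \<in> dual U" unfolding dual_def
  proof (intro CollectI ballI)
   fix w assume w: "w \<in> U"
   hence "nat (pairing (f (g 0)) w) \<le> nat (pairing (f (g 1)) w)" using g(2) by (auto simp: mono_def)
   moreover have "0 \<le> pairing (f (g 0)) w" "0 \<le> pairing (f (g 1)) w" using fG(1) w by (auto simp: dual_def)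
   ultimately show "0 \<le> pairing (f (g 1) - f (g 0)) w" by (simp add: pairing_diff)
  qed
  moreover have "f (g 1) \<in> G" using f(2) by blast
  ultimately have "f (g 0) = f (g 1)" using fG[of "g 0"] unfolding G_def by blast
  hence "g 0 = g 1" using f(1) by (simp add: inj_eq)
  moreover have "g 0 < g 1" using g(1) by (simp add: strict_mono_def)
  ultimately show False by simp
 qed
 moreover have "P m" if P0: "P 0" and PG: "\<forall>g\<in>G. \<forall>m\<in>dual U. P m --> P (g + m)" and m: "m \<in> dual U" for P m
  using m
 proof (induction "\<mu> m" arbitrary: m rule: less_induct)
  case less
  show ?case
  proof (cases "m = 0")
   case False
   obtain g where g: "g \<in> dual U \<and> g ~= 0 \<and> m - g \<in> dual U"
    "!!h. h \<in> dual U \<and> h ~= 0 \<and> m - h \<in> dual U ==> \<mu> g \<le> \<mu> h"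
    using ex_has_least_nat[of "%g. g \<in> dual U \<and> g ~= 0 \<and> m - g \<in> dual U" m \<mu>] False less.prems by auto
   have "g \<in> G" unfolding G_def
   proof (intro CollectI conjI ballI impI)
    fix h assume h: "h \<in> dual U" "h ~= 0" "g - h \<in> dual U"
    have "m - h = (m - g) + (g - h)" by simp
    hence "m - h \<in> dual U" using dual_add[of "m - g" U "g - h"] g(1) h(3) by simp
    with g(2) h have "\<mu> g \<le> \<mu> h" by blast
    hence "\<mu> (g - h) = 0" using \<mu>_diff[OF h(1,3)] by simp
    thus "h = g" using \<mu>_pos[OF h(3)] by force
   qed (use g in auto)
   moreover have "\<mu> (m - g) < \<mu> m" using \<mu>_diff[of g m] \<mu>_pos[of g] g(1) by simp
   hence "P (m - g)" using g(1) by (intro less.hyps) auto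
   ultimately have "P (g + (m - g))" using PG g(1) by blast
   thus ?thesis by simp
  qed (use P0 in simp)
 qed
 moreover have "G \<subseteq> dual U" by (auto simp: G_def)
 ultimately show ?thesis by blast
qed

text \<open>The dual cone may contain lines. Sign conditions on the coordinates cut it into pointed
  pieces, one for each set \<open>S\<close> of coordinates required to be nonnegative, and the
  generators of all pieces are collected.\<close>

theorem gordan:
 fixes U :: "(int ^ 'n) set"
 assumes fin: "finite U"
 shows "\<exists>G\<subseteq>dual U. finite G \<and> (\<forall>P. P 0 --> (\<forall>g\<in>G. \<forall>m\<in>dual U. P m --> P (g + m)) --> (\<forall>m\<in>dual U. P m))"
proof -
 define V where "V S = U \<union> range (%i. axis i (if i \<in> S then 1 else - 1 :: int))" for S :: "'n set"
 have pax: "pairing m (axis i c) = m $ i * c" for m :: "int ^ 'n" and i c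
  by (simp add: pairing_def axis_def if_distrib cong: if_cong)
 define good where "good S G \<longleftrightarrow> G \<subseteq> dual (V S) \<and> finite G \<and>
  (\<forall>P. P 0 --> (\<forall>g\<in>G. \<forall>m\<in>dual (V S). P m --> P (g + m)) --> (\<forall>m\<in>dual (V S). P m))" for S G
 have "\<exists>G. good S G" for S
 proof -
  have "m = 0" if "!!w. w \<in> V S ==> pairing m w = 0" for m
  proof -
   have "m $ i = 0" for i using that[of "axis i (if i \<in> S then 1 else - 1)"] by (auto simp: V_def pax split: if_splits)
   thus ?thesis by (simp add: vec_eq_iff)
  qed
  moreover have "finite (V S)" using fin by (simp add: V_def)
  ultimately show ?thesis using gordan_pointed[of "V S"] unfolding good_def by blast
 qed
 then obtain G where G: "\<forall>S. good S (G S)" using choice[of good] by blast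
 show ?thesis
 proof (intro exI[of _ "\<Union>S. G S"] conjI allI impI ballI)
  show "(\<Union>S. G S) \<subseteq> dual U"
  proof
   fix m assume "m \<in> (\<Union>S. G S)"
   then obtain S where "m \<in> G S" by blast
   hence "m \<in> dual (V S)" using G unfolding good_def by blast
   thus "m \<in> dual U" by (simp add: dual_def V_def)
  qed
  show "finite (\<Union>S. G S)" using G by (simp add: good_def)
  fix P m assume P: "P 0" "\<forall>g\<in>\<Union>S. G S. \<forall>m\<in>dual U. P m --> P (g + m)" and m: "m \<in> dual U"
  define S where "S = {i. 0 \<le> m $ i}"
  have "m \<in> dual (V S)" using m by (auto simp: dual_def V_def pax S_def)
  moreover have "dual (V S) \<subseteq> dual U" by (auto simp: dual_def V_def)
  ultimately show "P m" using G[rule_format, of S] P unfolding good_def by blast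
 qed
qed

section \<open>Finite subschemes of an affine chart\<close>

text \<open>A finite closed subscheme of an affine toric variety, with dimension zero in the form
  provided by \<open>algebraic_mod_if_krull_dim_0\<close>.\<close>

locale finite_subscheme = affine_monoid C for C :: "(int ^ 'n) set" +
 fixes \<aa> :: "((int ^ 'n) \<Rightarrow>\<^sub>0 complex) set"
 assumes \<aa>: "aideal \<aa>" and alg: "!!a. a \<in> lspan C ==> algebraic_mod \<aa> a"
begin

definition pts :: "(int ^ 'n => complex) set" where
 "pts = {pt \<in> extensional C. pt 0 = 1 \<and> (\<forall>a\<in>C. \<forall>b\<in>C. pt (a + b) = pt a * pt b)}"

text \<open>The kernel of the map from functions to the local ring of the subscheme at
  \<open>pt\<close>. Off the subscheme it is everything, see \<open>germ_trivial\<close>.\<close>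

definition germ_ideal :: "(int ^ 'n => complex) => ((int ^ 'n) \<Rightarrow>\<^sub>0 complex) set" where
 "germ_ideal pt = {g \<in> lspan C. \<exists>s\<in>lspan C. ev pt s ~= 0 \<and> s * g \<in> \<aa>}"

lemma eval_mult:
 "pt \<in> pts ==> f \<in> lspan C ==> g \<in> lspan C ==> ev pt (f * g) = ev pt f * ev pt g"
 by (rule eval_chart_mult) (auto simp: pts_def)

lemma eval_one: "pt \<in> pts ==> ev pt 1 = 1"
 unfolding one_eq_mon eval_chart_mon by (simp add: pts_def)

lemma pts_zero: "pt \<in> pts ==> pt 0 = 1" by (simp add: pts_def)

lemma eval_power: "pt \<in> pts ==> f \<in> lspan C ==> ev pt (f ^ k) = ev pt f ^ k"
 by (induction k) (simp_all add: eval_one eval_mult A_power)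

lemma \<aa>_mult: "f \<in> lspan C ==> g \<in> \<aa> ==> f * g \<in> \<aa>"
 using \<aa> by (simp add: aideal_def smod_def)

lemma \<aa>_add: "f \<in> \<aa> ==> g \<in> \<aa> ==> f + g \<in> \<aa>"
 using \<aa> by (simp add: aideal_def smod_def)

lemma \<aa>_A: "f \<in> \<aa> ==> f \<in> lspan C" using \<aa> by (auto simp: aideal_def)

lemma germI: "g \<in> lspan C ==> s \<in> lspan C ==> ev pt s ~= 0 ==> s * g \<in> \<aa> ==> g \<in> germ_ideal pt"
 by (auto simp: germ_ideal_def)

lemma germE:
 assumes "g \<in> germ_ideal pt"
 obtains s where "g \<in> lspan C" "s \<in> lspan C" "ev pt s ~= 0" "s * g \<in> \<aa>"
 using assms by (auto simp: germ_ideal_def)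

lemma germ_A: "g \<in> germ_ideal pt ==> g \<in> lspan C" by (erule germE)

lemma \<aa>_germ: "pt \<in> pts ==> f \<in> \<aa> ==> f \<in> germ_ideal pt"
 by (rule germI[of _ 1]) (simp_all add: \<aa>_A A_one eval_one)

lemma germ_mult: "f \<in> lspan C ==> g \<in> germ_ideal pt ==> f * g \<in> germ_ideal pt"
proof (erule germE)
 fix s assume h: "f \<in> lspan C" "g \<in> lspan C" "s \<in> lspan C" "ev pt s ~= 0" "s * g \<in> \<aa>"
 have "s * (f * g) \<in> \<aa>" using \<aa>_mult[OF h(1,5)] by (simp add: mult_ac)
 thus "f * g \<in> germ_ideal pt" by (rule germI[OF A_mult[OF h(1,2)] h(3,4)])
qed

lemma germ_add:
 assumes pt: "pt \<in> pts" and f: "f \<in> germ_ideal pt" and g: "g \<in> germ_ideal pt"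
 shows "f + g \<in> germ_ideal pt"
proof -
 obtain s where s: "f \<in> lspan C" "s \<in> lspan C" "ev pt s ~= 0" "s * f \<in> \<aa>" using f by (rule germE)
 obtain t where t: "g \<in> lspan C" "t \<in> lspan C" "ev pt t ~= 0" "t * g \<in> \<aa>" using g by (rule germE)
 have e: "(s * t) * (f + g) = t * (s * f) + s * (t * g)" by (simp add: algebra_simps)
 have "(s * t) * (f + g) \<in> \<aa>" unfolding e by (intro \<aa>_add \<aa>_mult s t)
 moreover have "ev pt (s * t) ~= 0" using s t by (simp add: eval_mult[OF pt])
 ultimately show ?thesis by (rule germI[OF A_add[OF s(1) t(1)] A_mult[OF s(2) t(2)], rotated])
qed

lemma germ_uminus: "f \<in> germ_ideal pt ==> - f \<in> germ_ideal pt"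
 using germ_mult[of "- 1" f pt] A_uminus[OF A_one] by simp

lemma germ_diff: "pt \<in> pts ==> f \<in> germ_ideal pt ==> g \<in> germ_ideal pt ==> f - g \<in> germ_ideal pt"
 using germ_add[of pt f "- g"] germ_uminus[of g pt] by simp

lemma germ_zero: "pt \<in> pts ==> 0 \<in> germ_ideal pt"
 using \<aa>_germ[of pt 0] \<aa> by (simp add: aideal_def smod_def)

lemma germ_cancel:
 assumes pt: "pt \<in> pts" and g: "g \<in> lspan C" and t: "t \<in> lspan C" "ev pt t ~= 0" and tg: "t * g \<in> germ_ideal pt"
 shows "g \<in> germ_ideal pt"
proof -
 obtain s where s: "s \<in> lspan C" "ev pt s ~= 0" "s * (t * g) \<in> \<aa>" using tg by (rule germE)
 show ?thesis
  by (rule germI[OF g A_mult[OF s(1) t(1)]]) (use s t in \<open>simp_all add: eval_mult[OF pt] mult.assoc\<close>)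
qed

text \<open>In a split equation for \<open>a\<close>, the factors whose root is not the value of
  \<open>a\<close> are nonzero at \<open>pt\<close> and can be cancelled.\<close>

lemma germ_nilpotent:
 assumes pt: "pt \<in> pts" and a: "a \<in> lspan C"
 shows "\<exists>k. (a - mon 0 (ev pt a)) ^ k \<in> germ_ideal pt"
proof -
 obtain R where R: "(\<Prod>c\<in>#R. a - mon 0 c) \<in> \<aa>" using alg[OF a] by (auto simp: algebraic_mod_def)
 have aC: "a - mon 0 c \<in> lspan C" for c using a const_in by (rule lspan_diff)
 have "\<exists>k. (a - mon 0 (ev pt a)) ^ k \<in> germ_ideal pt"
  if "b \<in> lspan C" "(\<Prod>c\<in>#R. a - mon 0 c) * b \<in> germ_ideal pt" "\<exists>k. b = (a - mon 0 (ev pt a)) ^ k" for R b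
  using that
 proof (induction R arbitrary: b)
  case empty
  thus ?case by auto
 next
  case (add c R)
  obtain k where k: "b = (a - mon 0 (ev pt a)) ^ k" using add.prems(3) by blast
  have pC: "(\<Prod>c\<in>#R. a - mon 0 c) \<in> lspan C" by (intro A_prod_mset aC)
  show ?case
  proof (cases "c = ev pt a")
   case True
   have "(\<Prod>c\<in>#R. a - mon 0 c) * ((a - mon 0 c) * b) \<in> germ_ideal pt"
    using add.prems(2) by (simp add: mult_ac)
   moreover have "(a - mon 0 c) * b = (a - mon 0 (ev pt a)) ^ Suc k" unfolding k True by simp
   ultimately show ?thesis using add.IH[of "(a - mon 0 c) * b"] A_mult[OF aC add.prems(1)] by blast
  next
   case False
   have "(a - mon 0 c) * ((\<Prod>c\<in>#R. a - mon 0 c) * b) \<in> germ_ideal pt"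
    using add.prems(2) by (simp add: mult_ac)
   moreover have "ev pt (a - mon 0 c) ~= 0"
    using False by (simp add: eval_chart_diff pts_zero[OF pt])
   ultimately have "(\<Prod>c\<in>#R. a - mon 0 c) * b \<in> germ_ideal pt"
    using germ_cancel[OF pt A_mult[OF pC add.prems(1)] aC] by blast
   thus ?thesis using add.IH[OF add.prems(1)] add.prems(3) by blast
  qed
 qed
 from this[of 1 R] show ?thesis
  using \<aa>_germ[OF pt R] A_one by (metis mult.right_neutral power_0)
qed

text \<open>\<open>s\<close> is a nonzero constant plus a nilpotent germ, so a finite geometric
  series inverts it.\<close>

lemma germ_invertible:
 assumes pt: "pt \<in> pts" and s: "s \<in> lspan C" "ev pt s ~= 0"
 shows "\<exists>t\<in>lspan C. s * t - 1 \<in> germ_ideal pt"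
proof -
 define c where "c = ev pt s"
 obtain k where k: "(s - mon 0 c) ^ k \<in> germ_ideal pt" using germ_nilpotent[OF pt s(1)] by (auto simp: c_def)
 define y where "y = s - mon 0 c"
 have y: "y \<in> lspan C" unfolding y_def using s(1) const_in by (rule lspan_diff)
 have "\<exists>t\<in>lspan C. s * t = mon 0 1 - (mon 0 (- inverse c) * y) ^ k"
 proof (induction k)
  case 0
  show ?case by (intro bexI[of _ 0]) simp_all
 next
  case (Suc k)
  then obtain t where t: "t \<in> lspan C" "s * t = mon 0 1 - (mon 0 (- inverse c) * y) ^ k" by blast
  define z where "z = mon 0 (- inverse c) * y"
  have zC: "z \<in> lspan C" unfolding z_def using const_in y by (rule A_mult)
  have sz: "s * mon 0 (inverse c) = 1 - z" using s(2) unfolding z_def y_def c_def[symmetric]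
   by (simp add: algebra_simps single_uminus)
  have "s * (t + mon 0 (inverse c) * z ^ k) = (1 - z ^ k) + (1 - z) * z ^ k"
   unfolding distrib_left t(2) mult.assoc[symmetric] sz by (simp add: z_def)
  also have "... = mon 0 1 - z ^ Suc k" by (simp add: algebra_simps)
  finally show ?case
   using A_add[OF t(1) A_mult[OF const_in A_power[OF zC]]] unfolding z_def[symmetric] by blast
 qed
 then obtain t where t: "t \<in> lspan C" "s * t = mon 0 1 - (mon 0 (- inverse c) * y) ^ k" by blast
 have "s * t - 1 = - ((mon 0 (- inverse c)) ^ k * y ^ k)" unfolding t(2) by (simp add: power_mult_distrib)
 moreover have "(mon 0 (- inverse c)) ^ k * y ^ k \<in> germ_ideal pt"
  using k by (intro germ_mult A_power const_in) (simp add: y_def)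
 ultimately show ?thesis using t(1) germ_uminus by metis
qed

text \<open>The functions that multiply \<open>g\<close> into the ideal form an ideal themselves. If
  it were proper, it would have a common zero, yet the germ of \<open>g\<close> at that point
  provides a member that does not vanish there.\<close>

lemma germ_local:
 assumes g: "g \<in> lspan C" and loc: "!!pt. pt \<in> pts ==> g \<in> germ_ideal pt"
 shows "g \<in> \<aa>"
proof (rule ccontr)
 assume ng: "g \<notin> \<aa>"
 define Q where "Q = {s \<in> lspan C. s * g \<in> \<aa>}"
 have Q: "aideal Q" unfolding aideal_def smod_def
 proof (intro conjI ballI)
  show "0 \<in> Q" using \<aa> by (simp add: Q_def aideal_def smod_def)
  show "a + b \<in> Q" if "a \<in> Q" "b \<in> Q" for a b
   using that by (simp add: Q_def A_add distrib_right \<aa>_add)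
  show "a * b \<in> Q" if "a \<in> lspan C" "b \<in> Q" for a b
   using that by (simp add: Q_def A_mult mult.assoc \<aa>_mult)
  show "Q \<subseteq> lspan C" by (auto simp: Q_def)
 qed
 have \<aa>Q: "\<aa> \<subseteq> Q"
 proof
  fix f assume f: "f \<in> \<aa>"
  have "f * g \<in> \<aa>" using \<aa>_mult[OF g f] by (simp add: mult.commute)
  thus "f \<in> Q" using \<aa>_A[OF f] by (simp add: Q_def)
 qed
 have "1 \<notin> Q" using ng by (simp add: Q_def)
 moreover have "algebraic_mod Q (mon m 1)" if "m \<in> C" for m
  using alg[of "mon m 1"] that \<aa>Q by (auto simp: algebraic_mod_def)
 ultimately obtain pt where pt: "pt \<in> extensional C" "pt 0 = 1" "\<forall>a\<in>C. \<forall>b\<in>C. pt (a + b) = pt a * pt b"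
  "\<forall>f\<in>Q. ev pt f = 0" using weak_nullstellensatz[OF Q] by blast
 hence "pt \<in> pts" by (simp add: pts_def)
 from loc[OF this] obtain s where "s \<in> lspan C" "ev pt s ~= 0" "s * g \<in> \<aa>" by (rule germE)
 with pt(4) show False by (auto simp: Q_def)
qed

lemma germ_trivial:
 assumes "f \<in> \<aa>" "ev pt f ~= 0" "g \<in> lspan C"
 shows "g \<in> germ_ideal pt"
 using germI[OF assms(3) \<aa>_A[OF assms(1)] assms(2)] \<aa>_mult[OF assms(3,1)] by (simp add: mult.commute)

lemma germ_eval:
 assumes pt: "pt \<in> pts" and van: "!!f. f \<in> \<aa> ==> ev pt f = 0" and g: "g \<in> germ_ideal pt"
 shows "ev pt g = 0"
proof -
 obtain s where s: "g \<in> lspan C" "s \<in> lspan C" "ev pt s ~= 0" "s * g \<in> \<aa>" using g by (rule germE)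
 thus ?thesis using van[OF s(4)] by (simp add: eval_mult[OF pt])
qed

text \<open>Take a monomial with different values at the two points. A power of it minus its value
  at \<open>pt'\<close> has zero germ at \<open>pt'\<close> and is a unit at
  \<open>pt\<close>.\<close>

lemma germ_separate:
 assumes pt: "pt \<in> pts" and pt': "pt' \<in> pts" and ne: "pt ~= pt'"
 shows "\<exists>e\<in>germ_ideal pt'. e - 1 \<in> germ_ideal pt"
proof -
 obtain m where m: "m \<in> C" "pt m ~= pt' m"
  using ne extensionalityI[of pt C pt'] pt pt' unfolding pts_def by blast
 have a: "mon m 1 \<in> lspan C" using m(1) by simp
 obtain k where k: "(mon m 1 - mon 0 (pt' m)) ^ k \<in> germ_ideal pt'" using germ_nilpotent[OF pt' a] by auto
 have aC: "mon m 1 - mon 0 (pt' m) \<in> lspan C" by (rule lspan_diff[OF a const_in])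
 have "ev pt (mon m 1 - mon 0 (pt' m)) ~= 0" using m(2) by (simp add: eval_chart_diff pts_zero[OF pt])
 hence "ev pt ((mon m 1 - mon 0 (pt' m)) ^ k) ~= 0" by (simp add: eval_power[OF pt aC])
 then obtain t where t: "t \<in> lspan C" "(mon m 1 - mon 0 (pt' m)) ^ k * t - 1 \<in> germ_ideal pt"
  using germ_invertible[OF pt A_power[OF aC]] by blast
 show ?thesis
 proof (rule bexI)
  show "(mon m 1 - mon 0 (pt' m)) ^ k * t - 1 \<in> germ_ideal pt" by (rule t(2))
  show "(mon m 1 - mon 0 (pt' m)) ^ k * t \<in> germ_ideal pt'"
   using germ_mult[OF t(1) k] by (simp add: mult.commute)
 qed
qed

lemma germ_crt:
 assumes "finite Z" "Z \<subseteq> pts" "!!pt. pt \<in> Z ==> g pt \<in> lspan C"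
 shows "\<exists>h\<in>lspan C. \<forall>pt\<in>Z. h - g pt \<in> germ_ideal pt" using assms
proof induction
 case empty
 show ?case using A_one by blast
next
 case (insert pt Z)
 then obtain h where h: "h \<in> lspan C" "!!pt'. pt' \<in> Z ==> h - g pt' \<in> germ_ideal pt'" by blast
 have pt: "pt \<in> pts" using insert.prems by simp
 \<comment> \<open>The Chinese remainder element: a product of separating functions, equal to one at
   \<open>pt\<close> and zero at the other points in the sense of germs.\<close>
 have "\<exists>e\<in>lspan C. e - 1 \<in> germ_ideal pt \<and> (\<forall>pt'\<in>Y. e \<in> germ_ideal pt')" if "Y \<subseteq> Z" for Y
  using finite_subset[OF that insert.hyps(1)] that
 proof induction
  case empty
  show ?case by (intro bexI[OF _ A_one]) (simp add: germ_zero[OF pt])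
 next
  case (insert pt' Y)
  then obtain e where e: "e \<in> lspan C" "e - 1 \<in> germ_ideal pt" "\<forall>pt'\<in>Y. e \<in> germ_ideal pt'" by blast
  have "pt' \<in> Z" using insert.prems by simp
  hence "pt' \<in> pts" "pt ~= pt'" using \<open>insert pt Z \<subseteq> pts\<close> \<open>pt \<notin> Z\<close> by auto
  then obtain d where d: "d \<in> germ_ideal pt'" "d - 1 \<in> germ_ideal pt" using germ_separate[OF pt] by blast
  have dC: "d \<in> lspan C" by (rule germ_A[OF d(1)])
  show ?case
  proof (intro bexI[of _ "e * d"] conjI ballI)
   have ed: "e * d - 1 = e * (d - 1) + (e - 1)" by (simp add: algebra_simps)
   show "e * d - 1 \<in> germ_ideal pt" unfolding ed by (rule germ_add[OF pt germ_mult[OF e(1) d(2)] e(2)])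
   show "e * d \<in> germ_ideal pt''" if "pt'' \<in> insert pt' Y" for pt''
   proof (cases "pt'' = pt'")
    case True
    thus ?thesis using germ_mult[OF e(1) d(1)] by simp
   next
    case False
    hence "e \<in> germ_ideal pt''" using that e(3) by blast
    from germ_mult[OF dC this] show ?thesis by (simp add: mult.commute)
   qed
  qed (rule A_mult[OF e(1) dC])
 qed
 from this[OF subset_refl] obtain e where e: "e \<in> lspan C" "e - 1 \<in> germ_ideal pt" "\<forall>pt'\<in>Z. e \<in> germ_ideal pt'" by blast
 have gh: "g pt - h \<in> lspan C" using insert.prems(2)[of pt] h(1) by (intro lspan_diff) auto
 show ?case
 proof (intro bexI[of _ "h + (g pt - h) * e"] ballI)
  show "h + (g pt - h) * e \<in> lspan C" by (rule A_add[OF h(1) A_mult[OF gh e(1)]])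
  fix pt' assume pt': "pt' \<in> insert pt Z"
  show "h + (g pt - h) * e - g pt' \<in> germ_ideal pt'"
  proof (cases "pt' = pt")
   case True
   have "h + (g pt - h) * e - g pt = (g pt - h) * (e - 1)" by (simp add: algebra_simps)
   thus ?thesis unfolding True by (simp only: germ_mult[OF gh e(2)])
  next
   case False
   hence Z: "pt' \<in> Z" "pt' \<in> pts" using pt' insert.prems(1) by auto
   have he: "h + (g pt - h) * e - g pt' = (h - g pt') + (g pt - h) * e" by simp
   show ?thesis unfolding he by (rule germ_add[OF Z(2) h(2)[OF Z(1)] germ_mult[OF gh bspec[OF e(3) Z(1)]]])
  qed
 qed
qed

end

text \<open>By Gordan's lemma a point is determined by its values on finitely many monomials, and
  each value is a root of the equation satisfied by that monomial.\<close>

lemma finite_zero_set: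
 assumes "finite_subscheme (dual U) \<aa>" and fin: "finite U"
 shows "finite {pt \<in> finite_subscheme.pts (dual U). \<forall>f\<in>\<aa>. ev pt f = 0}"
proof -
 interpret finite_subscheme "dual U" \<aa> by fact
 let ?Z = "{pt \<in> pts. \<forall>f\<in>\<aa>. ev pt f = 0}"
 obtain G where G: "G \<subseteq> dual U" "finite G"
  "!!P. P 0 ==> (\<forall>g\<in>G. \<forall>m\<in>dual U. P m --> P (g + m)) ==> (\<forall>m\<in>dual U. P m)"
  using gordan[OF fin] by blast
 have "\<forall>m\<in>dual U. \<exists>R. (\<Prod>c\<in>#R. mon m 1 - mon 0 c) \<in> \<aa>"
  using alg by (simp add: algebraic_mod_def)
 hence "\<exists>R. \<forall>m\<in>dual U. (\<Prod>c\<in>#R m. mon m 1 - mon 0 c) \<in> \<aa>" by (rule bchoice)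
 then obtain R where R: "\<forall>m\<in>dual U. (\<Prod>c\<in>#R m. mon m 1 - mon 0 c) \<in> \<aa>" by (elim exE)
 have "(%pt. restrict pt G) ` ?Z \<subseteq> PiE G (%m. set_mset (R m))"
 proof
  fix \<phi> assume "\<phi> \<in> (%pt. restrict pt G) ` ?Z"
  then obtain pt where pt: "pt \<in> pts" "\<forall>f\<in>\<aa>. ev pt f = 0" "\<phi> = restrict pt G" by blast
  have "pt m \<in># R m" if m: "m \<in> G" for m
  proof -
   have mU: "m \<in> dual U" using m G(1) by blast
   have aC: "mon m 1 - mon 0 c \<in> lspan (dual U)" for c
    by (rule lspan_diff[OF _ const_in]) (use mU in simp)
   have "ev pt (\<Prod>c\<in>#M. mon m 1 - mon 0 c) = (\<Prod>c\<in>#M. pt m - c)" for M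
   proof (induction M)
    case (add c M)
    have "(\<Prod>c\<in>#M. mon m 1 - mon 0 c) \<in> lspan (dual U)" by (intro A_prod_mset aC)
    with add show ?case by (simp add: eval_mult[OF pt(1) aC] eval_chart_diff pts_zero[OF pt(1)])
   qed (simp add: eval_one[OF pt(1)])
   moreover have "ev pt (\<Prod>c\<in>#R m. mon m 1 - mon 0 c) = 0" using R mU pt(2) by blast
   ultimately have "(\<Prod>c\<in>#R m. pt m - c) = 0" by simp
   thus ?thesis by (auto simp: prod_mset_zero_iff)
  qed
  thus "\<phi> \<in> PiE G (%m. set_mset (R m))" unfolding pt(3) by auto
 qed
 hence "finite ((%pt. restrict pt G) ` ?Z)" by (rule finite_subset) (simp add: finite_PiE G(2))
 moreover have "inj_on (%pt. restrict pt G) ?Z"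
 proof (rule inj_onI)
  fix pt pt' assume "pt \<in> ?Z" "pt' \<in> ?Z" and eq: "restrict pt G = restrict pt' G"
  hence pt: "pt \<in> pts" "pt' \<in> pts" by simp_all
  have "\<forall>m\<in>dual U. pt m = pt' m"
  proof (rule G(3))
   show "pt 0 = pt' 0" using pt by (simp add: pts_def)
   show "\<forall>g\<in>G. \<forall>m\<in>dual U. pt m = pt' m --> pt (g + m) = pt' (g + m)"
   proof (intro ballI impI)
    fix g m assume g: "g \<in> G" and m: "m \<in> dual U" "pt m = pt' m"
    have "g \<in> dual U" using g G(1) by blast
    moreover have "pt g = pt' g" using fun_cong[OF eq, of g] g by simp
    ultimately show "pt (g + m) = pt' (g + m)" using pt m by (simp add: pts_def)
   qed
  qed
  thus "pt = pt'" using extensionalityI[of pt "dual U" pt'] pt unfolding pts_def by blast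
 qed
 ultimately show ?thesis by (rule finite_imageD)
qed

section \<open>Germs of sections at the points of the subscheme\<close>

text \<open>The set \<open>pts\<close> involves no ideal; an instance whose ideal is the whole ring,
  where the empty product witnesses algebraicity, gives access to its definition.\<close>

lemma pts_eq:
 "finite_subscheme.pts (dual U) =
  {pt \<in> extensional (dual U). pt 0 = 1 \<and> (\<forall>a\<in>dual U. \<forall>b\<in>dual U. pt (a + b) = pt a * pt b)}"
proof -
 interpret finite_subscheme "dual U" "lspan (dual U)"
 proof -
  interpret affine_monoid "dual U" by (rule affine_monoid_dual)
  show "finite_subscheme (dual U) (lspan (dual U))"
  proof
   show "aideal (lspan (dual U))" by (simp add: aideal_def smod_def A_add A_mult)
   show "algebraic_mod (lspan (dual U)) a" for a
    unfolding algebraic_mod_def by (rule exI[of _ "{#}"]) (use A_one in simp)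
  qed
 qed
 show ?thesis by (rule pts_def)
qed

context toric
begin

lemma pts_chart_points: "sg \<in> \<Sigma> ==> finite_subscheme.pts (dc sg) = chart_points sg"
 by (simp add: pts_eq chart_points_def dual_monoid_eq)

lemma nef_face:
 assumes "nef_data c m" "sg \<in> \<Sigma>" "fc \<in> \<Sigma>" "fc \<subseteq> sg"
 shows "m sg - m fc \<in> dc fc" "m fc - m sg \<in> dc fc"
proof -
 have "pairing (m sg) w = pairing (m fc) w" if w: "w \<in> gens fc" for w
 proof -
  obtain i where i: "w = u i" "rvec (u i) \<in> fc" using w by (auto simp: gens_def)
  have "rvec (u i) \<in> sg" using i(2) assms(4) by blast
  hence "pairing (m sg) (u i) = - c $ i" "pairing (m fc) (u i) = - c $ i"
   using assms(1-3) i(2) unfolding nef_data_def by blast+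
  thus ?thesis using i(1) by simp
 qed
 thus "m sg - m fc \<in> dc fc" "m fc - m sg \<in> dc fc" by (simp_all add: dual_def pairing_diff)
qed

lemma eval_restrict:
 assumes "f \<in> lspan (dc sg)"
 shows "ev (restrict qt (dc sg)) f = ev qt f"
 unfolding eval_chart_def by (rule sum.cong) (use assms in \<open>auto simp: lspan_def\<close>)

lemma lspan_cuts_shift:
 assumes m: "cuts sg fc m" and f: "f \<in> lspan (dc fc)"
 shows "\<forall>\<^sub>F l in sequentially. mon (int l *s m) 1 * f \<in> lspan (dc sg)"
proof -
 have "\<forall>\<^sub>F l in sequentially. x + int l *s m \<in> dc sg" if "x \<in> supp f" for x
  unfolding eventually_sequentially
  by (rule cuts_shift[OF m]) (use that f in \<open>auto simp: lspan_def\<close>)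
 hence "\<forall>\<^sub>F l in sequentially. \<forall>x\<in>supp f. x + int l *s m \<in> dc sg"
  by (intro eventually_ball_finite finite_keys ballI)
 thus ?thesis
 proof (rule eventually_mono)
  fix l assume "\<forall>x\<in>supp f. x + int l *s m \<in> dc sg"
  hence "f \<in> lspan {x. int l *s m + x \<in> dc sg}" by (auto simp: lspan_def add.commute)
  thus "mon (int l *s m) 1 * f \<in> lspan (dc sg)" unfolding lspan_shift .
 qed
qed

end

lemma mon_mult_mult: "mon a 1 * (mon b 1 * f) = mon (a + b) (1 :: complex) * f" for a b :: "'m::ab_group_add"
 by (simp add: mult_single flip: mult.assoc)

context nef_system
begin

text \<open>The ideal of the subscheme in the chart of \<open>sg\<close>, in terms of local
  generators; \<open>chart_ideal_eq\<close> will identify it with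
  \<open>chart_ideal\<close>.\<close>

definition loc :: "(real ^ 'n) set => ((int ^ 'n) \<Rightarrow>\<^sub>0 complex) set" where
 "loc sg = affine_monoid.gen_ideal (dc sg) I (%j. mon (- mm j sg) 1 * F j)"

lemma loc_iff:
 "g \<in> loc sg \<longleftrightarrow> (\<exists>c. (\<forall>j\<in>I. c j \<in> lspan (dc sg)) \<and> g = (\<Sum>j\<in>I. c j * (mon (- mm j sg) 1 * F j)))"
 unfolding loc_def affine_monoid.gen_ideal_def[OF affine_monoid_dual] by blast

lemma scheme: "sg \<in> \<Sigma> ==> finite_subscheme (dc sg) (loc sg)"
proof -
 assume sg: "sg \<in> \<Sigma>"
 interpret affine_monoid "dc sg" by (rule affine_monoid_dual)
 show ?thesis
 proof
  show "aideal (loc sg)" unfolding loc_def by (rule aideal_gen_ideal) (rule F_local[OF _ sg])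
  show "algebraic_mod (loc sg) g" if "g \<in> lspan (dc sg)" for g
   using alg[OF sg that] by (simp add: loc_def)
 qed
qed

abbreviation germ :: "(real ^ 'n) set => (int ^ 'n => complex) => ((int ^ 'n) \<Rightarrow>\<^sub>0 complex) set" where
 "germ sg \<equiv> finite_subscheme.germ_ideal (dc sg) (loc sg)"

lemma loc_face:
 assumes sg: "sg \<in> \<Sigma>" and fc: "fc \<in> \<Sigma>" "fc \<subseteq> sg" and g: "g \<in> loc sg"
 shows "g \<in> loc fc"
proof -
 obtain c where c: "\<forall>j\<in>I. c j \<in> lspan (dc sg)" "g = (\<Sum>j\<in>I. c j * (mon (- mm j sg) 1 * F j))"
  using g unfolding loc_iff by blast
 have "(c j * mon (mm j fc - mm j sg) 1) * (mon (- mm j fc) 1 * F j) = c j * (mon (- mm j sg) 1 * F j)" for j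
  by (simp add: mult.assoc mon_mult_mult)
 moreover have "c j * mon (mm j fc - mm j sg) 1 \<in> lspan (dc fc)" if j: "j \<in> I" for j
 proof (rule lspan_mult)
  show "c j \<in> lspan (dc fc)" using c(1) j by (intro lspan_mono[OF _ dual_anti[OF fc(2)]]) blast
  show "mon (mm j fc - mm j sg) 1 \<in> lspan (dc fc)" using nef_face(2)[OF nef_a[OF j] sg fc] by simp
 qed (rule dual_add)
 ultimately show ?thesis
  unfolding loc_iff c(2) by (intro exI[of _ "%j. c j * mon (mm j fc - mm j sg) 1"]) simp
qed

text \<open>One power of the cutting character clears the denominators of all the finitely many
  coefficients.\<close>

lemma loc_shift:
 assumes sg: "sg \<in> \<Sigma>" and fc: "fc \<in> \<Sigma>" "fc \<subseteq> sg" and m: "cuts sg fc m" and g: "g \<in> loc fc"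
 shows "\<exists>l. mon (int l *s m) 1 * g \<in> loc sg"
proof -
 obtain c where c: "\<forall>j\<in>I. c j \<in> lspan (dc fc)" "g = (\<Sum>j\<in>I. c j * (mon (- mm j fc) 1 * F j))"
  using g unfolding loc_iff by blast
 define d where "d j = c j * mon (mm j sg - mm j fc) 1" for j
 have d: "d j \<in> lspan (dc fc)" if j: "j \<in> I" for j unfolding d_def
 proof (rule lspan_mult)
  show "c j \<in> lspan (dc fc)" using c(1) j by blast
  show "mon (mm j sg - mm j fc) 1 \<in> lspan (dc fc)" using nef_face(1)[OF nef_a[OF j] sg fc] by simp
 qed (rule dual_add)
 have "\<forall>\<^sub>F l in sequentially. \<forall>j\<in>I. mon (int l *s m) 1 * d j \<in> lspan (dc sg)"
  using lspan_cuts_shift[OF m d] by (intro eventually_ball_finite finI ballI)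
 then obtain l where l: "\<forall>j\<in>I. mon (int l *s m) 1 * d j \<in> lspan (dc sg)"
  unfolding eventually_sequentially by blast
 have "mon (int l *s m) 1 * g = (\<Sum>j\<in>I. (mon (int l *s m) 1 * d j) * (mon (- mm j sg) 1 * F j))"
  unfolding c(2) sum_distrib_left
 proof (rule sum.cong[OF refl])
  fix j
  have "d j * (mon (- mm j sg) 1 * F j) = c j * (mon (- mm j fc) 1 * F j)"
   unfolding d_def mult.assoc mon_mult_mult by simp
  thus "mon (int l *s m) 1 * (c j * (mon (- mm j fc) 1 * F j)) =
   (mon (int l *s m) 1 * d j) * (mon (- mm j sg) 1 * F j)" by (simp add: mult.assoc)
 qed
 hence "mon (int l *s m) 1 * g \<in> loc sg" using l unfolding loc_iff by (intro exI conjI)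
 thus ?thesis by blast
qed

lemma eval_mon_mult:
 assumes "fc \<in> \<Sigma>" "qt \<in> chart_points fc" "x \<in> dc fc" "f \<in> lspan (dc fc)"
 shows "ev qt (mon x 1 * f) = qt x * ev qt f"
 using eval_chart_mult[of "mon x 1" "dc fc" f qt] assms(3,4) point_add[OF assms(1,2)] by simp

lemma germ_face:
 assumes sg: "sg \<in> \<Sigma>" and fc: "fc \<in> \<Sigma>" "fc \<subseteq> sg" and qt: "qt \<in> chart_points fc"
  and g: "g \<in> lspan (dc sg)"
 shows "g \<in> germ sg (restrict qt (dc sg)) \<longleftrightarrow> g \<in> germ fc qt"
proof
 interpret S: finite_subscheme "dc sg" "loc sg" by (rule scheme[OF sg])
 interpret R: finite_subscheme "dc fc" "loc fc" by (rule scheme[OF fc(1)])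
 note sub = dual_anti[OF fc(2)]
 have gfc: "g \<in> lspan (dc fc)" using g sub by (rule lspan_mono)
 show "g \<in> germ fc qt" if h: "g \<in> germ sg (restrict qt (dc sg))"
 proof -
  obtain s where s: "s \<in> lspan (dc sg)" "ev (restrict qt (dc sg)) s ~= 0" "s * g \<in> loc sg"
   by (rule S.germE[OF h]) (rule that)
  show ?thesis
   by (rule R.germI[OF gfc lspan_mono[OF s(1) sub] _ loc_face[OF sg fc s(3)]]) (use s(2) eval_restrict[OF s(1)] in simp)
 qed
 show "g \<in> germ sg (restrict qt (dc sg))" if h: "g \<in> germ fc qt"
 proof -
  obtain s where s: "s \<in> lspan (dc fc)" "ev qt s ~= 0" "s * g \<in> loc fc"
   by (rule R.germE[OF h]) (rule that)
  obtain m where m: "cuts sg fc m" using ex_cuts[OF sg fc] by blast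
  have msg: "m \<in> dc sg" using m by (simp add: cuts_def)
  have mfc: "m \<in> dc fc" by (rule cuts_dual(1)[OF m fc(2)])
  obtain l where l: "mon (int l *s m) 1 * (s * g) \<in> loc sg" using loc_shift[OF sg fc m s(3)] by blast
  obtain k where k: "mon (int k *s m) 1 * s \<in> lspan (dc sg)"
   using lspan_cuts_shift[OF m s(1)] unfolding eventually_sequentially by blast
  have ml: "mon (int l *s m) 1 \<in> lspan (dc sg)" using dual_scale[OF msg] by simp
  have mk: "mon (int k *s m) 1 \<in> lspan (dc sg)" using dual_scale[OF msg] by simp
  define t where "t = mon (int l *s m) 1 * (mon (int k *s m) 1 * s)"
  have t: "t \<in> lspan (dc sg)" unfolding t_def using ml k by (rule S.A_mult)
  show ?thesis
  proof (rule S.germI[OF g t])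
   have "ev qt t = qt (int l *s m) * (qt (int k *s m) * ev qt s)" unfolding t_def
    using eval_mon_mult[OF fc(1) qt dual_scale[OF mfc] lspan_mono[OF k sub], of l]
     eval_mon_mult[OF fc(1) qt dual_scale[OF mfc] s(1), of k] by simp
   moreover have "qt (int l *s m) ~= 0" "qt (int k *s m) ~= 0"
    using point_scale[OF fc(1) qt mfc] cuts_nonzero[OF fc(1) qt m fc(2)] by simp_all
   ultimately show "ev (restrict qt (dc sg)) t ~= 0"
    using s(2) unfolding eval_restrict[OF t] by simp
   have "t * g = mon (int k *s m) 1 * (mon (int l *s m) 1 * (s * g))" by (simp add: t_def mult_ac)
   thus "t * g \<in> loc sg" using S.\<aa>_mult[OF mk l] by simp
  qed
 qed
qed

text \<open>A power of the cutting character moves \<open>g\<close> into the larger chart, and its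
  inverse modulo the germ, the function \<open>t\<close>, undoes this factor.\<close>

lemma germ_lift:
 assumes sg: "sg \<in> \<Sigma>" and fc: "fc \<in> \<Sigma>" "fc \<subseteq> sg" and qt: "qt \<in> chart_points fc"
  and g: "g \<in> lspan (dc fc)"
 shows "\<exists>g'\<in>lspan (dc sg). g - g' \<in> germ fc qt"
proof -
 interpret S: finite_subscheme "dc sg" "loc sg" by (rule scheme[OF sg])
 interpret R: finite_subscheme "dc fc" "loc fc" by (rule scheme[OF fc(1)])
 note sub = dual_anti[OF fc(2)]
 let ?pt = "restrict qt (dc sg)"
 have pt: "?pt \<in> S.pts" using restrict_point[OF sg fc qt] pts_chart_points[OF sg] by simp
 obtain m where m: "cuts sg fc m" using ex_cuts[OF sg fc] by blast
 have msg: "m \<in> dc sg" using m by (simp add: cuts_def)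
 have mfc: "m \<in> dc fc" by (rule cuts_dual(1)[OF m fc(2)])
 obtain k where k: "mon (int k *s m) 1 * g \<in> lspan (dc sg)"
  using lspan_cuts_shift[OF m g] unfolding eventually_sequentially by blast
 have mk: "mon (int k *s m) 1 \<in> lspan (dc sg)" using dual_scale[OF msg] by simp
 have "ev ?pt (mon (int k *s m) 1) ~= 0"
  unfolding eval_restrict[OF mk] using point_scale[OF fc(1) qt mfc] cuts_nonzero[OF fc(1) qt m fc(2)] by simp
 then obtain t where t: "t \<in> lspan (dc sg)" "mon (int k *s m) 1 * t - 1 \<in> germ sg ?pt"
  using S.germ_invertible[OF pt mk] by blast
 have "mon (int k *s m) 1 * t - 1 \<in> germ fc qt"
  using t(2) germ_face[OF sg fc qt S.germ_A[OF t(2)]] by simp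
 hence "- (g * (mon (int k *s m) 1 * t - 1)) \<in> germ fc qt" by (intro R.germ_uminus R.germ_mult[OF g])
 moreover have "- (g * (mon (int k *s m) 1 * t - 1)) = g - t * (mon (int k *s m) 1 * g)" by (simp add: algebra_simps)
 ultimately show ?thesis using S.A_mult[OF t(1) k] by auto
qed

section \<open>Sections of the line bundle near the points of the subscheme\<close>

abbreviation M :: "(real ^ 'n) set => int ^ 'n" where "M \<equiv> m_sum I"

definition sect :: "(real ^ 'n) set => ((int ^ 'n) \<Rightarrow>\<^sub>0 complex) set" where
 "sect fc = secs u (div_sum I) fc"

lemma sect_local: "sg \<in> \<Sigma> ==> f \<in> sect sg \<longleftrightarrow> mon (- M sg) 1 * f \<in> lspan (dc sg)"
 unfolding sect_def by (rule sect_iff) simp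

lemma sect_anti: "fc \<subseteq> sg ==> f \<in> sect sg ==> f \<in> sect fc"
 unfolding sect_def by (erule lspan_mono) (rule poly_pts_anti)

lemma sect_diff: "f \<in> sect sg ==> g \<in> sect sg ==> f - g \<in> sect sg"
 unfolding sect_def by (rule lspan_diff)

text \<open>The sections of the line bundle of \<open>b + \<Sum>\<^sub>j a\<^sub>j\<close> which vanish on the part of the subscheme
 supported at \<open>pz\<close>.\<close>

definition van :: "'n toric_point => ((int ^ 'n) \<Rightarrow>\<^sub>0 complex) set" where
 "van pz = {f. \<exists>fc qt. (fc, qt) \<in> pz \<and> mon (- M fc) 1 * f \<in> germ fc qt}"

text \<open>On the smaller chart the two local generators differ by a unit.\<close>

lemma van_face:
 assumes sg: "sg \<in> \<Sigma>" and fc: "fc \<in> \<Sigma>" "fc \<subseteq> sg" and qt: "qt \<in> chart_points fc" and f: "f \<in> sect sg"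
 shows "mon (- M sg) 1 * f \<in> germ sg (restrict qt (dc sg)) \<longleftrightarrow> mon (- M fc) 1 * f \<in> germ fc qt"
proof -
 interpret R: finite_subscheme "dc fc" "loc fc" by (rule scheme[OF fc(1)])
 note nf = nef_face[OF nef_sum[OF subset_refl] sg fc]
 have u: "mon (M sg - M fc) 1 \<in> lspan (dc fc)" "mon (M fc - M sg) 1 \<in> lspan (dc fc)"
  using nf by simp_all
 have e: "mon (- M fc) 1 * f = mon (M sg - M fc) 1 * (mon (- M sg) 1 * f)"
  "mon (- M sg) 1 * f = mon (M fc - M sg) 1 * (mon (- M fc) 1 * f)" by (simp_all add: mon_mult_mult)
 have "mon (- M sg) 1 * f \<in> germ fc qt \<longleftrightarrow> mon (- M fc) 1 * f \<in> germ fc qt"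
 proof
  assume "mon (- M sg) 1 * f \<in> germ fc qt"
  thus "mon (- M fc) 1 * f \<in> germ fc qt" unfolding e(1) by (rule R.germ_mult[OF u(1)])
 next
  assume "mon (- M fc) 1 * f \<in> germ fc qt"
  thus "mon (- M sg) 1 * f \<in> germ fc qt" unfolding e(2) by (rule R.germ_mult[OF u(2)])
 qed
 moreover have "mon (- M sg) 1 * f \<in> lspan (dc sg)" using f sect_local[OF sg] by simp
 ultimately show ?thesis using germ_face[OF sg fc qt] by simp
qed

lemma germ_sect:
 assumes "sg \<in> \<Sigma>" "mon (- M sg) 1 * f \<in> germ sg pt"
 shows "f \<in> sect sg"
 using finite_subscheme.germ_A[OF scheme[OF assms(1)] assms(2)] sect_local[OF assms(1)] by simp

lemma vanI: "(sg, pt) \<in> pz ==> mon (- M sg) 1 * f \<in> germ sg pt ==> f \<in> van pz"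
 unfolding van_def by blast

text \<open>Two representatives of a point both restrict from the chart of a common face, where the
  conditions coincide.\<close>

lemma van_iff:
 assumes pz: "pz \<in> toric_variety \<Sigma>" and pt: "(sg, pt) \<in> pz" and f: "f \<in> sect sg"
 shows "f \<in> van pz \<longleftrightarrow> mon (- M sg) 1 * f \<in> germ sg pt"
proof
 show "mon (- M sg) 1 * f \<in> germ sg pt ==> f \<in> van pz" by (rule vanI[OF pt])
 assume "f \<in> van pz"
 then obtain tc pt' where t: "(tc, pt') \<in> pz" "mon (- M tc) 1 * f \<in> germ tc pt'" unfolding van_def by blast
 note sg = rep_chart(1)[OF pz pt] and tc = rep_chart(1)[OF pz t(1)]
 obtain fc qt where fc: "fc \<in> \<Sigma>" "fc \<subseteq> sg" "fc \<subseteq> tc" "qt \<in> chart_points fc" "(fc, qt) \<in> pz"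
  "pt = restrict qt (dc sg)" "pt' = restrict qt (dc tc)" using rep_common[OF pz pt t(1)] .
 have "mon (- M fc) 1 * f \<in> germ fc qt"
  using t(2) van_face[OF tc fc(1,3,4) germ_sect[OF tc t(2)]] fc(7) by simp
 thus "mon (- M sg) 1 * f \<in> germ sg pt" using van_face[OF sg fc(1,2,4) f] fc(6) by simp
qed

lemma van_diff:
 assumes pz: "pz \<in> toric_variety \<Sigma>" and f: "f \<in> van pz" and g: "g \<in> van pz"
 shows "f - g \<in> van pz"
proof -
 obtain sg pt where s: "(sg, pt) \<in> pz" "mon (- M sg) 1 * f \<in> germ sg pt" using f unfolding van_def by blast
 obtain tc pt' where t: "(tc, pt') \<in> pz" "mon (- M tc) 1 * g \<in> germ tc pt'" using g unfolding van_def by blast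
 note sg = rep_chart(1)[OF pz s(1)] and tc = rep_chart(1)[OF pz t(1)]
 obtain fc qt where fc: "fc \<in> \<Sigma>" "fc \<subseteq> sg" "fc \<subseteq> tc" "qt \<in> chart_points fc" "(fc, qt) \<in> pz"
  "pt = restrict qt (dc sg)" "pt' = restrict qt (dc tc)" using rep_common[OF pz s(1) t(1)] .
 interpret R: finite_subscheme "dc fc" "loc fc" by (rule scheme[OF fc(1)])
 have "qt \<in> R.pts" using fc(4) pts_chart_points[OF fc(1)] by simp
 moreover have "mon (- M fc) 1 * f \<in> germ fc qt"
  using s(2) van_face[OF sg fc(1,2,4) germ_sect[OF sg s(2)]] fc(6) by simp
 moreover have "mon (- M fc) 1 * g \<in> germ fc qt"
  using t(2) van_face[OF tc fc(1,3,4) germ_sect[OF tc t(2)]] fc(7) by simp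
 ultimately have "mon (- M fc) 1 * (f - g) \<in> germ fc qt"
  unfolding right_diff_distrib by (rule R.germ_diff)
 thus ?thesis by (rule vanI[OF fc(5)])
qed

lemma van_zero:
 assumes pz: "pz \<in> toric_variety \<Sigma>"
 shows "0 \<in> van pz"
proof -
 obtain sg pt where s: "(sg, pt) \<in> pz" using point_rep[OF pz] by blast
 note sg = rep_chart[OF pz s]
 interpret finite_subscheme "dc sg" "loc sg" by (rule scheme[OF sg(1)])
 have "0 \<in> germ sg pt" using germ_zero sg(2) pts_chart_points[OF sg(1)] by simp
 thus ?thesis by (intro vanI[OF s]) simp
qed

lemma van_add: "pz \<in> toric_variety \<Sigma> ==> f \<in> van pz ==> g \<in> van pz ==> f + g \<in> van pz"
 using van_diff[of pz f "- g"] van_diff[of pz 0 g] van_zero[of pz] by simp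

lemma van_scale:
 assumes pz: "pz \<in> toric_variety \<Sigma>" and f: "f \<in> van pz"
 shows "mon 0 c * f \<in> van pz"
proof -
 obtain sg pt where s: "(sg, pt) \<in> pz" "mon (- M sg) 1 * f \<in> germ sg pt" using f unfolding van_def by blast
 interpret finite_subscheme "dc sg" "loc sg" by (rule scheme[OF rep_chart(1)[OF pz s(1)]])
 have "mon 0 c * (mon (- M sg) 1 * f) \<in> germ sg pt" by (rule germ_mult[OF const_in s(2)])
 thus ?thesis by (intro vanI[OF s(1)]) (simp add: mult_ac)
qed

lemma loc_sections:
 assumes sg: "sg \<in> \<Sigma>"
 shows "mon (- M sg) 1 * f \<in> loc sg \<longleftrightarrow>
  (in_ideal sg f)"
proof
 have sp: "M sg = mm j sg + m_sum (I - {j}) sg" if "j \<in> I" for j using m_sum_remove[OF subset_refl that] .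
 have e: "mon (- M sg) 1 * (F j * y) = (mon (- m_sum (I - {j}) sg) 1 * y) * (mon (- mm j sg) 1 * F j)" if "j \<in> I" for j y
 proof -
  have "(mon (- m_sum (I - {j}) sg) 1 * y) * (mon (- mm j sg) 1 * F j) =
   mon (- mm j sg) 1 * (mon (- m_sum (I - {j}) sg) 1 * (F j * y))" by (simp add: mult_ac)
  thus ?thesis unfolding mon_mult_mult sp[OF that] by simp
 qed
 {
  assume "mon (- M sg) 1 * f \<in> loc sg"
  then obtain c where c: "\<forall>j\<in>I. c j \<in> lspan (dc sg)"
   "mon (- M sg) 1 * f = (\<Sum>j\<in>I. c j * (mon (- mm j sg) 1 * F j))" unfolding loc_iff by blast
  define y where "y j = mon (m_sum (I - {j}) sg) 1 * c j" for j
  have "y j \<in> secs u (div_sum (I - {j})) sg" if "j \<in> I" for j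
   using c(1) that sect_iff[of "I - {j}" sg "y j"] sg by (simp add: y_def)
  moreover have "mon (- M sg) 1 * f = mon (- M sg) 1 * (\<Sum>j\<in>I. F j * y j)"
   unfolding c(2) sum_distrib_left by (rule sum.cong[OF refl]) (simp add: e y_def)
  hence "mon (M sg) 1 * (mon (- M sg) 1 * f) = mon (M sg) 1 * (mon (- M sg) 1 * (\<Sum>j\<in>I. F j * y j))" by simp
  hence "f = (\<Sum>j\<in>I. F j * y j)" by simp
  ultimately show "in_ideal sg f"
   by blast
 next
  assume "in_ideal sg f"
  then obtain y where y: "\<forall>j\<in>I. y j \<in> secs u (div_sum (I - {j})) sg" "f = (\<Sum>j\<in>I. F j * y j)"
   by (elim exE conjE) (rule that)
  have "mon (- m_sum (I - {j}) sg) 1 * y j \<in> lspan (dc sg)" if "j \<in> I" for j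
   using y(1) that sect_iff[of "I - {j}" sg "y j"] sg by simp
  moreover have "mon (- M sg) 1 * f = (\<Sum>j\<in>I. (mon (- m_sum (I - {j}) sg) 1 * y j) * (mon (- mm j sg) 1 * F j))"
   unfolding y(2) sum_distrib_left by (rule sum.cong[OF refl]) (rule e)
  ultimately show "mon (- M sg) 1 * f \<in> loc sg" unfolding loc_iff
   by (intro exI[of _ "%j. mon (- m_sum (I - {j}) sg) 1 * y j"]) blast
 }
qed

text \<open>Membership in the ideal of a chart is detected by germs, and every point of the chart
  represents a point of the variety.\<close>

lemma van_local:
 assumes fc: "fc \<in> \<Sigma>" and f: "f \<in> sect fc"
  and van: "!!pz qt. pz \<in> toric_variety \<Sigma> ==> (fc, qt) \<in> pz ==> f \<in> van pz"
 shows "mon (- M fc) 1 * f \<in> loc fc"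
proof (rule finite_subscheme.germ_local[OF scheme[OF fc]])
 show "mon (- M fc) 1 * f \<in> lspan (dc fc)" using f sect_local[OF fc] by simp
 fix qt assume "qt \<in> finite_subscheme.pts (dc fc)"
 hence "qt \<in> chart_points fc" using pts_chart_points[OF fc] by simp
 then obtain pz where pz: "pz \<in> toric_variety \<Sigma>" "(fc, qt) \<in> pz" using ex_class[OF fc] by blast
 from van[OF this] show "mon (- M fc) 1 * f \<in> germ fc qt" using van_iff[OF pz f] by simp
qed

lemma loc_van:
 assumes "pz \<in> toric_variety \<Sigma>" "(sg, pt) \<in> pz" "mon (- M sg) 1 * f \<in> loc sg"
 shows "f \<in> van pz"
proof (rule vanI[OF assms(2)])
 note sg = rep_chart[OF assms(1,2)]
 show "mon (- M sg) 1 * f \<in> germ sg pt"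
  using finite_subscheme.\<aa>_germ[OF scheme[OF sg(1)] _ assms(3)] sg(2) pts_chart_points[OF sg(1)] by simp
qed

definition zeros :: "'n toric_point set" where
 "zeros = {pz \<in> toric_variety \<Sigma>. \<exists>(sg, pt)\<in>pz. \<forall>g\<in>loc sg. ev pt g = 0}"

lemma zeros_variety: "pz \<in> zeros ==> pz \<in> toric_variety \<Sigma>" by (simp add: zeros_def)

lemma zeros_face:
 assumes sg: "sg \<in> \<Sigma>" and fc: "fc \<in> \<Sigma>" "fc \<subseteq> sg" and qt: "qt \<in> chart_points fc"
 shows "(\<forall>g\<in>loc sg. ev (restrict qt (dc sg)) g = 0) \<longleftrightarrow> (\<forall>g\<in>loc fc. ev qt g = 0)"
proof (intro iffI ballI)
 interpret S: finite_subscheme "dc sg" "loc sg" by (rule scheme[OF sg])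
 interpret R: finite_subscheme "dc fc" "loc fc" by (rule scheme[OF fc(1)])
 {
  fix g assume van: "\<forall>g\<in>loc sg. ev (restrict qt (dc sg)) g = 0" and g: "g \<in> loc fc"
  obtain m where m: "cuts sg fc m" using ex_cuts[OF sg fc] by blast
  have mfc: "m \<in> dc fc" by (rule cuts_dual(1)[OF m fc(2)])
  obtain l where l: "mon (int l *s m) 1 * g \<in> loc sg" using loc_shift[OF sg fc m g] by blast
  have "qt (int l *s m) * ev qt g = 0"
   using bspec[OF van l] eval_restrict[OF S.\<aa>_A[OF l]] eval_mon_mult[OF fc(1) qt dual_scale[OF mfc] R.\<aa>_A[OF g]]
   by simp
  thus "ev qt g = 0" using point_scale[OF fc(1) qt mfc] cuts_nonzero[OF fc(1) qt m fc(2)] by simp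
 next
  fix g assume van: "\<forall>g\<in>loc fc. ev qt g = 0" and g: "g \<in> loc sg"
  show "ev (restrict qt (dc sg)) g = 0"
   using bspec[OF van loc_face[OF sg fc g]] eval_restrict[OF S.\<aa>_A[OF g]] by simp
 }
qed

lemma zeros_rep:
 assumes pz: "pz \<in> toric_variety \<Sigma>" and pt: "(sg, pt) \<in> pz"
 shows "pz \<in> zeros \<longleftrightarrow> (\<forall>g\<in>loc sg. ev pt g = 0)"
proof
 show "\<forall>g\<in>loc sg. ev pt g = 0 ==> pz \<in> zeros" unfolding zeros_def using pz pt by blast
 assume "pz \<in> zeros"
 then obtain tc pt' where t: "(tc, pt') \<in> pz" "\<forall>g\<in>loc tc. ev pt' g = 0" unfolding zeros_def by blast
 note sg = rep_chart(1)[OF pz pt] and tc = rep_chart(1)[OF pz t(1)]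
 obtain fc qt where fc: "fc \<in> \<Sigma>" "fc \<subseteq> sg" "fc \<subseteq> tc" "qt \<in> chart_points fc" "(fc, qt) \<in> pz"
  "pt = restrict qt (dc sg)" "pt' = restrict qt (dc tc)" using rep_common[OF pz pt t(1)] .
 have "\<forall>g\<in>loc fc. ev qt g = 0" using t(2) zeros_face[OF tc fc(1,3,4)] unfolding fc(7) by (rule iffD1[rotated])
 thus "\<forall>g\<in>loc sg. ev pt g = 0" unfolding fc(6) by (rule iffD2[OF zeros_face[OF sg fc(1,2,4)]])
qed

lemma nonzero_van:
 assumes pz: "pz \<in> toric_variety \<Sigma>" "pz \<notin> zeros" and pt: "(sg, pt) \<in> pz" and f: "f \<in> sect sg"
 shows "f \<in> van pz"
proof (rule vanI[OF pt])
 note sg = rep_chart(1)[OF pz(1) pt]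
 obtain g where g: "g \<in> loc sg" "ev pt g ~= 0" using pz(2) zeros_rep[OF pz(1) pt] by blast
 have "mon (- M sg) 1 * f \<in> lspan (dc sg)" using f sect_local[OF sg] by simp
 thus "mon (- M sg) 1 * f \<in> germ sg pt" by (rule finite_subscheme.germ_trivial[OF scheme[OF sg] g])
qed

lemma finite_chart_zeros: "sg \<in> \<Sigma> ==> finite {pt \<in> chart_points sg. \<forall>g\<in>loc sg. ev pt g = 0}"
 using finite_zero_set[OF scheme finite_gens] pts_chart_points by simp

lemma finite_zeros: "finite zeros"
proof (rule finite_subset)
 let ?P = "SIGMA sg:\<Sigma>. {pt \<in> chart_points sg. \<forall>g\<in>loc sg. ev pt g = 0}"
 show "finite ((%p. glue \<Sigma> `` {p}) ` ?P)" by (intro finite_imageI finite_SigmaI finite_\<Sigma> finite_chart_zeros)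
 show "zeros \<subseteq> (%p. glue \<Sigma> `` {p}) ` ?P"
 proof
  fix pz assume z: "pz \<in> zeros"
  note pz = zeros_variety[OF z]
  obtain sg pt where g: "(sg, pt) \<in> pz" using point_rep[OF pz] by blast
  note sg = rep_chart[OF pz g]
  have "(sg, pt) \<in> ?P" using sg z zeros_rep[OF pz g] by simp
  moreover have "pz = glue \<Sigma> `` {(sg, pt)}"
   using rep_glue[OF pz g] rep_closed[OF pz g] by auto
  ultimately show "pz \<in> (%p. glue \<Sigma> `` {p}) ` ?P" by blast
 qed
qed

text \<open>Transports a section known on one chart through the point to another: it is restricted
  to a common face, and \<open>germ_lift\<close> returns a function on \<open>sg\<close> with the
  same germ.\<close>

lemma van_lift:
 assumes pz: "pz \<in> toric_variety \<Sigma>" and s: "(sg, pt) \<in> pz" and t: "(tc, pt') \<in> pz" and f: "f \<in> sect tc"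
 shows "\<exists>g\<in>lspan (dc sg). mon (M sg) 1 * g - f \<in> van pz"
proof -
 note sg = rep_chart(1)[OF pz s] and tc = rep_chart(1)[OF pz t]
 obtain fc qt where fc: "fc \<in> \<Sigma>" "fc \<subseteq> sg" "fc \<subseteq> tc" "qt \<in> chart_points fc" "(fc, qt) \<in> pz"
  using rep_common[OF pz s t] by blast
 interpret R: finite_subscheme "dc fc" "loc fc" by (rule scheme[OF fc(1)])
 note nf = nef_face[OF nef_sum[OF subset_refl] sg fc(1,2)]
 have u: "mon (M sg - M fc) 1 \<in> lspan (dc fc)" "mon (M fc - M sg) 1 \<in> lspan (dc fc)"
  using nf by simp_all
 have "mon (- M fc) 1 * f \<in> lspan (dc fc)"
  using sect_anti[OF fc(3) f] sect_local[OF fc(1)] by simp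
 from R.A_mult[OF u(2) this] have "mon (- M sg) 1 * f \<in> lspan (dc fc)" by (simp add: mon_mult_mult)
 then obtain g where g: "g \<in> lspan (dc sg)" "mon (- M sg) 1 * f - g \<in> germ fc qt"
  using germ_lift[OF sg fc(1,2,4)] by blast
 have "mon (M sg - M fc) 1 * (mon (- M sg) 1 * f - g) \<in> germ fc qt" by (rule R.germ_mult[OF u(1) g(2)])
 moreover have "mon (M sg - M fc) 1 * (mon (- M sg) 1 * f - g) = mon (- M fc) 1 * (f - mon (M sg) 1 * g)"
  by (simp add: right_diff_distrib mon_mult_mult)
 ultimately have "f - mon (M sg) 1 * g \<in> van pz" by (intro vanI[OF fc(5)]) simp
 from van_diff[OF pz van_zero[OF pz] this] show ?thesis by (intro bexI[OF _ g(1)]) simp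
qed

text \<open>The Chinese remainder theorem in one chart: the prescribed germ at the chosen point, if
  the chart contains it, and zero at the other points of the subscheme. Off the subscheme every
  section belongs to \<open>van\<close>.\<close>

lemma local_section:
 assumes z0: "pz\<^sub>0 \<in> zeros" and s0: "(sg\<^sub>0, pt\<^sub>0) \<in> pz\<^sub>0" and f0: "f\<^sub>0 \<in> sect sg\<^sub>0" and sg: "sg \<in> \<Sigma>"
 shows "\<exists>s\<in>sect sg. \<forall>pz\<in>toric_variety \<Sigma>. \<forall>pt. (sg, pt) \<in> pz -->
  (if pz = pz\<^sub>0 then s - f\<^sub>0 \<in> van pz else s \<in> van pz)"
proof -
 interpret S: finite_subscheme "dc sg" "loc sg" by (rule scheme[OF sg])
 note pz0 = zeros_variety[OF z0]
 have "\<exists>g\<in>lspan (dc sg). \<forall>pt. (sg, pt) \<in> pz\<^sub>0 --> mon (M sg) 1 * g - f\<^sub>0 \<in> van pz\<^sub>0"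
 proof (cases "\<exists>pt. (sg, pt) \<in> pz\<^sub>0")
  case True
  thus ?thesis using van_lift[OF pz0 _ s0 f0] by blast
 next
  case False
  thus ?thesis using S.A_one by blast
 qed
 then obtain g where g: "g \<in> lspan (dc sg)" "!!pt. (sg, pt) \<in> pz\<^sub>0 ==> mon (M sg) 1 * g - f\<^sub>0 \<in> van pz\<^sub>0"
  by blast
 define Z where "Z = {pt \<in> chart_points sg. \<forall>g\<in>loc sg. ev pt g = 0}"
 have "finite Z" "Z \<subseteq> S.pts"
  unfolding Z_def using finite_chart_zeros[OF sg] pts_chart_points[OF sg] by auto
 moreover have "(if (sg, pt) \<in> pz\<^sub>0 then g else 0) \<in> lspan (dc sg)" for pt using g(1) by simp
 ultimately obtain h where h: "h \<in> lspan (dc sg)"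
  "!!pt. pt \<in> Z ==> h - (if (sg, pt) \<in> pz\<^sub>0 then g else 0) \<in> germ sg pt"
  using S.germ_crt[of Z "%pt. if (sg, pt) \<in> pz\<^sub>0 then g else 0"] by blast
 show ?thesis
 proof (intro bexI[of _ "mon (M sg) 1 * h"] ballI allI impI)
  show hs: "mon (M sg) 1 * h \<in> sect sg" using h(1) by (simp add: sect_local[OF sg])
  fix pz pt assume pz: "pz \<in> toric_variety \<Sigma>" and pt: "(sg, pt) \<in> pz"
  show "if pz = pz\<^sub>0 then mon (M sg) 1 * h - f\<^sub>0 \<in> van pz else mon (M sg) 1 * h \<in> van pz"
  proof (cases "pz \<in> zeros")
   case True
   hence ptZ: "pt \<in> Z" using zeros_rep[OF pz pt] rep_chart(2)[OF pz pt] by (simp add: Z_def)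
   show ?thesis
   proof (cases "pz = pz\<^sub>0")
    case True
    have "mon (M sg) 1 * (h - g) \<in> van pz\<^sub>0"
     using h(2)[OF ptZ] pt True by (intro vanI[of sg pt]) simp_all
    from van_add[OF pz0 this g(2)] pt True show ?thesis by (simp add: right_diff_distrib)
   next
    case False
    hence "(sg, pt) \<notin> pz\<^sub>0" using rep_disjoint[OF pz pz0 pt] by blast
    hence "mon (M sg) 1 * h \<in> van pz" using h(2)[OF ptZ] by (intro vanI[OF pt]) simp
    with False show ?thesis by simp
   qed
  next
   case False
   hence "pz ~= pz\<^sub>0" using z0 by blast
   thus ?thesis using nonzero_van[OF pz False pt hs] by simp
  qed
 qed
qed

text \<open>On overlaps the local solutions differ by sections that vanish in all germs and hence
  lie in the ideal, so the double complex patches them. Applied to each point of the subscheme, this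
  is surjectivity onto the product of the local rings.\<close>

theorem global_section:
 assumes z0: "pz\<^sub>0 \<in> zeros" and s0: "(sg\<^sub>0, pt\<^sub>0) \<in> pz\<^sub>0" and g0: "g \<in> lspan (dc sg\<^sub>0)"
 shows "\<exists>z\<in>sect UNIV. mon (- M sg\<^sub>0) 1 * z - g \<in> germ sg\<^sub>0 pt\<^sub>0 \<and> (\<forall>pz\<in>zeros - {pz\<^sub>0}. z \<in> van pz)"
proof -
 note pz0 = zeros_variety[OF z0]
 note sg0 = rep_chart(1)[OF pz0 s0]
 define f where "f = mon (M sg\<^sub>0) 1 * g"
 have f: "f \<in> sect sg\<^sub>0" using g0 by (simp add: f_def sect_local[OF sg0])
 define Q where "Q sg s \<longleftrightarrow> s \<in> sect sg \<and> (\<forall>pz\<in>toric_variety \<Sigma>. \<forall>pt. (sg, pt) \<in> pz -->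
  (if pz = pz\<^sub>0 then s - f \<in> van pz else s \<in> van pz))" for sg s
 have "\<forall>sg\<in>\<Sigma>. \<exists>s. Q sg s" unfolding Q_def using local_section[OF z0 s0 f] unfolding Bex_def by (rule ballI)
 hence "\<exists>s. \<forall>sg\<in>\<Sigma>. Q sg (s sg)" by (rule bchoice)
 then obtain s where s: "\<forall>sg\<in>\<Sigma>. Q sg (s sg)" by (elim exE)
 have sec: "s sg \<in> sect sg" if "sg \<in> \<Sigma>" for sg
  using bspec[OF s that] unfolding Q_def by (rule conjunct1)
 have van: "if pz = pz\<^sub>0 then s sg - f \<in> van pz else s sg \<in> van pz"
  if "pz \<in> toric_variety \<Sigma>" "(sg, pt) \<in> pz" for pz sg pt
 proof -
  have "\<forall>pz\<in>toric_variety \<Sigma>. \<forall>pt. (sg, pt) \<in> pz --> (if pz = pz\<^sub>0 then s sg - f \<in> van pz else s sg \<in> van pz)"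
   using bspec[OF s rep_chart(1)[OF that]] unfolding Q_def by (rule conjunct2)
  from bspec[OF this that(1)] have "(sg, pt) \<in> pz --> (if pz = pz\<^sub>0 then s sg - f \<in> van pz else s sg \<in> van pz)"
   by (rule spec)
  thus ?thesis using that(2) by (rule mp)
 qed
 have "\<exists>z\<in>secs u (div_sum I) UNIV. \<forall>sg\<in>\<Sigma>.
   in_ideal sg (s sg - z)"
 proof (rule sections_surjective)
  show "s sg \<in> secs u (div_sum I) sg" if "sg \<in> \<Sigma>" for sg using sec[OF that] unfolding sect_def .
  fix sg tc assume sg: "sg \<in> \<Sigma>" and tc: "tc \<in> \<Sigma>"
  note fc = Int_in_fan[OF sg tc]
  have "mon (- M (sg \<inter> tc)) 1 * (s sg - s tc) \<in> loc (sg \<inter> tc)"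
  proof (rule van_local[OF fc])
   show "s sg - s tc \<in> sect (sg \<inter> tc)"
    by (intro sect_diff sect_anti[OF _ sec[OF sg]] sect_anti[OF _ sec[OF tc]]) auto
   fix pz qt assume pz: "pz \<in> toric_variety \<Sigma>" and qt: "(sg \<inter> tc, qt) \<in> pz"
   note v1 = van[OF pz rep_face[OF pz qt sg Int_lower1]] and v2 = van[OF pz rep_face[OF pz qt tc Int_lower2]]
   show "s sg - s tc \<in> van pz"
   proof (cases "pz = pz\<^sub>0")
    case True
    have "(s sg - f) - (s tc - f) \<in> van pz" using v1 v2 True by (rule_tac van_diff[OF pz]) simp_all
    thus ?thesis by simp
   next
    case False
    thus ?thesis using v1 v2 by (intro van_diff[OF pz]) simp_all
   qed
  qed
  thus "in_ideal (sg \<inter> tc) (s sg - s tc)"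
   unfolding loc_sections[OF fc] .
 qed
 then obtain z where zP: "z \<in> secs u (div_sum I) UNIV" and z': "\<forall>sg\<in>\<Sigma>.
   in_ideal sg (s sg - z)"
  by (elim bexE) (rule that)
 have z: "z \<in> sect UNIV" using zP unfolding sect_def .
 have loc: "mon (- M sg) 1 * (s sg - z) \<in> loc sg" if "sg \<in> \<Sigma>" for sg
  unfolding loc_sections[OF that] by (rule bspec[OF z' that])
 have sz: "s sg - z \<in> van pz" if "pz \<in> toric_variety \<Sigma>" "(sg, pt) \<in> pz" for pz sg pt
  by (rule loc_van[OF that loc[OF rep_chart(1)[OF that]]])
 show ?thesis
 proof (intro bexI[OF _ z] conjI ballI)
  have "s sg\<^sub>0 - f \<in> van pz\<^sub>0" using van[OF pz0 s0] by simp
  from van_diff[OF pz0 this sz[OF pz0 s0]] have "z - f \<in> van pz\<^sub>0" by simp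
  moreover have "z - f \<in> sect sg\<^sub>0" by (rule sect_diff[OF sect_anti[OF subset_UNIV z] f])
  ultimately have "mon (- M sg\<^sub>0) 1 * (z - f) \<in> germ sg\<^sub>0 pt\<^sub>0" using van_iff[OF pz0 s0] by simp
  thus "mon (- M sg\<^sub>0) 1 * z - g \<in> germ sg\<^sub>0 pt\<^sub>0" by (simp add: f_def right_diff_distrib)
 next
  fix pz assume "pz \<in> zeros - {pz\<^sub>0}"
  hence pz: "pz \<in> toric_variety \<Sigma>" "pz ~= pz\<^sub>0" using zeros_variety by auto
  obtain sg pt where g: "(sg, pt) \<in> pz" using point_rep[OF pz(1)] by blast
  have "s sg \<in> van pz" using van[OF pz(1) g] pz(2) by simp
  from van_diff[OF pz(1) this sz[OF pz(1) g]] show "z \<in> van pz" by simp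
 qed
qed

text \<open>Vanishing in all germs is membership in the ideal on every chart, which
  \<open>sections_injective\<close> turns into a global expression.\<close>

theorem global_ideal:
 assumes z: "z \<in> sect UNIV"
 shows "(\<forall>pz\<in>zeros. z \<in> van pz) \<longleftrightarrow>
  (in_ideal UNIV z)"
proof
 assume van: "\<forall>pz\<in>zeros. z \<in> van pz"
 show "in_ideal UNIV z"
 proof (rule sections_injective)
  show "z \<in> secs u (div_sum I) UNIV" using z unfolding sect_def .
  fix sg assume sg: "sg \<in> \<Sigma>"
  have zsg: "z \<in> sect sg" by (rule sect_anti[OF subset_UNIV z])
  have "mon (- M sg) 1 * z \<in> loc sg"
  proof (rule van_local[OF sg zsg])
   show "z \<in> van pz" if "pz \<in> toric_variety \<Sigma>" "(sg, pt) \<in> pz" for pz pt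
    using van nonzero_van[OF that(1) _ that(2) zsg] by blast
  qed
  thus "in_ideal sg z"
   unfolding loc_sections[OF sg] .
 qed
next
 assume "in_ideal UNIV z"
 then obtain e where e: "\<forall>j\<in>I. e j \<in> secs u (div_sum (I - {j})) UNIV" "z = (\<Sum>j\<in>I. F j * e j)"
  by (elim exE conjE) (rule that)
 show "\<forall>pz\<in>zeros. z \<in> van pz"
 proof
  fix pz assume "pz \<in> zeros"
  note pz = zeros_variety[OF this]
  obtain sg pt where g: "(sg, pt) \<in> pz" using point_rep[OF pz] by blast
  note sg = rep_chart(1)[OF pz g]
  have "\<forall>j\<in>I. e j \<in> secs u (div_sum (I - {j})) sg"
   using e(1) lspan_mono[OF _ poly_pts_anti[OF subset_UNIV]] by blast
  hence "mon (- M sg) 1 * z \<in> loc sg" unfolding loc_sections[OF sg] using e(2) by blast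
  thus "z \<in> van pz" by (rule loc_van[OF pz g])
 qed
qed

end

section \<open>Dimension of quotient spaces\<close>

text \<open>Complex subspaces, with scalars acting through constant polynomials.\<close>

definition csub :: "('m::comm_monoid_add \<Rightarrow>\<^sub>0 complex) set => bool" where
 "csub Y \<longleftrightarrow> 0 \<in> Y \<and> (\<forall>x\<in>Y. \<forall>y\<in>Y. x + y \<in> Y) \<and> (\<forall>c. \<forall>x\<in>Y. mon 0 c * x \<in> Y)"

lemma csub_zero: "csub Y ==> 0 \<in> Y"
 and csub_add: "csub Y ==> x \<in> Y ==> y \<in> Y ==> x + y \<in> Y"
 and csub_scale: "csub Y ==> x \<in> Y ==> mon 0 c * x \<in> Y" by (simp_all add: csub_def)

lemma csub_diff: "csub Y ==> x \<in> Y ==> y \<in> Y ==> x - y \<in> Y"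
 using csub_add[of Y x "mon 0 (- 1) * y"] csub_scale[of Y y "- 1"] by (simp add: single_uminus)

lemma csub_sum: "csub Y ==> (!!i. i \<in> B ==> f i \<in> Y) ==> sum f B \<in> Y"
 by (induction B rule: infinite_finite_induct) (simp_all add: csub_zero csub_add)

definition line_ext :: "('m::comm_monoid_add \<Rightarrow>\<^sub>0 complex) => ('m \<Rightarrow>\<^sub>0 complex) set => ('m \<Rightarrow>\<^sub>0 complex) set" where
 "line_ext v Y = {mon 0 c * v + y |c y. y \<in> Y}"

lemma line_ext_mem: "csub Y ==> v \<in> line_ext v Y"
 unfolding line_ext_def using csub_zero by (intro CollectI exI[of _ 1] exI[of _ 0]) simp

lemma line_ext_sub: "Y \<subseteq> line_ext v Y"
proof
 fix y assume "y \<in> Y"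
 thus "y \<in> line_ext v Y" unfolding line_ext_def by (intro CollectI exI[of _ 0] exI[of _ y]) simp
qed

lemma line_ext_least: "csub Z ==> v \<in> Z ==> Y \<subseteq> Z ==> line_ext v Y \<subseteq> Z"
 unfolding line_ext_def by (auto intro!: csub_add csub_scale)

lemma csub_line_ext:
 assumes "csub Y"
 shows "csub (line_ext v Y)" unfolding csub_def
proof (intro conjI ballI allI)
 show "0 \<in> line_ext v Y" using line_ext_sub[of Y v] csub_zero[OF assms] by blast
 fix x assume "x \<in> line_ext v Y"
 then obtain c y where x: "x = mon 0 c * v + y" "y \<in> Y" by (auto simp: line_ext_def)
 have "mon 0 d * x = mon 0 (d * c) * v + mon 0 d * y" for d
  by (simp add: x(1) distrib_left flip: mult.assoc)
 thus "mon 0 d * x \<in> line_ext v Y" for d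
  unfolding line_ext_def using csub_scale[OF assms x(2)] by blast
 fix x' assume "x' \<in> line_ext v Y"
 then obtain c' y' where x': "x' = mon 0 c' * v + y'" "y' \<in> Y" by (auto simp: line_ext_def)
 have "x + x' = mon 0 (c + c') * v + (y + y')" by (simp add: x(1) x'(1) single_add algebra_simps)
 thus "x + x' \<in> line_ext v Y" unfolding line_ext_def using csub_add[OF assms x(2) x'(2)] by blast
qed

text \<open>The relative dimension of \<open>Y\<close> over \<open>N\<close>, built one line at a
  time in the shape of the library's \<open>dimension\<close>, so that \<open>qdim_dimension\<close>
  can follow by rule induction. Uniqueness of the number is taken from there.\<close>

inductive qdim :: "('m::comm_monoid_add \<Rightarrow>\<^sub>0 complex) set => nat => ('m \<Rightarrow>\<^sub>0 complex) set => bool" for N where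
 qdim_0: "qdim N 0 N"
| qdim_Suc: "qdim N n Y ==> v \<notin> Y ==> qdim N (Suc n) (line_ext v Y)"

lemma qdim_csub: "qdim N n Y ==> csub N ==> csub Y"
 by (induction rule: qdim.induct) (simp_all add: csub_line_ext)

lemma qdim_sub: "qdim N n Y ==> N \<subseteq> Y"
 by (induction rule: qdim.induct) (use line_ext_sub in blast)+

lemma qdim_trans: "qdim Y m Z ==> qdim N n Y ==> qdim N (n + m) Z"
 by (induction rule: qdim.induct) (simp_all add: qdim_Suc)

lemma qdim_exists:
 assumes "finite B" "csub N" "csub Z" "N \<subseteq> Z" "B \<subseteq> Z"
  and span: "!!z. z \<in> Z ==> \<exists>c. z - (\<Sum>b\<in>B. mon 0 (c b) * b) \<in> N"
 shows "\<exists>n. qdim N n Z"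
proof -
 have "\<exists>n Y. qdim N n Y \<and> B \<subseteq> Y \<and> Y \<subseteq> Z" using assms(1,5)
 proof induction
  case empty
  show ?case using qdim_0[of N] assms(4) by blast
 next
  case (insert b B)
  then obtain n Y where Y: "qdim N n Y" "B \<subseteq> Y" "Y \<subseteq> Z" by blast
  show ?case
  proof (cases "b \<in> Y")
   case False
   have "insert b B \<subseteq> line_ext b Y"
    using Y(2) line_ext_sub[of Y b] line_ext_mem[OF qdim_csub[OF Y(1) assms(2)]] by blast
   moreover have "line_ext b Y \<subseteq> Z" using insert.prems by (intro line_ext_least[OF assms(3) _ Y(3)]) simp
   ultimately show ?thesis using qdim_Suc[OF Y(1) False] by blast
  qed (use Y in blast)
 qed
 then obtain n Y where Y: "qdim N n Y" "B \<subseteq> Y" "Y \<subseteq> Z" by blast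
 have "Z \<subseteq> Y"
 proof
  fix z assume "z \<in> Z"
  then obtain c where c: "z - (\<Sum>b\<in>B. mon 0 (c b) * b) \<in> N" using span by blast
  have cs: "csub Y" by (rule qdim_csub[OF Y(1) assms(2)])
  have "(\<Sum>b\<in>B. mon 0 (c b) * b) \<in> Y" using Y(2) by (intro csub_sum[OF cs] csub_scale[OF cs]) blast
  from csub_add[OF cs subsetD[OF qdim_sub[OF Y(1)] c] this] show "z \<in> Y" by simp
 qed
 with Y(1,3) show ?thesis by auto
qed

text \<open>By \<open>surj\<close>, \<open>\<theta>\<close> induces an isomorphism of the relative
  quotients, and each added line is lifted to \<open>Y\<close>.\<close>

lemma qdim_pullback:
 assumes add: "!!x y. \<theta> (x - y) = \<theta> x - \<theta> y" and scale: "!!c x. \<theta> (mon 0 c * x) = mon 0 c * \<theta> x"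
  and Y: "csub Y" and N: "csub N" and q: "qdim N n Z"
  and surj: "!!z. z \<in> Z ==> \<exists>y\<in>Y. \<theta> y - z \<in> N"
 shows "qdim {y \<in> Y. \<theta> y \<in> N} n {y \<in> Y. \<theta> y \<in> Z}" using q surj
proof (induction rule: qdim.induct)
 case qdim_0
 show ?case by (rule qdim.qdim_0)
next
 case (qdim_Suc n Z v)
 have Z: "csub Z" by (rule qdim_csub[OF qdim_Suc.hyps(1) N])
 have NZ: "N \<subseteq> Z" by (rule qdim_sub[OF qdim_Suc.hyps(1)])
 obtain w where w: "w \<in> Y" "\<theta> w - v \<in> N" using qdim_Suc.prems[OF line_ext_mem[OF Z]] by blast
 have wv: "\<theta> w - v \<in> Z" using w(2) NZ by blast
 have IH: "qdim {y \<in> Y. \<theta> y \<in> N} n {y \<in> Y. \<theta> y \<in> Z}"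
  by (rule qdim_Suc.IH) (use qdim_Suc.prems line_ext_sub[of Z v] in blast)
 have "w \<notin> {y \<in> Y. \<theta> y \<in> Z}"
 proof
  assume "w \<in> {y \<in> Y. \<theta> y \<in> Z}"
  hence "\<theta> w - (\<theta> w - v) \<in> Z" using w(2) NZ by (rule_tac csub_diff[OF Z]) auto
  with qdim_Suc.hyps(2) show False by simp
 qed
 moreover have "line_ext w {y \<in> Y. \<theta> y \<in> Z} = {y \<in> Y. \<theta> y \<in> line_ext v Z}"
 proof
  show "line_ext w {y \<in> Y. \<theta> y \<in> Z} \<subseteq> {y \<in> Y. \<theta> y \<in> line_ext v Z}"
  proof
   fix x assume "x \<in> line_ext w {y \<in> Y. \<theta> y \<in> Z}"
   then obtain c y where x: "x = mon 0 c * w + y" "y \<in> Y" "\<theta> y \<in> Z" by (auto simp: line_ext_def)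
   have "\<theta> x = \<theta> y - \<theta> (mon 0 (- c) * w)" unfolding add[symmetric] by (simp add: x(1) single_uminus add.commute)
   also have "... = mon 0 c * v + (mon 0 c * (\<theta> w - v) + \<theta> y)"
    unfolding scale by (simp add: single_uminus right_diff_distrib)
   finally have "\<theta> x = mon 0 c * v + (mon 0 c * (\<theta> w - v) + \<theta> y)" .
   moreover have "mon 0 c * (\<theta> w - v) + \<theta> y \<in> Z" by (rule csub_add[OF Z csub_scale[OF Z wv] x(3)])
   moreover have "x \<in> Y" unfolding x(1) by (intro csub_add[OF Y] csub_scale[OF Y] w(1) x(2))
   ultimately show "x \<in> {y \<in> Y. \<theta> y \<in> line_ext v Z}" unfolding line_ext_def by blast
  qed
  show "{y \<in> Y. \<theta> y \<in> line_ext v Z} \<subseteq> line_ext w {y \<in> Y. \<theta> y \<in> Z}"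
  proof
   fix x assume "x \<in> {y \<in> Y. \<theta> y \<in> line_ext v Z}"
   then obtain c z where x: "x \<in> Y" "\<theta> x = mon 0 c * v + z" "z \<in> Z" by (auto simp: line_ext_def)
   have "\<theta> (x - mon 0 c * w) = z - mon 0 c * (\<theta> w - v)" by (simp add: add scale x(2) right_diff_distrib)
   moreover have "z - mon 0 c * (\<theta> w - v) \<in> Z" by (rule csub_diff[OF Z x(3) csub_scale[OF Z wv]])
   moreover have "x - mon 0 c * w \<in> Y" by (intro csub_diff[OF Y] csub_scale[OF Y] w(1) x(1))
   ultimately have m: "x - mon 0 c * w \<in> {y \<in> Y. \<theta> y \<in> Z}" by simp
   have "mon 0 c * w + (x - mon 0 c * w) \<in> line_ext w {y \<in> Y. \<theta> y \<in> Z}"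
    unfolding line_ext_def by (rule CollectI, rule exI, rule exI, rule conjI[OF refl m])
   thus "x \<in> line_ext w {y \<in> Y. \<theta> y \<in> Z}" by simp
  qed
 qed
 ultimately show ?case using qdim.qdim_Suc[OF IH, of w] by (simp only: not_False_eq_True)
qed

text \<open>\<open>h\<close> has kernel \<open>N\<close>, so lines added over \<open>N\<close>
  become lines added over zero.\<close>

lemma qdim_dimension:
 fixes R (structure)
 assumes "ring R" and K: "K = range k" "K \<subseteq> carrier R" and V: "csub V" and N: "csub N" and q: "qdim N n Y" and YV: "Y \<subseteq> V"
  and h: "!!v. v \<in> V ==> h v \<in> carrier R"
  and h_add: "!!v w. v \<in> V ==> w \<in> V ==> h (v + w) = h v \<oplus> h w"
  and h_scale: "!!c v. v \<in> V ==> h (mon 0 c * v) = k c \<otimes> h v"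
  and ker: "!!v. v \<in> V ==> h v = \<zero> \<longleftrightarrow> v \<in> N"
 shows "ring.dimension R n K (h ` Y)"
proof -
 interpret ring R by fact
 show ?thesis using q YV
 proof (induction rule: qdim.induct)
  case qdim_0
  hence "h v = \<zero>" if "v \<in> N" for v using ker that by blast
  hence "h ` N = {\<zero>}" using csub_zero[OF N] by auto
  thus ?case by simp
 next
  case (qdim_Suc n Y v)
  have Y: "csub Y" by (rule qdim_csub[OF qdim_Suc.hyps(1) N])
  have NY: "N \<subseteq> Y" by (rule qdim_sub[OF qdim_Suc.hyps(1)])
  have YV: "Y \<subseteq> V" using qdim_Suc.prems line_ext_sub[of Y v] by blast
  have v: "v \<in> V" using qdim_Suc.prems line_ext_mem[OF Y, of v] by blast
  have "h v \<notin> h ` Y"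
  proof
   assume "h v \<in> h ` Y"
   then obtain y where y: "y \<in> Y" "h v = h y" by blast
   have yV: "y \<in> V" and yV': "mon 0 (- 1) * y \<in> V" using y(1) YV csub_scale[OF V] by auto
   have "h (v + mon 0 (- 1) * y) = h (y + mon 0 (- 1) * y)" using y(2) by (simp only: h_add[OF v yV'] h_add[OF yV yV'])
   also have "y + mon 0 (- 1) * y = 0" by (simp add: single_uminus)
   also have "h 0 = \<zero>" using ker[OF csub_zero[OF V]] csub_zero[OF N] by simp
   finally have "v + mon 0 (- 1) * y \<in> N" using ker[OF csub_add[OF V v yV']] by simp
   hence "v - y \<in> Y" using NY by (auto simp: single_uminus)
   from csub_add[OF Y this y(1)] qdim_Suc.hyps(2) show False by simp
  qed
  moreover have "h ` line_ext v Y = line_extension K (h v) (h ` Y)"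
  proof (rule Set.set_eqI)
   fix x
   have "h (mon 0 c * v + y) = k c \<otimes> h v \<oplus> h y" if "y \<in> Y" for c y
    using that YV by (subst h_add) (auto simp: h_scale[OF v] csub_scale[OF V v])
   thus "x \<in> h ` line_ext v Y \<longleftrightarrow> x \<in> line_extension K (h v) (h ` Y)"
    unfolding line_extension_mem_iff line_ext_def K(1) by (auto simp: image_iff) metis+
  qed
  ultimately show ?case using Suc_dim[OF h[OF v] _ qdim_Suc.IH[OF YV]] by simp
 qed
qed

section \<open>Local rings\<close>

text \<open>Operations in \<open>localization\<close> are unions over all pairs of representatives;
  they collapse once every pair gives the same class.\<close>

lemma UN_pairs_const:
 assumes ne: "A ~= {}" "B ~= {}" and f: "!!a s b t. (a, s) \<in> A ==> (b, t) \<in> B ==> f a s b t = C"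
 shows "(\<Union>(a, s)\<in>A. \<Union>(b, t)\<in>B. f a s b t) = C"
proof
 show "(\<Union>(a, s)\<in>A. \<Union>(b, t)\<in>B. f a s b t) \<subseteq> C"
 proof
  fix z assume "z \<in> (\<Union>(a, s)\<in>A. \<Union>(b, t)\<in>B. f a s b t)"
  then obtain a s b t where "(a, s) \<in> A" "(b, t) \<in> B" "z \<in> f a s b t" by auto
  thus "z \<in> C" using f by simp
 qed
 obtain a s where a: "(a, s) \<in> A" using ne(1) by auto
 obtain b t where b: "(b, t) \<in> B" using ne(2) by auto
 have "f a s b t \<subseteq> (\<Union>(a, s)\<in>A. \<Union>(b, t)\<in>B. f a s b t)" using a b by auto
 thus "C \<subseteq> (\<Union>(a, s)\<in>A. \<Union>(b, t)\<in>B. f a s b t)" unfolding f[OF a b] .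
qed

lemma complex_subfield:
 fixes S (structure) and k :: "complex => _"
 assumes "ring S" "!!c. k c \<in> carrier S" "!!c d. k (c * d) = k c \<otimes> k d" "!!c d. k (c + d) = k c \<oplus> k d"
  "k 1 = \<one>" "\<one> ~= \<zero>"
 shows "subfield (range k) S"
proof -
 let ?C = "ring_of_type_algebra :: complex ring"
 interpret C: field ?C by (rule field_from_type_algebra)
 have "k \<in> ring_hom ?C S"
  by (rule ring_hom_memI) (use assms in \<open>simp_all add: type_algebra_simps\<close>)
 then interpret h: ring_hom_ring ?C S k using assms(1) C.ring_axioms by (intro ring_hom_ringI2) auto
 show ?thesis using h.img_is_subfield(2)[OF C.carrier_is_subfield assms(6)] by (simp add: type_algebra_simps)
qed

context denominators
begin

lemma coset_zero: "smod J ==> J +>> x = \<zero>\<^bsub>aring Quot J\<^esub> \<longleftrightarrow> x \<in> J"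
proof -
 assume J: "smod J"
 have "\<zero>\<^bsub>aring Quot J\<^esub> = J +>> 0" unfolding coset_aring by (simp add: FactRing_def)
 thus ?thesis using coset_aring_eq_iff[OF J, of x 0] by simp
qed

lemma quot_one: "\<one>\<^bsub>aring Quot J\<^esub> = J +>> 1"
 by (simp add: FactRing_def aring_simps)

lemma cring_quot: "aideal J ==> cring (aring Quot J)"
 using ideal.quotient_is_cring[OF ideal_aring cring_aring] .

lemma aideal_smod: "aideal J ==> smod J" by (simp add: aideal_def)

end

lemma csub_lspan: "csub (lspan Q)" for Q :: "'m::comm_monoid_add set" unfolding csub_def
proof (intro conjI ballI allI)
 show "mon 0 c * x \<in> lspan Q" if "x \<in> lspan Q" for c x
  by (rule lspan_mult[OF _ that, of _ "{0}"]) auto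
qed (auto intro: lspan_add)

context finite_subscheme
begin

lemma csub_germ: "pt \<in> pts ==> csub (germ_ideal pt)"
 unfolding csub_def using germ_zero germ_add germ_mult[OF const_in] by blast

definition point_coset :: "(int ^ 'n => complex) => ((int ^ 'n) \<Rightarrow>\<^sub>0 complex) set set" where
 "point_coset pt = (%g. \<aa> +>\<^bsub>aring\<^esub> g) ` {g \<in> lspan C. ev pt g = 0}"

context
 fixes pt
 assumes pt: "pt \<in> pts" and van: "!!f. f \<in> \<aa> ==> ev pt f = 0"
begin

lemma point_coset_mem: "g \<in> lspan C ==> \<aa> +>\<^bsub>aring\<^esub> g \<in> point_coset pt \<longleftrightarrow> ev pt g = 0"
proof
 show "g \<in> lspan C ==> ev pt g = 0 ==> \<aa> +>\<^bsub>aring\<^esub> g \<in> point_coset pt"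
  unfolding point_coset_def by blast
 assume "\<aa> +>\<^bsub>aring\<^esub> g \<in> point_coset pt"
 then obtain g' where g': "\<aa> +>\<^bsub>aring\<^esub> g = \<aa> +>\<^bsub>aring\<^esub> g'" "ev pt g' = 0"
  unfolding point_coset_def by blast
 have "g - g' \<in> \<aa>" using g'(1) coset_aring_eq_iff[OF aideal_smod[OF \<aa>]] by blast
 from van[OF this] g'(2) show "ev pt g = 0" by (simp add: eval_chart_diff)
qed

lemma complement_point_coset:
 "carrier (aring Quot \<aa>) - point_coset pt = {\<aa> +>\<^bsub>aring\<^esub> g |g. g \<in> lspan C \<and> ev pt g ~= 0}"
 unfolding carrier_quot using point_coset_mem by blast

abbreviation Loc where "Loc \<equiv> localization (aring Quot \<aa>) (point_coset pt)"
abbreviation frac where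
 "frac g s \<equiv> local_frac (aring Quot \<aa>) (point_coset pt) (\<aa> +>\<^bsub>aring\<^esub> g) (\<aa> +>\<^bsub>aring\<^esub> s)"
abbreviation to_loc where
 "to_loc g \<equiv> local_frac (aring Quot \<aa>) (point_coset pt) (\<aa> +>\<^bsub>aring\<^esub> g) \<one>\<^bsub>aring Quot \<aa>\<^esub>"

text \<open>The multiplier in the equality of fractions and the denominator in
  \<open>germ_ideal\<close> are the same thing: a function that is nonzero at the point.\<close>

lemma local_frac_rel_germ:
 assumes A: "g \<in> lspan C" "s \<in> lspan C" "h \<in> lspan C" "t \<in> lspan C"
  and s: "ev pt s ~= 0" "ev pt t ~= 0"
 shows "((\<aa> +>\<^bsub>aring\<^esub> g, \<aa> +>\<^bsub>aring\<^esub> s), (\<aa> +>\<^bsub>aring\<^esub> h, \<aa> +>\<^bsub>aring\<^esub> t)) \<in>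
  local_frac_rel (aring Quot \<aa>) (point_coset pt) \<longleftrightarrow> g * t - h * s \<in> germ_ideal pt"
proof -
 let ?R = "aring Quot \<aa>" and ?c = "%g. \<aa> +>\<^bsub>aring\<^esub> g"
 interpret R: cring ?R by (rule cring_quot[OF \<aa>])
 have c: "?c x \<in> carrier ?R" if "x \<in> lspan C" for x unfolding carrier_quot using that by blast
 have minus: "?c x \<ominus>\<^bsub>?R\<^esub> ?c y = ?c (x - y)" if x: "x \<in> lspan C" and y: "y \<in> lspan C" for x y
 proof -
  note xy = lspan_diff[OF x y]
  have "?c x = ?c (x - y) \<oplus>\<^bsub>?R\<^esub> ?c y" unfolding quot_add[OF \<aa> xy y] by simp
  thus ?thesis using c[OF xy] c[OF y] by (simp add: a_minus_def R.a_assoc R.r_neg)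
 qed
 have gt: "g * t \<in> lspan C" "h * s \<in> lspan C" using A A_mult by blast+
 note d = lspan_diff[OF gt]
 have eq: "?c g \<otimes>\<^bsub>?R\<^esub> ?c t \<ominus>\<^bsub>?R\<^esub> ?c h \<otimes>\<^bsub>?R\<^esub> ?c s = ?c (g * t - h * s)"
  unfolding quot_mult[OF \<aa> A(1,4)] quot_mult[OF \<aa> A(3,2)] by (rule minus[OF gt])
 have "((?c g, ?c s), (?c h, ?c t)) \<in> local_frac_rel ?R (point_coset pt) \<longleftrightarrow>
  (\<exists>r\<in>carrier ?R - point_coset pt. r \<otimes>\<^bsub>?R\<^esub> ?c (g * t - h * s) = \<zero>\<^bsub>?R\<^esub>)"
  unfolding local_frac_rel_def eq[symmetric] using A s c point_coset_mem by simp
 also have "... \<longleftrightarrow> (\<exists>q\<in>lspan C. ev pt q ~= 0 \<and> ?c q \<otimes>\<^bsub>?R\<^esub> ?c (g * t - h * s) = \<zero>\<^bsub>?R\<^esub>)"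
  unfolding complement_point_coset by blast
 also have "... \<longleftrightarrow> (\<exists>q\<in>lspan C. ev pt q ~= 0 \<and> q * (g * t - h * s) \<in> \<aa>)"
  by (intro bex_cong conj_cong refl) (simp only: quot_mult[OF \<aa> _ d] coset_zero[OF aideal_smod[OF \<aa>]])
 finally show ?thesis unfolding germ_ideal_def using d by simp
qed

text \<open>The fractions which are equal to \<open>x\<close>; by \<open>germ_invertible\<close>, every fraction is of this form.\<close>

definition frac_class where
 "frac_class x = {(\<aa> +>\<^bsub>aring\<^esub> g, \<aa> +>\<^bsub>aring\<^esub> s) |g s.
  g \<in> lspan C \<and> s \<in> lspan C \<and> ev pt s ~= 0 \<and> g - s * x \<in> germ_ideal pt}"

lemma frac_eq:
 assumes A: "g \<in> lspan C" "s \<in> lspan C" "x \<in> lspan C" and s: "ev pt s ~= 0" and gx: "g - s * x \<in> germ_ideal pt"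
 shows "frac g s = frac_class x"
proof -
 have iff: "g * t - h * s \<in> germ_ideal pt \<longleftrightarrow> h - t * x \<in> germ_ideal pt" if h: "h \<in> lspan C" "t \<in> lspan C" for h t
 proof
  have hx: "h - t * x \<in> lspan C" by (rule lspan_diff[OF h(1) A_mult[OF h(2) A(3)]])
  have e: "s * (h - t * x) = t * (g - s * x) - (g * t - h * s)" by (simp add: algebra_simps)
  show "h - t * x \<in> germ_ideal pt" if "g * t - h * s \<in> germ_ideal pt"
   using germ_diff[OF pt germ_mult[OF h(2) gx] that] unfolding e[symmetric] by (rule germ_cancel[OF pt hx A(2) s])
  have "g * t - h * s = t * (g - s * x) - s * (h - t * x)" by (simp add: algebra_simps)
  thus "g * t - h * s \<in> germ_ideal pt" if "h - t * x \<in> germ_ideal pt"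
   using germ_diff[OF pt germ_mult[OF h(2) gx] germ_mult[OF A(2) that]] by simp
 qed
 show ?thesis
 proof (intro Set.set_eqI iffI)
  fix p assume p: "p \<in> frac g s"
  hence p': "fst p \<in> carrier (aring Quot \<aa>)" "snd p \<in> carrier (aring Quot \<aa>) - point_coset pt"
   unfolding local_frac_def local_frac_rel_def by auto
  obtain h where "fst p = \<aa> +>\<^bsub>aring\<^esub> h" "h \<in> lspan C" using p'(1) unfolding carrier_quot by blast
  moreover obtain t where "snd p = \<aa> +>\<^bsub>aring\<^esub> t" "t \<in> lspan C" "ev pt t ~= 0"
   using p'(2) unfolding complement_point_coset by blast
  ultimately have ht: "p = (\<aa> +>\<^bsub>aring\<^esub> h, \<aa> +>\<^bsub>aring\<^esub> t)" "h \<in> lspan C" "t \<in> lspan C" "ev pt t ~= 0"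
   by (simp_all add: prod_eq_iff)
  hence "g * t - h * s \<in> germ_ideal pt"
   using p local_frac_rel_germ[OF A(1,2) ht(2,3) s ht(4)] by (simp add: local_frac_def)
  thus "p \<in> frac_class x" unfolding frac_class_def using ht iff[OF ht(2,3)] by blast
 next
  fix p assume "p \<in> frac_class x"
  then obtain h t where ht: "p = (\<aa> +>\<^bsub>aring\<^esub> h, \<aa> +>\<^bsub>aring\<^esub> t)" "h \<in> lspan C" "t \<in> lspan C" "ev pt t ~= 0"
   "h - t * x \<in> germ_ideal pt" unfolding frac_class_def by blast
  thus "p \<in> frac g s"
   using local_frac_rel_germ[OF A(1,2) ht(2,3) s ht(4)] iff[OF ht(2,3)] by (simp add: local_frac_def)
 qed
qed

lemma to_loc_eq: "g \<in> lspan C ==> to_loc g = frac_class g"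
 unfolding quot_one by (rule frac_eq[OF _ A_one]) (simp_all add: eval_one[OF pt] germ_zero[OF pt])

lemma frac_class_self: "g \<in> lspan C ==> (\<aa> +>\<^bsub>aring\<^esub> g, \<aa> +>\<^bsub>aring\<^esub> 1) \<in> frac_class g"
 unfolding frac_class_def using A_one germ_zero[OF pt]
 by (intro CollectI exI[of _ g] exI[of _ 1]) (simp add: eval_one[OF pt])

text \<open>The local ring is the quotient of the coordinate ring by \<open>germ_ideal\<close>.
  Fractions add nothing new, because functions nonzero at the point are invertible modulo
  \<open>germ_ideal\<close>.\<close>

lemma local_ring_germ:
 shows "ring Loc" and "to_loc \<in> ring_hom aring Loc" and "to_loc ` lspan C = carrier Loc"
  and "!!g. g \<in> lspan C ==> to_loc g = \<zero>\<^bsub>Loc\<^esub> \<longleftrightarrow> g \<in> germ_ideal pt"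
proof -
 have carrier: "carrier Loc = frac_class ` lspan C"
 proof -
  have mem: "p \<in> carrier Loc \<longleftrightarrow> (\<exists>x\<in>carrier (aring Quot \<aa>). \<exists>y\<in>carrier (aring Quot \<aa>) - point_coset pt.
   p = local_frac (aring Quot \<aa>) (point_coset pt) x y)" for p
   by (auto simp: localization_def quotient_def local_frac_def)
  show ?thesis
  proof (intro equalityI subsetI)
   fix p assume "p \<in> carrier Loc"
   then obtain x y where xy: "x \<in> carrier (aring Quot \<aa>)" "y \<in> carrier (aring Quot \<aa>) - point_coset pt"
    "p = local_frac (aring Quot \<aa>) (point_coset pt) x y" unfolding mem by blast
   obtain g where g: "x = \<aa> +>\<^bsub>aring\<^esub> g" "g \<in> lspan C" using xy(1) unfolding carrier_quot by blast
   obtain s where "y = \<aa> +>\<^bsub>aring\<^esub> s" "s \<in> lspan C" "ev pt s ~= 0"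
    using xy(2) unfolding complement_point_coset by blast
   with g xy(3) have gs: "p = frac g s" "g \<in> lspan C" "s \<in> lspan C" "ev pt s ~= 0" by simp_all
   obtain t where t: "t \<in> lspan C" "s * t - 1 \<in> germ_ideal pt" using germ_invertible[OF pt gs(3,4)] by blast
   have "g - s * (t * g) = - (g * (s * t - 1))" by (simp add: algebra_simps)
   hence "g - s * (t * g) \<in> germ_ideal pt" using germ_uminus[OF germ_mult[OF gs(2) t(2)]] by simp
   from frac_eq[OF gs(2,3) A_mult[OF t(1) gs(2)] gs(4) this] show "p \<in> frac_class ` lspan C"
    using A_mult[OF t(1) gs(2)] gs(1) by simp
  next
   fix p assume "p \<in> frac_class ` lspan C"
   then obtain g where g: "p = frac_class g" "g \<in> lspan C" by (rule imageE)
   have "\<aa> +>\<^bsub>aring\<^esub> g \<in> carrier (aring Quot \<aa>)" unfolding carrier_quot using g(2) by blast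
   moreover have "\<one>\<^bsub>aring Quot \<aa>\<^esub> \<in> carrier (aring Quot \<aa>) - point_coset pt"
    unfolding quot_one complement_point_coset using A_one
    by (intro CollectI exI[of _ 1]) (simp add: eval_one[OF pt])
   ultimately show "p \<in> carrier Loc" unfolding mem g(1) to_loc_eq[OF g(2), symmetric] by (intro bexI) (rule refl)
  qed
 qed
 have ne: "frac_class x ~= {}" if "x \<in> lspan C" for x using frac_class_self[OF that] by blast
 have op: "local_frac (aring Quot \<aa>) (point_coset pt) (a \<otimes>\<^bsub>aring Quot \<aa>\<^esub> b) (s \<otimes>\<^bsub>aring Quot \<aa>\<^esub> t) = frac_class (x * y) \<and>
  local_frac (aring Quot \<aa>) (point_coset pt) (a \<otimes>\<^bsub>aring Quot \<aa>\<^esub> t \<oplus>\<^bsub>aring Quot \<aa>\<^esub> b \<otimes>\<^bsub>aring Quot \<aa>\<^esub> s)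
   (s \<otimes>\<^bsub>aring Quot \<aa>\<^esub> t) = frac_class (x + y)"
  if p: "(a, s) \<in> frac_class x" "(b, t) \<in> frac_class y" and xy: "x \<in> lspan C" "y \<in> lspan C" for a s b t x y
 proof -
  obtain g e where g: "a = \<aa> +>\<^bsub>aring\<^esub> g" "s = \<aa> +>\<^bsub>aring\<^esub> e" "g \<in> lspan C" "e \<in> lspan C" "ev pt e ~= 0"
   "g - e * x \<in> germ_ideal pt" using p(1) unfolding frac_class_def by blast
  obtain h d where h: "b = \<aa> +>\<^bsub>aring\<^esub> h" "t = \<aa> +>\<^bsub>aring\<^esub> d" "h \<in> lspan C" "d \<in> lspan C" "ev pt d ~= 0"
   "h - d * y \<in> germ_ideal pt" using p(2) unfolding frac_class_def by blast
  have m: "g * h \<in> lspan C" "e * d \<in> lspan C" "g * d \<in> lspan C" "h * e \<in> lspan C" "e * x \<in> lspan C"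
   using g h xy A_mult by blast+
  have ed: "ev pt (e * d) ~= 0" using g h by (simp add: eval_mult[OF pt])
  have "g * h - (e * d) * (x * y) = h * (g - e * x) + (e * x) * (h - d * y)" by (simp add: algebra_simps)
  hence "g * h - (e * d) * (x * y) \<in> germ_ideal pt"
   using germ_add[OF pt germ_mult[OF h(3) g(6)] germ_mult[OF m(5) h(6)]] by simp
  note 1 = frac_eq[OF m(1,2) A_mult[OF xy] ed this]
  have "(g * d + h * e) - (e * d) * (x + y) = d * (g - e * x) + e * (h - d * y)" by (simp add: algebra_simps)
  hence "(g * d + h * e) - (e * d) * (x + y) \<in> germ_ideal pt"
   using germ_add[OF pt germ_mult[OF h(4) g(6)] germ_mult[OF g(4) h(6)]] by simp
  note 2 = frac_eq[OF A_add[OF m(3,4)] m(2) A_add[OF xy] ed this]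
  show ?thesis
   unfolding g(1,2) h(1,2) quot_mult[OF \<aa> g(3) h(3)] quot_mult[OF \<aa> g(4) h(4)] quot_mult[OF \<aa> g(3) h(4)]
    quot_mult[OF \<aa> h(3) g(4)] quot_add[OF \<aa> m(3,4)] using 1 2 by (rule conjI)
 qed
 have mult: "frac_class x \<otimes>\<^bsub>Loc\<^esub> frac_class y = frac_class (x * y)"
  and add: "frac_class x \<oplus>\<^bsub>Loc\<^esub> frac_class y = frac_class (x + y)" if xy: "x \<in> lspan C" "y \<in> lspan C" for x y
  unfolding localization_def monoid.simps ring_record_simps
  by (rule UN_pairs_const[OF ne[OF xy(1)] ne[OF xy(2)]]; use op[OF _ _ xy] in blast)+
 show hom: "to_loc \<in> ring_hom aring Loc"
 proof (rule ring_hom_memI)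
  show "to_loc x \<in> carrier Loc" if "x \<in> carrier aring" for x using that unfolding carrier by (simp add: to_loc_eq)
  show "to_loc (x \<otimes>\<^bsub>aring\<^esub> y) = to_loc x \<otimes>\<^bsub>Loc\<^esub> to_loc y" if "x \<in> carrier aring" "y \<in> carrier aring" for x y
   using that by (simp add: aring_simps to_loc_eq A_mult mult)
  show "to_loc (x \<oplus>\<^bsub>aring\<^esub> y) = to_loc x \<oplus>\<^bsub>Loc\<^esub> to_loc y" if "x \<in> carrier aring" "y \<in> carrier aring" for x y
   using that by (simp add: aring_simps to_loc_eq A_add add)
  show "to_loc \<one>\<^bsub>aring\<^esub> = \<one>\<^bsub>Loc\<^esub>" by (simp add: aring_simps localization_def quot_one)
 qed
 show img: "to_loc ` lspan C = carrier Loc" unfolding carrier using to_loc_eq by (rule image_cong[OF refl])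
 have "\<aa> +>\<^bsub>aring\<^esub> 0 = \<zero>\<^bsub>aring Quot \<aa>\<^esub>" using coset_zero[OF aideal_smod[OF \<aa>]] smod_zero[OF aideal_smod[OF \<aa>]] by blast
 hence zero: "to_loc 0 = \<zero>\<^bsub>Loc\<^esub>" by (simp add: localization_def)
 with ring.ring_hom_imp_img_ring[OF ring_aring hom] img show "ring Loc" by (simp add: aring_simps)
 show "to_loc g = \<zero>\<^bsub>Loc\<^esub> \<longleftrightarrow> g \<in> germ_ideal pt" if g: "g \<in> lspan C" for g
 proof
  assume "to_loc g = \<zero>\<^bsub>Loc\<^esub>"
  hence "frac_class g = frac_class 0" unfolding zero[symmetric] to_loc_eq[OF g] to_loc_eq[OF lspan_zero] .
  hence "(\<aa> +>\<^bsub>aring\<^esub> g, \<aa> +>\<^bsub>aring\<^esub> 1) \<in> frac 0 1"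
   using frac_class_self[OF g] to_loc_eq[OF lspan_zero] by (simp add: quot_one)
  thus "g \<in> germ_ideal pt"
   using local_frac_rel_germ[OF lspan_zero A_one g A_one] germ_uminus[of "- g" pt]
   by (simp add: local_frac_def eval_one[OF pt])
 next
  assume J: "g \<in> germ_ideal pt"
  have "to_loc g = frac_class 0"
   unfolding quot_one by (rule frac_eq[OF g A_one lspan_zero]) (use J in \<open>simp_all add: eval_one[OF pt]\<close>)
  also have "... = to_loc 0" by (rule to_loc_eq[OF lspan_zero, symmetric])
  finally show "to_loc g = \<zero>\<^bsub>Loc\<^esub>" unfolding zero .
 qed
qed

lemma local_ring_dim:
 assumes d: "qdim (germ_ideal pt) d (lspan C)"
 shows "ring.dim Loc (range (%c. to_loc (mon 0 c))) (carrier Loc) = d"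
proof -
 interpret ring Loc by (rule local_ring_germ(1))
 note h = local_ring_germ(2)
 have mult: "to_loc (f * g) = to_loc f \<otimes>\<^bsub>Loc\<^esub> to_loc g" if "f \<in> lspan C" "g \<in> lspan C" for f g
  using ring_hom_mult[OF h, of f g] that by (simp add: aring_simps)
 have add: "to_loc (f + g) = to_loc f \<oplus>\<^bsub>Loc\<^esub> to_loc g" if "f \<in> lspan C" "g \<in> lspan C" for f g
  using ring_hom_add[OF h, of f g] that by (simp add: aring_simps)
 have closed: "to_loc f \<in> carrier Loc" if "f \<in> lspan C" for f
  using ring_hom_closed[OF h, of f] that by simp
 have one: "to_loc 1 = \<one>\<^bsub>Loc\<^esub>" using ring_hom_one[OF h] by (simp add: aring_simps)
 have "1 \<notin> germ_ideal pt" using germ_eval[OF pt van, of 1] eval_one[OF pt] by auto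
 hence ne: "\<one>\<^bsub>Loc\<^esub> ~= \<zero>\<^bsub>Loc\<^esub>" using local_ring_germ(4)[OF A_one] unfolding one by blast
 have K: "subfield (range (%c. to_loc (mon 0 c))) Loc"
 proof (rule complex_subfield)
  show "ring Loc" by (rule ring_axioms)
  show "to_loc (mon 0 c) \<in> carrier Loc" for c by (rule closed[OF const_in])
  show "to_loc (mon 0 (c * d)) = to_loc (mon 0 c) \<otimes>\<^bsub>Loc\<^esub> to_loc (mon 0 d)" for c d
   using mult[OF const_in const_in, of c d] by simp
  show "to_loc (mon 0 (c + d)) = to_loc (mon 0 c) \<oplus>\<^bsub>Loc\<^esub> to_loc (mon 0 d)" for c d
   using add[OF const_in const_in, of c d] by (simp add: single_add)
  show "to_loc (mon 0 1) = \<one>\<^bsub>Loc\<^esub>" using one by simp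
  show "\<one>\<^bsub>Loc\<^esub> ~= \<zero>\<^bsub>Loc\<^esub>" by (rule ne)
 qed
 have "dimension d (range (%c. to_loc (mon 0 c))) (to_loc ` lspan C)"
  by (rule qdim_dimension[OF ring_axioms refl _ csub_lspan csub_germ[OF pt] d subset_refl closed add _ local_ring_germ(4)])
   (auto intro: closed const_in simp: mult[OF const_in])
 hence D: "dimension d (range (%c. to_loc (mon 0 c))) (carrier Loc)" unfolding local_ring_germ(3) .
 show ?thesis unfolding dim_def
 proof (rule the_equality)
  show "dimension d (range (%c. to_loc (mon 0 c))) (carrier Loc)" by (rule D)
  show "n = d" if "dimension n (range (%c. to_loc (mon 0 c))) (carrier Loc)" for n
   by (rule dimension_is_inj[OF K that D])
 qed
qed

end

end

section \<open>Counting global sections by local dimensions\<close>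

context toric
begin

text \<open>By completeness every direction \<open>v\<close> is a nonnegative combination of ray
  generators, which bounds the product of \<open>m\<close> with \<open>v\<close> from below. Both
  signs of the coordinate vectors then give a box.\<close>

lemma finite_poly_pts: "finite (poly_pts u a UNIV)"
proof -
 define B where "B = real_of_int (\<Sum>i\<in>UNIV. \<bar>a $ i\<bar>)"
 have lower: "\<exists>b. \<forall>m\<in>poly_pts u a UNIV. b \<le> rvec m \<bullet> v" for v
 proof -
  obtain sg where sg: "sg \<in> \<Sigma>" "v \<in> sg" using covers by blast
  obtain c where c: "!!w. w \<in> gens sg ==> 0 \<le> c w" "v = (\<Sum>w\<in>gens sg. c w *\<^sub>R rvec w)"
   using cone_combination[OF sg] by blast
  have "(\<Sum>w\<in>gens sg. c w * - B) \<le> rvec m \<bullet> v" if m: "m \<in> poly_pts u a UNIV" for m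
   unfolding c(2) inner_sum_right
  proof (rule sum_mono)
   fix w assume w: "w \<in> gens sg"
   then obtain i where i: "w = u i" by (auto simp: gens_def)
   have "- a $ i \<le> pairing m w" using m i by (auto simp: poly_pts_def)
   moreover have "\<bar>a $ i\<bar> \<le> (\<Sum>i\<in>UNIV. \<bar>a $ i\<bar>)" by (intro member_le_sum) auto
   ultimately have "- B \<le> real_of_int (pairing m w)" unfolding B_def by linarith
   hence "c w * - B \<le> c w * real_of_int (pairing m w)" by (rule mult_left_mono[OF _ c(1)[OF w]])
   thus "c w * - B \<le> rvec m \<bullet> c w *\<^sub>R rvec w" by (simp add: rvec_inner)
  qed
  thus ?thesis by blast
 qed
 have ax: "rvec m \<bullet> axis j 1 = real_of_int (m $ j)" for m :: "int ^ 'n" and j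
  by (simp add: inner_axis rvec_def)
 have "\<forall>j. \<exists>K. \<forall>m\<in>poly_pts u a UNIV. K \<le> real_of_int (m $ j)"
  using lower[of "axis j 1" for j] unfolding ax by blast
 hence "\<exists>K. \<forall>j. \<forall>m\<in>poly_pts u a UNIV. K j \<le> real_of_int (m $ j)" by (rule choice)
 then obtain K where K: "!!j m. m \<in> poly_pts u a UNIV ==> K j \<le> real_of_int (m $ j)" by blast
 have "\<forall>j. \<exists>L. \<forall>m\<in>poly_pts u a UNIV. L \<le> - real_of_int (m $ j)"
  using lower[of "- axis j 1" for j] unfolding inner_minus_right ax by blast
 hence "\<exists>L. \<forall>j. \<forall>m\<in>poly_pts u a UNIV. L j \<le> - real_of_int (m $ j)" by (rule choice)
 then obtain L where L: "!!j m. m \<in> poly_pts u a UNIV ==> L j \<le> - real_of_int (m $ j)" by blast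
 have "poly_pts u a UNIV \<subseteq> (%f. \<chi> j. f j) ` (\<Pi>\<^sub>E j\<in>UNIV. {\<lfloor>K j\<rfloor>..\<lceil>- L j\<rceil>})"
 proof
  fix m assume m: "m \<in> poly_pts u a UNIV"
  have "m $ j \<in> {\<lfloor>K j\<rfloor>..\<lceil>- L j\<rceil>}" for j
   using K[OF m, of j] L[OF m, of j] by (simp add: floor_le_iff le_ceiling_iff)
  hence "(%j. m $ j) \<in> (\<Pi>\<^sub>E j\<in>UNIV. {\<lfloor>K j\<rfloor>..\<lceil>- L j\<rceil>})" by auto
  thus "m \<in> (%f. \<chi> j. f j) ` (\<Pi>\<^sub>E j\<in>UNIV. {\<lfloor>K j\<rfloor>..\<lceil>- L j\<rceil>})"
   by (rule rev_image_eqI) simp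
 qed
 thus ?thesis by (rule finite_subset) (intro finite_imageI finite_PiE; simp)
qed

end

context nef_system
begin

lemma csub_van: "pz \<in> toric_variety \<Sigma> ==> csub (van pz)"
 unfolding csub_def by (intro conjI ballI allI van_zero van_add van_scale)

lemma csub_sect: "csub (sect fc)" unfolding sect_def by (rule csub_lspan)

text \<open>By \<open>global_section\<close> the finitely many monomials of the space of global
  sections span the local ring.\<close>

lemma ex_local_dim:
 assumes pz: "pz \<in> zeros" and pt: "(sg, pt) \<in> pz"
 shows "\<exists>d. qdim (germ sg pt) d (lspan (dc sg))"
proof -
 note sg = rep_chart[OF zeros_variety[OF pz] pt]
 interpret finite_subscheme "dc sg" "loc sg" by (rule scheme[OF sg(1)])
 have ptp: "pt \<in> pts" using sg pts_chart_points by simp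
 let ?P = "poly_pts u (div_sum I) UNIV"
 define e where "e x = mon (- M sg) 1 * mon x (1 :: complex)" for x
 have fin: "finite ?P" by (rule finite_poly_pts)
 have inj: "inj_on e ?P"
 proof (rule inj_onI)
  fix x y assume "e x = e y"
  hence "mon (M sg) 1 * e x = mon (M sg) 1 * e y" by simp
  hence "mon x 1 = mon y (1 :: complex)" by (simp add: e_def)
  hence "coef (mon x 1) x = coef (mon y (1 :: complex)) x" by simp
  thus "x = y" by (simp add: lookup_single when_def split: if_splits)
 qed
 show ?thesis
 proof (rule qdim_exists[of "e ` ?P"])
  show "finite (e ` ?P)" using fin by simp
  show "csub (germ sg pt)" by (rule csub_germ[OF ptp])
  show "csub (lspan (dc sg))" by (rule csub_lspan)
  show "germ sg pt \<subseteq> lspan (dc sg)" using germ_A by blast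
  show "e ` ?P \<subseteq> lspan (dc sg)"
  proof (rule image_subsetI)
   fix x assume "x \<in> ?P"
   hence "mon x 1 \<in> sect UNIV" by (simp add: sect_def)
   from iffD1[OF sect_local[OF sg(1)] sect_anti[OF subset_UNIV this]]
   show "e x \<in> lspan (dc sg)" by (simp only: e_def)
  qed
  fix g assume "g \<in> lspan (dc sg)"
  then obtain z where z: "z \<in> sect UNIV" "mon (- M sg) 1 * z - g \<in> germ sg pt"
   using global_section[OF pz pt] by blast
  have "z = (\<Sum>x\<in>?P. mon x (coef z x))"
   using z(1) fin by (intro monomial_expansion_on) (auto simp: sect_def lspan_def)
  hence "mon (- M sg) 1 * z = mon (- M sg) 1 * (\<Sum>x\<in>?P. mon x (coef z x))" by simp
  also have "... = (\<Sum>x\<in>?P. mon 0 (coef z x) * e x)"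
   unfolding sum_distrib_left by (rule sum.cong[OF refl]) (simp add: e_def mult_single)
  also have "... = (\<Sum>b\<in>e ` ?P. mon 0 (coef z (inv_into ?P e b)) * b)"
   by (subst sum.reindex[OF inj]) (simp add: inv_into_f_f[OF inj])
  finally have eq: "mon (- M sg) 1 * z = (\<Sum>b\<in>e ` ?P. mon 0 (coef z (inv_into ?P e b)) * b)" .
  have "g - mon (- M sg) 1 * z \<in> germ sg pt" using germ_uminus[OF z(2)] by simp
  thus "\<exists>c. g - (\<Sum>b\<in>e ` ?P. mon 0 (c b) * b) \<in> germ sg pt"
   unfolding eq by (rule exI[of _ "%b. coef z (inv_into ?P e b)"])
 qed
qed

text \<open>The points are imposed one after another. Sections that vanish at the earlier points
  still realize every germ at the next one, so each point contributes its full local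
  dimension.\<close>

theorem qdim_sections:
 assumes rep: "!!pz. pz \<in> zeros ==> (sg pz, pt pz) \<in> pz"
  and d: "!!pz. pz \<in> zeros ==> qdim (germ (sg pz) (pt pz)) (d pz) (lspan (dc (sg pz)))"
 shows "qdim {z \<in> sect UNIV. \<forall>pz\<in>zeros. z \<in> van pz} (\<Sum>pz\<in>zeros. d pz) (sect UNIV)"
proof -
 have "qdim {z \<in> sect UNIV. \<forall>pz\<in>T. z \<in> van pz} (\<Sum>pz\<in>T. d pz) (sect UNIV)" if "T \<subseteq> zeros" for T
  using finite_subset[OF that finite_zeros] that
 proof induction
  case empty
  show ?case by (simp add: qdim_0)
 next
  case (insert pz T)
  have z: "pz \<in> zeros" using insert.prems by simp
  have IH: "qdim {z \<in> sect UNIV. \<forall>pz\<in>T. z \<in> van pz} (\<Sum>pz\<in>T. d pz) (sect UNIV)"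
   using insert.IH insert.prems by simp
  let ?Y = "{z \<in> sect UNIV. \<forall>pz\<in>T. z \<in> van pz}"
  note pz = zeros_variety[OF z] and r = rep[OF z]
  note sg = rep_chart[OF pz r]
  interpret finite_subscheme "dc (sg pz)" "loc (sg pz)" by (rule scheme[OF sg(1)])
  let ?\<theta> = "%f. mon (- M (sg pz)) 1 * f"
  have "qdim {y \<in> ?Y. ?\<theta> y \<in> germ (sg pz) (pt pz)} (d pz) {y \<in> ?Y. ?\<theta> y \<in> lspan (dc (sg pz))}"
  proof (rule qdim_pullback)
   show "?\<theta> (x - y) = ?\<theta> x - ?\<theta> y" for x y by (rule right_diff_distrib)
   show "?\<theta> (mon 0 c * x) = mon 0 c * ?\<theta> x" for c x by (simp add: mult_ac)
   show "csub ?Y" unfolding csub_def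
   proof (intro conjI ballI allI CollectI)
    have Tv: "pz \<in> toric_variety \<Sigma>" if "pz \<in> T" for pz using that insert.prems zeros_variety by auto
    note cv = csub_van[OF Tv]
    show "0 \<in> sect UNIV" by (rule csub_zero[OF csub_sect])
    show "0 \<in> van pz" if "pz \<in> T" for pz by (rule csub_zero[OF cv[OF that]])
    show "x + y \<in> sect UNIV" if "x \<in> ?Y" "y \<in> ?Y" for x y using that by (intro csub_add[OF csub_sect]) auto
    show "x + y \<in> van pz" if "x \<in> ?Y" "y \<in> ?Y" "pz \<in> T" for x y pz
     using that by (intro csub_add[OF cv]) auto
    show "mon 0 c * x \<in> sect UNIV" if "x \<in> ?Y" for x c using that by (intro csub_scale[OF csub_sect]) auto
    show "mon 0 c * x \<in> van pz" if "x \<in> ?Y" "pz \<in> T" for x c pz using that by (intro csub_scale[OF cv]) auto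
   qed
   show "csub (germ (sg pz) (pt pz))" by (rule csub_germ) (use sg pts_chart_points in simp)
   show "qdim (germ (sg pz) (pt pz)) (d pz) (lspan (dc (sg pz)))" by (rule d[OF z])
   fix g assume g: "g \<in> lspan (dc (sg pz))"
   obtain y where y: "y \<in> sect UNIV" "?\<theta> y - g \<in> germ (sg pz) (pt pz)" "\<forall>pz'\<in>zeros - {pz}. y \<in> van pz'"
    using global_section[OF z r g] by blast
   have "y \<in> ?Y" using y(1,3) insert.prems insert.hyps(2) by blast
   with y(2) show "\<exists>y\<in>?Y. ?\<theta> y - g \<in> germ (sg pz) (pt pz)" by blast
  qed
  moreover have "?\<theta> y \<in> lspan (dc (sg pz))" if "y \<in> sect UNIV" for y
   using sect_anti[OF subset_UNIV that, of "sg pz"] sect_local[OF sg(1)] by simp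
  hence "{y \<in> ?Y. ?\<theta> y \<in> lspan (dc (sg pz))} = ?Y" by blast
  moreover have "?\<theta> y \<in> germ (sg pz) (pt pz) \<longleftrightarrow> y \<in> van pz" if "y \<in> sect UNIV" for y
   using van_iff[OF pz r sect_anti[OF subset_UNIV that]] by simp
  hence "{y \<in> ?Y. ?\<theta> y \<in> germ (sg pz) (pt pz)} = {z \<in> sect UNIV. \<forall>pz'\<in>insert pz T. z \<in> van pz'}" by blast
  ultimately have "qdim {z \<in> sect UNIV. \<forall>pz'\<in>insert pz T. z \<in> van pz'} (d pz) ?Y" by (simp only:)
  from qdim_trans[OF IH this] insert.hyps show ?case by (simp add: sum.insert)
 qed
 thus ?thesis by blast
qed

end

section \<open>Homogenization\<close>

text \<open>The linear map induced by relabelling exponents, the common form of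
  \<open>to_laurent\<close>, \<open>homogenize\<close> and \<open>homog\<close>; terms whose
  exponents are identified are added.\<close>

definition push :: "('a => 'b) => ('a \<Rightarrow>\<^sub>0 complex) => 'b \<Rightarrow>\<^sub>0 complex" where
 "push \<phi> g = (\<Sum>m\<in>supp g. mon (\<phi> m) (coef g m))"

lemma push_superset:
 assumes "finite K" "supp g \<subseteq> K"
 shows "push \<phi> g = (\<Sum>m\<in>K. mon (\<phi> m) (coef g m))"
 unfolding push_def by (rule sum.mono_neutral_left) (use assms in \<open>auto simp: in_keys_iff\<close>)

lemma push_add: "push \<phi> (f + g) = push \<phi> f + push \<phi> g"
proof -
 have "supp f \<subseteq> supp f \<union> supp g" "supp g \<subseteq> supp f \<union> supp g" "supp (f + g) \<subseteq> supp f \<union> supp g"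
  using keys_add[of f g] by auto
 thus ?thesis
  by (simp add: push_superset[of "supp f \<union> supp g"] lookup_add single_add sum.distrib)
qed

lemma push_zero [simp]: "push \<phi> 0 = 0" by (simp add: push_def)

lemma push_mon [simp]: "push \<phi> (mon m c) = mon (\<phi> m) c"
 by (cases "c = 0") (simp_all add: push_def)

lemma push_sum: "push \<phi> (sum f M) = (\<Sum>i\<in>M. push \<phi> (f i))"
 by (induction M rule: infinite_finite_induct) (simp_all add: push_add)

lemma push_cong: "(!!m. m \<in> supp g ==> \<phi> m = \<psi> m) ==> push \<phi> g = push \<psi> g"
 unfolding push_def by (intro sum.cong) simp_all

lemma push_push: "push \<phi> (push \<psi> g) = push (%m. \<phi> (\<psi> m)) g"
 unfolding push_def[of \<psi>] push_sum push_mon by (simp add: push_def)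

lemma push_id [simp]: "push (%m. m) g = g" using monomial_expansion[of g] by (simp add: push_def)

lemma push_mult:
 assumes "!!a b. a \<in> supp f ==> b \<in> supp g ==> \<phi> (a + b) = \<phi>' a + \<phi>'' b"
 shows "push \<phi> (f * g) = push \<phi>' f * push \<phi>'' g"
proof -
 have "f * g = (\<Sum>a\<in>supp f. mon a (coef f a)) * (\<Sum>b\<in>supp g. mon b (coef g b))"
  by (simp flip: monomial_expansion)
 also have "... = (\<Sum>a\<in>supp f. \<Sum>b\<in>supp g. mon (a + b) (coef f a * coef g b))"
  by (simp add: sum_product mult_single)
 finally have "push \<phi> (f * g) = (\<Sum>a\<in>supp f. \<Sum>b\<in>supp g. mon (\<phi> (a + b)) (coef f a * coef g b))"
  by (simp add: push_sum)
 also have "... = (\<Sum>a\<in>supp f. \<Sum>b\<in>supp g. mon (\<phi>' a) (coef f a) * mon (\<phi>'' b) (coef g b))"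
  by (intro sum.cong refl) (simp add: assms mult_single)
 also have "... = push \<phi>' f * push \<phi>'' g" by (simp add: push_def sum_product)
 finally show ?thesis .
qed

lemma push_lspan:
 assumes "g \<in> lspan Q" "!!m. m \<in> Q ==> \<phi> m \<in> R"
 shows "push \<phi> g \<in> lspan R"
 unfolding push_def by (rule lspan_sum) (use assms in \<open>auto simp: lspan_def\<close>)

lemma push_inj: "inj \<phi> ==> push \<phi> f = push \<phi> g \<longleftrightarrow> f = g"
proof
 assume inj: "inj \<phi>" and "push \<phi> f = push \<phi> g"
 hence "push (inv_into UNIV \<phi>) (push \<phi> f) = push (inv_into UNIV \<phi>) (push \<phi> g)" by simp
 thus "f = g" using inj by (simp add: push_push)
qed simp

lemma push_onto:
 assumes "g \<in> lspan (\<phi> ` Q)"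
 shows "\<exists>f\<in>lspan Q. push \<phi> f = g"
proof
 show "push (inv_into Q \<phi>) g \<in> lspan Q" using assms by (rule push_lspan) (rule inv_into_into)
 have "push \<phi> (push (inv_into Q \<phi>) g) = push (%m. m) g"
  unfolding push_push by (rule push_cong) (use assms in \<open>auto simp: lspan_def f_inv_into_f\<close>)
 thus "push \<phi> (push (inv_into Q \<phi>) g) = g" by simp
qed

text \<open>Adding an exponent from \<open>\<Gamma>\<close> preserves both \<open>\<Gamma>\<close>
  and its complement, so the projection onto \<open>\<Gamma>\<close> commutes with multiplication by
  \<open>h\<close>.\<close>

lemma restr_mult:
 fixes R h :: "'m::comm_monoid_add \<Rightarrow>\<^sub>0 complex"
 assumes h: "h \<in> lspan \<Gamma>" and \<Gamma>: "!!x y. y \<in> \<Gamma> ==> x + y \<in> \<Gamma> \<longleftrightarrow> x \<in> \<Gamma>"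
 shows "restr \<Gamma> (R * h) = restr \<Gamma> R * h"
proof (rule poly_mapping_eqI)
 fix m
 have "R = restr \<Gamma> R + restr (- \<Gamma>) R" by (rule poly_mapping_eqI) (simp add: lookup_add coef_restr)
 hence "R * h = restr \<Gamma> R * h + restr (- \<Gamma>) R * h" by (metis distrib_right)
 moreover have "restr \<Gamma> R * h \<in> lspan \<Gamma>"
  by (rule lspan_mult[OF _ h, of _ \<Gamma>]) (auto simp: lspan_iff coef_restr \<Gamma> split: if_splits)
 moreover have "restr (- \<Gamma>) R * h \<in> lspan (- \<Gamma>)"
  by (rule lspan_mult[OF _ h, of _ "- \<Gamma>"]) (auto simp: lspan_iff coef_restr \<Gamma> split: if_splits)
 ultimately show "coef (restr \<Gamma> (R * h)) m = coef (restr \<Gamma> R * h) m"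
  using lspanD[of "restr \<Gamma> R * h" \<Gamma> m] lspanD[of "restr (- \<Gamma>) R * h" "- \<Gamma>" m]
  by (simp add: coef_restr lookup_add)
qed

lemma restr_sum: "restr D (sum f M) = (\<Sum>i\<in>M. restr D (f i))"
 by (rule poly_mapping_eqI) (simp add: coef_restr lookup_sum)

definition evec :: "('k \<Rightarrow>\<^sub>0 nat) => int ^ 'k" where
 "evec e = (\<chi> i. int (Poly_Mapping.lookup e i))"

lemma evec_add: "evec (e + e') = evec e + evec e'" by (simp add: evec_def vec_eq_iff lookup_add)

lemma evec_nonneg: "0 \<le> evec e $ i" by (simp add: evec_def)

lemma inj_evec: "inj evec"
 by (rule injI) (simp add: evec_def vec_eq_iff poly_mapping_eq_iff fun_eq_iff)

lemma evec_onto: "(!!i. 0 \<le> v $ i) ==> \<exists>e. evec e = (v :: int ^ 'k)"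
proof
 assume "!!i. 0 \<le> v $ i"
 thus "evec (Abs_poly_mapping (%i. nat (v $ i))) = v" by (simp add: evec_def vec_eq_iff)
qed

lemma to_laurent_push: "to_laurent f = push evec f" by (simp add: to_laurent_def push_def evec_def)

lemma homogenize_push: "homogenize u g = push (char_div u) g" by (simp add: homogenize_def push_def)

lemma to_laurent_mult: "to_laurent (f * g) = to_laurent f * to_laurent g"
 unfolding to_laurent_push by (rule push_mult) (rule evec_add)

lemma to_laurent_sum: "to_laurent (sum f M) = (\<Sum>i\<in>M. to_laurent (f i))"
 by (simp add: to_laurent_push push_sum)

lemma to_laurent_inj: "to_laurent f = to_laurent g \<longleftrightarrow> f = g"
 unfolding to_laurent_push by (rule push_inj[OF inj_evec])

lemma to_laurent_onto: "g \<in> lspan {v :: int ^ 'a. \<forall>i. 0 \<le> v $ i} ==> \<exists>f. to_laurent f = g"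
proof -
 assume "g \<in> lspan {v :: int ^ 'a. \<forall>i. 0 \<le> v $ i}"
 moreover have "{v. \<forall>i. 0 \<le> v $ i} \<subseteq> range (evec :: ('a \<Rightarrow>\<^sub>0 nat) => _)"
 proof
  fix v :: "int ^ 'a" assume "v \<in> {v. \<forall>i. 0 \<le> v $ i}"
  then obtain e where "evec e = v" using evec_onto[of v] by auto
  thus "v \<in> range evec" by blast
 qed
 ultimately have "g \<in> lspan (range evec)" by (rule lspan_mono)
 thus ?thesis unfolding to_laurent_push using push_onto by blast
qed

lemma char_div_add: "char_div u (m + m') = char_div u m + char_div u m'"
 by (simp add: char_div_def vec_eq_iff pairing_add)

lemma char_div_uminus: "char_div u (- m) = - char_div u m"
 by (simp add: char_div_def vec_eq_iff pairing_uminus)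

lemma homogenize_mult: "homogenize u (f * g) = homogenize u f * homogenize u g"
 unfolding homogenize_push by (rule push_mult) (rule char_div_add)

lemma homogenize_mon [simp]: "homogenize u (mon m c) = mon (char_div u m) c"
 by (simp add: homogenize_push)

lemma homogenize_sum: "homogenize u (sum f M) = (\<Sum>i\<in>M. homogenize u (f i))"
 by (simp add: homogenize_push push_sum)

text \<open>The exponent of the Cox monomial that corresponds to the character \<open>m\<close> in
  the degree of \<open>a\<close>. For \<open>m\<close> in \<open>poly_pts u a UNIV\<close> the
  entries are nonnegative and \<open>nat\<close> loses nothing.\<close>

definition expo :: "('k::finite => int ^ 'n) => int ^ 'k => int ^ 'n => 'k \<Rightarrow>\<^sub>0 nat" where
 "expo u a m = Abs_poly_mapping (%i. nat (a $ i + pairing m (u i)))"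

lemma evec_expo: "m \<in> poly_pts u a UNIV ==> evec (expo u a m) = a + char_div u m"
proof -
 assume m: "m \<in> poly_pts u a UNIV"
 have "0 \<le> a $ i + pairing m (u i)" for i using m by (auto simp: poly_pts_def dest: spec[of _ i])
 thus ?thesis by (simp add: evec_def expo_def char_div_def vec_eq_iff)
qed

definition homog :: "('k::finite => int ^ 'n) => int ^ 'k => ((int ^ 'n) \<Rightarrow>\<^sub>0 complex) => 'k cox" where
 "homog u a = push (expo u a)"

lemma to_laurent_homog:
 assumes "g \<in> secs u a UNIV"
 shows "to_laurent (homog u a g) = mon a 1 * homogenize u g"
proof -
 have "to_laurent (homog u a g) = push (%m. a + char_div u m) g"
  unfolding to_laurent_push homog_def push_push
  by (rule push_cong) (use assms evec_expo in \<open>auto simp: lspan_def\<close>)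
 also have "... = mon a 1 * homogenize u g"
  unfolding homogenize_push by (simp add: push_def sum_distrib_left mult_single)
 finally show ?thesis .
qed

lemma homog_add: "homog u a (f + g) = homog u a f + homog u a g" by (simp add: homog_def push_add)

lemma homog_sum: "homog u a (sum f M) = (\<Sum>i\<in>M. homog u a (f i))"
 by (simp add: homog_def push_sum)

lemma homog_scale:
 fixes u :: "'k::finite => int ^ 'n"
 shows "homog u a (mon 0 c * f) = mon 0 c * homog u a f"
proof -
 have "push (expo u a) (mon 0 c * f) = push (%_. 0) (mon (0 :: int ^ 'n) c) * push (expo u a) f"
  by (rule push_mult[of "mon 0 c" f "expo u a" "%_. 0" "expo u a"]) (auto split: if_splits)
 thus ?thesis by (simp add: homog_def)
qed

lemma homog_mult:
 assumes f: "f \<in> secs u a UNIV" and g: "g \<in> secs u a' UNIV"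
 shows "homog u (a + a') (f * g) = homog u a f * homog u a' g"
proof -
 have "f * g \<in> secs u (a + a') UNIV" by (rule lspan_mult[OF f g]) (rule poly_pts_add)
 hence "to_laurent (homog u (a + a') (f * g)) = to_laurent (homog u a f * homog u a' g)"
  unfolding to_laurent_mult to_laurent_homog[OF f] to_laurent_homog[OF g]
  by (simp add: to_laurent_homog homogenize_mult mon_mult_mult mult.left_commute mult.assoc)
 thus ?thesis unfolding to_laurent_inj .
qed

lemma divisor_class_eq: "divisor_class u a = {a + char_div u m |m. True}"
 by (auto simp: divisor_class_def r_coset_def torus_divisors_def add.commute)

lemma divisor_class_iff: "divisor_class u b = divisor_class u a \<longleftrightarrow> (\<exists>m. b = a + char_div u m)"
proof
 assume "divisor_class u b = divisor_class u a"
 moreover have "b \<in> divisor_class u b"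
  unfolding divisor_class_eq by (intro CollectI exI[of _ 0]) (simp add: char_div_def vec_eq_iff)
 ultimately show "\<exists>m. b = a + char_div u m" by (simp add: divisor_class_eq)
next
 assume "\<exists>m. b = a + char_div u m"
 then obtain m where b: "b = a + char_div u m" ..
 have "\<exists>m''. b + char_div u m' = a + char_div u m''" for m'
  by (intro exI[of _ "m + m'"]) (simp add: b char_div_add)
 moreover have "\<exists>m''. a + char_div u m' = b + char_div u m''" for m'
  by (intro exI[of _ "m' - m"]) (simp add: b char_div_add char_div_uminus flip: add_uminus_conv_diff)
 ultimately show "divisor_class u b = divisor_class u a" unfolding divisor_class_eq by blast
qed

lemma graded_piece_iff:
 "f \<in> graded_piece u (divisor_class u a) \<longleftrightarrow> (\<forall>e\<in>supp f. \<exists>m. evec e = a + char_div u m)"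
 by (simp add: graded_piece_def divisor_class_iff evec_def)

text \<open>A monomial of this degree has an exponent of the form \<open>a + char_div u m\<close>,
  and nonnegativity of the exponent is the condition that \<open>m\<close> is a global
  section.\<close>

lemma graded_piece_homog: "graded_piece u (divisor_class u a) = homog u a ` secs u a UNIV"
proof
 have pp: "m \<in> poly_pts u a UNIV" if "evec e = a + char_div u m" for e m unfolding poly_pts_def
 proof (intro CollectI allI impI)
  fix i
  have "evec e $ i = a $ i + pairing m (u i)" using that by (simp add: char_div_def)
  with evec_nonneg[of e i] show "- a $ i \<le> pairing m (u i)" by simp
 qed
 show "graded_piece u (divisor_class u a) \<subseteq> homog u a ` secs u a UNIV"
 proof
  fix f assume f: "f \<in> graded_piece u (divisor_class u a)"
  have "e \<in> expo u a ` poly_pts u a UNIV" if e: "e \<in> supp f" for e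
  proof -
   obtain m where m: "evec e = a + char_div u m" using f e unfolding graded_piece_iff by blast
   have "evec e = evec (expo u a m)" using m evec_expo[OF pp[OF m]] by simp
   thus ?thesis using pp[OF m] inj_evec by (auto dest: injD)
  qed
  hence "f \<in> lspan (expo u a ` poly_pts u a UNIV)" unfolding lspan_def by blast
  thus "f \<in> homog u a ` secs u a UNIV" unfolding homog_def using push_onto by blast
 qed
 show "homog u a ` secs u a UNIV \<subseteq> graded_piece u (divisor_class u a)"
 proof (rule image_subsetI)
  fix g assume g: "g \<in> secs u a UNIV"
  have "homog u a g \<in> lspan (expo u a ` poly_pts u a UNIV)"
   unfolding homog_def by (rule push_lspan[OF g]) blast
  thus "homog u a g \<in> graded_piece u (divisor_class u a)"
   unfolding graded_piece_iff lspan_def using evec_expo by blast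
 qed
qed

lemma Idl_type_algebra:
 fixes f :: "'i => 'r::comm_ring_1"
 assumes fin: "finite J"
 shows "Idl\<^bsub>ring_of_type_algebra\<^esub> (f ` J) = {\<Sum>j\<in>J. p j * f j |p. True}" (is "_ = ?S")
proof
 let ?R = "ring_of_type_algebra :: 'r ring"
 interpret R: cring ?R by (rule cring_from_type_algebra)
 interpret D: denominators "UNIV :: 'r set" "{1}" by unfold_locales auto
 have RD: "?R\<lparr>carrier := UNIV\<rparr> = ?R" by (simp add: ring_of_type_algebra_def)
 have "D.aideal ?S" unfolding D.aideal_def D.smod_def
 proof (intro conjI ballI)
  show "0 \<in> ?S" by (intro CollectI exI[of _ "%_. 0"]) simp
  show "x + y \<in> ?S" if xy: "x \<in> ?S" "y \<in> ?S" for x y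
  proof -
   obtain p q where "x = (\<Sum>j\<in>J. p j * f j)" "y = (\<Sum>j\<in>J. q j * f j)" using xy by blast
   thus ?thesis by (intro CollectI exI[of _ "%j. p j + q j"]) (simp add: distrib_right sum.distrib)
  qed
  show "r * x \<in> ?S" if xy: "x \<in> ?S" for r x
  proof -
   obtain p where "x = (\<Sum>j\<in>J. p j * f j)" using xy by blast
   thus ?thesis by (intro CollectI exI[of _ "%j. r * p j"]) (simp add: sum_distrib_left mult.assoc)
  qed
 qed simp
 hence "ideal ?S ?R" using D.ideal_aring[of ?S] unfolding RD by simp
 moreover have "f ` J \<subseteq> ?S"
 proof (rule image_subsetI)
  fix j assume j: "j \<in> J"
  have "(\<Sum>i\<in>J. (if i = j then 1 else 0) * f i) = (\<Sum>i\<in>J. if i = j then f i else 0)"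
   by (rule sum.cong) auto
  also have "... = f j" using fin j by simp
  finally show "f j \<in> ?S" by (intro CollectI exI[of _ "%i. if i = j then 1 else 0"]) simp
 qed
 ultimately show "Idl\<^bsub>?R\<^esub> (f ` J) \<subseteq> ?S" by (rule R.genideal_minimal)
 have I: "ideal (Idl\<^bsub>?R\<^esub> (f ` J)) ?R" by (rule R.genideal_ideal) (simp add: type_algebra_simps)
 have gen: "f ` J \<subseteq> Idl\<^bsub>?R\<^esub> (f ` J)" by (rule R.genideal_self) (simp add: type_algebra_simps)
 show "?S \<subseteq> Idl\<^bsub>?R\<^esub> (f ` J)"
 proof
  fix x assume "x \<in> ?S"
  then obtain p where x: "x = (\<Sum>j\<in>J. p j * f j)" by blast
  have "(\<Sum>j\<in>K. p j * f j) \<in> Idl\<^bsub>?R\<^esub> (f ` J)" if "K \<subseteq> J" for K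
   using finite_subset[OF that fin] that
  proof induction
   case empty
   show ?case using additive_subgroup.zero_closed[OF ideal.axioms(1)[OF I]] by (simp add: type_algebra_simps)
  next
   case (insert j K)
   have "p j * f j \<in> Idl\<^bsub>?R\<^esub> (f ` J)"
    using ideal.I_l_closed[OF I, of "f j" "p j"] gen insert.prems by (auto simp: type_algebra_simps)
   thus ?case
    using additive_subgroup.a_closed[OF ideal.axioms(1)[OF I], of "p j * f j" "\<Sum>j\<in>K. p j * f j"] insert
    by (simp add: type_algebra_simps)
  qed
  from this[of J] show "x \<in> Idl\<^bsub>?R\<^esub> (f ` J)" by (simp add: x)
 qed
qed

lemma to_laurent_x_hat:
 "to_laurent (x_hat u sg) = mon (\<chi> i. if rvec (u i) \<notin> sg then 1 else 0) 1"
proof -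
 have "to_laurent (\<Prod>i\<in>K. cox_var i) = mon (\<chi> i. if i \<in> K then 1 else 0) 1" if "finite K" for K :: "'a set"
  using that
 proof induction
  case empty
  have "to_laurent (1 :: 'a cox) = mon (evec 0) 1" unfolding to_laurent_push one_eq_mon push_mon ..
  thus ?case by (simp add: evec_def zero_vec_def)
 next
  case (insert i K)
  have "to_laurent (cox_var i) = mon (evec (Poly_Mapping.single i 1)) 1"
   by (simp add: cox_var_def to_laurent_push)
  moreover have "evec (Poly_Mapping.single i 1) + (\<chi> j. if j \<in> K then 1 else 0) = (\<chi> j. if j \<in> insert i K then 1 else 0)"
   using insert.hyps(2) by (auto simp: evec_def vec_eq_iff lookup_single when_def)
  ultimately show ?case using insert by (simp add: to_laurent_mult mult_single)
 qed
 thus ?thesis by (simp add: x_hat_def)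
qed

lemma to_laurent_x_hat_power:
 "to_laurent (x_hat u sg) ^ N = mon (\<chi> i. if rvec (u i) \<notin> sg then int N else 0) 1"
proof (induction N)
 case 0
 have "(\<chi> i. if rvec (u i) \<notin> sg then int 0 else 0) = 0" by (simp add: vec_eq_iff)
 thus ?case by (simp only: power_0 one_eq_mon)
next
 case (Suc N)
 have "(\<chi> i. if rvec (u i) \<notin> sg then 1 else 0) + (\<chi> i. if rvec (u i) \<notin> sg then int N else 0) =
  (\<chi> i. if rvec (u i) \<notin> sg then int (Suc N) else 0)" by (simp add: vec_eq_iff)
 with Suc show ?case by (simp add: to_laurent_x_hat mult_single)
qed

context toric
begin

lemma homogenize_inj: "homogenize u f = homogenize u g \<longleftrightarrow> f = g"
 unfolding homogenize_push by (rule push_inj[OF inj_char_div])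

text \<open>Taking the part of degree \<open>0\<close> turns a relation with coefficients in \<open>\<complex>[x\<^sub>i, x\<^sub>i\<^sup>-\<^sup>1]\<close> into one with
 coefficients in the coordinate ring of the torus.\<close>

lemma degree_zero_part:
 assumes eq: "homogenize u g = (\<Sum>j\<in>J. R j * homogenize u (F j))"
 shows "\<exists>q. (\<forall>j\<in>J. q j \<in> lspan {m. char_div u m \<in> supp (R j)}) \<and> g = (\<Sum>j\<in>J. q j * F j)"
proof -
 let ?\<Gamma> = "range (char_div u)"
 have hom: "homogenize u h \<in> lspan ?\<Gamma>" for h
  unfolding homogenize_push by (rule push_lspan[of h UNIV]) (auto simp: lspan_def)
 have grp: "x + y \<in> ?\<Gamma> \<longleftrightarrow> x \<in> ?\<Gamma>" if y: "y \<in> ?\<Gamma>" for x y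
 proof -
  obtain m where m: "y = char_div u m" using y by blast
  show ?thesis
  proof
   assume "x + y \<in> ?\<Gamma>"
   then obtain m' where "x + y = char_div u m'" by blast
   hence "x = char_div u (m' + - m)" unfolding char_div_add char_div_uminus m by (simp add: algebra_simps)
   thus "x \<in> ?\<Gamma>" by blast
  next
   assume "x \<in> ?\<Gamma>"
   then obtain m' where "x = char_div u m'" by blast
   hence "x + y = char_div u (m' + m)" by (simp add: m char_div_add)
   thus "x + y \<in> ?\<Gamma>" by blast
  qed
 qed
 have "\<exists>q. q \<in> lspan {m. char_div u m \<in> supp (R j)} \<and> homogenize u q = restr ?\<Gamma> (R j)" for j
 proof -
  have "restr ?\<Gamma> (R j) \<in> lspan (char_div u ` {m. char_div u m \<in> supp (R j)})"
   unfolding lspan_iff by (auto simp: coef_restr in_keys_iff split: if_splits)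
  from push_onto[OF this] show ?thesis unfolding homogenize_push by blast
 qed
 then obtain q where q: "!!j. q j \<in> lspan {m. char_div u m \<in> supp (R j)}"
  "!!j. homogenize u (q j) = restr ?\<Gamma> (R j)" by metis
 have "homogenize u g = restr ?\<Gamma> (homogenize u g)"
  by (rule poly_mapping_eqI) (use lspanD[OF hom] in \<open>auto simp: coef_restr\<close>)
 also have "... = (\<Sum>j\<in>J. homogenize u (q j) * homogenize u (F j))"
  unfolding eq restr_sum q(2) by (rule sum.cong[OF refl]) (rule restr_mult[OF hom grp])
 also have "... = homogenize u (\<Sum>j\<in>J. q j * F j)" by (simp add: homogenize_sum homogenize_mult)
 finally have "g = (\<Sum>j\<in>J. q j * F j)" unfolding homogenize_inj .
 with q(1) show ?thesis by blast
qed

end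

section \<open>The subscheme of a homogeneous ideal in the charts\<close>

lemma x_hat_power_mem: "x_hat u sg \<in> B ==> x_hat u sg ^ N \<in> B [^]\<^bsub>ideals_set cox_ring\<^esub> N"
proof (induction N)
 case 0
 show ?case by (simp add: nat_pow_def ideals_set_def type_algebra_simps)
next
 case (Suc N)
 have "x_hat u sg ^ N \<otimes>\<^bsub>cox_ring\<^esub> x_hat u sg \<in> ideal_prod cox_ring (B [^]\<^bsub>ideals_set cox_ring\<^esub> N) B"
  using Suc by (intro ideal_prod.prod) auto
 thus ?case by (simp add: nat_pow_def ideals_set_def type_algebra_simps mult.commute)
qed

lemma x_hat_irrelevant: "sg \<in> \<Sigma> ==> x_hat u sg \<in> irrelevant_ideal \<Sigma> u"
proof -
 assume "sg \<in> \<Sigma>"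
 interpret cring cox_ring by (rule cring_from_type_algebra)
 have "x_hat u ` \<Sigma> \<subseteq> irrelevant_ideal \<Sigma> u"
  unfolding irrelevant_ideal_def by (rule genideal_self) (simp add: type_algebra_simps)
 with \<open>sg \<in> \<Sigma>\<close> show ?thesis by blast
qed

lemma Idl_mult:
 fixes f :: "'i => 'r::comm_ring_1"
 assumes "finite J" "x \<in> Idl\<^bsub>ring_of_type_algebra\<^esub> (f ` J)"
 shows "r * x \<in> Idl\<^bsub>ring_of_type_algebra\<^esub> (f ` J)"
proof -
 obtain p where "x = (\<Sum>j\<in>J. p j * f j)" using assms unfolding Idl_type_algebra[OF assms(1)] by blast
 hence "r * x = (\<Sum>j\<in>J. (r * p j) * f j)" by (simp add: sum_distrib_left mult.assoc)
 thus ?thesis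
  unfolding Idl_type_algebra[OF assms(1)] by (intro CollectI exI[of _ "%j. r * p j"] conjI TrueI)
qed

text \<open>Negative entries occur at rays outside \<open>sg\<close> alone; \<open>N\<close> is the
  sum of the absolute values of all occurring entries and dominates each of them.\<close>

lemma clear_denominators:
 fixes T :: "'i => (int ^ 'k::finite) \<Rightarrow>\<^sub>0 complex"
 assumes fin: "finite J" and T: "!!j. j \<in> J ==> T j \<in> lspan {v. \<forall>i. rvec (u i) \<in> sg --> 0 \<le> v $ i}"
 shows "\<exists>N. \<forall>j\<in>J. \<exists>p. to_laurent p = to_laurent (x_hat u sg) ^ N * T j"
proof -
 define N where "N = nat (\<Sum>j\<in>J. \<Sum>v\<in>supp (T j). \<Sum>i\<in>UNIV. \<bar>v $ i\<bar>)"
 have "\<exists>p. to_laurent p = to_laurent (x_hat u sg) ^ N * T j" if j: "j \<in> J" for j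
 proof (rule to_laurent_onto)
  have "T j \<in> lspan {v. (\<chi> i. if rvec (u i) \<notin> sg then int N else 0) + v \<in> {v. \<forall>i. 0 \<le> v $ i}}"
   unfolding lspan_def
  proof (intro CollectI subsetI allI)
   fix v i assume v: "v \<in> supp (T j)"
   have "\<bar>v $ i\<bar> \<le> (\<Sum>i\<in>UNIV. \<bar>v $ i\<bar>)" by (intro member_le_sum) auto
   also have "... \<le> (\<Sum>v\<in>supp (T j). \<Sum>i\<in>UNIV. \<bar>v $ i\<bar>)" using v by (intro member_le_sum) (auto intro: sum_nonneg)
   also have "... \<le> (\<Sum>j\<in>J. \<Sum>v\<in>supp (T j). \<Sum>i\<in>UNIV. \<bar>v $ i\<bar>)"
    using j fin by (intro member_le_sum) (auto intro!: sum_nonneg)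
   finally have "\<bar>v $ i\<bar> \<le> int N" by (simp add: N_def)
   moreover have "v \<in> {v. \<forall>i. rvec (u i) \<in> sg --> 0 \<le> v $ i}"
    using T[OF j] v unfolding lspan_def by (elim CollectE) (rule subsetD)
   ultimately show "0 \<le> ((\<chi> i. if rvec (u i) \<notin> sg then int N else 0) + v) $ i"
    by (cases "rvec (u i) \<in> sg") simp_all
  qed
  thus "to_laurent (x_hat u sg) ^ N * T j \<in> lspan {v. \<forall>i. 0 \<le> v $ i}"
   unfolding to_laurent_x_hat_power lspan_shift .
 qed
 thus ?thesis by blast
qed

lemma to_laurent_nonneg: "to_laurent f \<in> lspan {v. \<forall>i. 0 \<le> v $ i}"
 unfolding to_laurent_push by (rule push_lspan[of f UNIV]) (auto simp: lspan_def evec_nonneg)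

lemma to_laurent_shift: "mon a 1 * to_laurent p \<in> lspan {v. \<forall>i. a $ i \<le> v $ i}"
proof -
 have "to_laurent p \<in> lspan {v. a + v \<in> {v. \<forall>i. a $ i \<le> v $ i}}"
  using to_laurent_nonneg by (rule lspan_mono) auto
 thus ?thesis unfolding lspan_shift .
qed

context toric
begin

lemma chart_ring_eq: "sg \<in> \<Sigma> ==> chart_ring sg = ring_of_type_algebra\<lparr>carrier := lspan (dc sg)\<rparr>"
 by (simp add: chart_ring_def dual_monoid_eq lspan_def)

context
 fixes J :: "'i set" and a :: "'i => int ^ 'k" and F :: "'i => (int ^ 'n) \<Rightarrow>\<^sub>0 complex" and Icox
 assumes fin: "finite J" and F: "!!j. j \<in> J ==> F j \<in> secs u (a j) UNIV"
 defines "Icox \<equiv> Idl\<^bsub>cox_ring\<^esub> ((%j. homog u (a j) (F j)) ` J)"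
begin

lemma Icox_iff: "f \<in> Icox \<longleftrightarrow> (\<exists>p. f = (\<Sum>j\<in>J. p j * homog u (a j) (F j)))"
 unfolding Icox_def Idl_type_algebra[OF fin] by blast

lemma to_laurent_Icox:
 "to_laurent (\<Sum>j\<in>J. p j * homog u (a j) (F j)) = (\<Sum>j\<in>J. (mon (a j) 1 * to_laurent (p j)) * homogenize u (F j))"
 unfolding to_laurent_sum by (rule sum.cong[OF refl]) (simp add: to_laurent_mult to_laurent_homog[OF F] mult_ac)

text \<open>The degree-zero part of a relation in the Cox ring gives a relation over the torus;
  nonnegativity of the original exponents at the rays of \<open>sg\<close> says that its
  coefficients, times the local generators, are regular on the chart. Conversely, a power of
  \<open>x_hat u sg\<close> clears the denominators of all coefficients at once.\<close>

lemma chart_ideal_eq: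
 assumes sg: "sg \<in> \<Sigma>" and nef: "!!j. j \<in> J ==> nef_data (a j) (mm j)"
 shows "chart_ideal u Icox sg = affine_monoid.gen_ideal (dc sg) J (%j. mon (- mm j sg) 1 * F j)"
  (is "_ = ?G")
proof
 let ?D = "dc sg"
 have G: "g \<in> ?G \<longleftrightarrow> (\<exists>c. (\<forall>j\<in>J. c j \<in> lspan ?D) \<and> g = (\<Sum>j\<in>J. c j * (mon (- mm j sg) 1 * F j)))" for g
  unfolding affine_monoid.gen_ideal_def[OF affine_monoid_dual] by blast
 have ma: "pairing (mm j sg) (u i) = - a j $ i" if "j \<in> J" "rvec (u i) \<in> sg" for i j
  using nef[OF that(1)] sg that(2) by (simp add: nef_data_def)
 have dualI: "x \<in> ?D" if "!!i. rvec (u i) \<in> sg ==> 0 \<le> pairing x (u i)" for x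
  using that by (auto simp: dual_def gens_def)
 show "chart_ideal u Icox sg \<subseteq> ?G"
 proof
  fix g assume "g \<in> chart_ideal u Icox sg"
  then obtain N f where f: "f \<in> Icox" "to_laurent (x_hat u sg) ^ N * homogenize u g = to_laurent f"
   unfolding chart_ideal_def by blast
  obtain p where p: "f = (\<Sum>j\<in>J. p j * homog u (a j) (F j))" using f(1) unfolding Icox_iff by blast
  define w where "w = (\<chi> i. if rvec (u i) \<notin> sg then int N else 0)"
  have "mon w 1 * homogenize u g = (\<Sum>j\<in>J. (mon (a j) 1 * to_laurent (p j)) * homogenize u (F j))"
   using f(2) unfolding p to_laurent_Icox to_laurent_x_hat_power w_def .
  hence "mon (- w) 1 * (mon w 1 * homogenize u g) =
   mon (- w) 1 * (\<Sum>j\<in>J. (mon (a j) 1 * to_laurent (p j)) * homogenize u (F j))" by simp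
  hence "homogenize u g = (\<Sum>j\<in>J. (mon (- w) 1 * (mon (a j) 1 * to_laurent (p j))) * homogenize u (F j))"
   by (simp add: sum_distrib_left mult.assoc)
  from degree_zero_part[OF this] obtain q where
   q: "\<forall>j\<in>J. q j \<in> lspan {m. char_div u m \<in> supp (mon (- w) 1 * (mon (a j) 1 * to_laurent (p j)))}"
    "g = (\<Sum>j\<in>J. q j * F j)" by blast
  have "mon (mm j sg) 1 * q j \<in> lspan ?D" if j: "j \<in> J" for j unfolding lspan_shift
  proof (rule lspan_mono[OF bspec[OF q(1) j]], intro subsetI CollectI)
   fix m assume "m \<in> {m. char_div u m \<in> supp (mon (- w) 1 * (mon (a j) 1 * to_laurent (p j)))}"
   moreover have "mon (- w) 1 * (mon (a j) 1 * to_laurent (p j)) \<in> lspan {v. \<forall>i. (- w + a j) $ i \<le> v $ i}"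
    unfolding mon_mult_mult by (rule to_laurent_shift)
   ultimately have m: "(- w + a j) $ i \<le> char_div u m $ i" for i unfolding lspan_def by blast
   show "mm j sg + m \<in> ?D"
   proof (rule dualI)
    fix i assume i: "rvec (u i) \<in> sg"
    have "a j $ i \<le> pairing m (u i)" using m[of i] i by (simp add: w_def char_div_def)
    thus "0 \<le> pairing (mm j sg + m) (u i)" by (simp add: pairing_add ma[OF j i])
   qed
  qed
  moreover have "g = (\<Sum>j\<in>J. (mon (mm j sg) 1 * q j) * (mon (- mm j sg) 1 * F j))"
   unfolding q(2) by (rule sum.cong[OF refl]) (simp add: mult.assoc mult.left_commute)
  ultimately show "g \<in> ?G"
   unfolding G by (intro exI[of _ "%j. mon (mm j sg) 1 * q j"] conjI ballI)
 qed
 show "?G \<subseteq> chart_ideal u Icox sg"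
 proof
  fix g assume g: "g \<in> ?G"
  then obtain c where c: "\<forall>j\<in>J. c j \<in> lspan ?D" "g = (\<Sum>j\<in>J. c j * (mon (- mm j sg) 1 * F j))"
   unfolding G by blast
  define v where "v j = - char_div u (mm j sg) - a j" for j
  define T where "T j = mon (v j) 1 * homogenize u (c j)" for j
  have T: "T j \<in> lspan {v. \<forall>i. rvec (u i) \<in> sg --> 0 \<le> v $ i}" if j: "j \<in> J" for j
   unfolding T_def lspan_shift homogenize_push
  proof (rule push_lspan[OF bspec[OF c(1) j]], intro CollectI allI impI)
   fix m i assume m: "m \<in> ?D" and i: "rvec (u i) \<in> sg"
   have "0 \<le> pairing m (u i)" using m i by (auto simp: dual_def gens_def)
   thus "0 \<le> (v j + char_div u m) $ i" by (simp add: v_def char_div_def ma[OF j i])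
  qed
  have "\<exists>N. \<forall>j\<in>J. \<exists>p. to_laurent p = to_laurent (x_hat u sg) ^ N * T j"
   by (rule clear_denominators[OF fin T])
  then obtain N where "\<forall>j\<in>J. \<exists>p. to_laurent p = to_laurent (x_hat u sg) ^ N * T j" ..
  from bchoice[OF this] obtain p where p: "\<forall>j\<in>J. to_laurent (p j) = to_laurent (x_hat u sg) ^ N * T j" ..
  have "homogenize u g = (\<Sum>j\<in>J. (mon (a j) 1 * T j) * homogenize u (F j))"
   unfolding c(2) homogenize_sum
  proof (rule sum.cong[OF refl])
   fix j
   have "mon (a j) 1 * T j = mon (- char_div u (mm j sg)) 1 * homogenize u (c j)"
    unfolding T_def mon_mult_mult by (simp add: v_def)
   thus "homogenize u (c j * (mon (- mm j sg) 1 * F j)) = (mon (a j) 1 * T j) * homogenize u (F j)"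
    by (simp add: homogenize_mult char_div_uminus mult_ac)
  qed
  moreover have "to_laurent (\<Sum>j\<in>J. p j * homog u (a j) (F j)) =
   (\<Sum>j\<in>J. to_laurent (x_hat u sg) ^ N * ((mon (a j) 1 * T j) * homogenize u (F j)))"
   unfolding to_laurent_Icox by (rule sum.cong[OF refl]) (use p in \<open>simp add: mult_ac\<close>)
  ultimately have "to_laurent (x_hat u sg) ^ N * homogenize u g = to_laurent (\<Sum>j\<in>J. p j * homog u (a j) (F j))"
   by (simp add: sum_distrib_left)
  moreover have "(\<Sum>j\<in>J. p j * homog u (a j) (F j)) \<in> Icox"
   unfolding Icox_iff by (rule exI[of _ p]) (rule refl)
  moreover have "g \<in> lspan ?D" unfolding c(2)
  proof (rule lspan_sum)
   fix j assume j: "j \<in> J"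
   have "mon (- mm j sg) 1 * F j \<in> lspan ?D" by (rule section_local[OF nef[OF j] sg F[OF j]])
   thus "c j * (mon (- mm j sg) 1 * F j) \<in> lspan ?D"
    by (rule lspan_mult[OF bspec[OF c(1) j]]) (rule dual_add)
  qed
  ultimately show "g \<in> chart_ideal u Icox sg" unfolding chart_ideal_def chart_ring_eq[OF sg] by auto
 qed
qed

text \<open>Taking the degree-zero part after division by the monomial of \<open>A\<close> replaces
  arbitrary coefficients by coefficients of degree \<open>A - a j\<close>; nonnegative exponents
  become the conditions for global sections.\<close>

lemma homog_mem_Icox:
 assumes z: "z \<in> secs u A UNIV"
 shows "homog u A z \<in> Icox \<longleftrightarrow>
  (\<exists>e. (\<forall>j\<in>J. e j \<in> secs u (A - a j) UNIV) \<and> z = (\<Sum>j\<in>J. F j * e j))"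
proof
 assume "homog u A z \<in> Icox"
 then obtain p where "homog u A z = (\<Sum>j\<in>J. p j * homog u (a j) (F j))" unfolding Icox_iff by blast
 hence "to_laurent (homog u A z) = (\<Sum>j\<in>J. (mon (a j) 1 * to_laurent (p j)) * homogenize u (F j))"
  by (simp only: to_laurent_Icox)
 hence "mon (- A) 1 * (mon A 1 * homogenize u z) =
  mon (- A) 1 * (\<Sum>j\<in>J. (mon (a j) 1 * to_laurent (p j)) * homogenize u (F j))"
  unfolding to_laurent_homog[OF z] by simp
 hence "homogenize u z = (\<Sum>j\<in>J. (mon (- A) 1 * (mon (a j) 1 * to_laurent (p j))) * homogenize u (F j))"
  by (simp add: sum_distrib_left mult.assoc)
 from degree_zero_part[OF this] obtain q where
  q: "\<forall>j\<in>J. q j \<in> lspan {m. char_div u m \<in> supp (mon (- A) 1 * (mon (a j) 1 * to_laurent (p j)))}"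
   "z = (\<Sum>j\<in>J. q j * F j)" by blast
 have "q j \<in> secs u (A - a j) UNIV" if j: "j \<in> J" for j
 proof (rule lspan_mono[OF bspec[OF q(1) j]], intro subsetI)
  fix m assume "m \<in> {m. char_div u m \<in> supp (mon (- A) 1 * (mon (a j) 1 * to_laurent (p j)))}"
  moreover have "mon (- A) 1 * (mon (a j) 1 * to_laurent (p j)) \<in> lspan {v. \<forall>i. (- A + a j) $ i \<le> v $ i}"
   unfolding mon_mult_mult by (rule to_laurent_shift)
  ultimately have m: "(- A + a j) $ i \<le> char_div u m $ i" for i unfolding lspan_def by blast
  show "m \<in> poly_pts u (A - a j) UNIV" unfolding poly_pts_def
  proof (intro CollectI allI impI)
   show "- (A - a j) $ i \<le> pairing m (u i)" for i using m[of i] by (simp add: char_div_def)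
  qed
 qed
 moreover have "z = (\<Sum>j\<in>J. F j * q j)" unfolding q(2) by (simp add: mult.commute)
 ultimately show "\<exists>e. (\<forall>j\<in>J. e j \<in> secs u (A - a j) UNIV) \<and> z = (\<Sum>j\<in>J. F j * e j)"
  by (intro exI[of _ q] conjI ballI)
next
 assume "\<exists>e. (\<forall>j\<in>J. e j \<in> secs u (A - a j) UNIV) \<and> z = (\<Sum>j\<in>J. F j * e j)"
 then obtain e where e: "\<forall>j\<in>J. e j \<in> secs u (A - a j) UNIV" "z = (\<Sum>j\<in>J. F j * e j)"
  by (elim exE conjE) (rule that)
 have "homog u A (F j * e j) = homog u (A - a j) (e j) * homog u (a j) (F j)" if j: "j \<in> J" for j
  using homog_mult[OF F[OF j] bspec[OF e(1) j]] by (simp add: mult.commute)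
 hence "homog u A z = (\<Sum>j\<in>J. homog u (A - a j) (e j) * homog u (a j) (F j))"
  unfolding e(2) homog_sum by (rule sum.cong[OF refl])
 thus "homog u A z \<in> Icox" unfolding Icox_iff by (rule exI[of _ "%j. homog u (A - a j) (e j)"])
qed

text \<open>A power of \<open>x_hat u sg\<close> lies in the matching power of the irrelevant ideal
  and is invertible on the chart. The exponent \<open>v\<close>, which passes to the local function,
  vanishes at the rays of \<open>sg\<close>, so its denominators are absorbed in the same
  way.\<close>

lemma saturation_local:
 assumes sg: "sg \<in> \<Sigma>" and nef: "nef_data A mA" and z: "z \<in> secs u A UNIV"
  and sat: "homog u A z \<in> saturation Icox (irrelevant_ideal \<Sigma> u)"
 shows "mon (- mA sg) 1 * z \<in> chart_ideal u Icox sg"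
proof -
 obtain N where N: "homog u A z * x_hat u sg ^ N \<in> Icox"
  using sat x_hat_power_mem[OF x_hat_irrelevant[OF sg]] unfolding saturation_def by blast
 define v where "v = - char_div u (mA sg) - A"
 have "v $ i = 0" if "rvec (u i) \<in> sg" for i
  using nef sg that by (simp add: v_def char_div_def nef_data_def)
 hence "mon v 1 \<in> lspan {v. \<forall>i. rvec (u i) \<in> sg --> 0 \<le> v $ i}" by simp
 then obtain N' p where p: "to_laurent p = to_laurent (x_hat u sg) ^ N' * mon v 1"
  using clear_denominators[of "{()}" "%_. mon v 1" u sg] by auto
 have e: "mon v 1 * (mon A 1 * homogenize u z) = homogenize u (mon (- mA sg) 1 * z)"
  unfolding mon_mult_mult by (simp add: v_def homogenize_mult char_div_uminus)
 have pow: "to_laurent (x_hat u sg ^ N) = to_laurent (x_hat u sg) ^ N"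
 proof (induction N)
  case 0
  have "to_laurent 1 = 1" unfolding one_eq_mon to_laurent_push push_mon by (simp add: evec_def flip: zero_vec_def)
  thus ?case by simp
 qed (simp add: to_laurent_mult)
 have "to_laurent (x_hat u sg) ^ (N + N') * homogenize u (mon (- mA sg) 1 * z) =
  (to_laurent (x_hat u sg) ^ N' * mon v 1) * ((mon A 1 * homogenize u z) * to_laurent (x_hat u sg) ^ N)"
  unfolding e[symmetric] power_add by (simp add: mult_ac)
 also have "... = to_laurent (p * (homog u A z * x_hat u sg ^ N))"
  unfolding to_laurent_mult to_laurent_homog[OF z] p pow ..
 finally have "to_laurent (x_hat u sg) ^ (N + N') * homogenize u (mon (- mA sg) 1 * z) =
  to_laurent (p * (homog u A z * x_hat u sg ^ N))" .
 moreover have "p * (homog u A z * x_hat u sg ^ N) \<in> Icox"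
  using N unfolding Icox_def by (rule Idl_mult[OF fin])
 moreover have "mon (- mA sg) 1 * z \<in> lspan (dc sg)" by (rule section_local[OF nef sg z])
 ultimately show ?thesis unfolding chart_ideal_def chart_ring_eq[OF sg] by auto
qed

lemma subset_saturation: "Icox \<subseteq> saturation Icox B"
proof
 fix f assume f: "f \<in> Icox"
 have "f * b \<in> Icox" for b
  using Idl_mult[OF fin f[unfolded Icox_def], of b] unfolding Icox_def by (simp add: mult.commute)
 thus "f \<in> saturation Icox B" unfolding saturation_def by blast
qed

end

end

section \<open>Divisor classes and base points\<close>

lemma comm_group_torus_divisors: "comm_group torus_divisors"
 by (rule comm_groupI) (auto simp: torus_divisors_def add_ac intro: exI[of _ "- x" for x])

lemma normal_char_div: "range (char_div u) \<lhd> torus_divisors"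
proof -
 interpret comm_group "torus_divisors :: (int ^ 'a) monoid" by (rule comm_group_torus_divisors)
 have inv: "inv\<^bsub>torus_divisors\<^esub> v = - v" for v :: "int ^ 'a"
  by (rule inv_equality) (simp_all add: torus_divisors_def)
 have "subgroup (range (char_div u)) torus_divisors"
 proof (rule subgroupI)
  show "range (char_div u) \<subseteq> carrier torus_divisors" by (simp add: torus_divisors_def)
  show "inv\<^bsub>torus_divisors\<^esub> x \<in> range (char_div u)" if "x \<in> range (char_div u)" for x
   using that unfolding inv by (auto simp flip: char_div_uminus)
  show "x \<otimes>\<^bsub>torus_divisors\<^esub> y \<in> range (char_div u)" if "x \<in> range (char_div u)" "y \<in> range (char_div u)" for x y
   using that by (auto simp: torus_divisors_def simp flip: char_div_add)
 qed simp
 thus ?thesis by (rule subgroup_imp_normal)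
qed

lemma comm_group_class_group: "comm_group (class_group u)" unfolding class_group_def
 by (rule comm_group.abelian_FactGroup[OF comm_group_torus_divisors normal_imp_subgroup[OF normal_char_div]])

lemma divisor_class_carrier: "divisor_class u a \<in> carrier (class_group u)"
 by (auto simp: class_group_def divisor_class_def FactGroup_def RCOSETS_def torus_divisors_def)

lemma divisor_class_mult: "divisor_class u a \<otimes>\<^bsub>class_group u\<^esub> divisor_class u b = divisor_class u (a + b)"
 using normal.rcos_sum[OF normal_char_div, of a b u]
 by (simp add: class_group_def divisor_class_def FactGroup_def torus_divisors_def)

lemma divisor_class_finprod:
 assumes "finite J"
 shows "(\<Otimes>\<^bsub>class_group u\<^esub> j\<in>J. divisor_class u (a j)) = divisor_class u (\<Sum>j\<in>J. a j)"
 using assms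
proof induction
 interpret comm_group "class_group u" by (rule comm_group_class_group)
 case empty
 have "\<one>\<^bsub>class_group u\<^esub> = divisor_class u 0"
  by (simp add: class_group_def FactGroup_def divisor_class_eq full_SetCompr_eq)
 thus ?case by simp
next
 interpret comm_group "class_group u" by (rule comm_group_class_group)
 case (insert j J)
 thus ?case by (simp add: divisor_class_carrier divisor_class_mult)
qed

lemma eval_cox_mon [simp]: "eval_cox x (mon e c) = c * (\<Prod>i\<in>UNIV. x $ i ^ Poly_Mapping.lookup e i)"
 by (cases "c = 0") (simp_all add: eval_cox_def)

lemma eval_x_hat: "eval_cox x (x_hat u sg) ~= 0 \<longleftrightarrow> (\<forall>i. rvec (u i) \<notin> sg --> x $ i ~= 0)"
proof -
 have "(\<Prod>i\<in>K. cox_var i) = mon (\<Sum>i\<in>K. Poly_Mapping.single i 1) 1" if "finite K" for K :: "'a set"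
  using that
 proof induction
  case empty
  show ?case by (simp only: prod.empty sum.empty one_eq_mon)
 next
  case (insert i K)
  thus ?case by (simp add: cox_var_def mult_single)
 qed
 hence e: "x_hat u sg = mon (\<Sum>i\<in>{i. rvec (u i) \<notin> sg}. Poly_Mapping.single i 1) 1" by (simp add: x_hat_def)
 have "Poly_Mapping.lookup (\<Sum>i\<in>{i. rvec (u i) \<notin> sg}. Poly_Mapping.single i 1) j = (if rvec (u j) \<notin> sg then 1 else 0 :: nat)" for j
  by (simp add: lookup_sum lookup_single when_def)
 thus ?thesis unfolding e by auto
qed

context toric
begin

definition cox_point :: "(real ^ 'n) set => complex ^ 'k => int ^ 'n => complex" where
 "cox_point sg x = (\<lambda>m\<in>dc sg. \<Prod>i\<in>UNIV. x $ i powi pairing m (u i))"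

lemma cox_point_mem:
 assumes sg: "sg \<in> \<Sigma>" and x: "!!i. rvec (u i) \<notin> sg ==> x $ i ~= 0"
 shows "cox_point sg x \<in> chart_points sg" unfolding chart_points_iff[OF sg]
proof (intro conjI ballI)
 fix m m' assume m: "m \<in> dc sg" and m': "m' \<in> dc sg"
 have "x $ i powi (pairing m (u i) + pairing m' (u i)) = x $ i powi pairing m (u i) * x $ i powi pairing m' (u i)" for i
 proof (cases "x $ i = 0")
  case True
  with x have "rvec (u i) \<in> sg" by blast
  hence "0 \<le> pairing m (u i)" "0 \<le> pairing m' (u i)" using m m' by (auto simp: dual_def gens_def)
  thus ?thesis by (simp add: power_int_def nat_add_distrib power_add)
 qed (simp add: power_int_add)
 thus "cox_point sg x (m + m') = cox_point sg x m * cox_point sg x m'"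
  using m m' by (simp add: cox_point_def dual_add pairing_add prod.distrib)
qed (simp_all add: cox_point_def)

lemma cox_point_restrict: "fc \<subseteq> sg ==> restrict (cox_point fc x) (dc sg) = cox_point sg x"
 unfolding cox_point_def using dual_anti[of fc sg] by (auto simp: restrict_restrict Int_absorb1)

lemma cox_quotient_class:
 assumes sg: "sg \<in> \<Sigma>" and x: "!!i. rvec (u i) \<notin> sg ==> x $ i ~= 0"
 shows "cox_quotient \<Sigma> u x = glue \<Sigma> `` {(sg, cox_point sg x)}"
proof -
 have "glue \<Sigma> `` {(tc, cox_point tc x)} = glue \<Sigma> `` {(sg, cox_point sg x)}"
  if tc: "tc \<in> \<Sigma>" and y: "!!i. rvec (u i) \<notin> tc ==> x $ i ~= 0" for tc
 proof (rule equiv_class_eq[OF equiv_glue])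
  have "cox_point (tc \<inter> sg) x \<in> chart_points (tc \<inter> sg)"
   by (rule cox_point_mem[OF Int_in_fan[OF tc sg]]) (use x y in blast)
  from glueI[OF tc sg Int_in_fan[OF tc sg] _ _ this]
  show "((tc, cox_point tc x), (sg, cox_point sg x)) \<in> glue \<Sigma>" by (simp add: cox_point_restrict)
 qed
 hence "\<forall>tc\<in>{tc \<in> \<Sigma>. eval_cox x (x_hat u tc) ~= 0}. glue \<Sigma> `` {(tc, cox_point tc x)} = glue \<Sigma> `` {(sg, cox_point sg x)}"
  unfolding eval_x_hat by blast
 moreover have "sg \<in> {tc \<in> \<Sigma>. eval_cox x (x_hat u tc) ~= 0}" unfolding eval_x_hat using sg x by blast
 moreover have "cox_quotient \<Sigma> u x = (\<Union>tc\<in>{tc \<in> \<Sigma>. eval_cox x (x_hat u tc) ~= 0}. glue \<Sigma> `` {(tc, cox_point tc x)})"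
  unfolding cox_quotient_def cox_point_def by (intro SUP_cong refl) (simp add: dual_monoid_eq)
 ultimately show ?thesis by (metis (no_types, lifting) SUP_eq_const empty_iff)
qed

text \<open>At the distinguished point of \<open>sg\<close>, with coordinate \<open>0\<close> at the
  rays of \<open>sg\<close> and \<open>1\<close> elsewhere, some form of the degree does not vanish.
  One of its monomials is then free of the variables of \<open>sg\<close>, and its character is the
  required \<open>m sg\<close>.\<close>

lemma basepoint_free_imp_nef:
 assumes bpf: "basepoint_free \<Sigma> u (divisor_class u a)"
 shows "\<exists>m. nef_data a m"
proof -
 have "\<exists>m. \<forall>i. (rvec (u i) \<in> sg --> pairing m (u i) = - a $ i) \<and> - a $ i \<le> pairing m (u i)" if sg: "sg \<in> \<Sigma>" for sg
 proof -
  define x :: "complex ^ 'k" where "x = (\<chi> i. if rvec (u i) \<in> sg then 0 else 1)"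
  have x: "x $ i ~= 0" if "rvec (u i) \<notin> sg" for i using that by (simp add: x_def)
  define pz where "pz = cox_quotient \<Sigma> u x"
  have p: "(sg, cox_point sg x) \<in> (SIGMA sg:\<Sigma>. chart_points sg)"
   using sg cox_point_mem[of sg x] x by blast
  have "pz = glue \<Sigma> `` {(sg, cox_point sg x)}"
   unfolding pz_def by (rule cox_quotient_class[OF sg]) (rule x)
  hence "pz \<in> toric_variety \<Sigma>" unfolding toric_variety_def using quotientI[OF p] by simp
  moreover have "\<not> basepoint \<Sigma> u (divisor_class u a) pz" using bpf by (simp add: basepoint_free_def)
  ultimately obtain f where f: "f \<in> graded_piece u (divisor_class u a)" "pz \<notin> Var_poly \<Sigma> u f"
   unfolding basepoint_def by blast
  have "x \<notin> affine_variety (irrelevant_ideal \<Sigma> u)"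
   using x_hat_irrelevant[OF sg] x eval_x_hat[of x u sg] unfolding affine_variety_def by blast
  hence "eval_cox x f ~= 0" using f(2) \<open>pz \<in> toric_variety \<Sigma>\<close> unfolding Var_poly_def pz_def by blast
  then obtain e where e: "e \<in> supp f" "(\<Prod>i\<in>UNIV. x $ i ^ Poly_Mapping.lookup e i) ~= 0"
   unfolding eval_cox_def by (metis (no_types, lifting) mult_zero_right sum.neutral)
  obtain m where m: "evec e = a + char_div u m" using f(1) e(1) unfolding graded_piece_iff by blast
  have m': "int (Poly_Mapping.lookup e i) = a $ i + pairing m (u i)" for i
   using arg_cong[OF m, of "%v. v $ i"] by (simp add: evec_def char_div_def)
  show ?thesis
  proof (intro exI[of _ m] allI conjI impI)
   fix i
   show "- a $ i \<le> pairing m (u i)" using m'[of i] by simp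
   assume "rvec (u i) \<in> sg"
   hence "x $ i = 0" by (simp add: x_def)
   moreover have "x $ i ^ Poly_Mapping.lookup e i ~= 0" using e(2) by simp
   ultimately have "Poly_Mapping.lookup e i = 0" by (cases "Poly_Mapping.lookup e i") auto
   thus "pairing m (u i) = - a $ i" using m'[of i] by simp
  qed
 qed
 hence "\<exists>m. \<forall>sg\<in>\<Sigma>. \<forall>i. (rvec (u i) \<in> sg --> pairing (m sg) (u i) = - a $ i) \<and> - a $ i \<le> pairing (m sg) (u i)"
  by (intro bchoice ballI)
 thus ?thesis unfolding nef_data_def .
qed

text \<open>The monomial of \<open>m sg\<close> involves only variables of rays outside
  \<open>sg\<close>, and these are nonzero on the preimage of the chart of
  \<open>sg\<close>.\<close>

lemma nef_imp_basepoint_free: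
 assumes nef: "nef_data a m"
 shows "basepoint_free \<Sigma> u (divisor_class u a)" unfolding basepoint_free_def
proof
 assume "\<exists>pz. basepoint \<Sigma> u (divisor_class u a) pz"
 then obtain pz where pz: "pz \<in> toric_variety \<Sigma>" and
  base: "!!f. f \<in> graded_piece u (divisor_class u a) ==> pz \<in> Var_poly \<Sigma> u f" unfolding basepoint_def by blast
 obtain sg pt where pt: "(sg, pt) \<in> pz" using point_rep[OF pz] by blast
 note sg = rep_chart(1)[OF pz pt]
 have m: "- a $ i \<le> pairing (m sg) (u i)" "rvec (u i) \<in> sg ==> pairing (m sg) (u i) = - a $ i" for i
  using nef sg unfolding nef_data_def by blast+
 have "mon (m sg) 1 \<in> secs u a UNIV" using m(1) by (simp add: poly_pts_def)
 hence "homog u a (mon (m sg) 1) \<in> graded_piece u (divisor_class u a)" unfolding graded_piece_homog by blast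
 hence "pz \<in> Var_poly \<Sigma> u (mon (expo u a (m sg)) 1)" by (intro base) (simp add: homog_def)
 then obtain x where x: "cox_quotient \<Sigma> u x = pz" "eval_cox x (mon (expo u a (m sg)) 1) = 0"
  unfolding Var_poly_def by blast
 \<comment> \<open>The point may have been produced from another cone \<open>tc\<close>. If the ray
   of \<open>i\<close> is in \<open>tc\<close>, the character cutting out the common face
   \<open>fc\<close> has nonzero exponent at \<open>x $ i\<close>, while its value at the point is
   nonzero.\<close>
 have nz: "x $ i ~= 0" if i: "rvec (u i) \<notin> sg" for i
 proof -
  obtain tc where tc: "tc \<in> \<Sigma>" "eval_cox x (x_hat u tc) ~= 0"
   and g: "((tc, \<lambda>m\<in>dual_monoid tc. \<Prod>i\<in>UNIV. x $ i powi pairing m (u i)), (sg, pt)) \<in> glue \<Sigma>"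
   using pt unfolding x(1)[symmetric] cox_quotient_def by blast
  show ?thesis
  proof (cases "rvec (u i) \<in> tc")
   case False
   thus ?thesis using tc(2) unfolding eval_x_hat by blast
  next
   case True
   obtain fc qt where fc: "fc \<in> \<Sigma>" "fc \<subseteq> tc" "fc \<subseteq> sg" "qt \<in> chart_points fc"
    and qt: "(\<lambda>m\<in>dual_monoid tc. \<Prod>i\<in>UNIV. x $ i powi pairing m (u i)) = restrict qt (dc tc)"
    using g by (rule glueE) (rule that)
   obtain k where k: "cuts tc fc k" using ex_cuts[OF tc(1) fc(1,2)] by blast
   have kd: "k \<in> dc tc" using k by (simp add: cuts_def)
   have "(\<Prod>i\<in>UNIV. x $ i powi pairing k (u i)) = qt k"
    using fun_cong[OF qt, of k] kd by (simp add: dual_monoid_eq[OF tc(1)])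
   hence "(\<Prod>i\<in>UNIV. x $ i powi pairing k (u i)) ~= 0" using cuts_nonzero[OF fc(1,4) k fc(2)] by simp
   hence "x $ i powi pairing k (u i) ~= 0" by simp
   moreover have "pairing k (u i) ~= 0" using k True i fc(3) by (auto simp: cuts_def gens_def)
   ultimately show ?thesis by auto
  qed
 qed
 have "x $ i ^ Poly_Mapping.lookup (expo u a (m sg)) i ~= 0" for i
 proof (cases "rvec (u i) \<in> sg")
  case True
  thus ?thesis using m(2) by (simp add: expo_def)
 qed (simp add: nz)
 hence "(\<Prod>i\<in>UNIV. x $ i ^ Poly_Mapping.lookup (expo u a (m sg)) i) ~= 0"
  unfolding prod_zero_iff[OF finite] by blast
 thus False using x(2) unfolding eval_cox_mon by (simp only: mult_1 not_False_eq_True)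
qed

section \<open>Regularity\<close>

text \<open>One degree at a time. By \<open>mem\<close> the quotient piece is the space of global
  sections modulo those vanishing in all germs, and its dimension is the sum of the local ones; a
  section in the saturation vanishes in all germs as well.\<close>

theorem nef_regularity:
 fixes J :: "nat set" and a :: "nat => int ^ 'k" and F :: "nat => (int ^ 'n) \<Rightarrow>\<^sub>0 complex"
 assumes fin: "finite J" and card: "card J = CARD('n)"
  and nef: "!!j. j \<in> J ==> nef_data (a j) (mm j)" and nefb: "nef_data b mb"
  and F: "!!j. j \<in> J ==> F j \<in> secs u (a j) UNIV"
  and Ic: "Ic = Idl\<^bsub>cox_ring\<^esub> ((%j. homog u (a j) (F j)) ` J)"
  and dim: "scheme_dim \<Sigma> u Ic = 0"
 shows "divisor_class u (b + (\<Sum>j\<in>J. a j)) \<in> Reg \<Sigma> u Ic"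
proof -
 have cideal: "chart_ideal u Ic sg = affine_monoid.gen_ideal (dc sg) J (%j. mon (- mm j sg) 1 * F j)"
  if "sg \<in> \<Sigma>" for sg unfolding Ic by (rule chart_ideal_eq[OF fin F that nef])
 interpret nef_system \<Sigma> u J a b mm mb F
 proof
  show "finite J" "card J = CARD('n)" by fact+
  show "nef_data (a j) (mm j)" "F j \<in> secs u (a j) UNIV" if "j \<in> J" for j
   using nef[OF that] F[OF that] by blast+
  show "nef_data b mb" by (rule nefb)
  \<comment> \<open>A chart that misses the subscheme has dimension minus infinity, which is why the
    bound \<open>0\<close> is used instead of equality.\<close>
  fix sg g assume sg: "sg \<in> \<Sigma>" and g: "g \<in> lspan (dc sg)"
  interpret affine_monoid "dc sg" by (rule affine_monoid_dual)
  have "aideal (gen_ideal J (%j. mon (- mm j sg) 1 * F j))"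
   by (rule aideal_gen_ideal) (rule section_local[OF nef sg F])
  moreover have "krull_dim (scheme_chart u Ic sg) \<le> scheme_dim \<Sigma> u Ic"
   unfolding scheme_dim_def using sg by (rule SUP_upper)
  hence "krull_dim (aring Quot gen_ideal J (%j. mon (- mm j sg) 1 * F j)) \<le> 0"
   unfolding dim scheme_chart_def chart_ring_eq[OF sg] cideal[OF sg] .
  ultimately show "algebraic_mod (gen_ideal J (%j. mon (- mm j sg) 1 * F j)) g"
   using g by (rule algebraic_mod_if_krull_dim_0)
 qed
 have loc: "chart_ideal u Ic sg = loc sg" if "sg \<in> \<Sigma>" for sg unfolding cideal[OF that] loc_def ..
 let ?A = "div_sum J"
 have A: "b + (\<Sum>j\<in>J. a j) = ?A" by (simp add: div_sum_def)
 have Aj: "div_sum (J - {j}) = ?A - a j" if "j \<in> J" for j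
  using div_sum_remove[OF subset_refl that] by simp
 have mem: "homog u ?A z \<in> Ic \<longleftrightarrow> (\<forall>pz\<in>zeros. z \<in> van pz)" if z: "z \<in> sect UNIV" for z
 proof -
  have "homog u ?A z \<in> Ic \<longleftrightarrow> (\<exists>e. (\<forall>j\<in>J. e j \<in> secs u (?A - a j) UNIV) \<and> z = (\<Sum>j\<in>J. F j * e j))"
   unfolding Ic by (rule homog_mem_Icox[OF fin F]) (use z in \<open>simp_all add: sect_def\<close>)
  also have "... \<longleftrightarrow> (\<exists>e. (\<forall>j\<in>J. e j \<in> secs u (div_sum (J - {j})) UNIV) \<and> z = (\<Sum>j\<in>J. F j * e j))"
   by (simp add: Aj cong: ball_cong)
  also have "... \<longleftrightarrow> (\<forall>pz\<in>zeros. z \<in> van pz)" by (rule global_ideal[OF z, symmetric])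
  finally show ?thesis .
 qed
 have graded: "graded_piece u (divisor_class u ?A) = homog u ?A ` sect UNIV"
  unfolding graded_piece_homog sect_def ..
 have Var: "Var_ideal \<Sigma> u Ic = zeros"
 proof (rule Set.set_eqI)
  fix pz
  have "(\<exists>(sg, pt)\<in>pz. \<forall>g\<in>chart_ideal u Ic sg. ev pt g = 0) \<longleftrightarrow> (\<exists>(sg, pt)\<in>pz. \<forall>g\<in>loc sg. ev pt g = 0)"
   if pz: "pz \<in> toric_variety \<Sigma>"
  proof (rule bex_cong[OF refl])
   fix p assume p: "p \<in> pz"
   obtain sg pt where pe: "p = (sg, pt)" by (cases p)
   show "(case p of (sg, pt) => \<forall>g\<in>chart_ideal u Ic sg. ev pt g = 0) \<longleftrightarrow>
    (case p of (sg, pt) => \<forall>g\<in>loc sg. ev pt g = 0)"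
    using loc[OF rep_chart(1)[OF pz p[unfolded pe]]] unfolding pe by simp
  qed
  thus "pz \<in> Var_ideal \<Sigma> u Ic \<longleftrightarrow> pz \<in> zeros" unfolding Var_ideal_def zeros_def by blast
 qed
 \<comment> \<open>The same choice of representative as in \<open>multiplicity\<close>, so that both
   sides speak of one local ring.\<close>
 define r where "r pz = (SOME p. p \<in> pz)" for pz :: "'n toric_point"
 have rep: "(fst (r pz), snd (r pz)) \<in> pz" if "pz \<in> zeros" for pz
 proof -
  have "\<exists>p. p \<in> pz" using point_rep[OF zeros_variety[OF that]] by blast
  thus ?thesis unfolding r_def prod.collapse by (rule someI_ex)
 qed
 have mult: "qdim (germ (fst (r pz)) (snd (r pz))) (multiplicity u Ic pz) (lspan (dual (gens (fst (r pz)))))"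
  if z: "pz \<in> zeros" for pz
 proof -
  obtain sg pt where re: "r pz = (sg, pt)" by (cases "r pz")
  have pt: "(sg, pt) \<in> pz" using rep[OF z] by (simp add: re)
  note sg = rep_chart[OF zeros_variety[OF z] pt]
  interpret S: finite_subscheme "dc sg" "loc sg" by (rule scheme[OF sg(1)])
  obtain d where d: "qdim (germ sg pt) d (lspan (dc sg))" using ex_local_dim[OF z pt] by blast
  have ptp: "pt \<in> S.pts" using sg pts_chart_points by simp
  have van: "!!f. f \<in> loc sg ==> ev pt f = 0" using z zeros_rep[OF zeros_variety[OF z] pt] by blast
  have P: "point_ideal u Ic sg pt = S.point_coset pt"
   unfolding point_ideal_def S.point_coset_def loc[OF sg(1)] chart_ring_eq[OF sg(1)] by simp
  have C: "scheme_chart u Ic sg = ring_of_type_algebra\<lparr>carrier := lspan (dc sg)\<rparr> Quot loc sg"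
   unfolding scheme_chart_def loc[OF sg(1)] chart_ring_eq[OF sg(1)] ..
  have "multiplicity u Ic pz = d" using S.local_ring_dim[OF ptp van d]
   unfolding multiplicity_def r_def[symmetric] re prod.case local_ring_def local_scalars_def P C loc[OF sg(1)]
    chart_ring_eq[OF sg(1)] .
  with d show ?thesis by (simp add: re)
 qed
 have q: "qdim {z \<in> sect UNIV. \<forall>pz\<in>zeros. z \<in> van pz} (scheme_degree \<Sigma> u Ic) (sect UNIV)"
  unfolding scheme_degree_def Var by (rule qdim_sections[OF rep mult])
 interpret D: denominators "UNIV :: 'k cox set" "{1}" by unfold_locales auto
 have RD: "cox_ring\<lparr>carrier := UNIV\<rparr> = (cox_ring :: 'k cox ring)" by (simp add: ring_of_type_algebra_def)
 have ideal: "D.aideal Ic" unfolding D.aideal_def D.smod_def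
 proof (intro conjI ballI)
  interpret R: cring "cox_ring :: 'k cox ring" by (rule cring_from_type_algebra)
  interpret idl: ideal Ic cox_ring unfolding Ic by (rule R.genideal_ideal) (simp add: type_algebra_simps)
  show "0 \<in> Ic" using idl.zero_closed by (simp add: type_algebra_simps)
  show "x + y \<in> Ic" if "x \<in> Ic" "y \<in> Ic" for x y using idl.a_closed[OF that] by (simp add: type_algebra_simps)
  show "c * x \<in> Ic" if "x \<in> Ic" for c x using idl.I_l_closed[OF that, of c] by (simp add: type_algebra_simps)
 qed simp
 note cosets = D.coset_zero[OF D.aideal_smod[OF ideal], unfolded RD]
  D.quot_add[OF ideal UNIV_I UNIV_I, unfolded RD] D.quot_mult[OF ideal UNIV_I UNIV_I, unfolded RD]
 have carr: "Ic +>\<^bsub>cox_ring\<^esub> f \<in> carrier (cox_ring Quot Ic)" for f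
  using D.carrier_quot[of Ic] unfolding RD by blast
 have "ring.dimension (cox_ring Quot Ic) (scheme_degree \<Sigma> u Ic) (quotient_scalars Ic)
   ((%z. Ic +>\<^bsub>cox_ring\<^esub> homog u ?A z) ` sect UNIV)"
 proof (rule qdim_dimension[where k = "%c. Ic +>\<^bsub>cox_ring\<^esub> mon 0 c" and V = "sect UNIV" and
    N = "{z \<in> sect UNIV. \<forall>pz\<in>zeros. z \<in> van pz}", OF _ _ _ _ _ q subset_refl])
  show "ring (cox_ring Quot Ic)" using D.cring_quot[OF ideal] unfolding RD by (rule cring.axioms(1))
  show "quotient_scalars Ic = range (%c. Ic +>\<^bsub>cox_ring\<^esub> mon 0 c)" by (simp add: quotient_scalars_def)
  show "quotient_scalars Ic \<subseteq> carrier (cox_ring Quot Ic)" using carr by (auto simp: quotient_scalars_def)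
  show "csub (sect UNIV)" by (rule csub_sect)
  show "csub {z \<in> sect UNIV. \<forall>pz\<in>zeros. z \<in> van pz}"
   using csub_sect[of UNIV] csub_van[OF zeros_variety] unfolding csub_def by auto
  show "Ic +>\<^bsub>cox_ring\<^esub> homog u ?A z \<in> carrier (cox_ring Quot Ic)" for z by (rule carr)
  show "Ic +>\<^bsub>cox_ring\<^esub> homog u ?A (z + z') =
    (Ic +>\<^bsub>cox_ring\<^esub> homog u ?A z) \<oplus>\<^bsub>cox_ring Quot Ic\<^esub> (Ic +>\<^bsub>cox_ring\<^esub> homog u ?A z')" for z z'
   by (simp add: cosets homog_add)
  show "Ic +>\<^bsub>cox_ring\<^esub> homog u ?A (mon 0 c * z) =
    (Ic +>\<^bsub>cox_ring\<^esub> mon 0 c) \<otimes>\<^bsub>cox_ring Quot Ic\<^esub> (Ic +>\<^bsub>cox_ring\<^esub> homog u ?A z)" for c z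
   by (simp add: cosets homog_scale)
  show "Ic +>\<^bsub>cox_ring\<^esub> homog u ?A z = \<zero>\<^bsub>cox_ring Quot Ic\<^esub> \<longleftrightarrow> z \<in> {z \<in> sect UNIV. \<forall>pz\<in>zeros. z \<in> van pz}"
   if "z \<in> sect UNIV" for z using that mem[OF that] by (simp add: cosets)
 qed
 hence "ring.dimension (cox_ring Quot Ic) (scheme_degree \<Sigma> u Ic) (quotient_scalars Ic)
   (quotient_piece u Ic (divisor_class u ?A))" by (simp add: quotient_piece_def graded image_image)
 moreover have "Ic \<inter> graded_piece u (divisor_class u ?A) =
  saturation Ic (irrelevant_ideal \<Sigma> u) \<inter> graded_piece u (divisor_class u ?A)"
 proof
  have "Ic \<subseteq> saturation Ic (irrelevant_ideal \<Sigma> u)" unfolding Ic by (rule subset_saturation[OF fin F])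
  thus "Ic \<inter> graded_piece u (divisor_class u ?A) \<subseteq>
    saturation Ic (irrelevant_ideal \<Sigma> u) \<inter> graded_piece u (divisor_class u ?A)"
   by blast
  show "saturation Ic (irrelevant_ideal \<Sigma> u) \<inter> graded_piece u (divisor_class u ?A) \<subseteq>
    Ic \<inter> graded_piece u (divisor_class u ?A)"
  proof
   fix f assume f: "f \<in> saturation Ic (irrelevant_ideal \<Sigma> u) \<inter> graded_piece u (divisor_class u ?A)"
   then obtain z where z: "z \<in> sect UNIV" "f = homog u ?A z" unfolding graded by blast
   \<comment> \<open>A section in the saturation lies in the ideal on every chart, since the
     irrelevant ideal contains a unit of that chart.\<close>
   have "mon (- M sg) 1 * z \<in> loc sg" if sg: "sg \<in> \<Sigma>" for sg
    unfolding loc[OF sg, symmetric] Ic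
    by (rule saturation_local[OF fin F sg nef_sum[OF subset_refl]])
     (use z f in \<open>simp_all add: sect_def flip: Ic\<close>)
   hence "z \<in> van pz" if "pz \<in> zeros" for pz
    using loc_van[OF zeros_variety[OF that] rep[OF that]] rep_chart(1)[OF zeros_variety[OF that] rep[OF that]] by blast
   hence "f \<in> Ic" using mem[OF z(1)] z(2) by blast
   with f show "f \<in> Ic \<inter> graded_piece u (divisor_class u ?A)" by blast
  qed
 qed
 moreover have "V_basepoint_free \<Sigma> u Ic (divisor_class u ?A)"
  using nef_imp_basepoint_free[OF nef_sum[OF subset_refl]] by (auto simp: V_basepoint_free_def basepoint_free_def)
 ultimately show ?thesis unfolding Reg_def A using divisor_class_carrier by blast
qed

end

theorem corollary4p1:
  fixes \<Sigma> :: "(real ^ 'n) set set"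
    and u :: "'k::finite \<Rightarrow> int ^ 'n"
    and f :: "'n \<Rightarrow> 'k cox"
    and \<alpha> :: "'n \<Rightarrow> (int ^ 'k) set"
    and \<alpha>\<^sub>0 :: "(int ^ 'k) set"
    and I :: "'k cox set"
  assumes "complete_fan \<Sigma>" and "ray_generators \<Sigma> u"
    and "\<And>i. \<alpha> i \<in> Pic0 \<Sigma> u"
    and "\<And>i. f i \<in> graded_piece u (\<alpha> i)"
    and "I = Idl\<^bsub>cox_ring\<^esub> (range f)"
    and "scheme_dim \<Sigma> u I = 0"
    and "\<alpha>\<^sub>0 \<in> Pic0 \<Sigma> u"
  shows "regularity_pair \<Sigma> u I ((\<Otimes>\<^bsub>class_group u\<^esub> i \<in> UNIV. \<alpha> i), \<alpha>\<^sub>0)"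
proof -
 interpret toric \<Sigma> u by unfold_locales fact+
 have Pic0: "\<exists>a. \<beta> = divisor_class u a \<and> (\<exists>m. nef_data a m)" if "\<beta> \<in> Pic0 \<Sigma> u" for \<beta>
 proof -
  obtain a where "\<beta> = divisor_class u a" "basepoint_free \<Sigma> u \<beta>" using \<open>\<beta> \<in> Pic0 \<Sigma> u\<close> by (auto simp: Pic0_def Pic_def)
  thus ?thesis using basepoint_free_imp_nef by blast
 qed
 have "\<exists>a m. \<alpha> i = divisor_class u a \<and> nef_data a m" for i using Pic0[OF assms(3)] by blast
 then obtain a mm where a: "!!i. \<alpha> i = divisor_class u (a i)" and mm: "!!i. nef_data (a i) (mm i)" by metis
 have "\<exists>F. F \<in> secs u (a i) UNIV \<and> f i = homog u (a i) F" for i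
  using assms(4)[of i] unfolding a graded_piece_homog by blast
 then obtain F where F: "!!i. F i \<in> secs u (a i) UNIV" "!!i. f i = homog u (a i) (F i)" by metis
 obtain a0 m0 where a0: "\<alpha>\<^sub>0 = divisor_class u a0" "nef_data a0 m0" using Pic0[OF assms(7)] by blast
 \<comment> \<open>The forms are indexed by the coordinate type, while the Koszul signs need an
   ordered index set of naturals.\<close>
 obtain \<beta> where \<beta>: "bij_betw \<beta> {..<CARD('n)} (UNIV :: 'n set)"
  using ex_bij_betw_nat_finite[of "UNIV :: 'n set"] by (auto simp: atLeast0LessThan)
 have "range f = f ` (\<beta> ` {..<CARD('n)})" using \<beta> by (simp add: bij_betw_def)
 hence I: "I = Idl\<^bsub>cox_ring\<^esub> ((%j. homog u (a (\<beta> j)) (F (\<beta> j))) ` {..<CARD('n)})"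
  unfolding assms(5) by (simp add: image_image F(2))
 \<comment> \<open>Instantiated with \<open>b = 0\<close> for the first degree and with
   \<open>b = a0\<close> for the second.\<close>
 have reg: "divisor_class u (b + (\<Sum>i\<in>UNIV. a i)) \<in> Reg \<Sigma> u I" if b: "nef_data b mb" for b mb
 proof -
  have "divisor_class u (b + (\<Sum>j<CARD('n). a (\<beta> j))) \<in> Reg \<Sigma> u I"
   by (rule nef_regularity[where mm = "%j. mm (\<beta> j)", OF _ _ mm b F(1) I assms(6)]) simp_all
  moreover have "(\<Sum>j<CARD('n). a (\<beta> j)) = (\<Sum>i\<in>UNIV. a i)" using \<beta> by (rule sum.reindex_bij_betw)
  ultimately show ?thesis by simp
 qed
 have sum: "(\<Otimes>\<^bsub>class_group u\<^esub> i \<in> UNIV. \<alpha> i) = divisor_class u (\<Sum>i\<in>UNIV. a i)"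
  unfolding a by (rule divisor_class_finprod) simp
 have "divisor_class u (\<Sum>i\<in>UNIV. a i) \<in> Reg \<Sigma> u I" using reg[OF nef_data_zero] by simp
 moreover have "divisor_class u (\<Sum>i\<in>UNIV. a i) \<otimes>\<^bsub>class_group u\<^esub> \<alpha>\<^sub>0 \<in> Reg \<Sigma> u I"
  using reg[OF a0(2)] by (simp add: a0(1) divisor_class_mult add.commute)
 moreover have "V_basepoint_free \<Sigma> u I \<alpha>\<^sub>0"
  using nef_imp_basepoint_free[OF a0(2)] by (auto simp: V_basepoint_free_def basepoint_free_def a0(1))
 ultimately show ?thesis
  unfolding regularity_pair_def sum by (simp add: divisor_class_carrier a0(1))
qed

end
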